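(* Let $P(x)=p_0+p_1x$ where $p_0,p_1\in\mathbb{R}$ and $p_1\neq 0$, and let $H$ be the Hankel operator in $L^2(\mathbb{R}_+)$ with kernel $h(t)=P(\ln t)\,t^{-1}$. Put $q_0=p_0-\gamma p_1$ (where $\gamma$ is the Euler constant), $q_1=p_1$, and $v(\xi)=\sqrt{\pi}/\sqrt{\cosh(\pi\xi)}$. Let $T:L^2(\mathbb{R})\to L^2(\mathbb{R})$ be the unitary operator $$(Tg)(\xi)=v(\xi)^{-1}e^{iq_0q_1^{-1}\xi}\,g\Big(\int_0^\xi v(\eta)^{-2}\,d\eta\Big).$$ Then $$H=q_1F^*TDT^*F,$$ where $D=i\,d/d\xi$. The operator $H$ is essentially self-adjoint on the set $\mathcal{D}_0$, and it is self-adjoint on the set $F^*\mathcal{D}_*$. The spectrum of the operator $H$ is simple, absolutely continuous, and it coincides with $\mathbb{R}$.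
   Context: On $\mathcal{D}_0$ the operator $H$ acts by $(Hf)(t)=\int_0^\infty h(t+s)f(s)\,ds$, and $H$ also denotes the closure of this operator in $L^2(\mathbb{R}_+)$. Here $\mathcal{D}_0$ is the set of functions $f$ on $\mathbb{R}_+$ satisfying $|f(t)|\le C\,t^{-1/2}(1+|\ln t|)^{-n}$ for some $C$ and some $n>K+1$, where $K=1$ is the degree of $P$. The set $\mathcal{D}_*\subset L^2(\mathbb{R})$ consists of functions $g\in L^2(\mathbb{R})\cap \mathsf{H}^1_{\rm loc}(\mathbb{R})$ such that $vQ(D)(vg)\in L^2(\mathbb{R})$, where $Q(x)=q_0+q_1x$ and $\mathsf{H}^1_{\rm loc}$ is the local Sobolev space. The operator $D$ in the formula for $H$ is self-adjoint in $L^2(\mathbb{R})$ with domain the Sobolev space $\mathsf{H}^1(\mathbb{R})$. The unitary operator $F:L^2(\mathbb{R}_+)\to L^2(\mathbb{R})$ is $$(Ff)(\xi)=\frac{\Gamma(1/2+i\xi)}{|\Gamma(1/2+i\xi)|}(\Phi Uf)(\xi),\quad (Uf)(x)=e^{x/2}f(e^x),\quad (\Phi u)(\xi)=(2\pi)^{-1/2}\int_{-\infty}^\infty u(x)e^{-ix\xi}\,dx.$$ *)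

theory Defs
  imports "HOL-Analysis.Analysis"
begin

section \<open>The spaces $L^2(M)$\<close>

text \<open>
  Elements of \<^term>\<open>L2 M\<close> are represented by functions; two functions denote the same element if they
  agree almost everywhere.
\<close>

definition L2 :: "'a measure \<Rightarrow> ('a \<Rightarrow> complex) set" where
  "L2 M = {f \<in> borel_measurable M. integrable M (\<lambda>x. (cmod (f x))\<^sup>2)}"

definition L2_inner :: "'a measure \<Rightarrow> ('a \<Rightarrow> complex) \<Rightarrow> ('a \<Rightarrow> complex) \<Rightarrow> complex" where
  "L2_inner M f g = (\<integral>x. f x * cnj (g x) \<partial>M)"

definition L2_norm :: "'a measure \<Rightarrow> ('a \<Rightarrow> complex) \<Rightarrow> real" where
  "L2_norm M f = sqrt (\<integral>x. (cmod (f x))\<^sup>2 \<partial>M)"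

definition L2_dense :: "'a measure \<Rightarrow> ('a \<Rightarrow> complex) set \<Rightarrow> bool" where
  "L2_dense M S \<longleftrightarrow>
     (\<forall>f \<in> L2 M. \<forall>\<epsilon> > 0. \<exists>g \<in> S. L2_norm M (\<lambda>x. f x - g x) < \<epsilon>)"


section \<open>Operators between $L^2$ spaces\<close>

text \<open>
  A possibly unbounded operator from \<^term>\<open>L2 M\<close> to \<^term>\<open>L2 N\<close> is represented by its graph, a set of
  pairs in \<^term>\<open>L2 M \<times> L2 N\<close> that contains with each pair all pairs that agree with it almost
  everywhere in both components. All operators constructed below have this closure property, so that
  equality of operators, domains included, is equality of graphs.
\<close>

type_synonym ('a, 'b) l2op = "(('a \<Rightarrow> complex) \<times> ('b \<Rightarrow> complex)) set"

definition op_of ::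
  "'a measure \<Rightarrow> 'b measure \<Rightarrow> (('a \<Rightarrow> complex) \<Rightarrow> 'b \<Rightarrow> complex) \<Rightarrow> ('a, 'b) l2op" where
  "op_of M N \<Phi> = {(f, g). f \<in> L2 M \<and> g \<in> L2 N \<and> (AE x in N. g x = \<Phi> f x)}"

definition op_id :: "'a measure \<Rightarrow> ('a, 'a) l2op" where
  "op_id M = op_of M M (\<lambda>f. f)"

abbreviation op_comp :: "('b, 'c) l2op \<Rightarrow> ('a, 'b) l2op \<Rightarrow> ('a, 'c) l2op"
    (infixr "\<circ>\<^sub>L" 70) where
  "A \<circ>\<^sub>L B \<equiv> B O A"

definition op_scale :: "'b measure \<Rightarrow> complex \<Rightarrow> ('a, 'b) l2op \<Rightarrow> ('a, 'b) l2op" where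
  "op_scale N c A = {(f, k). k \<in> L2 N \<and> (\<exists>g. (f, g) \<in> A \<and> (AE x in N. k x = c * g x))}"

definition op_restrict :: "('a, 'b) l2op \<Rightarrow> ('a \<Rightarrow> complex) set \<Rightarrow> ('a, 'b) l2op" where
  "op_restrict A S = {(f, g). (f, g) \<in> A \<and> f \<in> S}"

definition op_closure :: "'a measure \<Rightarrow> 'b measure \<Rightarrow> ('a, 'b) l2op \<Rightarrow> ('a, 'b) l2op" where
  "op_closure M N A = {(f, g). f \<in> L2 M \<and> g \<in> L2 N \<and>
     (\<forall>\<epsilon> > 0. \<exists>(f', g') \<in> A. L2_norm M (\<lambda>x. f x - f' x) < \<epsilon> \<and> L2_norm N (\<lambda>x. g x - g' x) < \<epsilon>)}"

definition op_adj :: "'a measure \<Rightarrow> 'b measure \<Rightarrow> ('a, 'b) l2op \<Rightarrow> ('b, 'a) l2op" where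
  "op_adj M N A = {(g, k). g \<in> L2 N \<and> k \<in> L2 M \<and>
     (\<forall>(f, h) \<in> A. L2_inner N h g = L2_inner M f k)}"

definition unitary_op :: "'a measure \<Rightarrow> 'b measure \<Rightarrow> ('a, 'b) l2op \<Rightarrow> bool" where
  "unitary_op M N A \<longleftrightarrow> Domain A = L2 M \<and> Range A = L2 N \<and>
     (\<forall>(f, g) \<in> A. \<forall>(f', g') \<in> A. L2_inner N g g' = L2_inner M f f')"

text \<open>Density of the domain and \<open>A = A\<^sup>*\<close> force \<open>A\<close> to be linear and single-valued almost everywhere.\<close>

definition selfadjoint :: "'a measure \<Rightarrow> ('a, 'a) l2op \<Rightarrow> bool" where
  "selfadjoint M A \<longleftrightarrow> L2_dense M (Domain A) \<and> op_adj M M A = A"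

definition selfadjoint_on :: "'a measure \<Rightarrow> ('a, 'a) l2op \<Rightarrow> ('a \<Rightarrow> complex) set \<Rightarrow> bool" where
  "selfadjoint_on M A S \<longleftrightarrow> Domain A = S \<and> selfadjoint M A"

definition ess_selfadjoint_on :: "'a measure \<Rightarrow> ('a, 'a) l2op \<Rightarrow> ('a \<Rightarrow> complex) set \<Rightarrow> bool" where
  "ess_selfadjoint_on M A S \<longleftrightarrow> S \<subseteq> Domain A \<and> selfadjoint M (op_closure M M (op_restrict A S))"


section \<open>Spectrum and spectral measure\<close>

text \<open>The graph of $(A - z)^{-1}$.\<close>

definition op_resolvent :: "'a measure \<Rightarrow> ('a, 'a) l2op \<Rightarrow> complex \<Rightarrow> ('a, 'a) l2op" where
  "op_resolvent M A z =
     {(k, f). k \<in> L2 M \<and> (\<exists>h. (f, h) \<in> A \<and> (AE x in M. k x = h x - z * f x))}"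

text \<open>For linear \<open>A\<close> the norm bound also gives injectivity of $A - z$.\<close>

definition resolvent_set :: "'a measure \<Rightarrow> ('a, 'a) l2op \<Rightarrow> complex set" where
  "resolvent_set M A = {z. Domain (op_resolvent M A z) = L2 M \<and>
     (\<exists>C. \<forall>(k, f) \<in> op_resolvent M A z. L2_norm M f \<le> C * L2_norm M k)}"

definition op_spectrum :: "'a measure \<Rightarrow> ('a, 'a) l2op \<Rightarrow> complex set" where
  "op_spectrum M A = - resolvent_set M A"

definition orth_projection :: "'a measure \<Rightarrow> ('a, 'a) l2op \<Rightarrow> bool" where
  "orth_projection M P \<longleftrightarrow> Domain P = L2 M \<and> op_adj M M P = P \<and> P \<circ>\<^sub>L P = P"

text \<open>
  A representative of \<open>A f\<close>; for the operators to which this is applied (orthogonal projections) it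
  is unique almost everywhere.
\<close>

definition op_app :: "('a, 'b) l2op \<Rightarrow> ('a \<Rightarrow> complex) \<Rightarrow> 'b \<Rightarrow> complex" where
  "op_app A f = (SOME g. (f, g) \<in> A)"

definition projection_valued_measure :: "'a measure \<Rightarrow> (real set \<Rightarrow> ('a, 'a) l2op) \<Rightarrow> bool" where
  "projection_valued_measure M E \<longleftrightarrow>
     (\<forall>\<Delta> \<in> sets borel. orth_projection M (E \<Delta>)) \<and>
     E UNIV = op_id M \<and>
     (\<forall>\<Delta> :: nat \<Rightarrow> real set. range \<Delta> \<subseteq> sets borel \<and> disjoint_family \<Delta> \<longrightarrow>
       (\<forall>f \<in> L2 M.
         (\<lambda>n. L2_norm M (\<lambda>x. op_app (E (\<Union>i. \<Delta> i)) f x - (\<Sum>i<n. op_app (E (\<Delta> i)) f x)))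
           \<longlonglongrightarrow> 0))"

text \<open>The measure $\Delta \mapsto \langle E(\Delta) f, f\rangle$.\<close>

definition scalar_measure ::
  "'a measure \<Rightarrow> (real set \<Rightarrow> ('a, 'a) l2op) \<Rightarrow> ('a \<Rightarrow> complex) \<Rightarrow> real measure" where
  "scalar_measure M E f =
     measure_of UNIV (sets borel) (\<lambda>\<Delta>. ennreal (Re (L2_inner M (op_app (E \<Delta>) f) f)))"

text \<open>
  \<open>E\<close> is the spectral measure of \<open>A\<close>, that is $A = \int \lambda\, dE(\lambda)$: the domain of \<open>A\<close> consists of
  all \<open>f\<close> with $\int \lambda^2\, d\langle E(\lambda) f, f\rangle < \infty$, and
  $\langle A f, f\rangle = \int \lambda\, d\langle E(\lambda) f, f\rangle$ there, which determines \<open>A\<close> by polarization.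
\<close>

definition spectral_measure_of ::
  "'a measure \<Rightarrow> ('a, 'a) l2op \<Rightarrow> (real set \<Rightarrow> ('a, 'a) l2op) \<Rightarrow> bool" where
  "spectral_measure_of M A E \<longleftrightarrow>
     projection_valued_measure M E \<and>
     Domain A = {f \<in> L2 M. integrable (scalar_measure M E f) (\<lambda>r. r\<^sup>2)} \<and>
     (\<forall>(f, g) \<in> A. L2_inner M g f = complex_of_real (\<integral>r. r \<partial>(scalar_measure M E f)))"

definition ac_spectrum :: "'a measure \<Rightarrow> ('a, 'a) l2op \<Rightarrow> bool" where
  "ac_spectrum M A \<longleftrightarrow> (\<exists>E. spectral_measure_of M A E \<and>
     (\<forall>f \<in> L2 M. absolutely_continuous lborel (scalar_measure M E f)))"

text \<open>Simplicity: some \<open>g\<close> is generating, i.e. the span of all $E(\Delta) g$ is dense.\<close>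

definition simple_spectrum :: "'a measure \<Rightarrow> ('a, 'a) l2op \<Rightarrow> bool" where
  "simple_spectrum M A \<longleftrightarrow> (\<exists>E. spectral_measure_of M A E \<and>
     (\<exists>g \<in> L2 M. L2_dense M
        {(\<lambda>x. \<Sum>i<n. c i * op_app (E (\<Delta> i)) g x) | (n :: nat) c \<Delta>. \<forall>i<n. \<Delta> i \<in> sets borel}))"


section \<open>Weak derivatives and Sobolev spaces on the line\<close>

text \<open>Real-valued test functions suffice, as both sides of the defining identity are linear in them.\<close>

definition test_fun :: "(real \<Rightarrow> real) \<Rightarrow> bool" where
  "test_fun \<phi> \<longleftrightarrow> (\<forall>k x. (deriv ^^ k) \<phi> field_differentiable at x) \<and>
     (\<exists>R. \<forall>x. \<bar>x\<bar> > R \<longrightarrow> \<phi> x = 0)"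

definition loc_integrable :: "(real \<Rightarrow> complex) \<Rightarrow> bool" where
  "loc_integrable f \<longleftrightarrow> (\<forall>a b. set_integrable lborel {a..b} f)"

definition weak_deriv :: "(real \<Rightarrow> complex) \<Rightarrow> (real \<Rightarrow> complex) \<Rightarrow> bool" where
  "weak_deriv f f' \<longleftrightarrow> loc_integrable f \<and> loc_integrable f' \<and>
     (\<forall>\<phi>. test_fun \<phi> \<longrightarrow>
       (\<integral>x. f x * of_real (deriv \<phi> x) \<partial>lborel) = - (\<integral>x. f' x * of_real (\<phi> x) \<partial>lborel))"

definition L2_loc :: "(real \<Rightarrow> complex) set" where
  "L2_loc = {f \<in> borel_measurable lborel.
     \<forall>a b. set_integrable lborel {a..b} (\<lambda>x. (cmod (f x))\<^sup>2)}"

definition H1_loc :: "(real \<Rightarrow> complex) set" where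
  "H1_loc = {f \<in> L2_loc. \<exists>f' \<in> L2_loc. weak_deriv f f'}"

text \<open>$D = i\,d/d\xi$ with domain the Sobolev space $H^1$: both \<open>f\<close> and its weak derivative lie in $L^2$.\<close>

definition D_op :: "(real, real) l2op" where
  "D_op = {(f, g). f \<in> L2 lborel \<and> g \<in> L2 lborel \<and>
     (\<exists>f' \<in> L2 lborel. weak_deriv f f' \<and> (AE \<xi> in lborel. g \<xi> = \<i> * f' \<xi>))}"


section \<open>The Hankel operator\<close>

definition lborel_plus :: "real measure" where
  "lborel_plus = restrict_space lborel {0<..}"

definition D0_set :: "nat \<Rightarrow> (real \<Rightarrow> complex) set" where
  "D0_set K = {f \<in> borel_measurable lborel_plus. \<exists>C n. n > real K + 1 \<and>
     (AE t in lborel_plus. cmod (f t) \<le> C * t powr (-1/2) * (1 + \<bar>ln t\<bar>) powr (- n))}"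

definition hankel_op :: "nat \<Rightarrow> (real \<Rightarrow> real) \<Rightarrow> (real, real) l2op" where
  "hankel_op K h = op_closure lborel_plus lborel_plus
     (op_restrict
       (op_of lborel_plus lborel_plus (\<lambda>f t. \<integral>s. of_real (h (t + s)) * f s \<partial>lborel_plus))
       (D0_set K))"


section \<open>The transformations $F$ and $T$\<close>

definition U_op :: "(real, real) l2op" where
  "U_op = op_of lborel_plus lborel (\<lambda>f x. of_real (exp (x / 2)) * f (exp x))"

text \<open>
  The integral defines the Fourier transform on $L^1 \cap L^2$; the closure is its extension by continuity
  to $L^2$.
\<close>

definition fourier_op :: "(real, real) l2op" where
  "fourier_op = op_closure lborel lborel
     (op_restrict
       (op_of lborel lborel
         (\<lambda>u \<xi>. of_real ((2 * pi) powr (-1/2)) * (\<integral>x. u x * exp (- (\<i> * of_real (x * \<xi>))) \<partial>lborel)))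
       {u. integrable lborel u})"

definition gamma_phase_op :: "(real, real) l2op" where
  "gamma_phase_op = op_of lborel lborel
     (\<lambda>w \<xi>. Gamma (1/2 + \<i> * of_real \<xi>) / of_real (cmod (Gamma (1/2 + \<i> * of_real \<xi>))) * w \<xi>)"

definition F_op :: "(real, real) l2op" where
  "F_op = gamma_phase_op \<circ>\<^sub>L fourier_op \<circ>\<^sub>L U_op"

definition v_fun :: "real \<Rightarrow> real" where
  "v_fun \<xi> = sqrt pi / sqrt (cosh (pi * \<xi>))"

definition T_op :: "real \<Rightarrow> real \<Rightarrow> (real, real) l2op" where
  "T_op q0 q1 = op_of lborel lborel
     (\<lambda>g \<xi>. of_real (inverse (v_fun \<xi>)) * exp (\<i> * of_real (q0 * inverse q1 * \<xi>)) *
        g (LBINT \<eta>=0..\<xi>. inverse ((v_fun \<eta>)\<^sup>2)))"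

text \<open>Here \<open>w\<close> is the weak derivative of \<open>v g\<close>, so that $Q(D)(vg) = q_0 v g + q_1 i w$.\<close>

definition Dstar_set :: "real \<Rightarrow> real \<Rightarrow> (real \<Rightarrow> complex) set" where
  "Dstar_set q0 q1 = {g \<in> L2 lborel \<inter> H1_loc.
     \<exists>w. weak_deriv (\<lambda>\<xi>. of_real (v_fun \<xi>) * g \<xi>) w \<and>
       (\<lambda>\<xi>. of_real (v_fun \<xi>) *
          (of_real q0 * (of_real (v_fun \<xi>) * g \<xi>) + of_real q1 * (\<i> * w \<xi>))) \<in> L2 lborel}"

end

theory Submission
  imports Defs "HOL-Probability.Probability"
begin

text \<open>
  The operator becomes explicit in three changes of representation.

  In logarithmic coordinates $t = e^x$, that is after conjugation by \<open>U\<close>, the Hankel kernel factors.  Since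
  $\Gamma'(1) = -\gamma$, it is a Laplace transform,
  $P(\ln t)/t = \int_0^\infty e^{-t\lambda}(q_0 - q_1\ln\lambda)\,d\lambda$ with $q_0 = p_0 - \gamma p_1$ and $q_1 = p_1$
  (\<open>kernel_factorization\<close>).  On $\mathcal{D}_0$ the conjugated operator is therefore the product $K(q_0 - q_1x)K$,
  where \<open>K\<close> is the integral operator with kernel $\kappa(x + y)$, $\kappa(x) = e^{x/2 - e^x}$
  (\<open>hankel_log_coordinates\<close>).

  The Fourier transform of $\kappa$ is $(2\pi)^{-1/2}\Gamma(1/2 - i\xi)$.  As the kernel of \<open>K\<close> depends on $x + y$ and not
  on $x - y$, the operator \<open>K\<close> becomes the reflection $\xi\mapsto-\xi$ followed by the multiplication by
  $\Gamma(1/2 - i\xi)$; the two reflections turn $q_0 - q_1x$ into $q_0 + q_1x$, which becomes $Q(D)$.  In all,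
  $\Phi UHU^*\Phi^* = \Gamma(1/2 - i\xi)\,Q(D)\,\Gamma(1/2 + i\xi)$.  By the reflection formula
  $|\Gamma(1/2 + i\xi)|^2 = \pi/\cosh(\pi\xi) = v(\xi)^2$, and the phase in \<open>F\<close> leaves $FHF^* = vQ(D)v$.

  Finally $vQ(D)v = q_1TDT^*$ (\<open>T_intertwines\<close>): the factor $e^{iq_0q_1^{-1}\xi}$ in \<open>T\<close> absorbs $q_0$, since
  conjugation by it shifts \<open>D\<close> by a constant, and the change of variable with derivative $v^{-2}$ absorbs the two factors \<open>v\<close>.

  These identities give $H\subseteq q_1F^*TDT^*F$ on $\mathcal{D}_0$ (\<open>hankel_on_D0_maps_to_D\<close>).  The right-hand side is
  self-adjoint, hence closed.  For equality after closing it is enough that $\mathcal{D}_0$ contains a core of the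
  right-hand side.  Test functions form a core of \<open>D\<close> (\<open>test_functions_core\<close>), and their preimages under $T^*F$
  lie in $\mathcal{D}_0$ (\<open>test_function_in_D0_image\<close>): they are inverse Mellin transforms of smooth functions with
  compact support, so that they have rapid decay in $\ln t$.  This proves the formula for \<open>H\<close> and essential
  self-adjointness (\<open>hankel_closure\<close>).

  The domain of \<open>D\<close> consists of the functions that have an absolutely continuous representative with derivative
  in $L^2$.  The product and chain rules for such functions carry it over to $\mathcal{D}_*$ (\<open>T_D_domain\<close>).

  The Fourier transform makes \<open>D\<close> the multiplication by the independent variable (\<open>D_op_eq_fourier\<close>).  Hence
  \<open>H\<close> is unitarily equivalent to the multiplication by $q_1\xi$ in $L^2(\mathbb{R})$
  (\<open>spectral_representation\<close>), from which the properties of the spectrum can be read off, as in the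
  locale \<open>l2_scaling\<close>.
\<close>

section \<open>The Hilbert space structure of $L^2(M)$\<close>

lemma borel_measurable_cnj [measurable]:
  "f \<in> borel_measurable M \<Longrightarrow> (\<lambda>x. cnj (f x)) \<in> borel_measurable M"
  by (rule measurable_compose[of f M borel]) (auto intro!: borel_measurable_continuous_onI continuous_intros)

lemma L2_measurable [measurable_dest]: "f \<in> L2 M \<Longrightarrow> f \<in> borel_measurable M"
  by (simp add: L2_def)

lemma L2_integrable_sq: "f \<in> L2 M \<Longrightarrow> integrable M (\<lambda>x. (cmod (f x))\<^sup>2)"
  by (simp add: L2_def)

lemma L2I: "f \<in> borel_measurable M \<Longrightarrow> integrable M (\<lambda>x. (cmod (f x))\<^sup>2) \<Longrightarrow> f \<in> L2 M"
  by (simp add: L2_def)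

lemma L2_dominated:
  assumes "integrable M g" "f \<in> borel_measurable M" "AE x in M. (cmod (f x))\<^sup>2 \<le> g x"
  shows "f \<in> L2 M"
proof (rule L2I)
  show "integrable M (\<lambda>x. (cmod (f x))\<^sup>2)"
    by (rule Bochner_Integration.integrable_bound[OF assms(1)])
       (use assms in auto)
qed fact

lemma L2_AE_cong:
  assumes "f \<in> L2 M" "g \<in> borel_measurable M" "AE x in M. g x = f x"
  shows "g \<in> L2 M"
  by (rule L2_dominated[OF L2_integrable_sq[OF assms(1)] assms(2)]) (use assms(3) in auto)

lemma L2_zero [simp]: "(\<lambda>x. 0) \<in> L2 M"
  by (simp add: L2_def)

lemma L2_bounded_mult:
  assumes "f \<in> L2 M" "m \<in> borel_measurable M" "AE x in M. cmod (m x) \<le> C"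
  shows "(\<lambda>x. m x * f x) \<in> L2 M"
proof (rule L2_dominated)
  show "integrable M (\<lambda>x. C\<^sup>2 * (cmod (f x))\<^sup>2)" using L2_integrable_sq[OF assms(1)] by simp
  show "AE x in M. (cmod (m x * f x))\<^sup>2 \<le> C\<^sup>2 * (cmod (f x))\<^sup>2"
    using assms(3) by eventually_elim (auto simp: norm_mult power_mult_distrib intro!: mult_right_mono power_mono)
qed (use assms in measurable)

lemma L2_scale: "f \<in> L2 M \<Longrightarrow> (\<lambda>x. c * f x) \<in> L2 M"
  by (rule L2_bounded_mult[where C = "cmod c"]) auto

lemma L2_cnj: "f \<in> L2 M \<Longrightarrow> (\<lambda>x. cnj (f x)) \<in> L2 M"
  by (rule L2_dominated[OF L2_integrable_sq]) (auto simp: L2_def)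

lemma norm_add_sq_le: "(cmod (a + b))\<^sup>2 \<le> 2 * (cmod a)\<^sup>2 + 2 * (cmod b)\<^sup>2"
proof -
  have "(cmod (a + b))\<^sup>2 \<le> (cmod a + cmod b)\<^sup>2" by (intro power_mono norm_triangle_ineq) auto
  also have "\<dots> \<le> 2 * (cmod a)\<^sup>2 + 2 * (cmod b)\<^sup>2"
    using sum_squares_ge_zero[of "cmod a - cmod b" 0] by (simp add: power2_eq_square algebra_simps)
  finally show ?thesis .
qed

lemma L2_add:
  assumes "f \<in> L2 M" "g \<in> L2 M" shows "(\<lambda>x. f x + g x) \<in> L2 M"
proof (rule L2_dominated)
  show "integrable M (\<lambda>x. 2 * (cmod (f x))\<^sup>2 + 2 * (cmod (g x))\<^sup>2)"
    using assms by (auto simp: L2_def)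
qed (use assms norm_add_sq_le in \<open>auto simp: L2_def\<close>)

lemma L2_minus: "f \<in> L2 M \<Longrightarrow> (\<lambda>x. - f x) \<in> L2 M"
  using L2_scale[of f M "-1"] by simp

lemma L2_diff:
  assumes "f \<in> L2 M" "g \<in> L2 M" shows "(\<lambda>x. f x - g x) \<in> L2 M"
  using L2_add[OF assms(1) L2_minus[OF assms(2)]] by simp

lemma L2_sum:
  "(\<And>i. i \<in> I \<Longrightarrow> f i \<in> L2 M) \<Longrightarrow> (\<lambda>x. \<Sum>i\<in>I. f i x) \<in> L2 M"
  by (induction I rule: infinite_finite_induct) (auto intro: L2_add)

lemma L2_integrable_mult:
  assumes "f \<in> L2 M" "g \<in> L2 M" shows "integrable M (\<lambda>x. f x * g x)"
proof (rule Bochner_Integration.integrable_bound)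
  show "integrable M (\<lambda>x. (cmod (f x))\<^sup>2 + (cmod (g x))\<^sup>2)"
    using assms by (auto simp: L2_def)
  have "cmod a * cmod b \<le> (cmod a)\<^sup>2 + (cmod b)\<^sup>2" for a b
  proof -
    have "0 \<le> (cmod a - cmod b)\<^sup>2 + (cmod a)\<^sup>2 + (cmod b)\<^sup>2" by simp
    then show ?thesis by (simp add: power2_eq_square algebra_simps)
  qed
  then show "AE x in M. norm (f x * g x) \<le> norm ((cmod (f x))\<^sup>2 + (cmod (g x))\<^sup>2)"
    by (auto simp: norm_mult)
qed (use assms in measurable)

lemma L2_integrable_inner:
  assumes "f \<in> L2 M" "g \<in> L2 M" shows "integrable M (\<lambda>x. f x * cnj (g x))"
  by (rule L2_integrable_mult[OF assms(1) L2_cnj[OF assms(2)]])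

lemma L2_norm_nonneg [simp]: "0 \<le> L2_norm M f"
  by (simp add: L2_norm_def)

lemma L2_norm_sq: "(L2_norm M f)\<^sup>2 = (\<integral>x. (cmod (f x))\<^sup>2 \<partial>M)"
  by (simp add: L2_norm_def)

lemma L2_inner_self: "L2_inner M f f = of_real ((L2_norm M f)\<^sup>2)"
  unfolding L2_inner_def L2_norm_sq complex_norm_square[symmetric] by (simp flip: of_real_power)

lemma L2_inner_commute: "L2_inner M g f = cnj (L2_inner M f g)"
  unfolding L2_inner_def Bochner_Integration.integral_cnj[symmetric]
  by (simp add: mult.commute)

lemma L2_inner_add_left:
  assumes "f \<in> L2 M" "g \<in> L2 M" "h \<in> L2 M"
  shows "L2_inner M (\<lambda>x. f x + g x) h = L2_inner M f h + L2_inner M g h"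
  unfolding L2_inner_def by (simp add: distrib_right L2_integrable_inner assms)

lemma L2_inner_scale_left: "L2_inner M (\<lambda>x. c * f x) h = c * L2_inner M f h"
  unfolding L2_inner_def by (simp add: mult.assoc)

lemma L2_inner_diff_left:
  assumes "f \<in> L2 M" "g \<in> L2 M" "h \<in> L2 M"
  shows "L2_inner M (\<lambda>x. f x - g x) h = L2_inner M f h - L2_inner M g h"
  unfolding L2_inner_def by (simp add: left_diff_distrib L2_integrable_inner assms)

lemma L2_inner_add_right:
  assumes "f \<in> L2 M" "g \<in> L2 M" "h \<in> L2 M"
  shows "L2_inner M h (\<lambda>x. f x + g x) = L2_inner M h f + L2_inner M h g"
  unfolding L2_inner_def by (simp add: distrib_left L2_integrable_inner assms)

lemma L2_inner_diff_right:
  assumes "f \<in> L2 M" "g \<in> L2 M" "h \<in> L2 M"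
  shows "L2_inner M h (\<lambda>x. f x - g x) = L2_inner M h f - L2_inner M h g"
  unfolding L2_inner_def by (simp add: right_diff_distrib L2_integrable_inner assms)

lemma L2_inner_scale_right: "L2_inner M h (\<lambda>x. c * f x) = cnj c * L2_inner M h f"
  unfolding L2_inner_def by (simp add: mult.left_commute)

lemma L2_inner_AE_cong:
  assumes "AE x in M. f x = f' x" "AE x in M. g x = g' x"
    "f \<in> borel_measurable M" "f' \<in> borel_measurable M" "g \<in> borel_measurable M" "g' \<in> borel_measurable M"
  shows "L2_inner M f g = L2_inner M f' g'"
  unfolding L2_inner_def by (intro integral_cong_AE) (use assms in auto)

lemma L2_norm_AE_cong:
  assumes "AE x in M. f x = f' x" "f \<in> borel_measurable M" "f' \<in> borel_measurable M"
  shows "L2_norm M f = L2_norm M f'"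
proof -
  have "(\<integral>x. (cmod (f x))\<^sup>2 \<partial>M) = (\<integral>x. (cmod (f' x))\<^sup>2 \<partial>M)"
    by (intro integral_cong_AE) (use assms in auto)
  then show ?thesis unfolding L2_norm_def by simp
qed

lemma L2_norm_scale: "L2_norm M (\<lambda>x. c * f x) = cmod c * L2_norm M f"
  by (simp add: L2_norm_def norm_mult power_mult_distrib real_sqrt_mult)

lemma L2_norm_minus_commute: "L2_norm M (\<lambda>x. f x - g x) = L2_norm M (\<lambda>x. g x - f x)"
  by (simp add: L2_norm_def norm_minus_commute)

lemma L2_norm_eq_0:
  assumes "f \<in> L2 M" shows "L2_norm M f = 0 \<longleftrightarrow> (AE x in M. f x = 0)"
  unfolding L2_norm_def using integral_nonneg_eq_0_iff_AE[OF L2_integrable_sq[OF assms]] by simp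

lemma L2_Cauchy_Schwarz:
  assumes f: "f \<in> L2 M" and g: "g \<in> L2 M"
  shows "cmod (L2_inner M f g) \<le> L2_norm M f * L2_norm M g"
proof (cases "L2_norm M f = 0 \<or> L2_norm M g = 0")
  case True
  then have "AE x in M. f x * cnj (g x) = 0"
    using L2_norm_eq_0[OF f] L2_norm_eq_0[OF g] by auto
  then have "L2_inner M f g = 0" unfolding L2_inner_def
    by (intro integral_eq_zero_AE)
  then show ?thesis by simp
next
  case False
  define a where "a = L2_norm M f"
  define b where "b = L2_norm M g"
  have ab: "a > 0" "b > 0"
    using False L2_norm_nonneg[of M f] L2_norm_nonneg[of M g] unfolding a_def b_def by linarith+
  have sq: "integrable M (\<lambda>x. (cmod (f x))\<^sup>2)" "integrable M (\<lambda>x. (cmod (g x))\<^sup>2)"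
    using f g by (auto simp: L2_def)
  have am: "cmod (f x) * cmod (g x) \<le> b / (2*a) * (cmod (f x))\<^sup>2 + a / (2*b) * (cmod (g x))\<^sup>2" for x
  proof -
    have "0 \<le> (b * cmod (f x) - a * cmod (g x))\<^sup>2 / (2*a*b)" using ab by simp
    also have "\<dots> = b / (2*a) * (cmod (f x))\<^sup>2 + a / (2*b) * (cmod (g x))\<^sup>2 - cmod (f x) * cmod (g x)"
      using ab by (simp add: field_simps power2_eq_square)
    finally show ?thesis by simp
  qed
  have "cmod (L2_inner M f g) \<le> (\<integral>x. cmod (f x * cnj (g x)) \<partial>M)"
    unfolding L2_inner_def by (rule integral_norm_bound)
  also have "\<dots> \<le> (\<integral>x. b / (2*a) * (cmod (f x))\<^sup>2 + a / (2*b) * (cmod (g x))\<^sup>2 \<partial>M)"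
    using am L2_integrable_inner[OF f g] sq by (intro integral_mono integrable_norm) (auto simp: norm_mult)
  also have "\<dots> = b / (2*a) * a\<^sup>2 + a / (2*b) * b\<^sup>2"
    using sq by (simp add: L2_norm_sq[symmetric] a_def b_def)
  also have "\<dots> = a * b" using ab by (simp add: field_simps power2_eq_square)
  finally show ?thesis unfolding a_def b_def .
qed

lemma L2_norm_add_sq:
  assumes f: "f \<in> L2 M" and g: "g \<in> L2 M"
  shows "(L2_norm M (\<lambda>x. f x + g x))\<^sup>2 = (L2_norm M f)\<^sup>2 + (L2_norm M g)\<^sup>2 + 2 * Re (L2_inner M f g)"
proof -
  have "complex_of_real ((L2_norm M (\<lambda>x. f x + g x))\<^sup>2) = L2_inner M (\<lambda>x. f x + g x) (\<lambda>x. f x + g x)"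
    by (simp add: L2_inner_self)
  also have "\<dots> = L2_inner M f f + L2_inner M g g + (L2_inner M f g + cnj (L2_inner M f g))"
    using f g by (simp add: L2_inner_add_left L2_inner_add_right L2_add L2_inner_commute[of M g f])
  also have "\<dots> = complex_of_real ((L2_norm M f)\<^sup>2 + (L2_norm M g)\<^sup>2 + 2 * Re (L2_inner M f g))"
    by (simp add: L2_inner_self complex_add_cnj)
  finally show ?thesis using of_real_eq_iff by blast
qed

lemma L2_triangle:
  assumes f: "f \<in> L2 M" and g: "g \<in> L2 M"
  shows "L2_norm M (\<lambda>x. f x + g x) \<le> L2_norm M f + L2_norm M g"
proof (rule power2_le_imp_le)
  have "Re (L2_inner M f g) \<le> L2_norm M f * L2_norm M g"
    using complex_Re_le_cmod L2_Cauchy_Schwarz[OF f g] order_trans by blast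
  then show "(L2_norm M (\<lambda>x. f x + g x))\<^sup>2 \<le> (L2_norm M f + L2_norm M g)\<^sup>2"
    unfolding L2_norm_add_sq[OF f g] by (simp add: power2_eq_square algebra_simps)
qed simp

lemma L2_triangle_diff:
  assumes "f \<in> L2 M" "g \<in> L2 M" "h \<in> L2 M"
  shows "L2_norm M (\<lambda>x. f x - h x) \<le> L2_norm M (\<lambda>x. f x - g x) + L2_norm M (\<lambda>x. g x - h x)"
  using L2_triangle[OF L2_diff[OF assms(1,2)] L2_diff[OF assms(2,3)]] by simp

lemma L2_norm_diff_ge:
  assumes "f \<in> L2 M" "g \<in> L2 M"
  shows "\<bar>L2_norm M f - L2_norm M g\<bar> \<le> L2_norm M (\<lambda>x. f x - g x)"
  using L2_triangle[OF L2_diff[OF assms] assms(2)] L2_triangle[OF L2_diff[OF assms(2,1)] assms(1)]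
  by (simp add: L2_norm_minus_commute[of M g f] abs_le_iff)

lemma L2_norm_diff_le_0_AE:
  assumes "f \<in> L2 M" "g \<in> L2 M" "L2_norm M (\<lambda>x. f x - g x) = 0"
  shows "AE x in M. f x = g x"
  using L2_norm_eq_0[OF L2_diff[OF assms(1,2)]] assms(3) by simp

lemma L2_norm_tendsto:
  assumes "\<And>n. f n \<in> L2 M" "g \<in> L2 M" "(\<lambda>n. L2_norm M (\<lambda>x. f n x - g x)) \<longlonglongrightarrow> 0"
  shows "(\<lambda>n. L2_norm M (f n)) \<longlonglongrightarrow> L2_norm M g"
proof (rule LIM_zero_cancel, rule Lim_null_comparison[OF _ assms(3)])
  show "\<forall>\<^sub>F n in sequentially. norm (L2_norm M (f n) - L2_norm M g) \<le> L2_norm M (\<lambda>x. f n x - g x)"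
    using L2_norm_diff_ge assms by (intro always_eventually allI) auto
qed

lemma L2_inner_tendsto:
  assumes "\<And>n. f n \<in> L2 M" "g \<in> L2 M" "h \<in> L2 M" "(\<lambda>n. L2_norm M (\<lambda>x. f n x - g x)) \<longlonglongrightarrow> 0"
  shows "(\<lambda>n. L2_inner M (f n) h) \<longlonglongrightarrow> L2_inner M g h"
proof (rule LIM_zero_cancel, rule Lim_null_comparison)
  show "(\<lambda>n. L2_norm M (\<lambda>x. f n x - g x) * L2_norm M h) \<longlonglongrightarrow> 0"
    using tendsto_mult_left_zero[OF assms(4)] .
  show "\<forall>\<^sub>F n in sequentially. norm (L2_inner M (f n) h - L2_inner M g h)
      \<le> L2_norm M (\<lambda>x. f n x - g x) * L2_norm M h"
    using L2_Cauchy_Schwarz[OF L2_diff[OF assms(1,2)] assms(3)] assms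
    by (intro always_eventually allI) (simp add: L2_inner_diff_left)
qed

lemma L2_dominated_convergence:
  assumes "integrable M w" "\<And>n. f n \<in> borel_measurable M" "g \<in> borel_measurable M"
    and "\<And>n. AE x in M. (cmod (f n x - g x))\<^sup>2 \<le> w x" "AE x in M. (\<lambda>n. f n x) \<longlonglongrightarrow> g x"
  shows "(\<lambda>n. L2_norm M (\<lambda>x. f n x - g x)) \<longlonglongrightarrow> 0"
proof -
  have "(\<lambda>n. \<integral>x. (cmod (f n x - g x))\<^sup>2 \<partial>M) \<longlonglongrightarrow> (\<integral>x. 0 \<partial>M)"
  proof (rule integral_dominated_convergence[OF _ _ assms(1)])
    show "AE x in M. (\<lambda>n. (cmod (f n x - g x))\<^sup>2) \<longlonglongrightarrow> 0"
      using assms(5) by eventually_elim (auto intro!: tendsto_eq_intros LIM_zero)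
  qed (use assms in auto)
  from tendsto_real_sqrt[OF this] show ?thesis unfolding L2_norm_def by simp
qed

subsection \<open>Completeness\<close>

text \<open>
  A sequence that converges as fast as a geometric series in norm converges almost everywhere:
  the series $\sum_k 2^k |g_{k+1} - g_k|^2$ has a finite integral, so that its terms are bounded at
  almost every point and $\sum_k |g_{k+1} - g_k|$ is dominated by a geometric series there.
\<close>

lemma L2_fast_Cauchy_AE:
  assumes g: "\<And>n. g n \<in> L2 M" and fast: "\<And>k. L2_norm M (\<lambda>x. g (Suc k) x - g k x) \<le> (1/2)^k"
  shows "AE x in M. convergent (\<lambda>n. g n x)"
proof -
  let ?d = "\<lambda>k x. g (Suc k) x - g k x"
  have d: "?d k \<in> L2 M" for k using g by (auto intro: L2_diff)
  note [measurable] = L2_measurable[OF g]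
  have int: "(\<integral>\<^sup>+x. ennreal (2^k * (cmod (?d k x))\<^sup>2) \<partial>M) \<le> ennreal ((1/2)^k)" for k
  proof -
    have "(\<integral>\<^sup>+x. ennreal (2^k * (cmod (?d k x))\<^sup>2) \<partial>M) = ennreal (\<integral>x. 2^k * (cmod (?d k x))\<^sup>2 \<partial>M)"
      using L2_integrable_sq[OF d] by (intro nn_integral_eq_integral) auto
    also have "(\<integral>x. 2^k * (cmod (?d k x))\<^sup>2 \<partial>M) = 2^k * (L2_norm M (?d k))\<^sup>2"
      by (simp add: L2_norm_sq)
    also have "\<dots> \<le> 2^k * ((1/2)^k)\<^sup>2" using fast[of k] by (intro mult_left_mono power_mono) auto
    also have "\<dots> = (1/2)^k" by (simp add: power2_eq_square power_divide)
    finally show ?thesis by (simp add: ennreal_leI)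
  qed
  have "(\<integral>\<^sup>+x. (\<Sum>k. ennreal (2^k * (cmod (?d k x))\<^sup>2)) \<partial>M) = (\<Sum>k. \<integral>\<^sup>+x. ennreal (2^k * (cmod (?d k x))\<^sup>2) \<partial>M)"
    by (intro nn_integral_suminf) measurable
  also have "\<dots> \<le> (\<Sum>k. ennreal ((1/2)^k))" by (intro suminf_le int) auto
  also have "\<dots> = ennreal (\<Sum>k. (1/2)^k)" by (intro suminf_ennreal2) (auto intro: summable_geometric)
  also have "\<dots> < \<infinity>" by simp
  finally have fin: "(\<integral>\<^sup>+x. (\<Sum>k. ennreal (2^k * (cmod (?d k x))\<^sup>2)) \<partial>M) \<noteq> \<infinity>" by simp
  have "AE x in M. (\<Sum>k. ennreal (2^k * (cmod (?d k x))\<^sup>2)) \<noteq> \<infinity>"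
  proof (rule nn_integral_noteq_infinite)
    show "(\<lambda>x. \<Sum>k. ennreal (2^k * (cmod (?d k x))\<^sup>2)) \<in> borel_measurable M" by measurable
  qed (rule fin)
  then show ?thesis
  proof eventually_elim
    case (elim x)
    have "summable (\<lambda>k. 2^k * (cmod (?d k x))\<^sup>2)"
      using elim by (intro summable_suminf_not_top) auto
    then have "(\<lambda>k. 2^k * (cmod (?d k x))\<^sup>2) \<longlonglongrightarrow> 0" by (rule summable_LIMSEQ_zero)
    then have "Bseq (\<lambda>k. 2^k * (cmod (?d k x))\<^sup>2)" by (intro convergent_imp_Bseq) (auto simp: convergent_def)
    then obtain C where C: "C > 0" "\<And>k. norm (2^k * (cmod (?d k x))\<^sup>2) \<le> C" by (auto simp: Bseq_def)
    have "cmod (?d k x) \<le> sqrt C * (1 / sqrt 2)^k" for k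
    proof (rule power2_le_imp_le)
      have "(sqrt C * (1 / sqrt 2)^k)\<^sup>2 = C * ((1 / sqrt 2)\<^sup>2)^k"
        using C(1) unfolding power_mult_distrib power_mult[symmetric] by (simp add: mult.commute)
      also have "\<dots> = C / 2^k" by (simp add: power_divide)
      finally show "(cmod (?d k x))\<^sup>2 \<le> (sqrt C * (1 / sqrt 2)^k)\<^sup>2"
        using C(2)[of k] by (simp add: pos_le_divide_eq mult.commute)
    qed (use C in auto)
    then have "summable (\<lambda>k. ?d k x)"
      by (intro summable_comparison_test[OF _ summable_mult[OF summable_geometric[of "1/sqrt 2"]]]) auto
    then have "convergent (\<lambda>n. \<Sum>k<n. ?d k x)" by (simp add: summable_iff_convergent)
    then have "convergent (\<lambda>n. g n x - g 0 x)" by (simp add: sum_lessThan_telescope[of "\<lambda>k. g k x"])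
    then obtain l where "(\<lambda>n. g n x - g 0 x) \<longlonglongrightarrow> l" by (auto simp: convergent_def)
    from tendsto_add[OF this tendsto_const[of "g 0 x"]] show ?case by (auto simp: convergent_def)
  qed
qed

text \<open>
  The Riesz--Fischer theorem: the almost everywhere limit of a fast subsequence is the limit in norm,
  by Fatou's lemma.
\<close>

theorem L2_complete:
  assumes f: "\<And>n. f n \<in> L2 M"
    and Cauchy: "\<And>e. e > 0 \<Longrightarrow> \<exists>N. \<forall>m\<ge>N. \<forall>n\<ge>N. L2_norm M (\<lambda>x. f m x - f n x) < e"
  shows "\<exists>g\<in>L2 M. (\<lambda>n. L2_norm M (\<lambda>x. f n x - g x)) \<longlonglongrightarrow> 0"
proof -
  have "\<forall>k. \<exists>N. \<forall>m\<ge>N. \<forall>n\<ge>N. L2_norm M (\<lambda>x. f m x - f n x) < (1/2)^k"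
    using Cauchy by simp
  then obtain N where N: "\<And>k m n. m \<ge> N k \<Longrightarrow> n \<ge> N k \<Longrightarrow> L2_norm M (\<lambda>x. f m x - f n x) < (1/2)^k"
    by metis
  define r where "r k = (\<Sum>i\<le>k. N i) + k" for k
  have r_ge: "r k \<ge> N k" "r k \<ge> k" for k
    using member_le_sum[of k "{..k}" N] by (auto simp: r_def)
  have r_mono: "r k \<le> r (Suc k)" for k by (simp add: r_def)
  let ?g = "\<lambda>k. f (r k)"
  note [measurable] = L2_measurable[OF f]
  have "AE x in M. convergent (\<lambda>k. ?g k x)"
  proof (rule L2_fast_Cauchy_AE)
    show "L2_norm M (\<lambda>x. ?g (Suc k) x - ?g k x) \<le> (1/2)^k" for k
      using N[of k "r (Suc k)" "r k"] r_ge r_mono order_trans less_imp_le by metis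
  qed (rule f)
  define g where "g x = lim (\<lambda>k. ?g k x)" for x
  have g_meas [measurable]: "g \<in> borel_measurable M"
    unfolding g_def using f by (intro borel_measurable_lim_metric) (auto simp: L2_def)
  have conv: "AE x in M. (\<lambda>k. ?g k x) \<longlonglongrightarrow> g x"
    using \<open>AE x in M. convergent (\<lambda>k. ?g k x)\<close> by eventually_elim (auto simp: g_def convergent_LIMSEQ_iff)
  have fatou: "(\<integral>\<^sup>+x. ennreal ((cmod (f m x - g x))\<^sup>2) \<partial>M) \<le> ennreal (((1/2)^k)\<^sup>2)" if m: "m \<ge> N k" for m k
  proof -
    have "(\<integral>\<^sup>+x. ennreal ((cmod (f m x - g x))\<^sup>2) \<partial>M)
        = (\<integral>\<^sup>+x. liminf (\<lambda>j. ennreal ((cmod (f m x - ?g j x))\<^sup>2)) \<partial>M)"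
    proof (rule nn_integral_cong_AE)
      show "AE x in M. ennreal ((cmod (f m x - g x))\<^sup>2) = liminf (\<lambda>j. ennreal ((cmod (f m x - ?g j x))\<^sup>2))"
        using conv
      proof eventually_elim
        case (elim x)
        then have "(\<lambda>j. ennreal ((cmod (f m x - ?g j x))\<^sup>2)) \<longlonglongrightarrow> ennreal ((cmod (f m x - g x))\<^sup>2)"
          by (intro tendsto_ennrealI tendsto_intros)
        then show ?case by (intro lim_imp_Liminf[symmetric]) auto
      qed
    qed
    also have "\<dots> \<le> liminf (\<lambda>j. \<integral>\<^sup>+x. ennreal ((cmod (f m x - ?g j x))\<^sup>2) \<partial>M)"
      by (intro nn_integral_liminf) measurable
    also have "\<dots> \<le> liminf (\<lambda>j::nat. ennreal (((1/2)^k)\<^sup>2))"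
    proof (rule Liminf_mono, rule eventually_sequentiallyI[of "N k"])
      fix j assume j: "N k \<le> j"
      have "(\<integral>\<^sup>+x. ennreal ((cmod (f m x - ?g j x))\<^sup>2) \<partial>M) = ennreal (\<integral>x. (cmod (f m x - ?g j x))\<^sup>2 \<partial>M)"
        using L2_integrable_sq[OF L2_diff[OF f f]] by (intro nn_integral_eq_integral) auto
      also have "\<dots> = ennreal ((L2_norm M (\<lambda>x. f m x - ?g j x))\<^sup>2)" by (simp add: L2_norm_sq)
      also have "\<dots> \<le> ennreal (((1/2)^k)\<^sup>2)"
        using N[OF m, of "r j"] r_ge(2)[of j] j by (intro ennreal_leI power_mono) auto
      finally show "(\<integral>\<^sup>+x. ennreal ((cmod (f m x - ?g j x))\<^sup>2) \<partial>M) \<le> ennreal (((1/2)^k)\<^sup>2)" .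
    qed
    also have "\<dots> = ennreal (((1/2)^k)\<^sup>2)" by (simp add: Liminf_const)
    finally show ?thesis .
  qed
  have diff: "(\<lambda>x. f m x - g x) \<in> L2 M" if "m \<ge> N k" for m k
  proof (rule L2I)
    show "integrable M (\<lambda>x. (cmod (f m x - g x))\<^sup>2)"
      using fatou[OF that] f by (intro integrableI_bounded) (auto simp: le_less_trans[OF _ ennreal_less_top])
  qed (use f in measurable)
  have norm_le: "L2_norm M (\<lambda>x. f m x - g x) \<le> (1/2)^k" if "m \<ge> N k" for m k
  proof (rule power2_le_imp_le)
    have eq: "ennreal ((L2_norm M (\<lambda>x. f m x - g x))\<^sup>2) = (\<integral>\<^sup>+x. ennreal ((cmod (f m x - g x))\<^sup>2) \<partial>M)"
      using L2_integrable_sq[OF diff[OF that]] by (simp add: L2_norm_sq nn_integral_eq_integral)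
    have "ennreal ((L2_norm M (\<lambda>x. f m x - g x))\<^sup>2) \<le> ennreal (((1/2)^k)\<^sup>2)"
      unfolding eq by (rule fatou[OF that])
    then show "(L2_norm M (\<lambda>x. f m x - g x))\<^sup>2 \<le> ((1/2)^k)\<^sup>2"
      by (subst (asm) ennreal_le_iff) auto
  qed simp
  have "g \<in> L2 M"
    using L2_diff[OF f[of "N 0"] diff[of 0 "N 0"]] by simp
  moreover have "(\<lambda>n. L2_norm M (\<lambda>x. f n x - g x)) \<longlonglongrightarrow> 0"
  proof (rule LIMSEQ_I)
    fix e :: real assume "e > 0"
    then obtain k where k: "(1/2)^k < e" using real_arch_pow_inv[of e "1/2"] by auto
    then show "\<exists>n0. \<forall>n\<ge>n0. norm (L2_norm M (\<lambda>x. f n x - g x) - 0) < e"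
      using le_less_trans[OF norm_le k] by (intro exI[of _ "N k"]) simp
  qed
  ultimately show ?thesis by blast
qed

subsection \<open>Density by orthogonality\<close>

text \<open>
  The set \<open>S\<close> is dense if only \<open>0\<close> is orthogonal to it.  A sequence in \<open>S\<close> that minimizes the distance
  to \<open>f\<close> is Cauchy by the parallelogram identity; \<open>f - p\<close> is orthogonal to \<open>S\<close> for its limit \<open>p\<close>.
\<close>

theorem L2_dense_if_orthogonal_zero:
  assumes S: "S \<subseteq> L2 M" and S0: "(\<lambda>x. 0) \<in> S"
    and lin: "\<And>f g c. f \<in> S \<Longrightarrow> g \<in> S \<Longrightarrow> (\<lambda>x. f x + c * g x) \<in> S"
    and orth: "\<And>f. f \<in> L2 M \<Longrightarrow> (\<And>s. s \<in> S \<Longrightarrow> L2_inner M s f = 0) \<Longrightarrow> AE x in M. f x = 0"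
  shows "L2_dense M S"
  unfolding L2_dense_def
proof (intro ballI allI impI)
  fix f and \<epsilon> :: real assume f: "f \<in> L2 M" and eps: "\<epsilon> > 0"
  define d where "d = Inf ((\<lambda>s. L2_norm M (\<lambda>x. f x - s x)) ` S)"
  have bdd: "bdd_below ((\<lambda>s. L2_norm M (\<lambda>x. f x - s x)) ` S)" by (rule bdd_belowI[of _ 0]) auto
  have d_le: "d \<le> L2_norm M (\<lambda>x. f x - s x)" if "s \<in> S" for s
    unfolding d_def using bdd that by (intro cInf_lower) auto
  have d0: "d \<ge> 0" unfolding d_def using S0 by (intro cInf_greatest) auto
  have "\<exists>s\<in>S. L2_norm M (\<lambda>x. f x - s x) < d + 1 / Suc n" for n
    using cInf_lessD[of "(\<lambda>s. L2_norm M (\<lambda>x. f x - s x)) ` S" "d + 1 / Suc n"] S0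
    unfolding d_def by auto
  then obtain s where s: "\<And>n. s n \<in> S" "\<And>n. L2_norm M (\<lambda>x. f x - s n x) < d + 1 / Suc n" by metis
  have sL: "s n \<in> L2 M" for n using s(1) S by auto
  have par: "(L2_norm M (\<lambda>x. s m x - s n x))\<^sup>2 \<le>
      2 * (d + 1 / Suc m)\<^sup>2 + 2 * (d + 1 / Suc n)\<^sup>2 - 4 * d\<^sup>2" for m n
  proof -
    let ?a = "\<lambda>x. f x - s m x" and ?b = "\<lambda>x. f x - s n x"
    have L: "?a \<in> L2 M" "?b \<in> L2 M" using f sL by (auto intro: L2_diff)
    have "(L2_norm M (\<lambda>x. ?a x + ?b x))\<^sup>2 + (L2_norm M (\<lambda>x. ?a x + (-1) * ?b x))\<^sup>2
        = 2 * (L2_norm M ?a)\<^sup>2 + 2 * (L2_norm M ?b)\<^sup>2"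
      using L2_norm_add_sq[OF L] L2_norm_add_sq[OF L(1) L2_scale[OF L(2), of "-1"]]
      unfolding L2_inner_scale_right L2_norm_scale by simp
    moreover have "L2_norm M (\<lambda>x. ?a x + (-1) * ?b x) = L2_norm M (\<lambda>x. s m x - s n x)"
      by (simp add: L2_norm_def norm_minus_commute)
    moreover have "(\<lambda>x. s m x / 2 + s n x / 2) \<in> S"
    proof -
      have "(\<lambda>x. 0 + (1/2) * s m x) \<in> S" using lin[OF S0 s(1), of "1/2"] .
      from lin[OF this s(1)[of n], of "1/2"] show ?thesis by simp
    qed
    moreover have "L2_norm M (\<lambda>x. ?a x + ?b x) = 2 * L2_norm M (\<lambda>x. f x - (s m x / 2 + s n x / 2))"
      using L2_norm_scale[of M 2 "\<lambda>x. f x - (s m x / 2 + s n x / 2)"] by (simp add: algebra_simps)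
    ultimately have eq: "4 * (L2_norm M (\<lambda>x. f x - (s m x / 2 + s n x / 2)))\<^sup>2 + (L2_norm M (\<lambda>x. s m x - s n x))\<^sup>2
        = 2 * (L2_norm M ?a)\<^sup>2 + 2 * (L2_norm M ?b)\<^sup>2" and mid: "(\<lambda>x. s m x / 2 + s n x / 2) \<in> S"
      by (auto simp: power_mult_distrib)
    have "d\<^sup>2 \<le> (L2_norm M (\<lambda>x. f x - (s m x / 2 + s n x / 2)))\<^sup>2"
      using d_le[OF mid] d0 by (intro power_mono) auto
    moreover have "(L2_norm M ?a)\<^sup>2 \<le> (d + 1 / Suc m)\<^sup>2" "(L2_norm M ?b)\<^sup>2 \<le> (d + 1 / Suc n)\<^sup>2"
      using s(2)[of m] s(2)[of n] by (auto intro!: power_mono)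
    ultimately show ?thesis using eq by linarith
  qed
  have lim_par: "(\<lambda>n. 2 * (d + 1 / Suc n)\<^sup>2 - 2 * d\<^sup>2) \<longlonglongrightarrow> 0"
    by (rule tendsto_eq_intros LIMSEQ_Suc[OF lim_1_over_n] refl | simp)+
  have "\<exists>p\<in>L2 M. (\<lambda>n. L2_norm M (\<lambda>x. s n x - p x)) \<longlonglongrightarrow> 0"
  proof (rule L2_complete[OF sL])
    fix e :: real assume e: "e > 0"
    then have "\<forall>\<^sub>F n in sequentially. 2 * (d + 1 / Suc n)\<^sup>2 - 2 * d\<^sup>2 < e\<^sup>2 / 2"
      by (intro order_tendstoD[OF lim_par]) auto
    then obtain N where N: "\<And>n. n \<ge> N \<Longrightarrow> 2 * (d + 1 / Suc n)\<^sup>2 - 2 * d\<^sup>2 < e\<^sup>2 / 2"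
      by (auto simp: eventually_sequentially)
    have "L2_norm M (\<lambda>x. s m x - s n x) < e" if "m \<ge> N" "n \<ge> N" for m n
    proof (rule power2_less_imp_less)
      show "(L2_norm M (\<lambda>x. s m x - s n x))\<^sup>2 < e\<^sup>2"
        using par[of m n] N[OF that(1)] N[OF that(2)] by linarith
    qed (use e in simp)
    then show "\<exists>N. \<forall>m\<ge>N. \<forall>n\<ge>N. L2_norm M (\<lambda>x. s m x - s n x) < e" by blast
  qed
  then obtain p where p: "p \<in> L2 M" and sp: "(\<lambda>n. L2_norm M (\<lambda>x. s n x - p x)) \<longlonglongrightarrow> 0" by blast
  let ?r = "\<lambda>x. f x - p x"
  have r: "?r \<in> L2 M" using f p by (rule L2_diff)
  have "(\<lambda>n. L2_norm M (\<lambda>x. f x - s n x)) \<longlonglongrightarrow> L2_norm M ?r"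
  proof (rule L2_norm_tendsto)
    show "(\<lambda>n. L2_norm M (\<lambda>x. (f x - s n x) - (f x - p x))) \<longlonglongrightarrow> 0"
      using sp by (simp add: L2_norm_minus_commute)
  qed (use f sL r in \<open>auto intro: L2_diff\<close>)
  moreover have "(\<lambda>n. d + 1 / Suc n) \<longlonglongrightarrow> d"
    by (rule tendsto_eq_intros LIMSEQ_Suc[OF lim_1_over_n] refl | simp)+
  ultimately have r_le: "L2_norm M ?r \<le> d" using s(2) by (intro LIMSEQ_le) (auto intro: less_imp_le)
  have r_min: "d \<le> L2_norm M (\<lambda>x. ?r x + c * t x)" if t: "t \<in> S" for t c
  proof -
    have tL: "t \<in> L2 M" using t S by auto
    have "(\<lambda>n. L2_norm M (\<lambda>x. f x - s n x + c * t x)) \<longlonglongrightarrow> L2_norm M (\<lambda>x. ?r x + c * t x)"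
    proof (rule L2_norm_tendsto)
      show "(\<lambda>n. L2_norm M (\<lambda>x. (f x - s n x + c * t x) - (f x - p x + c * t x))) \<longlonglongrightarrow> 0"
        using sp by (simp add: L2_norm_minus_commute)
    qed (use f sL p tL in \<open>auto intro!: L2_add[OF L2_diff L2_scale]\<close>)
    moreover have "d \<le> L2_norm M (\<lambda>x. f x - s n x + c * t x)" for n
      using d_le[OF lin[OF s(1)[of n] t, of "-c"]] by (simp add: algebra_simps)
    ultimately show ?thesis by (intro LIMSEQ_le_const) auto
  qed
  have "L2_inner M t ?r = 0" if t: "t \<in> S" for t
  proof -
    have tL: "t \<in> L2 M" using t S by auto
    define z where "z = L2_inner M ?r t"
    define K where "K = (L2_norm M t)\<^sup>2"
    have ineq: "2 * a * (cmod z)\<^sup>2 \<le> a\<^sup>2 * (cmod z)\<^sup>2 * K" if "a > 0" for a :: real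
    proof -
      let ?c = "- of_real a * z"
      have "(L2_norm M ?r)\<^sup>2 \<le> (L2_norm M (\<lambda>x. ?r x + ?c * t x))\<^sup>2"
        using r_min[OF t, of ?c] r_le by (intro power_mono) auto
      also have "\<dots> = (L2_norm M ?r)\<^sup>2 + (cmod ?c * L2_norm M t)\<^sup>2 + 2 * Re (cnj ?c * z)"
        using L2_norm_add_sq[OF r L2_scale[OF tL, of ?c]] unfolding L2_inner_scale_right L2_norm_scale z_def .
      also have "Re (cnj ?c * z) = - a * (cmod z)\<^sup>2"
        unfolding cmod_power2 by (simp add: power2_eq_square) algebra
      finally show ?thesis using that by (simp add: K_def norm_mult power_mult_distrib)
    qed
    \<comment> \<open>As $a\to0$ the left-hand side is of first and the right-hand side of second order in \<open>a\<close>, which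
      forces $z = 0$; the value $a = 1/(K+1)$ is small enough.\<close>
    have "cmod z = 0"
    proof (rule ccontr)
      assume "cmod z \<noteq> 0"
      then have z: "(cmod z)\<^sup>2 > 0" by simp
      have K0: "K \<ge> 0" by (simp add: K_def)
      have "(2 * (1/(K+1))) * (cmod z)\<^sup>2 \<le> ((1/(K+1))\<^sup>2 * K) * (cmod z)\<^sup>2"
        using ineq[of "1/(K+1)"] K0 by (simp add: mult_ac)
      then have "2 * (1/(K+1)) \<le> (1/(K+1))\<^sup>2 * K" using z by (rule mult_right_le_imp_le)
      then have "2 * (1/(K+1)) \<le> (K/(K+1)) * (1/(K+1))" by (simp add: power2_eq_square mult_ac)
      then have "2 \<le> K/(K+1)" by (rule mult_right_le_imp_le) (use K0 in simp)
      moreover have "K/(K+1) \<le> 1" using K0 by simp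
      ultimately show False by linarith
    qed
    then show ?thesis using L2_inner_commute[of M t ?r] by (simp add: z_def)
  qed
  from orth[OF r this] have "L2_norm M ?r = 0" using L2_norm_eq_0[OF r] by simp
  then have "L2_norm M (\<lambda>x. f x - s n x) \<le> L2_norm M (\<lambda>x. s n x - p x)" for n
    using L2_triangle_diff[OF f p sL[of n]] L2_norm_minus_commute[of M p "s n"] by linarith
  moreover obtain n where "L2_norm M (\<lambda>x. s n x - p x) < \<epsilon>"
    using order_tendstoD(2)[OF sp eps] by (auto simp: eventually_sequentially)
  ultimately have "L2_norm M (\<lambda>x. f x - s n x) < \<epsilon>" by (rule le_less_trans)
  then show "\<exists>g\<in>S. L2_norm M (\<lambda>x. f x - g x) < \<epsilon>" using s(1) by blast
qed

lemma L2_dense_sequence: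
  assumes "L2_dense M S" "f \<in> L2 M"
  obtains s where "\<And>n::nat. s n \<in> S" "(\<lambda>n. L2_norm M (\<lambda>x. s n x - f x)) \<longlonglongrightarrow> 0"
proof -
  have "\<exists>g\<in>S. L2_norm M (\<lambda>x. f x - g x) < 1 / Suc n" for n
    using assms by (auto simp: L2_dense_def)
  then obtain s where s: "\<And>n. s n \<in> S" "\<And>n. L2_norm M (\<lambda>x. f x - s n x) < 1 / Suc n" by metis
  have "(\<lambda>n. L2_norm M (\<lambda>x. s n x - f x)) \<longlonglongrightarrow> 0"
    using s(2) by (intro Lim_null_comparison[OF _ LIMSEQ_Suc[OF lim_1_over_n]] always_eventually)
      (auto simp: L2_norm_minus_commute[of M _ f] intro!: less_imp_le)
  with s(1) show ?thesis by (rule that)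
qed

lemma L2_orthogonal_dense_zero:
  assumes "L2_dense M S" "S \<subseteq> L2 M" "f \<in> L2 M" "\<And>s. s \<in> S \<Longrightarrow> L2_inner M s f = 0"
  shows "AE x in M. f x = 0"
proof -
  obtain s where s: "\<And>n::nat. s n \<in> S" "(\<lambda>n. L2_norm M (\<lambda>x. s n x - f x)) \<longlonglongrightarrow> 0"
    using L2_dense_sequence[OF assms(1,3)] by blast
  have "(\<lambda>n. L2_inner M (s n) f) \<longlonglongrightarrow> L2_inner M f f"
    using s assms by (intro L2_inner_tendsto) auto
  then have "L2_inner M f f = 0" using assms(4) s(1) by (simp add: LIMSEQ_const_iff)
  then show ?thesis using L2_norm_eq_0[OF assms(3)] by (simp add: L2_inner_self)
qed

section \<open>Unitary operators and transported multiplication operators\<close>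

text \<open>
  The property of graphs that makes them relations between elements of $L^2$, not between representatives.
\<close>

definition ae_closed :: "'a measure \<Rightarrow> 'b measure \<Rightarrow> ('a, 'b) l2op \<Rightarrow> bool" where
  "ae_closed M N A \<longleftrightarrow> A \<subseteq> L2 M \<times> L2 N \<and>
     (\<forall>f g f' g'. (f, g) \<in> A \<longrightarrow> f' \<in> borel_measurable M \<longrightarrow> g' \<in> borel_measurable N \<longrightarrow>
        (AE x in M. f' x = f x) \<longrightarrow> (AE x in N. g' x = g x) \<longrightarrow> (f', g') \<in> A)"

text \<open>
  A graph that satisfies the definition of unitarity need not contain all representatives, so that closedness under
  changes on null sets is a separate assumption.  Then the adjoint is exactly the converse graph.
\<close>

locale l2_unitary =
  fixes M :: "'a measure" and N :: "'b measure" and W :: "('a, 'b) l2op"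
  assumes unitary: "unitary_op M N W" and closed: "ae_closed M N W"
begin

lemma in_L2: "(f, g) \<in> W \<Longrightarrow> f \<in> L2 M" "(f, g) \<in> W \<Longrightarrow> g \<in> L2 N"
  using closed by (auto simp: ae_closed_def)

lemma image_ex: "f \<in> L2 M \<Longrightarrow> \<exists>g. (f, g) \<in> W"
  using unitary by (auto simp: unitary_op_def)

lemma preimage_ex: "g \<in> L2 N \<Longrightarrow> \<exists>f. (f, g) \<in> W"
  using unitary by (auto simp: unitary_op_def)

lemma inner_eq: "(f, g) \<in> W \<Longrightarrow> (f', g') \<in> W \<Longrightarrow> L2_inner N g g' = L2_inner M f f'"
  using unitary by (fastforce simp: unitary_op_def)

lemma norm_eq: assumes "(f, g) \<in> W" shows "L2_norm N g = L2_norm M f"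
proof -
  have "complex_of_real ((L2_norm N g)\<^sup>2) = complex_of_real ((L2_norm M f)\<^sup>2)"
    using inner_eq[OF assms assms] unfolding L2_inner_self .
  then have "(L2_norm N g)\<^sup>2 = (L2_norm M f)\<^sup>2" using of_real_eq_iff by blast
  then show ?thesis by simp
qed

lemma AE_replace:
  assumes "(f, g) \<in> W" "f' \<in> borel_measurable M" "g' \<in> borel_measurable N"
    "AE x in M. f' x = f x" "AE x in N. g' x = g x"
  shows "(f', g') \<in> W"
  using closed assms unfolding ae_closed_def by blast

lemma linear:
  assumes 1: "(f, g) \<in> W" and 2: "(f', g') \<in> W"
  shows "((\<lambda>x. f x + c * f' x), (\<lambda>x. g x + c * g' x)) \<in> W"
proof -
  let ?F = "\<lambda>x. f x + c * f' x" and ?G = "\<lambda>x. g x + c * g' x"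
  note L = in_L2[OF 1] in_L2[OF 2]
  have F: "?F \<in> L2 M" and G: "?G \<in> L2 N" using L by (auto intro: L2_add L2_scale)
  \<comment> \<open>Linearity comes from the preservation of inner products: the distance of an image \<open>k\<close> of the
    linear combination to the combination of the images is expressed by inner products, and vanishes.\<close>
  obtain k where k: "(?F, k) \<in> W" using image_ex[OF F] by blast
  note kL = in_L2(2)[OF k]
  note e = L2_inner_add_left L2_inner_add_right L2_inner_diff_left L2_inner_diff_right
    L2_inner_scale_left L2_inner_scale_right
  have kG: "L2_inner N k ?G = L2_inner M ?F ?F"
    using L F kL by (simp add: e L2_scale L2_add inner_eq[OF k 1] inner_eq[OF k 2] algebra_simps)
  have gg: "L2_inner N ?G ?G = L2_inner M ?F ?F"
    using L by (simp add: e L2_scale L2_add inner_eq[OF 1 1] inner_eq[OF 2 1] inner_eq[OF 1 2] inner_eq[OF 2 2] algebra_simps)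
  have "L2_inner N (\<lambda>x. k x - ?G x) (\<lambda>x. k x - ?G x) =
      L2_inner N k k - L2_inner N k ?G - (L2_inner N ?G k - L2_inner N ?G ?G)"
    using kL G by (subst L2_inner_diff_left[OF kL G L2_diff[OF kL G]])
       (simp add: L2_inner_diff_right)
  also have "\<dots> = 0"
    using inner_eq[OF k k] kG gg L2_inner_commute[of N ?G k] L2_inner_commute[of M ?F ?F] by simp
  finally have "L2_norm N (\<lambda>x. k x - ?G x) = 0" by (simp add: L2_inner_self)
  then have "AE x in N. ?G x = k x"
    using L2_norm_diff_le_0_AE[OF kL G] by (auto elim: eventually_mono)
  then show ?thesis using AE_replace[OF k] F G by (auto simp: L2_measurable)
qed

lemma diff:
  assumes "(f, g) \<in> W" "(f', g') \<in> W"
  shows "((\<lambda>x. f x - f' x), (\<lambda>x. g x - g' x)) \<in> W"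
  using linear[OF assms, of "-1"] by simp

lemma zero: "((\<lambda>x. 0), (\<lambda>x. 0)) \<in> W"
proof -
  obtain g where "((\<lambda>x. 0), g) \<in> W" using image_ex[OF L2_zero] by blast
  from diff[OF this this] show ?thesis by simp
qed

lemma scale: "(f, g) \<in> W \<Longrightarrow> ((\<lambda>x. c * f x), (\<lambda>x. c * g x)) \<in> W"
  using linear[OF zero, of f g c] by simp

lemma sum:
  "(\<And>i. i < n \<Longrightarrow> (f i, g i) \<in> W) \<Longrightarrow>
     ((\<lambda>x. \<Sum>i<(n::nat). c i * f i x), (\<lambda>x. \<Sum>i<n. c i * g i x)) \<in> W"
proof (induction n)
  case 0 then show ?case using zero by simp
next
  case (Suc n)
  then show ?case using linear[of "\<lambda>x. \<Sum>i<n. c i * f i x" "\<lambda>x. \<Sum>i<n. c i * g i x" "f n" "g n" "c n"]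
    by simp
qed

lemma dist_eq:
  "(f, g) \<in> W \<Longrightarrow> (f', g') \<in> W \<Longrightarrow> L2_norm N (\<lambda>x. g x - g' x) = L2_norm M (\<lambda>x. f x - f' x)"
  using norm_eq[OF diff] by blast

lemma image_unique:
  assumes "(f, g) \<in> W" "(f', g') \<in> W" "AE x in M. f x = f' x"
  shows "AE x in N. g x = g' x"
proof -
  have "L2_norm M (\<lambda>x. f x - f' x) = 0"
    using L2_norm_eq_0[OF L2_diff[OF in_L2(1)[OF assms(1)] in_L2(1)[OF assms(2)]]] assms(3) by simp
  then show ?thesis
    using L2_norm_diff_le_0_AE[OF in_L2(2)[OF assms(1)] in_L2(2)[OF assms(2)]] dist_eq[OF assms(1,2)] by simp
qed

lemma preimage_unique:
  assumes "(f, g) \<in> W" "(f', g') \<in> W" "AE x in N. g x = g' x"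
  shows "AE x in M. f x = f' x"
proof -
  have "L2_norm N (\<lambda>x. g x - g' x) = 0"
    using L2_norm_eq_0[OF L2_diff[OF in_L2(2)[OF assms(1)] in_L2(2)[OF assms(2)]]] assms(3) by simp
  then show ?thesis
    using L2_norm_diff_le_0_AE[OF in_L2(1)[OF assms(1)] in_L2(1)[OF assms(2)]] dist_eq[OF assms(1,2)] by simp
qed

lemma converse: "l2_unitary N M (W\<inverse>)"
proof
  show "unitary_op N M (W\<inverse>)"
    using unitary inner_eq by (auto simp: unitary_op_def)
  show "ae_closed N M (W\<inverse>)"
    using closed unfolding ae_closed_def by blast
qed

lemma adj_eq_converse: "op_adj M N W = W\<inverse>"
proof (intro set_eqI iffI; clarify)
  fix g k assume "(g, k) \<in> op_adj M N W"
  then have gk: "g \<in> L2 N" "k \<in> L2 M" and adj: "\<And>f h. (f, h) \<in> W \<Longrightarrow> L2_inner N h g = L2_inner M f k"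
    by (auto simp: op_adj_def)
  obtain k' where k': "(k', g) \<in> W" using preimage_ex[OF gk(1)] by blast
  have k'L: "k' \<in> L2 M" using in_L2 k' by blast
  have "L2_inner M f k' = L2_inner M f k" if f: "f \<in> L2 M" for f
    using image_ex[OF f] inner_eq[OF _ k'] adj by metis
  then have "L2_inner M (\<lambda>x. k' x - k x) (\<lambda>x. k' x - k x) = 0"
    using L2_inner_diff_right[OF k'L gk(2) L2_diff[OF k'L gk(2)]] L2_diff[OF k'L gk(2)] by simp
  then have "L2_norm M (\<lambda>x. k' x - k x) = 0" by (simp add: L2_inner_self)
  then have "AE x in M. k x = k' x"
    using L2_norm_diff_le_0_AE[OF k'L gk(2)] by (auto elim: eventually_mono)
  then show "(k, g) \<in> W" using AE_replace[OF k', of k g] gk by (auto simp: L2_measurable)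
next
  fix g k assume "(k, g) \<in> W"
  then show "(g, k) \<in> op_adj M N W"
    using in_L2 inner_eq unfolding op_adj_def by fast
qed

end

lemma l2_unitary_comp:
  assumes "l2_unitary M N W" "l2_unitary N K V"
  shows "l2_unitary M K (W O V)"
proof
  interpret W: l2_unitary M N W by fact
  interpret V: l2_unitary N K V by fact
  show "unitary_op M K (W O V)"
    unfolding unitary_op_def
  proof (intro conjI)
    show "Domain (W O V) = L2 M" using W.image_ex V.image_ex W.in_L2 by blast
    show "Range (W O V) = L2 K" using W.preimage_ex V.preimage_ex V.in_L2 by blast
    show "\<forall>(f, g)\<in>W O V. \<forall>(f', g')\<in>W O V. L2_inner K g g' = L2_inner M f f'"
      using W.inner_eq V.inner_eq by fastforce
  qed
  show "ae_closed M K (W O V)"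
    unfolding ae_closed_def
  proof (intro conjI allI impI)
    show "W O V \<subseteq> L2 M \<times> L2 K" using W.in_L2 V.in_L2 by blast
    fix f g f' g'
    assume "(f, g) \<in> W O V" and m: "f' \<in> borel_measurable M" "g' \<in> borel_measurable K"
      and ae: "AE x in M. f' x = f x" "AE x in K. g' x = g x"
    then obtain h where h: "(f, h) \<in> W" "(h, g) \<in> V" by blast
    have "(f', h) \<in> W" using W.AE_replace[OF h(1) m(1) _ ae(1), of h] W.in_L2(2)[OF h(1)] by (simp add: L2_measurable)
    moreover have "(h, g') \<in> V" using V.AE_replace[OF h(2) _ m(2) _ ae(2), of h] W.in_L2(2)[OF h(1)] by (simp add: L2_measurable)
    ultimately show "(f', g') \<in> W O V" by blast
  qed
qed

context l2_unitary
begin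

lemma adj_conj:
  assumes A: "A \<subseteq> L2 N \<times> L2 N"
  shows "op_adj M M (W O A O W\<inverse>) = W O op_adj N N A O W\<inverse>"
proof (intro set_eqI iffI; clarify)
  fix g k assume gk: "(g, k) \<in> op_adj M M (W O A O W\<inverse>)"
  then have L: "g \<in> L2 M" "k \<in> L2 M" by (auto simp: op_adj_def)
  obtain g' k' where W: "(g, g') \<in> W" "(k, k') \<in> W" using L image_ex by blast
  have "L2_inner N b g' = L2_inner N a k'" if ab: "(a, b) \<in> A" for a b
  proof -
    obtain f h where fh: "(f, a) \<in> W" "(h, b) \<in> W" using A ab preimage_ex by blast
    then have "(f, h) \<in> W O A O W\<inverse>" using ab by blast
    then have "L2_inner M h g = L2_inner M f k" using gk by (auto simp: op_adj_def)
    then show ?thesis using inner_eq[OF fh(2) W(1)] inner_eq[OF fh(1) W(2)] by simp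
  qed
  then have "(g', k') \<in> op_adj N N A" using W in_L2 by (auto simp: op_adj_def)
  then show "(g, k) \<in> W O op_adj N N A O W\<inverse>" using W by blast
next
  fix g g' k' k assume W: "(g, g') \<in> W" "(k, k') \<in> W" and adj: "(g', k') \<in> op_adj N N A"
  have "L2_inner M h g = L2_inner M f k" if fh: "(f, h) \<in> W O A O W\<inverse>" for f h
  proof -
    obtain a b where ab: "(f, a) \<in> W" "(h, b) \<in> W" "(a, b) \<in> A" using fh by blast
    then have "L2_inner N b g' = L2_inner N a k'" using adj by (auto simp: op_adj_def)
    then show ?thesis using inner_eq[OF ab(2) W(1)] inner_eq[OF ab(1) W(2)] by simp
  qed
  then show "(g, k) \<in> op_adj M M (W O A O W\<inverse>)" using W in_L2 by (auto simp: op_adj_def)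
qed

lemma selfadjoint_conj:
  assumes A: "A \<subseteq> L2 N \<times> L2 N" and sa: "selfadjoint N A"
  shows "selfadjoint M (W O A O W\<inverse>)"
  unfolding selfadjoint_def
proof
  show "op_adj M M (W O A O W\<inverse>) = W O A O W\<inverse>"
    using adj_conj[OF A] sa by (simp add: selfadjoint_def)
  show "L2_dense M (Domain (W O A O W\<inverse>))"
    unfolding L2_dense_def
  proof (intro ballI allI impI)
    fix f and e :: real assume f: "f \<in> L2 M" and e: "e > 0"
    obtain g where g: "(f, g) \<in> W" using image_ex[OF f] by blast
    obtain g' where g': "g' \<in> Domain A" "L2_norm N (\<lambda>x. g x - g' x) < e"
      using sa in_L2(2)[OF g] e unfolding selfadjoint_def L2_dense_def by blast
    obtain h where h: "(g', h) \<in> A" using g' by blast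
    obtain f' k where fk: "(f', g') \<in> W" "(k, h) \<in> W" using h A preimage_ex by blast
    then show "\<exists>g\<in>Domain (W O A O W\<inverse>). L2_norm M (\<lambda>x. f x - g x) < e"
      using h dist_eq[OF g fk(1)] g'(2) by (intro bexI[of _ f']) auto
  qed
qed

end

definition mult_op :: "'b measure \<Rightarrow> ('b \<Rightarrow> real) \<Rightarrow> ('b, 'b) l2op" where
  "mult_op N l = op_of N N (\<lambda>f x. of_real (l x) * f x)"

lemma mult_op_iff: "(f, g) \<in> mult_op N l \<longleftrightarrow> f \<in> L2 N \<and> g \<in> L2 N \<and> (AE x in N. g x = of_real (l x) * f x)"
  by (simp add: mult_op_def op_of_def)

lemma mult_op_subset: "mult_op N l \<subseteq> L2 N \<times> L2 N"
  by (auto simp: mult_op_iff)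

text \<open>
  Vectors supported in a set \<open>{\<bar>l\<bar> \<le> n}\<close> lie in the domain of the multiplication by \<open>l\<close>, which makes
  the domain dense and identifies the adjoint by testing with such vectors.
\<close>

lemma cutoff_L2:
  fixes l :: "'b \<Rightarrow> real"
  assumes [measurable]: "l \<in> borel_measurable N" and f: "f \<in> L2 N"
  shows "(\<lambda>x. of_real (indicator {x. \<bar>l x\<bar> \<le> c} x) * f x) \<in> L2 N"
    "(\<lambda>x. of_real (l x) * (of_real (indicator {x. \<bar>l x\<bar> \<le> c} x) * f x)) \<in> L2 N"
proof -
  have m: "(\<lambda>x. indicator {x. \<bar>l x\<bar> \<le> c} x :: real) \<in> borel_measurable N"
    unfolding indicator_def by measurable
  note [measurable] = m
  show "(\<lambda>x. of_real (indicator {x. \<bar>l x\<bar> \<le> c} x) * f x) \<in> L2 N"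
    by (rule L2_bounded_mult[OF f, where C = 1]) (auto simp: indicator_def)
  have "(\<lambda>x. of_real (l x * indicator {x. \<bar>l x\<bar> \<le> c} x) * f x) \<in> L2 N"
    by (rule L2_bounded_mult[OF f, where C = "\<bar>c\<bar>"]) (auto simp: indicator_def)
  then show "(\<lambda>x. of_real (l x) * (of_real (indicator {x. \<bar>l x\<bar> \<le> c} x) * f x)) \<in> L2 N"
    by (simp add: mult.assoc)
qed

lemma mult_op_adj:
  assumes [measurable]: "l \<in> borel_measurable N"
  shows "op_adj N N (mult_op N l) = mult_op N l"
proof (intro set_eqI iffI; clarify)
  fix g k assume gk: "(g, k) \<in> op_adj N N (mult_op N l)"
  then have L: "g \<in> L2 N" "k \<in> L2 N" by (auto simp: op_adj_def)
  note [measurable] = L[THEN L2_measurable]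
  have "AE x in N. of_real (indicator {x. \<bar>l x\<bar> \<le> real n} x) * (of_real (l x) * g x - k x) = 0" for n
  proof -
    let ?i = "\<lambda>x. complex_of_real (indicator {x. \<bar>l x\<bar> \<le> real n} x)"
    let ?r = "\<lambda>x. ?i x * (of_real (l x) * g x - k x)"
    have "(\<lambda>x. of_real (l x) * (?i x * g x) - ?i x * k x) \<in> L2 N"
      using cutoff_L2[OF assms L(1)] cutoff_L2[OF assms L(2)] by (auto intro: L2_diff)
    then have r: "?r \<in> L2 N" by (simp add: algebra_simps)
    have r': "(\<lambda>x. of_real (l x) * (?i x * ?r x)) \<in> L2 N" "(\<lambda>x. ?i x * ?r x) \<in> L2 N"
      using cutoff_L2[OF assms r] by auto
    then have "((\<lambda>x. ?i x * ?r x), (\<lambda>x. of_real (l x) * (?i x * ?r x))) \<in> mult_op N l"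
      by (simp add: mult_op_iff)
    then have "L2_inner N (\<lambda>x. of_real (l x) * (?i x * ?r x)) g = L2_inner N (\<lambda>x. ?i x * ?r x) k"
      using gk by (auto simp: op_adj_def)
    moreover have "L2_inner N ?r ?r = L2_inner N (\<lambda>x. of_real (l x) * (?i x * ?r x)) g - L2_inner N (\<lambda>x. ?i x * ?r x) k"
      unfolding L2_inner_def
      by (subst Bochner_Integration.integral_diff[symmetric])
         (use L2_integrable_inner[OF r'(1) L(1)] L2_integrable_inner[OF r'(2) L(2)] in
           \<open>auto intro!: Bochner_Integration.integral_cong simp: algebra_simps indicator_def\<close>)
    ultimately have "L2_norm N ?r = 0" by (simp add: L2_inner_self)
    then show ?thesis using L2_norm_eq_0[OF r] by simp
  qed
  then have "AE x in N. \<forall>n. of_real (indicator {x. \<bar>l x\<bar> \<le> real n} x) * (of_real (l x) * g x - k x) = 0"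
    unfolding AE_all_countable by blast
  then have "AE x in N. k x = of_real (l x) * g x"
  proof eventually_elim
    case (elim x)
    obtain n where "\<bar>l x\<bar> \<le> real n" using real_arch_simple by blast
    then show ?case using elim[rule_format, of n] by (auto simp: indicator_def)
  qed
  then show "(g, k) \<in> mult_op N l" using L by (simp add: mult_op_iff)
next
  fix g k assume gk: "(g, k) \<in> mult_op N l"
  then have L: "g \<in> L2 N" "k \<in> L2 N" "AE x in N. k x = of_real (l x) * g x" by (auto simp: mult_op_iff)
  note [measurable] = L(1,2)[THEN L2_measurable]
  have "L2_inner N h g = L2_inner N f k" if "(f, h) \<in> mult_op N l" for f h
  proof -
    have fh: "f \<in> L2 N" "h \<in> L2 N" "AE x in N. h x = of_real (l x) * f x" using that by (auto simp: mult_op_iff)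
    note [measurable] = fh(1,2)[THEN L2_measurable]
    show ?thesis unfolding L2_inner_def
      by (rule integral_cong_AE) (use fh(3) L(3) in \<open>auto elim!: eventually_elim2 simp: mult_ac\<close>)
  qed
  then show "(g, k) \<in> op_adj N N (mult_op N l)" using L by (auto simp: op_adj_def)
qed

lemma selfadjoint_mult_op:
  assumes [measurable]: "l \<in> borel_measurable N"
  shows "selfadjoint N (mult_op N l)"
  unfolding selfadjoint_def
proof
  show "L2_dense N (Domain (mult_op N l))"
    unfolding L2_dense_def
  proof (intro ballI allI impI)
    fix f and e :: real assume f: "f \<in> L2 N" and e: "e > 0"
    let ?f = "\<lambda>n x. complex_of_real (indicator {x. \<bar>l x\<bar> \<le> real n} x) * f x"
    have "(\<lambda>n. L2_norm N (\<lambda>x. ?f n x - f x)) \<longlonglongrightarrow> 0"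
    proof (rule L2_dominated_convergence[OF L2_integrable_sq[OF f]])
      show "?f n \<in> borel_measurable N" for n using cutoff_L2(1)[OF assms f] L2_measurable by blast
      show "AE x in N. (cmod (?f n x - f x))\<^sup>2 \<le> (cmod (f x))\<^sup>2" for n by (auto simp: indicator_def)
      show "AE x in N. (\<lambda>n. ?f n x) \<longlonglongrightarrow> f x"
      proof (rule AE_I2, rule tendsto_eventually)
        fix x
        obtain n where "\<bar>l x\<bar> \<le> real n" using real_arch_simple by blast
        then show "\<forall>\<^sub>F n in sequentially. ?f n x = f x"
          by (intro eventually_sequentiallyI[of n]) (auto simp: indicator_def)
      qed
    qed (use f in measurable)
    then have "\<forall>\<^sub>F n in sequentially. L2_norm N (\<lambda>x. ?f n x - f x) < e" using e order_tendstoD(2) by blast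
    then obtain n where n: "L2_norm N (\<lambda>x. ?f n x - f x) < e" by (auto simp: eventually_sequentially)
    have "(?f n, \<lambda>x. of_real (l x) * ?f n x) \<in> mult_op N l"
      using cutoff_L2[OF assms f] by (simp add: mult_op_iff)
    then show "\<exists>g\<in>Domain (mult_op N l). L2_norm N (\<lambda>x. f x - g x) < e"
      using n by (intro bexI[of _ "?f n"]) (auto simp: L2_norm_minus_commute)
  qed
qed (rule mult_op_adj, fact)

section \<open>Spectral theory of a transported multiplication operator\<close>

text \<open>
  The sets where the real or the imaginary part of \<open>G\<close> is positive, or negative, suffice.
\<close>

lemma AE_zero_if_set_integrals_zero:
  fixes G :: "'a \<Rightarrow> complex"
  assumes G: "integrable M G" and zero: "\<And>B. B \<in> sets M \<Longrightarrow> (\<integral>x. indicator B x *\<^sub>R G x \<partial>M) = 0"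
  shows "AE x in M. G x = 0"
proof -
  have real: "AE x in M. r x \<le> 0" if r: "integrable M r" and z: "\<And>B. B \<in> sets M \<Longrightarrow> (\<integral>x. indicator B x * r x \<partial>M) = 0"
    for r :: "'a \<Rightarrow> real"
  proof -
    have [measurable]: "r \<in> borel_measurable M" using r by auto
    let ?B = "{x \<in> space M. 0 < r x}"
    have B: "?B \<in> sets M" by measurable
    have "integrable M (\<lambda>x. indicator ?B x * r x)" using integrable_mult_indicator[OF B r] by simp
    moreover have "AE x in M. 0 \<le> indicator ?B x * r x" by (auto simp: indicator_def)
    ultimately have "AE x in M. indicator ?B x * r x = 0"
      using integral_nonneg_eq_0_iff_AE z[OF B] by blast
    with AE_space show ?thesis by eventually_elim (auto simp: indicator_def split: if_splits)
  qed
  have ig: "integrable M (\<lambda>x. indicator B x *\<^sub>R G x)" if "B \<in> sets M" for B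
    by (rule integrable_mult_indicator[OF that G])
  have re: "(\<integral>x. indicator B x * Re (G x) \<partial>M) = 0" and im: "(\<integral>x. indicator B x * Im (G x) \<partial>M) = 0"
    if "B \<in> sets M" for B
    using zero[OF that] integral_Re[OF ig[OF that]] integral_Im[OF ig[OF that]] by simp_all
  have "AE x in M. Re (G x) \<le> 0" "AE x in M. - Re (G x) \<le> 0" "AE x in M. Im (G x) \<le> 0" "AE x in M. - Im (G x) \<le> 0"
    using re im G real[of "\<lambda>x. Re (G x)"] real[of "\<lambda>x. - Re (G x)"] real[of "\<lambda>x. Im (G x)"] real[of "\<lambda>x. - Im (G x)"]
    by simp_all
  then show ?thesis by eventually_elim (auto simp: complex_eq_iff)
qed

lemma L2_norm_mono:
  assumes f: "f \<in> borel_measurable M" and g: "g \<in> L2 M" and C: "0 \<le> C" and le: "AE x in M. cmod (f x) \<le> C * cmod (g x)"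
  shows "L2_norm M f \<le> C * L2_norm M g"
proof (rule power2_le_imp_le)
  have le2: "AE x in M. (cmod (f x))\<^sup>2 \<le> C\<^sup>2 * (cmod (g x))\<^sup>2"
    using le by eventually_elim (auto simp: power_mult_distrib[symmetric] intro!: power_mono)
  have ig: "integrable M (\<lambda>x. C\<^sup>2 * (cmod (g x))\<^sup>2)" using L2_integrable_sq[OF g] by simp
  have "f \<in> L2 M" by (rule L2_dominated[OF ig f le2])
  then have "(L2_norm M f)\<^sup>2 \<le> (\<integral>x. C\<^sup>2 * (cmod (g x))\<^sup>2 \<partial>M)"
    unfolding L2_norm_sq using le2 ig by (intro integral_mono_AE L2_integrable_sq)
  then show "(L2_norm M f)\<^sup>2 \<le> (C * L2_norm M g)\<^sup>2"
    by (simp add: power_mult_distrib L2_norm_sq)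
qed (use C in simp)

text \<open>
  The operator \<open>A\<close> that the unitary \<open>W\<close> carries to the multiplication by \<open>l\<close>.  Its spectral projections are the
  multiplications by the indicator functions of $l^{-1}(\Delta)$, and the scalar spectral measure of a vector with
  image \<open>g\<close> is the image under \<open>l\<close> of the measure with density $|g|^2$.
\<close>

locale l2_multiplier = l2_unitary M N W for M :: "'a measure" and N :: "'b measure" and W +
  fixes l :: "'b \<Rightarrow> real"
  assumes l_measurable [measurable]: "l \<in> borel_measurable N"
begin

definition A :: "('a, 'a) l2op" where "A = W O mult_op N l O W\<inverse>"

definition E :: "real set \<Rightarrow> ('a, 'a) l2op" where
  "E \<Delta> = W O mult_op N (\<lambda>x. indicator \<Delta> (l x)) O W\<inverse>"

lemma conj_mult_iff:
  assumes "(f, g) \<in> W" "(k, h) \<in> W"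
  shows "(f, k) \<in> W O mult_op N m O W\<inverse> \<longleftrightarrow> (AE x in N. h x = of_real (m x) * g x)"
proof
  assume "(f, k) \<in> W O mult_op N m O W\<inverse>"
  then obtain a b where ab: "(f, a) \<in> W" "(a, b) \<in> mult_op N m" "(k, b) \<in> W" by blast
  have "AE x in N. a x = g x" "AE x in N. b x = h x"
    using image_unique[OF ab(1) assms(1)] image_unique[OF ab(3) assms(2)] by auto
  moreover have "AE x in N. b x = of_real (m x) * a x" using ab(2) by (simp add: mult_op_iff)
  ultimately show "AE x in N. h x = of_real (m x) * g x" by eventually_elim simp
next
  assume "AE x in N. h x = of_real (m x) * g x"
  then have "(g, h) \<in> mult_op N m" using in_L2(2)[OF assms(1)] in_L2(2)[OF assms(2)] by (simp add: mult_op_iff)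
  then show "(f, k) \<in> W O mult_op N m O W\<inverse>" using assms by blast
qed

lemma conj_mult_in_L2:
  "(f, k) \<in> W O mult_op N m O W\<inverse> \<Longrightarrow> f \<in> L2 M \<and> k \<in> L2 M"
  using in_L2 by blast

lemma selfadjoint_A: "selfadjoint M A"
  unfolding A_def by (rule selfadjoint_conj[OF mult_op_subset selfadjoint_mult_op]) measurable

lemma indicator_measurable [measurable]:
  "\<Delta> \<in> sets borel \<Longrightarrow> (\<lambda>x. indicator \<Delta> (l x) :: real) \<in> borel_measurable N"
  by (rule measurable_compose[OF l_measurable borel_measurable_indicator])

lemma indicator_L2:
  "g \<in> L2 N \<Longrightarrow> \<Delta> \<in> sets borel \<Longrightarrow> (\<lambda>x. of_real (indicator \<Delta> (l x)) * g x) \<in> L2 N"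
  by (rule L2_bounded_mult[where C = 1]) (auto simp: indicator_def)

lemma E_app:
  assumes fg: "(f, g) \<in> W" and D: "\<Delta> \<in> sets borel"
  shows "(op_app (E \<Delta>) f, \<lambda>x. of_real (indicator \<Delta> (l x)) * g x) \<in> W"
    "(f, op_app (E \<Delta>) f) \<in> E \<Delta>"
proof -
  let ?h = "\<lambda>x. complex_of_real (indicator \<Delta> (l x)) * g x"
  have h: "?h \<in> L2 N" using indicator_L2[OF in_L2(2)[OF fg] D] .
  obtain k0 where k0: "(k0, ?h) \<in> W" using preimage_ex[OF h] by blast
  have "(f, k0) \<in> E \<Delta>" unfolding E_def using conj_mult_iff[OF fg k0] by simp
  then show *: "(f, op_app (E \<Delta>) f) \<in> E \<Delta>" unfolding op_app_def by (rule someI[of "\<lambda>g. (f, g) \<in> E \<Delta>"])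
  then have kL: "op_app (E \<Delta>) f \<in> L2 M" unfolding E_def using conj_mult_in_L2 by blast
  obtain h' where h': "(op_app (E \<Delta>) f, h') \<in> W" using image_ex[OF kL] by blast
  have "AE x in N. h' x = ?h x" using * conj_mult_iff[OF fg h'] unfolding E_def by simp
  then show "(op_app (E \<Delta>) f, ?h) \<in> W"
    by (intro AE_replace[OF h']) (use kL h in \<open>auto simp: L2_measurable\<close>)
qed

lemma orth_projection_E:
  assumes D: "\<Delta> \<in> sets borel" shows "orth_projection M (E \<Delta>)"
  unfolding orth_projection_def
proof (intro conjI)
  show "Domain (E \<Delta>) = L2 M"
    using E_app(2)[OF _ D] image_ex conj_mult_in_L2 unfolding E_def by blast
  show "op_adj M M (E \<Delta>) = E \<Delta>"
    unfolding E_def by (subst adj_conj[OF mult_op_subset], subst mult_op_adj) (use D in auto)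
  show "E \<Delta> \<circ>\<^sub>L E \<Delta> = E \<Delta>"
  proof (intro set_eqI iffI; clarify)
    fix f m k assume fm: "(f, m) \<in> E \<Delta>" and mk: "(m, k) \<in> E \<Delta>"
    obtain g n h where W: "(f, g) \<in> W" "(m, n) \<in> W" "(k, h) \<in> W"
      using fm mk image_ex conj_mult_in_L2 unfolding E_def by meson
    have "AE x in N. n x = of_real (indicator \<Delta> (l x)) * g x" "AE x in N. h x = of_real (indicator \<Delta> (l x)) * n x"
      using conj_mult_iff[OF W(1,2), THEN iffD1, OF fm[unfolded E_def]]
        conj_mult_iff[OF W(2,3), THEN iffD1, OF mk[unfolded E_def]] by auto
    then have "AE x in N. h x = of_real (indicator \<Delta> (l x)) * g x"
      by eventually_elim (auto simp: indicator_def)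
    then show "(f, k) \<in> E \<Delta>" using conj_mult_iff[OF W(1,3)] unfolding E_def by blast
  next
    fix f k assume fk: "(f, k) \<in> E \<Delta>"
    obtain g h where W: "(f, g) \<in> W" "(k, h) \<in> W"
      using fk image_ex conj_mult_in_L2 unfolding E_def by meson
    have "AE x in N. h x = of_real (indicator \<Delta> (l x)) * g x"
      using conj_mult_iff[OF W, THEN iffD1, OF fk[unfolded E_def]] .
    then have "AE x in N. h x = of_real (indicator \<Delta> (l x)) * h x"
      by eventually_elim (auto simp: indicator_def)
    then have "(k, k) \<in> E \<Delta>" unfolding E_def by (rule conj_mult_iff[OF W(2,2), THEN iffD2])
    with fk show "(f, k) \<in> E \<Delta> \<circ>\<^sub>L E \<Delta>" by blast
  qed
qed

lemma E_UNIV: "E UNIV = op_id M"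
proof (intro set_eqI iffI; clarify)
  fix f k assume fk: "(f, k) \<in> E UNIV"
  obtain g h where W: "(f, g) \<in> W" "(k, h) \<in> W"
    using fk image_ex conj_mult_in_L2 unfolding E_def by meson
  have "AE x in N. h x = g x" using fk conj_mult_iff[OF W] unfolding E_def by simp
  then show "(f, k) \<in> op_id M"
    using preimage_unique[OF W(2,1)] in_L2(1)[OF W(1)] in_L2(1)[OF W(2)] by (simp add: op_id_def op_of_def)
next
  fix f k assume "(f, k) \<in> op_id M"
  then have L: "f \<in> L2 M" "k \<in> L2 M" "AE x in M. k x = f x" by (auto simp: op_id_def op_of_def)
  obtain g h where W: "(f, g) \<in> W" "(k, h) \<in> W" using L image_ex by meson
  then show "(f, k) \<in> E UNIV" using conj_mult_iff[OF W] image_unique[OF W(2,1) L(3)] unfolding E_def by simp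
qed

lemma E_countably_additive:
  assumes D: "range \<Delta> \<subseteq> sets borel" "disjoint_family \<Delta>" and f: "f \<in> L2 M"
  shows "(\<lambda>n. L2_norm M (\<lambda>x. op_app (E (\<Union>i. \<Delta> i)) f x - (\<Sum>i<n. op_app (E (\<Delta> i)) f x))) \<longlonglongrightarrow> 0"
proof -
  obtain g where fg: "(f, g) \<in> W" using image_ex[OF f] by blast
  note [measurable] = L2_measurable[OF in_L2(2)[OF fg]]
  have Dm [measurable]: "\<Delta> i \<in> sets borel" for i using D by auto
  have Um [measurable]: "(\<Union>i. \<Delta> i) \<in> sets borel" by auto
  let ?i = "\<lambda>A x. complex_of_real (indicator A (l x)) * g x"
  have "((\<lambda>x. \<Sum>i<n. 1 * op_app (E (\<Delta> i)) f x), (\<lambda>x. \<Sum>i<n. 1 * ?i (\<Delta> i) x)) \<in> W" for n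
    by (rule sum) (rule E_app(1)[OF fg Dm])
  from dist_eq[OF this E_app(1)[OF fg Um]]
  have eq: "L2_norm M (\<lambda>x. op_app (E (\<Union>i. \<Delta> i)) f x - (\<Sum>i<n. op_app (E (\<Delta> i)) f x))
      = L2_norm N (\<lambda>x. (\<Sum>i<n. ?i (\<Delta> i) x) - ?i (\<Union>i. \<Delta> i) x)" for n
    using L2_norm_minus_commute[of M "op_app (E (\<Union>i. \<Delta> i)) f" "\<lambda>x. \<Sum>i<n. op_app (E (\<Delta> i)) f x"] by simp
  have sums: "(\<lambda>i. indicator (\<Delta> i) y :: real) sums indicator (\<Union>i. \<Delta> i) y" for y
    using D(2) by (intro indicator_sums) (auto simp: disjoint_family_on_def)
  have bound: "\<bar>(\<Sum>i<n. indicator (\<Delta> i) y) - indicator (\<Union>i. \<Delta> i) y\<bar> \<le> (1::real)" for n y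
  proof -
    have "(\<Sum>i<n. indicator (\<Delta> i) y) \<le> (\<Sum>i. indicator (\<Delta> i) y :: real)"
      using sums[of y] by (intro sum_le_suminf) (auto simp: sums_iff)
    then have "(\<Sum>i<n. indicator (\<Delta> i) y) \<le> (indicator (\<Union>i. \<Delta> i) y :: real)"
      using sums[of y] by (simp add: sums_iff)
    moreover have "0 \<le> (\<Sum>i<n. indicator (\<Delta> i) y :: real)" by (intro sum_nonneg) auto
    moreover have "indicator (\<Union>i. \<Delta> i) y \<le> (1::real)" by (auto simp: indicator_def)
    ultimately show ?thesis by linarith
  qed
  have fac: "(\<Sum>i<n. ?i (\<Delta> i) x) = of_real (\<Sum>i<n. indicator (\<Delta> i) (l x)) * g x" for n x
    by (simp add: sum_distrib_right)
  show ?thesis unfolding eq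
  proof (rule L2_dominated_convergence[OF L2_integrable_sq[OF in_L2(2)[OF fg]]])
    fix n
    show "AE x in N. (cmod ((\<Sum>i<n. ?i (\<Delta> i) x) - ?i (\<Union>i. \<Delta> i) x))\<^sup>2 \<le> (cmod (g x))\<^sup>2"
    proof (rule AE_I2)
      fix x
      have "(\<Sum>i<n. ?i (\<Delta> i) x) - ?i (\<Union>i. \<Delta> i) x
          = of_real ((\<Sum>i<n. indicator (\<Delta> i) (l x)) - indicator (\<Union>i. \<Delta> i) (l x)) * g x"
        unfolding fac by (simp add: left_diff_distrib)
      then have "cmod ((\<Sum>i<n. ?i (\<Delta> i) x) - ?i (\<Union>i. \<Delta> i) x)
          = \<bar>(\<Sum>i<n. indicator (\<Delta> i) (l x)) - indicator (\<Union>i. \<Delta> i) (l x)\<bar> * cmod (g x)"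
        by (simp only: norm_mult norm_of_real)
      also have "\<dots> \<le> 1 * cmod (g x)" using bound by (intro mult_right_mono) auto
      finally show "(cmod ((\<Sum>i<n. ?i (\<Delta> i) x) - ?i (\<Union>i. \<Delta> i) x))\<^sup>2 \<le> (cmod (g x))\<^sup>2"
        by (intro power_mono) auto
    qed
    show "(\<lambda>x. \<Sum>i<n. ?i (\<Delta> i) x) \<in> borel_measurable N" by measurable
  next
    show "?i (\<Union>i. \<Delta> i) \<in> borel_measurable N" by measurable
    show "AE x in N. (\<lambda>n. \<Sum>i<n. ?i (\<Delta> i) x) \<longlonglongrightarrow> ?i (\<Union>i. \<Delta> i) x"
      unfolding fac using sums by (intro AE_I2 tendsto_intros) (simp add: sums_def)
  qed
qed

lemma projection_valued_measure_E: "projection_valued_measure M E"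
  unfolding projection_valued_measure_def
  using orth_projection_E E_UNIV E_countably_additive by blast

lemma scalar_measure_eq:
  assumes fg: "(f, g) \<in> W"
  shows "scalar_measure M E f = distr (density N (\<lambda>x. ennreal ((cmod (g x))\<^sup>2))) borel l"
    (is "_ = ?D")
proof -
  note g = in_L2(2)[OF fg]
  note [measurable] = L2_measurable[OF g]
  have eq: "ennreal (Re (L2_inner M (op_app (E \<Delta>) f) f)) = emeasure ?D \<Delta>" if D[measurable]: "\<Delta> \<in> sets borel" for \<Delta>
  proof -
    have "L2_inner M (op_app (E \<Delta>) f) f = L2_inner N (\<lambda>x. of_real (indicator \<Delta> (l x)) * g x) g"
      using inner_eq[OF E_app(1)[OF fg D] fg] by simp
    also have "\<dots> = (\<integral>x. complex_of_real (indicator \<Delta> (l x) * (cmod (g x))\<^sup>2) \<partial>N)"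
      unfolding L2_inner_def by (intro Bochner_Integration.integral_cong refl) (simp add: complex_norm_square mult.assoc del: of_real_power)
    finally have "Re (L2_inner M (op_app (E \<Delta>) f) f) = (\<integral>x. indicator \<Delta> (l x) * (cmod (g x))\<^sup>2 \<partial>N)"
      by (simp only: integral_complex_of_real Re_complex_of_real)
    moreover have "integrable N (\<lambda>x. indicator \<Delta> (l x) * (cmod (g x))\<^sup>2)"
      by (rule Bochner_Integration.integrable_bound[OF L2_integrable_sq[OF g]]) (auto simp: indicator_def)
    ultimately have "ennreal (Re (L2_inner M (op_app (E \<Delta>) f) f)) = (\<integral>\<^sup>+x. ennreal (indicator \<Delta> (l x) * (cmod (g x))\<^sup>2) \<partial>N)"
      by (simp add: nn_integral_eq_integral)
    also have "\<dots> = (\<integral>\<^sup>+x. ennreal ((cmod (g x))\<^sup>2) * indicator (l -` \<Delta> \<inter> space N) x \<partial>N)"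
      by (intro nn_integral_cong) (auto simp: indicator_def)
    also have "\<dots> = emeasure ?D \<Delta>"
      by (subst emeasure_distr) (auto simp: emeasure_density)
    finally show ?thesis .
  qed
  have "scalar_measure M E f = measure_of UNIV (sets borel) (emeasure ?D)"
    unfolding scalar_measure_def using eq
    by (intro measure_of_eq) (auto simp: sigma_algebra.sigma_sets_eq[OF sets.sigma_algebra_axioms[of borel, simplified]])
  also have "\<dots> = ?D" using measure_of_of_measure[of ?D] by simp
  finally show ?thesis .
qed

lemma spectral_measure: "spectral_measure_of M A E"
  unfolding spectral_measure_of_def
proof (intro conjI)
  show "projection_valued_measure M E" by (rule projection_valued_measure_E)
  have integrable_iff: "integrable (scalar_measure M E f) r \<longleftrightarrow> integrable N (\<lambda>x. (cmod (g x))\<^sup>2 * r (l x))"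
    and integral_eq: "integral\<^sup>L (scalar_measure M E f) r = (\<integral>x. (cmod (g x))\<^sup>2 * r (l x) \<partial>N)"
    if fg: "(f, g) \<in> W" and r[measurable]: "r \<in> borel_measurable borel" for f g and r :: "real \<Rightarrow> real"
  proof -
    note [measurable] = L2_measurable[OF in_L2(2)[OF fg]]
    show "integrable (scalar_measure M E f) r \<longleftrightarrow> integrable N (\<lambda>x. (cmod (g x))\<^sup>2 * r (l x))"
      unfolding scalar_measure_eq[OF fg] by (subst integrable_distr_eq) (auto simp: integrable_density)
    show "integral\<^sup>L (scalar_measure M E f) r = (\<integral>x. (cmod (g x))\<^sup>2 * r (l x) \<partial>N)"
      unfolding scalar_measure_eq[OF fg] by (subst integral_distr) (auto simp: integral_density)
  qed
  show "Domain A = {f \<in> L2 M. integrable (scalar_measure M E f) (\<lambda>r. r\<^sup>2)}"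
  proof (intro set_eqI)
    fix f
    show "f \<in> Domain A \<longleftrightarrow> f \<in> {f \<in> L2 M. integrable (scalar_measure M E f) (\<lambda>r. r\<^sup>2)}"
    proof (cases "f \<in> L2 M")
      case True
      then obtain g where fg: "(f, g) \<in> W" using image_ex by blast
      note g = in_L2(2)[OF fg]
      note [measurable] = L2_measurable[OF g]
      let ?h = "\<lambda>x. complex_of_real (l x) * g x"
      have "f \<in> Domain A \<longleftrightarrow> ?h \<in> L2 N"
      proof
        assume "f \<in> Domain A"
        then obtain k where fk: "(f, k) \<in> A" by blast
        then obtain h where kh: "(k, h) \<in> W" using conj_mult_in_L2 image_ex unfolding A_def by meson
        have "AE x in N. h x = ?h x" using fk conj_mult_iff[OF fg kh] unfolding A_def by simp
        then show "?h \<in> L2 N" by (intro L2_AE_cong[OF in_L2(2)[OF kh]]) auto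
      next
        assume "?h \<in> L2 N"
        then obtain k where kh: "(k, ?h) \<in> W" using preimage_ex by blast
        then have "(f, k) \<in> A" unfolding A_def by (subst conj_mult_iff[OF fg]) auto
        then show "f \<in> Domain A" by blast
      qed
      also have "\<dots> \<longleftrightarrow> integrable N (\<lambda>x. (cmod (g x))\<^sup>2 * (l x)\<^sup>2)"
        by (simp add: L2_def norm_mult power_mult_distrib mult.commute)
      also have "\<dots> \<longleftrightarrow> integrable (scalar_measure M E f) (\<lambda>r. r\<^sup>2)"
        by (subst integrable_iff[OF fg]) auto
      finally show ?thesis using True by simp
    next
      case False
      then show ?thesis using conj_mult_in_L2 unfolding A_def by blast
    qed
  qed
  show "\<forall>(f, k)\<in>A. L2_inner M k f = complex_of_real (\<integral>r. r \<partial>(scalar_measure M E f))"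
  proof clarify
    fix f k assume fk: "(f, k) \<in> A"
    obtain g h where W: "(f, g) \<in> W" "(k, h) \<in> W"
      using fk image_ex conj_mult_in_L2 unfolding A_def by meson
    note [measurable] = in_L2(2)[OF W(1), THEN L2_measurable] in_L2(2)[OF W(2), THEN L2_measurable]
    have ae: "AE x in N. h x = of_real (l x) * g x" using fk conj_mult_iff[OF W] unfolding A_def by blast
    have "L2_inner M k f = L2_inner N h g" using inner_eq[OF W(2,1)] by simp
    also have "\<dots> = (\<integral>x. complex_of_real ((cmod (g x))\<^sup>2 * l x) \<partial>N)"
      unfolding L2_inner_def
      by (rule integral_cong_AE) (use ae in \<open>auto elim!: eventually_mono simp: complex_norm_square mult_ac simp del: of_real_power\<close>)
    also have "\<dots> = complex_of_real (\<integral>r. r \<partial>(scalar_measure M E f))"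
      by (subst integral_eq[OF W(1)]) (simp_all only: integral_complex_of_real measurable_ident_sets)
    finally show "L2_inner M k f = complex_of_real (\<integral>r. r \<partial>(scalar_measure M E f))" .
  qed
qed

end

text \<open>
  With Lebesgue measure and the injective multiplier \<open>a x\<close>, the images of the densities $|g|^2$ are absolutely
  continuous, a single vector without zeros generates, and every real number is attained.
\<close>

locale l2_scaling = l2_multiplier M lborel W "\<lambda>x. a * x"
  for M :: "'a measure" and W :: "('a, real) l2op" and a :: real +
  assumes a_nonzero: "a \<noteq> 0"
begin

lemma ac_spectrum_A: "ac_spectrum M A"
  unfolding ac_spectrum_def
proof (intro exI conjI ballI)
  show "spectral_measure_of M A E" by (rule spectral_measure)
  fix f assume "f \<in> L2 M"
  then obtain g where fg: "(f, g) \<in> W" using image_ex by blast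
  note [measurable] = L2_measurable[OF in_L2(2)[OF fg]]
  show "absolutely_continuous lborel (scalar_measure M E f)"
    unfolding absolutely_continuous_def
  proof
    fix Z :: "real set" assume Z: "Z \<in> null_sets lborel"
    then have [measurable]: "Z \<in> sets borel" by auto
    have "0 = emeasure lborel Z" using Z by auto
    also have "\<dots> = emeasure (density (distr lborel borel (\<lambda>x. 0 + a * x)) (\<lambda>_. ennreal \<bar>a\<bar>)) Z"
      using lborel_real_affine[OF a_nonzero, of 0] by simp
    also have "\<dots> = ennreal \<bar>a\<bar> * emeasure lborel ((\<lambda>x. a * x) -` Z)"
      by (simp add: emeasure_density emeasure_distr nn_integral_cmult)
    finally have "emeasure lborel ((\<lambda>x. a * x) -` Z) = 0" using a_nonzero by simp
    then have pre: "(\<lambda>x. a * x) -` Z \<in> null_sets lborel"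
      using measurable_sets[of "\<lambda>x. a * x" lborel borel Z] by (intro null_setsI) auto
    then have notin: "AE x in lborel. x \<notin> (\<lambda>x. a * x) -` Z" by (rule AE_not_in)
    have "(\<integral>\<^sup>+x. ennreal ((cmod (g x))\<^sup>2) * indicator ((\<lambda>x. a * x) -` Z) x \<partial>lborel) = (\<integral>\<^sup>+x. 0 \<partial>(lborel :: real measure))"
    proof (rule nn_integral_cong_AE)
      show "AE x in lborel. ennreal ((cmod (g x))\<^sup>2) * indicator ((\<lambda>x. a * x) -` Z) x = 0"
        using notin by eventually_elim auto
    qed
    then have "emeasure (scalar_measure M E f) Z = 0"
      unfolding scalar_measure_eq[OF fg] using pre
      by (subst emeasure_distr) (auto simp: emeasure_density)
    then show "Z \<in> null_sets (scalar_measure M E f)"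
      by (intro null_setsI) (auto simp: scalar_measure_eq[OF fg])
  qed
qed

text \<open>
  The generating vector is a Gaussian: a function orthogonal to its restrictions to all Borel sets
  vanishes, since the Gaussian has no zeros.
\<close>

lemma simple_spectrum_A: "simple_spectrum M A"
proof -
  define e :: "real \<Rightarrow> complex" where "e x = of_real (exp (- x\<^sup>2 / 2))" for x
  have eL: "e \<in> L2 lborel"
  proof (rule L2I)
    have int: "integrable lborel (\<lambda>x. sqrt (2*pi) * std_normal_density (0 + sqrt 2 * x))"
      using lborel_integrable_real_affine[OF integrable_std_normal_moment[of 0], of "sqrt 2" 0] by simp
    have eq: "(cmod (e x))\<^sup>2 = sqrt (2*pi) * std_normal_density (0 + sqrt 2 * x)" for x
      by (simp add: std_normal_density_def e_def power_mult_distrib exp_double[symmetric])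
    show "integrable lborel (\<lambda>x. (cmod (e x))\<^sup>2)" unfolding eq by (rule int)
    show "e \<in> borel_measurable lborel" unfolding e_def by measurable
  qed
  note [measurable] = L2_measurable[OF eL]
  let ?i = "\<lambda>\<Delta> x. complex_of_real (indicator \<Delta> (a * x)) * e x"
  let ?S = "{(\<lambda>x. \<Sum>i<n. c i * ?i (\<Delta> i) x) | (n :: nat) c \<Delta>. \<forall>i<n. \<Delta> i \<in> sets borel}"
  have dense: "L2_dense lborel ?S"
  proof (rule L2_dense_if_orthogonal_zero)
    show "?S \<subseteq> L2 lborel" by (auto intro!: L2_sum L2_scale indicator_L2[OF eL])
    show "(\<lambda>x. 0) \<in> ?S" by (auto intro!: exI[of _ "0::nat"])
    show "(\<lambda>x. f x + d * g x) \<in> ?S" if fS: "f \<in> ?S" and gS: "g \<in> ?S" for f g d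
    proof -
      obtain n c \<Delta> where f: "f = (\<lambda>x. \<Sum>i<n. c i * ?i (\<Delta> i) x)" "\<forall>i<(n::nat). \<Delta> i \<in> sets borel"
        using fS by blast
      obtain n' c' \<Delta>' where g: "g = (\<lambda>x. \<Sum>i<n'. c' i * ?i (\<Delta>' i) x)" "\<forall>i<(n'::nat). \<Delta>' i \<in> sets borel"
        using gS by blast
      let ?c = "\<lambda>i. if i < n then c i else d * c' (i - n)" and ?D = "\<lambda>i. if i < n then \<Delta> i else \<Delta>' (i - n)"
      have "(\<Sum>i<n + n'. ?c i * ?i (?D i) x) = f x + d * g x" for x
      proof -
        have "(\<Sum>i<n + n'. ?c i * ?i (?D i) x) = (\<Sum>i<n. ?c i * ?i (?D i) x) + (\<Sum>i=n..<n+n'. ?c i * ?i (?D i) x)"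
          by (simp add: sum.atLeastLessThan_concat[of 0 n "n+n'", symmetric] lessThan_atLeast0 del: sum.op_ivl_Suc)
        also have "(\<Sum>i=n..<n+n'. ?c i * ?i (?D i) x) = (\<Sum>i<n'. d * (c' i * ?i (\<Delta>' i) x))"
          using sum.shift_bounds_nat_ivl[of "\<lambda>i. ?c i * ?i (?D i) x" 0 n n']
          by (simp add: lessThan_atLeast0 add.commute mult.assoc)
        finally show ?thesis by (simp add: f g sum_distrib_left)
      qed
      moreover have "\<forall>i<n+n'. ?D i \<in> sets borel" using f(2) g(2) by auto
      ultimately show ?thesis by (intro CollectI exI[of _ "n+n'"] exI[of _ ?c] exI[of _ ?D]) auto
    qed
    show "AE x in lborel. f x = 0" if f: "f \<in> L2 lborel" and orth: "\<And>s. s \<in> ?S \<Longrightarrow> L2_inner lborel s f = 0" for f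
    proof -
      have "AE x in lborel. e x * cnj (f x) = 0"
      proof (rule AE_zero_if_set_integrals_zero[OF L2_integrable_inner[OF eL f]])
        fix B :: "real set" assume "B \<in> sets lborel"
        then have [measurable]: "B \<in> sets borel" by simp
        let ?D = "(\<lambda>y. y / a) -` B"
        have "?D \<in> sets borel" using measurable_sets[of "\<lambda>y. y / a" borel borel B] by simp
        then have "?i ?D \<in> ?S"
          by (intro CollectI exI[of _ 1] exI[of _ "\<lambda>_. 1"] exI[of _ "\<lambda>_. ?D"]) auto
        from orth[OF this] show "(\<integral>x. indicator B x *\<^sub>R (e x * cnj (f x)) \<partial>lborel) = 0"
          using a_nonzero unfolding L2_inner_def by (simp add: indicator_def scaleR_conv_of_real mult.assoc if_distrib[of of_real] cong: if_cong)
      qed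
      then show ?thesis by eventually_elim (simp add: e_def)
    qed
  qed
  obtain g0 where g0: "(g0, e) \<in> W" using preimage_ex[OF eL] by blast
  show ?thesis unfolding simple_spectrum_def
  proof (intro exI conjI bexI)
    show "spectral_measure_of M A E" by (rule spectral_measure)
    show "g0 \<in> L2 M" using in_L2(1)[OF g0] .
    show "L2_dense M {(\<lambda>x. \<Sum>i<n. c i * op_app (E (\<Delta> i)) g0 x) | (n :: nat) c \<Delta>. \<forall>i<n. \<Delta> i \<in> sets borel}"
      unfolding L2_dense_def
    proof (intro ballI allI impI)
      fix f and \<epsilon> :: real assume f: "f \<in> L2 M" and eps: "\<epsilon> > 0"
      obtain g where fg: "(f, g) \<in> W" using image_ex[OF f] by blast
      obtain s where s: "s \<in> ?S" "L2_norm lborel (\<lambda>x. g x - s x) < \<epsilon>"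
        using dense in_L2(2)[OF fg] eps unfolding L2_dense_def by blast
      obtain n c \<Delta> where D: "s = (\<lambda>x. \<Sum>i<n. c i * ?i (\<Delta> i) x)" "\<forall>i<(n::nat). \<Delta> i \<in> sets borel" using s(1) by blast
      have "((\<lambda>x. \<Sum>i<n. c i * op_app (E (\<Delta> i)) g0 x), s) \<in> W"
        unfolding D(1) using D(2) by (intro sum E_app(1)[OF g0]) auto
      from dist_eq[OF fg this] s(2)
      have "L2_norm M (\<lambda>x. f x - (\<Sum>i<n. c i * op_app (E (\<Delta> i)) g0 x)) < \<epsilon>" by simp
      then show "\<exists>h\<in>{(\<lambda>x. \<Sum>i<n. c i * op_app (E (\<Delta> i)) g0 x) | (n :: nat) c \<Delta>. \<forall>i<n. \<Delta> i \<in> sets borel}.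
          L2_norm M (\<lambda>x. f x - h x) < \<epsilon>"
        using D(2) by (intro bexI[of _ "\<lambda>x. \<Sum>i<n. c i * op_app (E (\<Delta> i)) g0 x"]) auto
    qed
  qed
qed

lemma resolvent_iff:
  assumes "(k, h) \<in> W" "(f, g) \<in> W"
  shows "(k, f) \<in> op_resolvent M A z \<longleftrightarrow> (AE x in lborel. h x = (of_real (a * x) - z) * g x)"
proof
  assume "(k, f) \<in> op_resolvent M A z"
  then obtain k' where k': "(f, k') \<in> A" "AE x in M. k x = k' x - z * f x" by (auto simp: op_resolvent_def)
  then obtain h' where W': "(k', h') \<in> W" using conj_mult_in_L2 image_ex unfolding A_def by meson
  have "AE x in lborel. h' x = of_real (a * x) * g x" using k' conj_mult_iff[OF assms(2) W'] unfolding A_def by blast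
  moreover have "AE x in lborel. h x = h' x + (- z) * g x"
    using image_unique[OF assms(1) linear[OF W' assms(2), of "-z"]] k'(2) by simp
  ultimately show "AE x in lborel. h x = (of_real (a * x) - z) * g x"
    by eventually_elim (simp add: algebra_simps)
next
  assume ae: "AE x in lborel. h x = (of_real (a * x) - z) * g x"
  have W': "((\<lambda>x. k x + z * f x), (\<lambda>x. h x + z * g x)) \<in> W" using linear[OF assms] .
  have "AE x in lborel. h x + z * g x = of_real (a * x) * g x" using ae by eventually_elim (simp add: algebra_simps)
  then have "(f, \<lambda>x. k x + z * f x) \<in> A" using conj_mult_iff[OF assms(2) W'] unfolding A_def by blast
  then show "(k, f) \<in> op_resolvent M A z"
    using in_L2(1)[OF assms(1)] by (auto simp: op_resolvent_def intro!: exI[of _ "\<lambda>x. k x + z * f x"])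
qed

lemma resolvent_in_L2: "(k, f) \<in> op_resolvent M A z \<Longrightarrow> k \<in> L2 M \<and> f \<in> L2 M"
  using conj_mult_in_L2 unfolding op_resolvent_def A_def by blast

lemma resolvent_set_nonreal:
  assumes "Im z \<noteq> 0" shows "z \<in> resolvent_set M A"
proof -
  have Im_le: "\<bar>Im z\<bar> \<le> cmod (of_real (a * x) - z)" for x
    using abs_Im_le_cmod[of "of_real (a * x) - z"] by simp
  then have nz: "of_real (a * x) - z \<noteq> 0" for x using assms by (metis abs_le_zero_iff norm_zero)
  have "L2 M \<subseteq> Domain (op_resolvent M A z)"
  proof
    fix k assume "k \<in> L2 M"
    then obtain h where kh: "(k, h) \<in> W" using image_ex by blast
    have "(\<lambda>x. inverse (of_real (a * x) - z) * h x) \<in> L2 lborel"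
    proof (rule L2_bounded_mult[OF in_L2(2)[OF kh], where C = "1 / \<bar>Im z\<bar>"])
      show "AE x in lborel. cmod (inverse (of_real (a * x) - z)) \<le> 1 / \<bar>Im z\<bar>"
      proof (rule AE_I2)
        fix x
        show "cmod (inverse (of_real (a * x) - z)) \<le> 1 / \<bar>Im z\<bar>"
          unfolding norm_inverse inverse_eq_divide[of "cmod _"]
          using assms nz by (intro divide_left_mono Im_le mult_pos_pos) (auto simp del: of_real_mult)
      qed
    qed measurable
    then obtain f where fg: "(f, \<lambda>x. inverse (of_real (a * x) - z) * h x) \<in> W" using preimage_ex by blast
    have "(k, f) \<in> op_resolvent M A z" unfolding resolvent_iff[OF kh fg] using nz by (simp add: mult.assoc[symmetric])
    then show "k \<in> Domain (op_resolvent M A z)" by blast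
  qed
  moreover have "L2_norm M f \<le> 1 / \<bar>Im z\<bar> * L2_norm M k" if kf: "(k, f) \<in> op_resolvent M A z" for k f
  proof -
    obtain h g where W: "(k, h) \<in> W" "(f, g) \<in> W" using resolvent_in_L2[OF kf] image_ex by meson
    have "AE x in lborel. h x = (of_real (a * x) - z) * g x" using kf resolvent_iff[OF W] by blast
    then have "AE x in lborel. cmod (g x) \<le> 1 / \<bar>Im z\<bar> * cmod (h x)"
    proof eventually_elim
      case (elim x)
      have "\<bar>Im z\<bar> * cmod (g x) \<le> cmod (h x)" unfolding elim norm_mult using Im_le by (intro mult_right_mono) auto
      then show ?case using assms by (simp add: field_simps)
    qed
    then have "L2_norm lborel g \<le> 1 / \<bar>Im z\<bar> * L2_norm lborel h"
      using in_L2(2)[OF W(1)] in_L2(2)[OF W(2)] by (intro L2_norm_mono L2_measurable) auto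
    then show ?thesis using norm_eq[OF W(1)] norm_eq[OF W(2)] by simp
  qed
  ultimately show ?thesis using resolvent_in_L2 unfolding resolvent_set_def by blast
qed

text \<open>
  Functions supported near \<open>r / a\<close> are approximate eigenvectors for the real number \<open>r\<close>.
\<close>

lemma real_not_resolvent: "of_real r \<notin> resolvent_set M A"
proof
  assume "complex_of_real r \<in> resolvent_set M A"
  then obtain C where C: "\<And>k f. (k, f) \<in> op_resolvent M A (of_real r) \<Longrightarrow> L2_norm M f \<le> C * L2_norm M k"
    unfolding resolvent_set_def by fast
  \<comment> \<open>On an interval of this half-width around \<open>r / a\<close> the factor \<open>a x - r\<close> is at most
    $1/(2(|C| + 1))$, which contradicts the bound \<open>C\<close> of the resolvent.\<close>
  define d where "d = 1 / (\<bar>a\<bar> * (2 * (\<bar>C\<bar> + 1)))"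
  have d: "d > 0" using a_nonzero by (simp add: d_def)
  let ?I = "{r / a - d..r / a + d}"
  define g :: "real \<Rightarrow> complex" where "g x = of_real (indicator ?I x)" for x
  have gsq: "(cmod (g x))\<^sup>2 = indicator ?I x" for x by (simp add: g_def indicator_def)
  have g: "g \<in> L2 lborel"
  proof (rule L2I)
    show "g \<in> borel_measurable lborel" unfolding g_def by measurable
    show "integrable lborel (\<lambda>x. (cmod (g x))\<^sup>2)"
      unfolding gsq by (rule integrable_real_indicator) (auto simp: emeasure_lborel_Icc_eq)
  qed
  have gn: "(L2_norm lborel g)\<^sup>2 = 2 * d" unfolding L2_norm_sq gsq using d by simp
  then have gpos: "L2_norm lborel g > 0" using d by (metis L2_norm_nonneg less_eq_real_def mult_pos_pos zero_less_numeral zero_power2 less_irrefl)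
  let ?h = "\<lambda>x. (of_real (a * x) - of_real r) * g x"
  have le: "cmod (?h x) \<le> \<bar>a\<bar> * d * cmod (g x)" for x
  proof (cases "x \<in> ?I")
    case True
    have "\<bar>a * x - r\<bar> = \<bar>a\<bar> * \<bar>x - r / a\<bar>" using a_nonzero by (simp add: abs_mult[symmetric] right_diff_distrib)
    also have "\<dots> \<le> \<bar>a\<bar> * d" using True by (intro mult_left_mono) auto
    finally show ?thesis using True by (simp add: g_def norm_mult of_real_diff[symmetric] del: of_real_diff of_real_mult)
  qed (simp add: g_def)
  have [measurable]: "g \<in> borel_measurable lborel" using g by (rule L2_measurable)
  have h: "?h \<in> L2 lborel"
  proof (rule L2_dominated)
    show "integrable lborel (\<lambda>x. (\<bar>a\<bar> * d)\<^sup>2 * (cmod (g x))\<^sup>2)" using L2_integrable_sq[OF g] by simp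
    show "AE x in lborel. (cmod (?h x))\<^sup>2 \<le> (\<bar>a\<bar> * d)\<^sup>2 * (cmod (g x))\<^sup>2"
      using le by (intro AE_I2) (simp only: power_mult_distrib[symmetric], intro power_mono, auto)
  qed measurable
  obtain f k where W: "(f, g) \<in> W" "(k, ?h) \<in> W" using preimage_ex[OF g] preimage_ex[OF h] by blast
  have "(k, f) \<in> op_resolvent M A (of_real r)" by (simp add: resolvent_iff[OF W(2,1)])
  from C[OF this] have "L2_norm lborel g \<le> C * L2_norm lborel ?h" using norm_eq[OF W(1)] norm_eq[OF W(2)] by simp
  also have "\<dots> \<le> \<bar>C\<bar> * (\<bar>a\<bar> * d * L2_norm lborel g)"
    using L2_norm_mono[OF _ g, of ?h "\<bar>a\<bar> * d"] le d by (intro mult_mono) auto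
  also have "\<dots> = (\<bar>C\<bar> / (2 * (\<bar>C\<bar> + 1))) * L2_norm lborel g" using a_nonzero by (simp add: d_def)
  also have "\<dots> < 1 * L2_norm lborel g" using gpos by (intro mult_strict_right_mono) (auto simp: field_simps)
  finally show False by simp
qed

lemma op_spectrum_A: "op_spectrum M A = \<real>"
proof (intro set_eqI iffI)
  fix z assume "z \<in> op_spectrum M A"
  then show "z \<in> \<real>" using resolvent_set_nonreal[of z] by (auto simp: op_spectrum_def complex_is_Real_iff)
next
  fix z :: complex assume "z \<in> \<real>"
  then show "z \<in> op_spectrum M A" using real_not_resolvent by (auto simp: op_spectrum_def elim!: Reals_cases)
qed

end

section \<open>Primitives of locally integrable functions\<close>

lemma loc_integrable_measurable [measurable_dest]:
  assumes "loc_integrable f" shows "f \<in> borel_measurable borel"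
proof (rule borel_measurable_LIMSEQ_metric)
  show "(\<lambda>x. indicator {- real n..real n} x *\<^sub>R f x) \<in> borel_measurable borel" for n
  proof -
    have "integrable lborel (\<lambda>x. indicator {- real n..real n} x *\<^sub>R f x)"
      using assms by (simp add: loc_integrable_def set_integrable_def)
    then show ?thesis by (simp add: borel_measurable_integrable[of lborel, simplified])
  qed
  show "(\<lambda>n. indicator {- real n..real n} x *\<^sub>R f x) \<longlonglongrightarrow> f x" for x
  proof (rule tendsto_eventually)
    obtain n where "\<bar>x\<bar> \<le> real n" using real_arch_simple by blast
    then show "\<forall>\<^sub>F n in sequentially. indicator {- real n..real n} x *\<^sub>R f x = f x"
      by (intro eventually_sequentiallyI[of n]) (auto simp: indicator_def)
  qed
qed

lemma loc_integrable_add: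
  "loc_integrable f \<Longrightarrow> loc_integrable g \<Longrightarrow> loc_integrable (\<lambda>x. f x + g x)"
  by (auto simp: loc_integrable_def)

lemma loc_integrable_mult_continuous:
  assumes f: "loc_integrable f" and m: "continuous_on UNIV m"
  shows "loc_integrable (\<lambda>x. m x * f x)"
  unfolding loc_integrable_def set_integrable_def
proof (intro allI)
  fix a b :: real
  note [measurable] = loc_integrable_measurable[OF f] borel_measurable_continuous_onI[OF m]
  have "compact (m ` {a..b})" by (intro compact_continuous_image continuous_on_subset[OF m]) auto
  from compact_imp_bounded[OF this] obtain C where C: "\<And>x. x \<in> {a..b} \<Longrightarrow> cmod (m x) \<le> C"
    by (force simp: bounded_iff)
  have "integrable lborel (\<lambda>x. indicator {a..b} x *\<^sub>R f x)"
    using f by (simp add: loc_integrable_def set_integrable_def)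
  then have "integrable lborel (\<lambda>x. of_real C * (indicator {a..b} x *\<^sub>R f x))"
    by (rule integrable_mult_right)
  then show "integrable lborel (\<lambda>x. indicator {a..b} x *\<^sub>R (m x * f x))"
  proof (rule Bochner_Integration.integrable_bound)
    have "norm (indicator {a..b} x *\<^sub>R (m x * f x)) \<le> norm (of_real C * (indicator {a..b} x *\<^sub>R f x))" for x
    proof (cases "x \<in> {a..b}")
      case True
      have "cmod (m x) * cmod (f x) \<le> \<bar>C\<bar> * cmod (f x)" using C[OF True] by (intro mult_right_mono) auto
      then show ?thesis using True by (simp add: norm_mult)
    qed simp
    then show "AE x in lborel. norm (indicator {a..b} x *\<^sub>R (m x * f x)) \<le> norm (of_real C * (indicator {a..b} x *\<^sub>R f x))" by simp
  qed measurable
qed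

lemma loc_integrable_cmult: "loc_integrable f \<Longrightarrow> loc_integrable (\<lambda>x. c * f x)"
  by (rule loc_integrable_mult_continuous) auto

lemma loc_integrable_diff:
  "loc_integrable f \<Longrightarrow> loc_integrable g \<Longrightarrow> loc_integrable (\<lambda>x. f x - g x)"
  by (auto simp: loc_integrable_def)

lemma loc_integrable_continuous: "continuous_on UNIV f \<Longrightarrow> loc_integrable f"
  unfolding loc_integrable_def set_integrable_def
  by (auto intro!: borel_integrable_atLeastAtMost'[unfolded set_integrable_def] intro: continuous_on_subset)

lemma loc_integrable_L2_loc:
  assumes "f \<in> L2_loc" shows "loc_integrable f"
  unfolding loc_integrable_def set_integrable_def
proof (intro allI)
  fix a b :: real
  have [measurable]: "f \<in> borel_measurable borel" using assms by (simp add: L2_loc_def)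
  have 1: "integrable lborel (\<lambda>x. indicator {a..b} x *\<^sub>R (1::real))"
    using borel_integrable_atLeastAtMost'[of a b "\<lambda>_. 1::real"] by (simp add: set_integrable_def)
  have 2: "integrable lborel (\<lambda>x. indicator {a..b} x *\<^sub>R (cmod (f x))\<^sup>2)"
    using assms by (simp add: L2_loc_def set_integrable_def)
  have le: "t \<le> 1 + t\<^sup>2" for t :: real
    using zero_le_power2[of "t - 1/2"] by (simp add: power2_eq_square algebra_simps)
  show "integrable lborel (\<lambda>x. indicator {a..b} x *\<^sub>R f x)"
    by (rule Bochner_Integration.integrable_bound[OF Bochner_Integration.integrable_add[OF 1 2]])
       (use le in \<open>auto simp: indicator_def\<close>)
qed

lemma L2_imp_L2_loc: "f \<in> L2 lborel \<Longrightarrow> f \<in> L2_loc"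
  using integrable_mult_indicator[of "{a..b}" lborel "\<lambda>x. (cmod (f x))\<^sup>2" for a b]
  unfolding L2_loc_def set_integrable_def L2_def by auto

lemma loc_integrable_L2: "f \<in> L2 lborel \<Longrightarrow> loc_integrable f"
  by (rule loc_integrable_L2_loc[OF L2_imp_L2_loc])

lemma loc_integrable_AE_cong:
  assumes "loc_integrable f" "g \<in> borel_measurable borel" "AE x in lborel. g x = f x"
  shows "loc_integrable g"
  unfolding loc_integrable_def set_integrable_def
proof (intro allI)
  fix a b :: real
  have [measurable]: "f \<in> borel_measurable borel" using assms(1) by (rule loc_integrable_measurable)
  have "integrable lborel (\<lambda>x. indicator {a..b} x *\<^sub>R f x)" using assms(1) by (simp add: loc_integrable_def set_integrable_def)
  then show "integrable lborel (\<lambda>x. indicator {a..b} x *\<^sub>R g x)"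
    by (rule integrable_cong_AE_imp) (use assms(2,3) in auto)
qed

text \<open>
  \<open>F\<close> is a primitive of \<open>f\<close>: an absolutely continuous function with derivative \<open>f\<close> almost
  everywhere.  Sobolev functions on the line are handled through such representatives, for which the
  product and chain rules are statements about integrals over intervals.
\<close>

definition primitive :: "(real \<Rightarrow> complex) \<Rightarrow> (real \<Rightarrow> complex) \<Rightarrow> bool" where
  "primitive F f \<longleftrightarrow> loc_integrable f \<and> (\<forall>a b. a \<le> b \<longrightarrow> F b - F a = (LINT x:{a..b}|lborel. f x))"

lemma primitive_loc_integrable: "primitive F f \<Longrightarrow> loc_integrable f"
  by (simp add: primitive_def)

lemma primitive_diff_eq: "primitive F f \<Longrightarrow> a \<le> b \<Longrightarrow> F b - F a = (LINT x:{a..b}|lborel. f x)"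
  by (simp add: primitive_def)

lemma set_lborel_integral_eq:
  assumes "loc_integrable f"
  shows "f integrable_on {a..b}" "(LINT x:{a..b}|lborel. f x) = integral {a..b} f"
  using set_borel_integral_eq_integral[of "{a..b}" f] assms by (auto simp: loc_integrable_def)

lemma primitive_continuous:
  assumes "primitive F f" shows "continuous_on UNIV F"
proof -
  note loc = primitive_loc_integrable[OF assms]
  have "isCont F x" for x
  proof -
    have "F y = F (x-1) + integral {x-1..y} f" if "y \<in> {x-1..x+1}" for y
      using primitive_diff_eq[OF assms, of "x-1" y] that set_lborel_integral_eq(2)[OF loc]
      by (simp add: algebra_simps)
    moreover have "continuous_on {x-1..x+1} (\<lambda>y. F (x-1) + integral {x-1..y} f)"
      by (intro continuous_intros indefinite_integral_continuous_1 set_lborel_integral_eq(1)[OF loc])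
    ultimately have "continuous_on {x-1..x+1} F" using continuous_on_cong by (metis (no_types, lifting))
    then have "continuous_on {x-1<..<x+1} F" by (rule continuous_on_subset) auto
    then show ?thesis by (simp add: continuous_on_eq_continuous_at)
  qed
  then show ?thesis by (simp add: continuous_on_eq_continuous_at)
qed

lemma primitive_measurable: "primitive F f \<Longrightarrow> F \<in> borel_measurable borel"
  by (intro borel_measurable_continuous_onI primitive_continuous)

lemma primitive_exists:
  assumes loc: "loc_integrable f" shows "\<exists>F. primitive F f"
proof
  define F where "F x = (if 0 \<le> x then integral {0..x} f else - integral {x..0} f)" for x
  note int = set_lborel_integral_eq(1)[OF loc]
  have comb: "integral {a..c} f + integral {c..b} f = integral {a..b} f" if "a \<le> c" "c \<le> b" for a b c
    by (rule Henstock_Kurzweil_Integration.integral_combine[OF that int])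
  show "primitive F f" unfolding primitive_def
  proof (intro conjI allI impI loc)
    fix a b :: real assume ab: "a \<le> b"
    show "F b - F a = (LINT x:{a..b}|lborel. f x)"
      unfolding set_lborel_integral_eq(2)[OF loc] F_def
      using ab comb[of 0 a b] comb[of a 0 b] comb[of a b 0] by (auto simp: algebra_simps)
  qed
qed

lemma primitive_of_C1:
  assumes F: "\<And>x. (F has_vector_derivative f x) (at x)" and f: "continuous_on UNIV f"
  shows "primitive F f"
  unfolding primitive_def
proof (intro conjI allI impI)
  show loc: "loc_integrable f" by (rule loc_integrable_continuous[OF f])
  fix a b :: real assume "a \<le> b"
  then have "(f has_integral (F b - F a)) {a..b}"
    using F by (intro fundamental_theorem_of_calculus) (auto intro: has_vector_derivative_at_within)
  then show "F b - F a = (LINT x:{a..b}|lborel. f x)"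
    unfolding set_lborel_integral_eq(2)[OF loc] by (simp add: integral_unique)
qed

lemma primitive_add:
  assumes "primitive F f" "primitive G g"
  shows "primitive (\<lambda>x. F x + G x) (\<lambda>x. f x + g x)"
  unfolding primitive_def
proof (intro conjI allI impI)
  show "loc_integrable (\<lambda>x. f x + g x)" using assms loc_integrable_add by (auto simp: primitive_def)
  fix a b :: real assume "a \<le> b"
  moreover have "set_integrable lborel {a..b} f" "set_integrable lborel {a..b} g"
    using assms by (auto simp: primitive_def loc_integrable_def)
  ultimately show "F b + G b - (F a + G a) = (LINT x:{a..b}|lborel. f x + g x)"
    using primitive_diff_eq[OF assms(1)] primitive_diff_eq[OF assms(2)] by (simp add: algebra_simps)
qed

lemma primitive_cmult:
  assumes "primitive F f" shows "primitive (\<lambda>x. c * F x) (\<lambda>x. c * f x)"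
  using assms loc_integrable_cmult by (auto simp: primitive_def right_diff_distrib[symmetric])

lemma primitive_add_const: "primitive F f \<Longrightarrow> primitive (\<lambda>x. F x + c) f"
  by (auto simp: primitive_def)

lemma primitive_cnj:
  assumes "primitive F f" shows "primitive (\<lambda>x. cnj (F x)) (\<lambda>x. cnj (f x))"
  unfolding primitive_def
proof (intro conjI allI impI)
  have "integrable lborel (\<lambda>x. indicator {a..b} x *\<^sub>R f x)" for a b
    using assms by (auto simp: primitive_def loc_integrable_def set_integrable_def)
  then have "integrable lborel (\<lambda>x. cnj (indicator {a..b} x *\<^sub>R f x))" for a b
    by (rule integrable_cnj)
  then show "loc_integrable (\<lambda>x. cnj (f x))" unfolding loc_integrable_def set_integrable_def by simp
  fix a b :: real assume "a \<le> b"
  then show "cnj (F b) - cnj (F a) = (LINT x:{a..b}|lborel. cnj (f x))"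
    using arg_cong[OF primitive_diff_eq[OF assms], of a b cnj] Bochner_Integration.integral_cnj[of lborel "\<lambda>x. indicator {a..b} x *\<^sub>R f x"]
    by (simp add: set_lebesgue_integral_def)
qed

lemma primitive_AE_cong:
  assumes "primitive F f" "g \<in> borel_measurable borel" "AE x in lborel. g x = f x"
  shows "primitive F g"
  unfolding primitive_def
proof (intro conjI allI impI)
  show "loc_integrable g" by (rule loc_integrable_AE_cong[OF primitive_loc_integrable[OF assms(1)] assms(2,3)])
  have [measurable]: "f \<in> borel_measurable borel" using assms by (auto simp: primitive_def)
  fix a b :: real assume "a \<le> b"
  have "(LINT x:{a..b}|lborel. f x) = (LINT x:{a..b}|lborel. g x)"
    unfolding set_lebesgue_integral_def
    by (rule integral_cong_AE) (use assms in auto)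
  then show "F b - F a = (LINT x:{a..b}|lborel. g x)" using primitive_diff_eq[OF assms(1) \<open>a \<le> b\<close>] by simp
qed

lemma integrable_tensor:
  fixes p q :: "real \<Rightarrow> complex"
  assumes p: "integrable lborel p" and q: "integrable lborel q"
  shows "integrable (lborel \<Otimes>\<^sub>M lborel) (\<lambda>(s, t). p s * q t)"
proof (rule lborel_pair.Fubini_integrable)
  have [measurable]: "p \<in> borel_measurable borel" "q \<in> borel_measurable borel" using p q by auto
  show "(\<lambda>(s, t). p s * q t) \<in> borel_measurable (lborel \<Otimes>\<^sub>M lborel)" by measurable
  show "integrable lborel (\<lambda>x. \<integral>y. norm (case (x, y) of (s, t) \<Rightarrow> p s * q t) \<partial>lborel)"
    using p by (simp add: norm_mult)
  show "AE x in lborel. integrable lborel (\<lambda>y. case (x, y) of (s, t) \<Rightarrow> p s * q t)"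
    using q by simp
qed

text \<open>
  The product rule is Fubini's theorem for $f(s) g(t)$ on a square, divided along its diagonal into two
  triangles.
\<close>

lemma primitive_mult:
  assumes F: "primitive F f" and G: "primitive G g"
  shows "primitive (\<lambda>x. F x * G x) (\<lambda>x. F x * g x + f x * G x)"
  unfolding primitive_def
proof (intro conjI allI impI)
  note loc = primitive_loc_integrable[OF F] primitive_loc_integrable[OF G]
  note cont = primitive_continuous[OF F] primitive_continuous[OF G]
  have l1: "loc_integrable (\<lambda>x. F x * g x)" by (rule loc_integrable_mult_continuous[OF loc(2) cont(1)])
  have l2: "loc_integrable (\<lambda>x. f x * G x)"
    using loc_integrable_mult_continuous[OF loc(1) cont(2)] by (simp add: mult.commute)
  show "loc_integrable (\<lambda>x. F x * g x + f x * G x)" by (rule loc_integrable_add[OF l1 l2])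
  fix a b :: real assume ab: "a \<le> b"
  note [measurable] = loc[THEN loc_integrable_measurable] cont[THEN borel_measurable_continuous_onI]
  define p where "p s = indicator {a..b} s *\<^sub>R f s" for s
  define q where "q t = indicator {a..b} t *\<^sub>R g t" for t
  have p: "integrable lborel p" and q: "integrable lborel q"
    using loc by (simp_all add: p_def [abs_def] q_def [abs_def] loc_integrable_def set_integrable_def)
  have [measurable]: "p \<in> borel_measurable borel" "q \<in> borel_measurable borel" using p q by auto
  have pI: "(\<integral>s. p s \<partial>lborel) = F b - F a" and qI: "(\<integral>t. q t \<partial>lborel) = G b - G a"
    using primitive_diff_eq[OF F ab] primitive_diff_eq[OF G ab] by (simp_all add: p_def q_def set_lebesgue_integral_def)
  let ?K = "\<lambda>s t. p s * q t"
  have K: "integrable (lborel \<Otimes>\<^sub>M lborel) (\<lambda>(s, t). ?K s t)" by (rule integrable_tensor[OF p q])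
  have K1: "integrable (lborel \<Otimes>\<^sub>M lborel) (\<lambda>(s, t). if s \<le> t then ?K s t else 0)"
    by (rule Bochner_Integration.integrable_bound[OF K]) (auto split: if_splits)
  have K2: "integrable (lborel \<Otimes>\<^sub>M lborel) (\<lambda>(s, t). if t < s then ?K s t else 0)"
    by (rule Bochner_Integration.integrable_bound[OF K]) (auto split: if_splits)
  have Ft: "F t - F a = (\<integral>s. (if s \<le> t then p s else 0) \<partial>lborel)" if "t \<in> {a..b}" for t
    using primitive_diff_eq[OF F, of a t] that unfolding set_lebesgue_integral_def p_def
    by (auto intro!: Bochner_Integration.integral_cong simp: indicator_def)
  have Gs: "G s - G a = (\<integral>t. (if t < s then q t else 0) \<partial>lborel)" if "s \<in> {a..b}" for s
  proof -
    have "G s - G a = (\<integral>t. indicator {a..s} t *\<^sub>R g t \<partial>lborel)"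
      using primitive_diff_eq[OF G, of a s] that unfolding set_lebesgue_integral_def by simp
    also have "\<dots> = (\<integral>t. (if t < s then q t else 0) \<partial>lborel)"
    proof (rule integral_cong_AE)
      show "AE t in lborel. indicator {a..s} t *\<^sub>R g t = (if t < s then q t else 0)"
        by (rule AE_mp[OF AE_lborel_singleton[of s]], rule AE_I2) (use that in \<open>auto simp: q_def indicator_def\<close>)
    qed measurable
    finally show ?thesis .
  qed
  have A1: "(LINT t:{a..b}|lborel. (F t - F a) * g t) = (\<integral>t. (\<integral>s. (if s \<le> t then ?K s t else 0) \<partial>lborel) \<partial>lborel)"
    unfolding set_lebesgue_integral_def
  proof (rule Bochner_Integration.integral_cong[OF refl])
    fix t
    have "indicator {a..b} t *\<^sub>R ((F t - F a) * g t) = (\<integral>s. (if s \<le> t then p s else 0) \<partial>lborel) * q t"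
      by (cases "t \<in> {a..b}") (auto simp: Ft q_def)
    also have "\<dots> = (\<integral>s. (if s \<le> t then p s else 0) * q t \<partial>lborel)"
      by (simp only: integral_mult_left_zero)
    also have "\<dots> = (\<integral>s. (if s \<le> t then ?K s t else 0) \<partial>lborel)"
      by (intro Bochner_Integration.integral_cong) auto
    finally show "indicator {a..b} t *\<^sub>R ((F t - F a) * g t) = \<dots>" .
  qed
  have A2: "(LINT s:{a..b}|lborel. f s * (G s - G a)) = (\<integral>s. (\<integral>t. (if t < s then ?K s t else 0) \<partial>lborel) \<partial>lborel)"
    unfolding set_lebesgue_integral_def
  proof (rule Bochner_Integration.integral_cong[OF refl])
    fix s
    have "indicator {a..b} s *\<^sub>R (f s * (G s - G a)) = p s * (\<integral>t. (if t < s then q t else 0) \<partial>lborel)"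
      by (cases "s \<in> {a..b}") (auto simp: Gs p_def)
    also have "\<dots> = (\<integral>t. p s * (if t < s then q t else 0) \<partial>lborel)"
      by (simp only: integral_mult_right_zero)
    also have "\<dots> = (\<integral>t. (if t < s then ?K s t else 0) \<partial>lborel)"
      by (intro Bochner_Integration.integral_cong) auto
    finally show "indicator {a..b} s *\<^sub>R (f s * (G s - G a)) = \<dots>" .
  qed
  have "(LINT t:{a..b}|lborel. (F t - F a) * g t) + (LINT s:{a..b}|lborel. f s * (G s - G a))
      = (\<integral>z. (case z of (s, t) \<Rightarrow> if s \<le> t then ?K s t else 0) \<partial>(lborel \<Otimes>\<^sub>M lborel))
      + (\<integral>z. (case z of (s, t) \<Rightarrow> if t < s then ?K s t else 0) \<partial>(lborel \<Otimes>\<^sub>M lborel))"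
    unfolding A1 A2 using lborel_pair.integral_snd[OF K1] lborel_pair.integral_fst'[OF K2] by simp
  also have "\<dots> = (\<integral>z. (case z of (s, t) \<Rightarrow> ?K s t) \<partial>(lborel \<Otimes>\<^sub>M lborel))"
    unfolding Bochner_Integration.integral_add[OF K1 K2, symmetric]
    by (intro Bochner_Integration.integral_cong) auto
  also have "\<dots> = (F b - F a) * (G b - G a)"
    using lborel_pair.integral_fst'[OF K] by (simp add: pI qI)
  finally have tri: "(LINT t:{a..b}|lborel. (F t - F a) * g t) + (LINT s:{a..b}|lborel. f s * (G s - G a)) = (F b - F a) * (G b - G a)" .
  have si: "set_integrable lborel {a..b} (\<lambda>x. F x * g x)" "set_integrable lborel {a..b} (\<lambda>x. f x * G x)"
    "set_integrable lborel {a..b} f" "set_integrable lborel {a..b} g"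
    using l1 l2 loc by (auto simp: loc_integrable_def)
  have 1: "(LINT t:{a..b}|lborel. (F t - F a) * g t) = (LINT t:{a..b}|lborel. F t * g t) - F a * (G b - G a)"
    using si primitive_diff_eq[OF G ab] by (simp add: left_diff_distrib)
  have 2: "(LINT s:{a..b}|lborel. f s * (G s - G a)) = (LINT s:{a..b}|lborel. f s * G s) - (F b - F a) * G a"
    using si primitive_diff_eq[OF F ab] by (simp add: right_diff_distrib)
  have "(LINT x:{a..b}|lborel. F x * g x + f x * G x) = (LINT t:{a..b}|lborel. F t * g t) + (LINT s:{a..b}|lborel. f s * G s)"
    using si by simp
  also have "\<dots> = (F b - F a) * (G b - G a) + F a * (G b - G a) + (F b - F a) * G a"
    unfolding tri[symmetric] 1 2 by simp
  finally show "F b * G b - F a * G a = (LINT x:{a..b}|lborel. F x * g x + f x * G x)"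
    by (simp add: algebra_simps)
qed

text \<open>
  The substitution rule for monotone changes of variables, applied to the real and imaginary parts.
\<close>

lemma primitive_compose:
  assumes F: "primitive F f" and X: "\<And>x. (X has_real_derivative X' x) (at x)"
    and X': "continuous_on UNIV X'" and nonneg: "\<And>x. 0 \<le> X' x"
  shows "primitive (\<lambda>x. F (X x)) (\<lambda>x. of_real (X' x) * f (X x))"
proof -
  have mono: "X a \<le> X b" if "a \<le> b" for a b
    using DERIV_nonneg_imp_nondecreasing[OF that, of X] X nonneg by blast
  have real: "set_integrable lborel {a..b} (\<lambda>x. r (X x) * X' x) \<and>
       (LINT x:{X a..X b}|lborel. r x) = (LINT x:{a..b}|lborel. r (X x) * X' x)"
    if "a \<le> b" "set_integrable lborel {X a..X b} r" for r :: "real \<Rightarrow> real" and a b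
    using integral_substitution[OF that(2) X continuous_on_subset[OF X' subset_UNIV] nonneg that(1)]
    by (simp add: set_lebesgue_integral_def mult.commute)
  note loc = primitive_loc_integrable[OF F]
  have int: "set_integrable lborel {a..b} f" for a b using loc by (simp add: loc_integrable_def)
  have re: "set_integrable lborel {a..b} (\<lambda>x. Re (f x))" and im: "set_integrable lborel {a..b} (\<lambda>x. Im (f x))" for a b
    using integrable_Re[OF int[of a b, unfolded set_integrable_def]] integrable_Im[OF int[of a b, unfolded set_integrable_def]]
    by (simp_all add: set_integrable_def)
  have cI: "set_integrable lborel {a..b} (\<lambda>x. of_real (X' x) * f (X x)) \<and>
      (LINT x:{X a..X b}|lborel. f x) = (LINT x:{a..b}|lborel. of_real (X' x) * f (X x))" if ab: "a \<le> b" for a b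
  proof -
    note R = real[OF ab re] and I = real[OF ab im]
    have iR: "integrable lborel (\<lambda>x. indicator {a..b} x * (Re (f (X x)) * X' x))"
      and iI: "integrable lborel (\<lambda>x. indicator {a..b} x * (Im (f (X x)) * X' x))"
      using R I by (simp_all add: set_integrable_def)
    have eq: "indicator {a..b} x *\<^sub>R (of_real (X' x) * f (X x)) =
        Complex (indicator {a..b} x * (Re (f (X x)) * X' x)) (indicator {a..b} x * (Im (f (X x)) * X' x))" for x
      by (simp add: complex_eq_iff mult.commute)
    have int1: "set_integrable lborel {a..b} (\<lambda>x. of_real (X' x) * f (X x))"
      unfolding set_integrable_def eq Complex_eq
      by (intro Bochner_Integration.integrable_add integrable_mult_right integrable_of_real iR iI)
    have "(LINT x:{X a..X b}|lborel. f x) = Complex (LINT x:{X a..X b}|lborel. Re (f x)) (LINT x:{X a..X b}|lborel. Im (f x))"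
      using integral_Re[OF int[of "X a" "X b", unfolded set_integrable_def]] integral_Im[OF int[of "X a" "X b", unfolded set_integrable_def]]
      by (simp add: complex_eq_iff set_lebesgue_integral_def)
    also have "\<dots> = (LINT x:{a..b}|lborel. of_real (X' x) * f (X x))"
      using R I integral_Re[OF int1[unfolded set_integrable_def]] integral_Im[OF int1[unfolded set_integrable_def]]
      by (simp add: complex_eq_iff set_lebesgue_integral_def mult_ac)
    finally show ?thesis using int1 by simp
  qed
  show ?thesis unfolding primitive_def loc_integrable_def
  proof (intro conjI allI impI)
    fix a b :: real
    show "set_integrable lborel {a..b} (\<lambda>x. of_real (X' x) * f (X x))"
      by (cases "a \<le> b") (use cI in \<open>auto simp: set_integrable_def\<close>)
    assume "a \<le> b"
    then show "F (X b) - F (X a) = (LINT x:{a..b}|lborel. of_real (X' x) * f (X x))"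
      using cI primitive_diff_eq[OF F mono] by simp
  qed
qed

text \<open>
  An integrable function with an integrable derivative tends to \<open>0\<close> at infinity, since its distance from its
  mean over a unit interval is at most the integral of the modulus of the derivative over that interval.
\<close>

lemma primitive_integral_zero:
  assumes P: "primitive P p" and iP: "integrable lborel P" and ip: "integrable lborel p"
  shows "(\<integral>x. p x \<partial>lborel) = 0"
proof -
  have [measurable]: "P \<in> borel_measurable borel" "p \<in> borel_measurable borel" using iP ip by auto
  have tail: "(\<lambda>n. LINT x:{c n..c n + 1}|lborel. norm (f x)) \<longlonglongrightarrow> 0"
    if f: "integrable lborel f" and c: "\<And>x. \<forall>\<^sub>F n in sequentially. x \<notin> {c n..c n + 1}"
    for f :: "real \<Rightarrow> complex" and c :: "nat \<Rightarrow> real"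
  proof -
    have [measurable]: "f \<in> borel_measurable borel" using f by auto
    have "(\<lambda>n. \<integral>x. indicator {c n..c n + 1} x *\<^sub>R norm (f x) \<partial>lborel) \<longlonglongrightarrow> (\<integral>x. 0 \<partial>(lborel :: real measure))"
    proof (rule integral_dominated_convergence[OF _ _ integrable_norm[OF f]])
      show "AE x in lborel. (\<lambda>n. indicator {c n..c n + 1} x *\<^sub>R norm (f x)) \<longlonglongrightarrow> 0"
      proof (rule AE_I2, rule tendsto_eventually)
        fix x
        show "\<forall>\<^sub>F n in sequentially. indicator {c n..c n + 1} x *\<^sub>R norm (f x) = 0"
          using c[of x] by (rule eventually_mono) auto
      qed
    qed (auto simp: indicator_def)
    then show ?thesis by (simp add: set_lebesgue_integral_def)
  qed
  have lim: "(\<lambda>n. P (c n)) \<longlonglongrightarrow> 0" if c: "\<And>x. \<forall>\<^sub>F n in sequentially. x \<notin> {c n..c n + 1}" for c :: "nat \<Rightarrow> real"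
  proof (rule Lim_null_comparison[OF _ tendsto_add_zero[OF tail[OF iP c] tail[OF ip c]]], intro always_eventually allI)
    fix n
    let ?I = "{c n..c n + 1}"
    have si: "set_integrable lborel ?I P" "set_integrable lborel ?I p" "set_integrable lborel ?I (\<lambda>x. norm (P x))" "set_integrable lborel ?I (\<lambda>x. norm (p x))"
      unfolding set_integrable_def by (intro integrable_mult_indicator integrable_norm iP ip; simp)+
    have ptw: "norm (P (c n)) \<le> norm (P x) + (LINT y:?I|lborel. norm (p y))" if x: "x \<in> ?I" for x
    proof -
      have "norm (P x - P (c n)) \<le> (LINT y:{c n..x}|lborel. norm (p y))"
        using primitive_diff_eq[OF P, of "c n" x] x
          set_integral_norm_bound[OF primitive_loc_integrable[OF P, unfolded loc_integrable_def, rule_format], of "c n" x]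
        by simp
      also have "\<dots> \<le> (LINT y:?I|lborel. norm (p y))"
        using integrable_norm[OF ip] x unfolding set_lebesgue_integral_def
        by (intro integral_mono integrable_mult_indicator) (auto simp: indicator_def)
      finally show ?thesis using norm_triangle_ineq2[of "P (c n)" "P x"] by (simp add: norm_minus_commute)
    qed
    have sc: "set_integrable lborel ?I (\<lambda>_. k)" for k :: real by (simp add: set_integrable_def)
    have one: "(LINT x:?I|lborel. k) = k" for k :: real
      by (simp add: set_lebesgue_integral_def)
    have "norm (P (c n)) = (LINT x:?I|lborel. norm (P (c n)))" using one by simp
    also have "\<dots> \<le> (LINT x:?I|lborel. norm (P x) + (LINT y:?I|lborel. norm (p y)))"
    proof (rule set_integral_mono)
      show "set_integrable lborel ?I (\<lambda>x. norm (P (c n)))" "set_integrable lborel ?I (\<lambda>x. norm (P x) + (LINT y:?I|lborel. norm (p y)))"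
        by (rule sc, rule set_integral_add(1)[OF si(3) sc])
    qed (rule ptw)
    also have "\<dots> = (LINT x:?I|lborel. norm (P x)) + (LINT y:?I|lborel. norm (p y))"
      using set_integral_add(2)[OF si(3) sc] one by simp
    finally show "norm (P (c n)) \<le> (LINT x:?I|lborel. norm (P x)) + (LINT y:?I|lborel. norm (p y))" .
  qed
  have l1: "(\<lambda>n. P (real n)) \<longlonglongrightarrow> 0"
  proof (rule lim)
    fix x :: real
    obtain m where "x < real m" using reals_Archimedean2 by blast
    then show "\<forall>\<^sub>F n in sequentially. x \<notin> {real n..real n + 1}" by (intro eventually_sequentiallyI[of m]) auto
  qed
  have l2: "(\<lambda>n. P (- real n)) \<longlonglongrightarrow> 0"
  proof (rule lim)
    fix x :: real
    obtain m where "1 - x < real m" using reals_Archimedean2 by blast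
    then show "\<forall>\<^sub>F n in sequentially. x \<notin> {- real n..- real n + 1}" by (intro eventually_sequentiallyI[of m]) auto
  qed
  have "(\<lambda>n. \<integral>x. indicator {- real n..real n} x *\<^sub>R p x \<partial>lborel) \<longlonglongrightarrow> (\<integral>x. p x \<partial>lborel)"
  proof (rule integral_dominated_convergence[OF _ _ integrable_norm[OF ip]])
    show "AE x in lborel. (\<lambda>n. indicator {- real n..real n} x *\<^sub>R p x) \<longlonglongrightarrow> p x"
    proof (rule AE_I2, rule tendsto_eventually)
      fix x :: real
      obtain n where "\<bar>x\<bar> \<le> real n" using real_arch_simple by blast
      then show "\<forall>\<^sub>F n in sequentially. indicator {- real n..real n} x *\<^sub>R p x = p x"
        by (intro eventually_sequentiallyI[of n]) (auto simp: indicator_def)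
    qed
  qed (auto simp: indicator_def)
  moreover have "(\<integral>x. indicator {- real n..real n} x *\<^sub>R p x \<partial>lborel) = P (real n) - P (- real n)" for n
    using primitive_diff_eq[OF P, of "- real n" "real n"] by (simp add: set_lebesgue_integral_def)
  moreover have "(\<lambda>n. P (real n) - P (- real n)) \<longlonglongrightarrow> 0" using tendsto_diff[OF l1 l2] by simp
  ultimately show ?thesis using LIMSEQ_unique by auto
qed

lemma primitive_integration_by_parts:
  assumes F: "primitive F f" "F \<in> L2 lborel" "f \<in> L2 lborel" and G: "primitive G g" "G \<in> L2 lborel" "g \<in> L2 lborel"
  shows "(\<integral>x. f x * G x \<partial>lborel) = - (\<integral>x. F x * g x \<partial>lborel)"
proof -
  note i = L2_integrable_mult[OF F(2) G(3)] L2_integrable_mult[OF F(3) G(2)]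
  have "(\<integral>x. F x * g x + f x * G x \<partial>lborel) = 0"
    by (rule primitive_integral_zero[OF primitive_mult[OF F(1) G(1)] L2_integrable_mult[OF F(2) G(2)]])
       (rule Bochner_Integration.integrable_add[OF i])
  then show ?thesis using i by (simp add: eq_neg_iff_add_eq_0 add.commute)
qed

section \<open>Test functions and weak derivatives\<close>

definition smooth :: "(real \<Rightarrow> real) \<Rightarrow> bool" where
  "smooth \<phi> \<longleftrightarrow> (\<forall>k x. (deriv ^^ k) \<phi> field_differentiable at x)"

lemma test_fun_smooth: "test_fun \<phi> \<longleftrightarrow> smooth \<phi> \<and> (\<exists>R. \<forall>x. \<bar>x\<bar> > R \<longrightarrow> \<phi> x = 0)"
  by (simp add: test_fun_def smooth_def)

lemma smooth_coinduct:
  assumes "\<phi> \<in> S" "\<And>f x. f \<in> S \<Longrightarrow> f field_differentiable at x" "\<And>f. f \<in> S \<Longrightarrow> deriv f \<in> S"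
  shows "smooth \<phi>"
proof -
  have "(deriv ^^ k) \<phi> \<in> S" for k by (induction k) (use assms in auto)
  then show ?thesis using assms(2) by (simp add: smooth_def)
qed

lemma smooth_differentiable: "smooth \<phi> \<Longrightarrow> \<phi> field_differentiable at x"
  unfolding smooth_def by (metis funpow_0)

lemma smooth_deriv: "smooth \<phi> \<Longrightarrow> smooth (deriv \<phi>)"
  unfolding smooth_def by (metis funpow_Suc_right comp_apply)

lemma smooth_has_derivative: "smooth \<phi> \<Longrightarrow> (\<phi> has_real_derivative deriv \<phi> x) (at x)"
  using smooth_differentiable by (simp add: DERIV_deriv_iff_field_differentiable)

lemma smooth_continuous: "smooth \<phi> \<Longrightarrow> continuous_on UNIV \<phi>"
  by (intro continuous_at_imp_continuous_on ballI field_differentiable_imp_continuous_at smooth_differentiable)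

lemma smooth_of_derivative:
  assumes "\<And>x. (\<phi> has_real_derivative \<psi> x) (at x)" "smooth \<psi>"
  shows "smooth \<phi>"
proof (rule smooth_coinduct[where S = "insert \<phi> {f. smooth f}"])
  have "deriv \<phi> = \<psi>" using assms(1) by (intro ext DERIV_imp_deriv)
  then show "deriv f \<in> insert \<phi> {f. smooth f}" if "f \<in> insert \<phi> {f. smooth f}" for f
    using that smooth_deriv assms(2) by auto
  show "f field_differentiable at x" if "f \<in> insert \<phi> {f. smooth f}" for f x
    using that assms(1) smooth_differentiable by (auto simp: field_differentiable_def)
qed simp

text \<open>
  The derivative of a product of smooth functions is not such a product, but a sum of two.  Closing under sums
  gives a class that is stable under derivatives.
\<close>

inductive_set product_sums :: "(real \<Rightarrow> real) set" where
  prod: "smooth \<phi> \<Longrightarrow> smooth \<psi> \<Longrightarrow> (\<lambda>x. \<phi> x * \<psi> x) \<in> product_sums"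
| sum: "f \<in> product_sums \<Longrightarrow> g \<in> product_sums \<Longrightarrow> (\<lambda>x. f x + g x) \<in> product_sums"

lemma product_sums_derivative:
  "f \<in> product_sums \<Longrightarrow> \<exists>f'\<in>product_sums. \<forall>x. (f has_real_derivative f' x) (at x)"
proof (induction rule: product_sums.induct)
  case (prod \<phi> \<psi>)
  have "(\<lambda>x. deriv \<phi> x * \<psi> x + deriv \<psi> x * \<phi> x) \<in> product_sums"
    using prod smooth_deriv by (intro product_sums.intros) auto
  moreover have "((\<lambda>x. \<phi> x * \<psi> x) has_real_derivative deriv \<phi> x * \<psi> x + deriv \<psi> x * \<phi> x) (at x)" for x
    using DERIV_mult[OF smooth_has_derivative[OF prod(1)] smooth_has_derivative[OF prod(2)]] .
  ultimately show ?case by (intro bexI[of _ "\<lambda>x. deriv \<phi> x * \<psi> x + deriv \<psi> x * \<phi> x"] allI)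
next
  case (sum f g)
  then obtain f' g' where "f' \<in> product_sums" "\<And>x. (f has_real_derivative f' x) (at x)"
    "g' \<in> product_sums" "\<And>x. (g has_real_derivative g' x) (at x)" by blast
  then show ?case by (intro bexI[of _ "\<lambda>x. f' x + g' x"] allI DERIV_add product_sums.sum)
qed

lemma smooth_mult:
  assumes "smooth \<phi>" "smooth \<psi>" shows "smooth (\<lambda>x. \<phi> x * \<psi> x)"
proof (rule smooth_coinduct[where S = product_sums])
  fix f assume f: "f \<in> product_sums"
  then obtain f' where f': "f' \<in> product_sums" "\<And>x. (f has_real_derivative f' x) (at x)"
    using product_sums_derivative by blast
  then show "f field_differentiable at x" for x by (auto simp: field_differentiable_def)
  have "deriv f = f'" using f'(2) by (intro ext DERIV_imp_deriv)
  then show "deriv f \<in> product_sums" using f'(1) by simp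
qed (rule product_sums.prod[OF assms])

lemma smooth_affine:
  assumes "smooth \<phi>" shows "smooth (\<lambda>x. \<phi> (a * x + b))"
proof (rule smooth_coinduct[where S = "{\<lambda>x. c * \<psi> (a * x + b) | c \<psi>. smooth \<psi>}"])
  show "(\<lambda>x. \<phi> (a * x + b)) \<in> {\<lambda>x. c * \<psi> (a * x + b) | c \<psi>. smooth \<psi>}"
    using assms by (intro CollectI exI[of _ 1] exI[of _ \<phi>]) auto
  fix f assume "f \<in> {\<lambda>x. c * \<psi> (a * x + b) | c \<psi>. smooth \<psi>}"
  then obtain c \<psi> where f: "f = (\<lambda>x. c * \<psi> (a * x + b))" "smooth \<psi>" by blast
  have D: "(f has_real_derivative c * a * deriv \<psi> (a * x + b)) (at x)" for x
    unfolding f(1) by (auto intro!: derivative_eq_intros DERIV_chain2[OF smooth_has_derivative[OF f(2)]])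
  then show "f field_differentiable at x" for x by (auto simp: field_differentiable_def)
  have "deriv f = (\<lambda>x. c * a * deriv \<psi> (a * x + b))" using D by (intro ext DERIV_imp_deriv)
  then show "deriv f \<in> {\<lambda>x. c * \<psi> (a * x + b) | c \<psi>. smooth \<psi>}"
    using smooth_deriv[OF f(2)] by blast
qed

lemma smooth_lincomb:
  assumes "smooth \<phi>" "smooth \<psi>" shows "smooth (\<lambda>x. a * \<phi> x + b * \<psi> x)"
proof (rule smooth_coinduct[where S = "{\<lambda>x. a * \<phi> x + b * \<psi> x | \<phi> \<psi>. smooth \<phi> \<and> smooth \<psi>}"])
  show "(\<lambda>x. a * \<phi> x + b * \<psi> x) \<in> {\<lambda>x. a * \<phi> x + b * \<psi> x | \<phi> \<psi>. smooth \<phi> \<and> smooth \<psi>}" using assms by blast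
  fix f assume "f \<in> {\<lambda>x. a * \<phi> x + b * \<psi> x | \<phi> \<psi>. smooth \<phi> \<and> smooth \<psi>}"
  then obtain \<phi> \<psi> where f: "f = (\<lambda>x. a * \<phi> x + b * \<psi> x)" "smooth \<phi>" "smooth \<psi>" by blast
  have D: "(f has_real_derivative a * deriv \<phi> x + b * deriv \<psi> x) (at x)" for x
    unfolding f(1) by (intro DERIV_add DERIV_cmult smooth_has_derivative f)
  then show "f field_differentiable at x" for x by (auto simp: field_differentiable_def)
  have "deriv f = (\<lambda>x. a * deriv \<phi> x + b * deriv \<psi> x)" using D by (intro ext DERIV_imp_deriv)
  then show "deriv f \<in> {\<lambda>x. a * \<phi> x + b * \<psi> x | \<phi> \<psi>. smooth \<phi> \<and> smooth \<psi>}"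
    using smooth_deriv f by blast
qed

lemma smooth_diff: "smooth \<phi> \<Longrightarrow> smooth \<psi> \<Longrightarrow> smooth (\<lambda>x. \<phi> x - \<psi> x)"
  using smooth_lincomb[of \<phi> \<psi> 1 "-1"] by simp

text \<open>
  The class of the functions $p(1/x)e^{-1/x}$, extended by \<open>0\<close> to $x\le0$, contains its derivatives, which shows that
  its elements are smooth; $p = 1$ is the standard building block of smooth bumps.
\<close>

definition exp_step :: "real poly \<Rightarrow> real \<Rightarrow> real" where
  "exp_step p x = (if 0 < x then poly p (inverse x) * exp (- inverse x) else 0)"

lemma poly_exp_tendsto_0: "((\<lambda>y. poly p y * exp (- y)) \<longlongrightarrow> (0::real)) at_top"
proof -
  have "((\<lambda>y. \<Sum>i\<le>degree p. coeff p i * (y ^ i / exp y)) \<longlongrightarrow> (\<Sum>i\<le>degree p. coeff p i * 0)) at_top"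
    by (intro tendsto_intros tendsto_power_div_exp_0)
  then show ?thesis
    by (simp add: poly_altdef sum_distrib_right exp_minus divide_inverse mult.assoc)
qed

lemma exp_step_derivative:
  "(exp_step p has_real_derivative exp_step ((p - pderiv p) * [:0, 0, 1:]) x) (at x)"
proof -
  consider "x > 0" | "x < 0" | "x = 0" by linarith
  then show ?thesis
  proof cases
    case 1
    have "((\<lambda>x. poly p (inverse x) * exp (- inverse x)) has_real_derivative exp_step ((p - pderiv p) * [:0, 0, 1:]) x) (at x)"
      using 1 by (auto intro!: derivative_eq_intros DERIV_chain2[OF poly_DERIV] simp: exp_step_def field_simps power2_eq_square)
    then show ?thesis
      by (rule has_field_derivative_transform_within_open[where S = "{0<..}"]) (use 1 in \<open>auto simp: exp_step_def\<close>)
  next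
    case 2
    have "((\<lambda>x. 0) has_real_derivative 0) (at x)" by simp
    then have "(exp_step p has_real_derivative 0) (at x)"
      by (rule has_field_derivative_transform_within_open[where S = "{..<0}"]) (use 2 in \<open>auto simp: exp_step_def\<close>)
    then show ?thesis using 2 by (simp add: exp_step_def)
  next
    case 3
    have "((\<lambda>h. exp_step p h / h) \<longlongrightarrow> 0) (at 0)"
    proof (rule filterlim_split_at)
      show "((\<lambda>h. exp_step p h / h) \<longlongrightarrow> 0) (at_left 0)"
        by (rule tendsto_eventually) (auto simp: exp_step_def eventually_at_left_field intro: exI[of _ "-1"])
      have "((\<lambda>h. poly ([:0, 1:] * p) (inverse h) * exp (- inverse h)) \<longlongrightarrow> 0) (at_right 0)"
        by (rule filterlim_compose[OF poly_exp_tendsto_0 filterlim_inverse_at_top_right])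
      then show "((\<lambda>h. exp_step p h / h) \<longlongrightarrow> 0) (at_right 0)"
        by (rule Lim_transform_eventually)
           (auto simp: eventually_at_right_field exp_step_def divide_inverse intro!: exI[of _ 1])
    qed
    then have "(exp_step p has_real_derivative 0) (at 0)"
      unfolding DERIV_def by (simp add: exp_step_def)
    then show ?thesis using 3 by (simp add: exp_step_def)
  qed
qed

lemma smooth_exp_step: "smooth (exp_step p)"
proof (rule smooth_coinduct[where S = "range exp_step"])
  fix f assume "f \<in> range exp_step"
  then obtain q where f: "f = exp_step q" by blast
  show "f field_differentiable at x" for x
    unfolding f using exp_step_derivative by (auto simp: field_differentiable_def)
  have "deriv f = exp_step ((q - pderiv q) * [:0, 0, 1:])"
    unfolding f using exp_step_derivative by (intro ext DERIV_imp_deriv)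
  then show "deriv f \<in> range exp_step" by blast
qed simp

text \<open>These bumps increase to the indicator function of the open interval from \<open>a\<close> to \<open>b\<close>.\<close>

definition bump :: "real \<Rightarrow> real \<Rightarrow> nat \<Rightarrow> real \<Rightarrow> real" where
  "bump a b n x = exp_step 1 (real (Suc n) * x + (- real (Suc n) * a)) * exp_step 1 (- real (Suc n) * x + real (Suc n) * b)"

lemma bump_pos_iff: "0 < real (Suc n) * x + (- real (Suc n) * a) \<longleftrightarrow> a < x"
    "0 < - real (Suc n) * x + real (Suc n) * b \<longleftrightarrow> x < b"
proof -
  have "real (Suc n) * x + (- real (Suc n) * a) = real (Suc n) * (x - a)"
    "- real (Suc n) * x + real (Suc n) * b = real (Suc n) * (b - x)" by (simp_all add: algebra_simps)
  then show "0 < real (Suc n) * x + (- real (Suc n) * a) \<longleftrightarrow> a < x"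
    "0 < - real (Suc n) * x + real (Suc n) * b \<longleftrightarrow> x < b" by (simp_all add: zero_less_mult_iff del: of_nat_Suc)
qed

lemma bump_outside: "x \<notin> {a<..<b} \<Longrightarrow> bump a b n x = 0"
  unfolding bump_def exp_step_def bump_pos_iff by auto

lemma smooth_bump: "smooth (bump a b n)"
  unfolding bump_def by (intro smooth_mult smooth_affine smooth_exp_step)

lemma test_fun_bump: "test_fun (bump a b n)"
  unfolding test_fun_smooth
proof (intro conjI smooth_bump exI[of _ "max \<bar>a\<bar> \<bar>b\<bar>"] allI impI)
  fix x assume "max \<bar>a\<bar> \<bar>b\<bar> < \<bar>x\<bar>"
  then show "bump a b n x = 0" by (intro bump_outside) auto
qed

lemma bump_bounds: "0 \<le> bump a b n x" "bump a b n x \<le> indicator {a<..<b} x"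
proof -
  have *: "0 \<le> exp_step 1 y" "exp_step 1 y \<le> 1" for y by (auto simp: exp_step_def)
  then show "0 \<le> bump a b n x" by (simp add: bump_def)
  show "bump a b n x \<le> indicator {a<..<b} x"
  proof (cases "x \<in> {a<..<b}")
    case True
    have "bump a b n x \<le> 1 * 1" unfolding bump_def using * by (intro mult_mono) auto
    then show ?thesis using True by simp
  qed (simp add: bump_outside)
qed

lemma bump_tendsto: "(\<lambda>n. bump a b n x) \<longlonglongrightarrow> indicator {a<..<b} x"
proof (cases "x \<in> {a<..<b}")
  case True
  have lim: "(\<lambda>n. exp_step 1 (real (Suc n) * c)) \<longlonglongrightarrow> 1" if c: "c > 0" for c
  proof -
    have "(\<lambda>n. exp (- (inverse c * inverse (real (Suc n))))) \<longlonglongrightarrow> exp (- (inverse c * 0))"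
      by (intro tendsto_intros LIMSEQ_inverse_real_of_nat)
    then show ?thesis using c by (simp add: exp_step_def zero_less_mult_iff mult.commute del: of_nat_Suc)
  qed
  have "(\<lambda>n. exp_step 1 (real (Suc n) * (x - a)) * exp_step 1 (real (Suc n) * (b - x))) \<longlonglongrightarrow> 1 * 1"
    using True by (intro tendsto_mult lim) auto
  then show ?thesis using True by (simp add: bump_def algebra_simps)
qed (simp add: bump_outside)

lemma integral_bump_tendsto:
  assumes F: "loc_integrable F"
  shows "(\<lambda>n. \<integral>x. F x * of_real (bump a b n x) \<partial>lborel) \<longlonglongrightarrow> (LINT x:{a..b}|lborel. F x)"
proof -
  note [measurable] = loc_integrable_measurable[OF F] borel_measurable_continuous_onI[OF smooth_continuous[OF smooth_bump]]
  have i: "integrable lborel (\<lambda>x. indicator {a..b} x *\<^sub>R F x)"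
    using F by (simp add: loc_integrable_def set_integrable_def)
  have bd: "cmod (F x * of_real (bump a b n x)) \<le> norm (indicator {a..b} x *\<^sub>R F x)" for n x
  proof (cases "x \<in> {a<..<b}")
    case True
    have "cmod (F x) * \<bar>bump a b n x\<bar> \<le> cmod (F x) * 1"
      using True bump_bounds[of a b n x] by (intro mult_left_mono) auto
    then show ?thesis using True by (simp add: norm_mult)
  qed (simp add: bump_outside)
  have "(\<lambda>n. \<integral>x. F x * of_real (bump a b n x) \<partial>lborel) \<longlonglongrightarrow> (\<integral>x. F x * of_real (indicator {a<..<b} x) \<partial>lborel)"
    by (rule integral_dominated_convergence[OF _ _ integrable_norm[OF i]])
       (measurable, intro AE_I2 tendsto_intros bump_tendsto, intro AE_I2 bd)
  moreover have "(\<integral>x. F x * of_real (indicator {a<..<b} x) \<partial>lborel) = (LINT x:{a..b}|lborel. F x)"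
    unfolding set_lebesgue_integral_def
  proof (rule integral_cong_AE)
    show "AE x in lborel. F x * of_real (indicator {a<..<b} x) = indicator {a..b} x *\<^sub>R F x"
      by (rule AE_mp[OF AE_lborel_singleton[of a]], rule AE_mp[OF AE_lborel_singleton[of b]])
         (auto simp: indicator_def)
  qed measurable
  ultimately show ?thesis by simp
qed

text \<open>
  The intervals form a generator of the Borel sets that is stable under intersections.
\<close>

lemma AE_zero_if_interval_integrals_zero:
  assumes G: "loc_integrable G" and zero: "\<And>a b. a \<le> b \<Longrightarrow> (LINT x:{a..b}|lborel. G x) = 0"
  shows "AE x in lborel. G x = 0"
proof -
  note [measurable] = loc_integrable_measurable[OF G]
  have "AE x in lborel. indicator {- real n..real n} x *\<^sub>R G x = 0" for n
  proof (rule AE_zero_if_set_integrals_zero)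
    let ?G = "\<lambda>x. indicator {- real n..real n} x *\<^sub>R G x"
    show iG: "integrable lborel ?G" using G by (simp add: loc_integrable_def set_integrable_def)
    have I: "integrable lborel (\<lambda>x. indicator B x *\<^sub>R ?G x)" if "B \<in> sets borel" for B
      by (rule integrable_mult_indicator[OF _ iG]) (use that in simp)
    have Icc: "(\<integral>x. indicator {a..b} x *\<^sub>R ?G x \<partial>lborel) = 0" for a b :: real
    proof -
      have "(\<integral>x. indicator {a..b} x *\<^sub>R ?G x \<partial>lborel) = (LINT x:{max a (- real n)..min b (real n)}|lborel. G x)"
        unfolding set_lebesgue_integral_def by (intro Bochner_Integration.integral_cong) (auto simp: indicator_def)
      also have "\<dots> = 0"
      proof (cases "max a (- real n) \<le> min b (real n)")
        case True then show ?thesis by (rule zero)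
      next
        case False then show ?thesis by (simp add: set_lebesgue_integral_def del: max.bounded_iff min.bounded_iff)
      qed
      finally show ?thesis .
    qed
    have all: "(\<integral>x. ?G x \<partial>lborel) = 0"
      using zero[of "- real n" "real n"] by (simp add: set_lebesgue_integral_def)
    fix B :: "real set" assume "B \<in> sets lborel"
    then have sB: "B \<in> sigma_sets UNIV (range (\<lambda>(a, b). {a..b::real}))"
      by (simp add: borel_eq_atLeastAtMost)
    have Is: "Int_stable (range (\<lambda>(a, b). {a..b::real}))" unfolding Int_stable_def by auto
    have "range (\<lambda>(a, b). {a..b::real}) \<subseteq> Pow UNIV" by simp
    from Is this sB show "(\<integral>x. indicator B x *\<^sub>R ?G x \<partial>lborel) = 0"
    proof (induction rule: sigma_sets_induct_disjoint)
      case (basic A) then show ?case using Icc by auto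
    next
      case empty then show ?case by simp
    next
      case (compl A)
      have A: "A \<in> sets borel" using compl(1) by (simp add: borel_eq_atLeastAtMost)
      have "(\<integral>x. indicator (UNIV - A) x *\<^sub>R ?G x \<partial>lborel) = (\<integral>x. ?G x - indicator A x *\<^sub>R ?G x \<partial>lborel)"
        by (intro Bochner_Integration.integral_cong) (auto simp: indicator_def)
      then show ?case using Bochner_Integration.integral_diff[OF iG I[OF A]] all compl(2) by simp
    next
      case (union A)
      have A: "A i \<in> sets borel" for i using union(2) by (auto simp: borel_eq_atLeastAtMost)
      have "(\<lambda>i. \<integral>x. indicator (\<Union>j<i. A j) x *\<^sub>R ?G x \<partial>lborel) \<longlonglongrightarrow> (\<integral>x. indicator (\<Union>i. A i) x *\<^sub>R ?G x \<partial>lborel)"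
      proof (rule integral_dominated_convergence[OF _ _ integrable_norm[OF iG]])
        show "AE x in lborel. (\<lambda>i. indicator (\<Union>j<i. A j) x *\<^sub>R ?G x) \<longlonglongrightarrow> indicator (\<Union>i. A i) x *\<^sub>R ?G x"
          by (intro AE_I2 tendsto_intros LIMSEQ_indicator_UN)
      qed (use A in \<open>auto simp: indicator_def\<close>)
      moreover have "(\<integral>x. indicator (\<Union>j<i. A j) x *\<^sub>R ?G x \<partial>lborel) = 0" for i
      proof -
        have "indicator (\<Union>j<i. A j) x = (\<Sum>j<i. indicator (A j) x :: real)" for x
          using union(1) by (intro indicator_UN_disjoint) (auto simp: disjoint_family_on_def)
        then have "(\<integral>x. indicator (\<Union>j<i. A j) x *\<^sub>R ?G x \<partial>lborel) = (\<Sum>j<i. \<integral>x. indicator (A j) x *\<^sub>R ?G x \<partial>lborel)"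
          using I[OF A] by (simp only: scaleR_sum_left) (rule Bochner_Integration.integral_sum)
        then show ?thesis using union(3) by simp
      qed
      ultimately show ?case by (simp add: LIMSEQ_const_iff)
    qed
  qed
  then have "AE x in lborel. \<forall>n. indicator {- real n..real n} x *\<^sub>R G x = 0" unfolding AE_all_countable by blast
  then show ?thesis
  proof eventually_elim
    case (elim x)
    obtain n where "\<bar>x\<bar> \<le> real n" using real_arch_simple by blast
    then show ?case using elim[rule_format, of n] by (auto simp: indicator_def)
  qed
qed

lemma AE_zero_if_test_integrals_zero:
  assumes G: "loc_integrable G" and zero: "\<And>\<phi>. test_fun \<phi> \<Longrightarrow> (\<integral>x. G x * of_real (\<phi> x) \<partial>lborel) = 0"
  shows "AE x in lborel. G x = 0"
proof (rule AE_zero_if_interval_integrals_zero[OF G])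
  fix a b :: real
  show "(LINT x:{a..b}|lborel. G x) = 0"
    using integral_bump_tendsto[OF G, of a b] zero[OF test_fun_bump] by (simp add: LIMSEQ_const_iff)
qed

lemma test_fun_primitive:
  assumes "test_fun \<phi>" shows "primitive (\<lambda>x. of_real (\<phi> x)) (\<lambda>x. of_real (deriv \<phi> x))"
proof (rule primitive_of_C1)
  have s: "smooth \<phi>" using assms by (simp add: test_fun_smooth)
  show "((\<lambda>x. complex_of_real (\<phi> x)) has_vector_derivative of_real (deriv \<phi> x)) (at x)" for x
    using smooth_has_derivative[OF s, of x] by (rule has_vector_derivative_of_real)
  show "continuous_on UNIV (\<lambda>x. complex_of_real (deriv \<phi> x))"
    using smooth_continuous[OF smooth_deriv[OF s]] by (intro continuous_intros)
qed

lemma test_fun_support: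
  assumes "test_fun \<phi>"
  obtains R where "R > 0" "\<And>x. R \<le> \<bar>x\<bar> \<Longrightarrow> \<phi> x = 0" "\<And>x. R \<le> \<bar>x\<bar> \<Longrightarrow> deriv \<phi> x = 0"
proof -
  obtain R0 where R0: "\<And>x. \<bar>x\<bar> > R0 \<Longrightarrow> \<phi> x = 0" using assms by (auto simp: test_fun_def)
  define R where "R = \<bar>R0\<bar> + 1"
  have "deriv \<phi> x = 0" if "R \<le> \<bar>x\<bar>" for x
  proof (rule DERIV_imp_deriv)
    have x: "x \<in> {y. \<bar>R0\<bar> < \<bar>y\<bar>}" using that by (simp add: R_def)
    have "((\<lambda>_. 0) has_real_derivative 0) (at x)" by simp
    then show "(\<phi> has_real_derivative 0) (at x)"
    proof (rule has_field_derivative_transform_within_open[OF _ _ x])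
      show "open {y::real. \<bar>R0\<bar> < \<bar>y\<bar>}" by (intro open_Collect_less continuous_intros)
    qed (use R0 in auto)
  qed
  moreover have "\<phi> x = 0" if "R \<le> \<bar>x\<bar>" for x using that R0 by (simp add: R_def)
  moreover have "R > 0" by (simp add: R_def)
  ultimately show ?thesis using that by blast
qed

lemma test_fun_deriv: assumes "test_fun \<phi>" shows "test_fun (deriv \<phi>)"
proof -
  obtain R where "\<And>x. R \<le> \<bar>x\<bar> \<Longrightarrow> deriv \<phi> x = 0" using test_fun_support[OF assms] by metis
  then show ?thesis using assms smooth_deriv by (auto simp: test_fun_smooth intro!: exI[of _ R])
qed

lemma compact_support_integral:
  fixes f :: "real \<Rightarrow> complex"
  assumes "\<And>x. R \<le> \<bar>x\<bar> \<Longrightarrow> f x = 0"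
  shows "(\<integral>x. f x \<partial>lborel) = (LINT x:{-R..R}|lborel. f x)"
    "loc_integrable f \<Longrightarrow> integrable lborel f"
proof -
  have eq: "f = (\<lambda>x. indicator {-R..R} x *\<^sub>R f x)" using assms by (auto simp: indicator_def abs_le_iff intro!: ext)
  show "(\<integral>x. f x \<partial>lborel) = (LINT x:{-R..R}|lborel. f x)"
    unfolding set_lebesgue_integral_def by (subst eq) (rule refl)
  show "integrable lborel f" if "loc_integrable f"
    by (subst eq) (use that in \<open>simp add: loc_integrable_def set_integrable_def\<close>)
qed

lemma continuous_compact_support_L2:
  fixes f :: "real \<Rightarrow> complex"
  assumes f: "continuous_on UNIV f" and R: "\<And>x. R \<le> \<bar>x\<bar> \<Longrightarrow> f x = 0"
  shows "f \<in> L2 lborel" "integrable lborel f"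
proof -
  show "integrable lborel f" by (rule compact_support_integral(2)[OF R loc_integrable_continuous[OF f]])
  have "integrable lborel (\<lambda>x. f x * cnj (f x))"
    by (rule compact_support_integral(2)[where R = R]) (auto simp: R intro!: loc_integrable_continuous continuous_intros f)
  from integrable_norm[OF this] have "integrable lborel (\<lambda>x. (cmod (f x))\<^sup>2)"
    by (simp add: norm_mult power2_eq_square)
  then show "f \<in> L2 lborel" using borel_measurable_continuous_onI[OF f] by (intro L2I) auto
qed

lemma test_fun_L2:
  assumes "test_fun \<phi>" shows "(\<lambda>x. of_real (\<phi> x)) \<in> L2 lborel" "integrable lborel (\<lambda>x. complex_of_real (\<phi> x))"
proof -
  obtain R where R: "\<And>x. R \<le> \<bar>x\<bar> \<Longrightarrow> \<phi> x = 0" using test_fun_support[OF assms] by metis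
  have c: "continuous_on UNIV (\<lambda>x. complex_of_real (\<phi> x))"
    using assms smooth_continuous by (intro continuous_intros) (simp add: test_fun_smooth)
  show "(\<lambda>x. of_real (\<phi> x)) \<in> L2 lborel" "integrable lborel (\<lambda>x. complex_of_real (\<phi> x))"
    by (rule continuous_compact_support_L2[OF c, of R]; simp add: R)+
qed

lemma test_fun_mult_integrable:
  assumes "loc_integrable f" "test_fun \<phi>" shows "integrable lborel (\<lambda>x. f x * of_real (\<phi> x))"
proof -
  obtain R where R: "\<And>x. R \<le> \<bar>x\<bar> \<Longrightarrow> \<phi> x = 0" using test_fun_support[OF assms(2)] by metis
  have "loc_integrable (\<lambda>x. of_real (\<phi> x) * f x)"
    by (rule loc_integrable_mult_continuous[OF assms(1)])
       (use assms smooth_continuous in \<open>auto simp: test_fun_smooth intro!: continuous_intros\<close>)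
  then show ?thesis by (intro compact_support_integral(2)[of R]) (auto simp: R mult.commute)
qed

theorem primitive_imp_weak_deriv:
  assumes F: "primitive F f" shows "weak_deriv F f"
  unfolding weak_deriv_def
proof (intro conjI allI impI)
  show lF: "loc_integrable F" by (rule loc_integrable_continuous[OF primitive_continuous[OF F]])
  show lf: "loc_integrable f" by (rule primitive_loc_integrable[OF F])
  fix \<phi> assume t: "test_fun \<phi>"
  obtain R where R: "R > 0" "\<And>x. R \<le> \<bar>x\<bar> \<Longrightarrow> \<phi> x = 0" "\<And>x. R \<le> \<bar>x\<bar> \<Longrightarrow> deriv \<phi> x = 0" using test_fun_support[OF t] by metis
  have i: "integrable lborel (\<lambda>x. F x * of_real (deriv \<phi> x))" "integrable lborel (\<lambda>x. f x * of_real (\<phi> x))"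
    using test_fun_mult_integrable lF lf t test_fun_deriv by blast+
  have "0 = F R * of_real (\<phi> R) - F (-R) * of_real (\<phi> (-R))" using R by simp
  also have "\<dots> = (LINT x:{-R..R}|lborel. F x * of_real (deriv \<phi> x) + f x * of_real (\<phi> x))"
    using primitive_diff_eq[OF primitive_mult[OF F test_fun_primitive[OF t]], of "-R" R] R(1) by simp
  also have "\<dots> = (\<integral>x. F x * of_real (deriv \<phi> x) + f x * of_real (\<phi> x) \<partial>lborel)"
    by (rule compact_support_integral(1)[symmetric]) (simp add: R)
  also have "\<dots> = (\<integral>x. F x * of_real (deriv \<phi> x) \<partial>lborel) + (\<integral>x. f x * of_real (\<phi> x) \<partial>lborel)"
    by (rule Bochner_Integration.integral_add[OF i])
  finally show "(\<integral>x. F x * of_real (deriv \<phi> x) \<partial>lborel) = - (\<integral>x. f x * of_real (\<phi> x) \<partial>lborel)"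
    by (simp add: eq_neg_iff_add_eq_0)
qed

lemma continuous_antiderivative:
  fixes \<psi> :: "real \<Rightarrow> 'a :: banach"
  assumes "continuous_on UNIV \<psi>"
  obtains \<Psi> where "\<And>x. (\<Psi> has_vector_derivative \<psi> x) (at x)"
proof -
  define \<Psi> where "\<Psi> x = (if 0 \<le> x then integral {0..x} \<psi> else - integral {x..0} \<psi>)" for x
  have int: "\<psi> integrable_on {a..b}" for a b
    by (rule integrable_continuous_real[OF continuous_on_subset[OF assms]]) auto
  have comb: "integral {a..c} \<psi> + integral {c..b} \<psi> = integral {a..b} \<psi>" if "a \<le> c" "c \<le> b" for a b c
    by (rule Henstock_Kurzweil_Integration.integral_combine[OF that int])
  have "(\<Psi> has_vector_derivative \<psi> x) (at x)" for x
  proof -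
    have "((\<lambda>u. integral {x-1..u} \<psi>) has_vector_derivative \<psi> x) (at x within {x-1..x+1})"
      by (rule integral_has_vector_derivative[OF continuous_on_subset[OF assms]]) auto
    then have "((\<lambda>u. integral {x-1..u} \<psi>) has_vector_derivative \<psi> x) (at x within {x-1<..<x+1})"
      by (rule has_vector_derivative_within_subset) auto
    then have D: "((\<lambda>u. integral {x-1..u} \<psi> + \<Psi> (x-1)) has_vector_derivative \<psi> x) (at x)"
      by (auto simp: at_within_open[of x "{x-1<..<x+1}"] intro!: derivative_eq_intros)
    show ?thesis
    proof (rule has_vector_derivative_transform_within_open[OF D, of "{x-1<..<x+1}"])
      fix u assume "u \<in> {x-1<..<x+1}"
      then show "integral {x-1..u} \<psi> + \<Psi> (x-1) = \<Psi> u"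
        unfolding \<Psi>_def using comb[of 0 "x-1" u] comb[of "x-1" 0 u] comb[of "x-1" u 0] by (auto simp: algebra_simps)
    qed auto
  qed
  then show ?thesis by (rule that)
qed

text \<open>
  For the lemma of du Bois-Reymond a difference \<open>\<psi> - \<psi>(\<cdot> - s)\<close> of a bump and its translate is used: it is
  the derivative of a test function.  Hence the integral of \<open>F\<close> over an interval does not change when the
  interval is translated, so that the increments of a primitive of \<open>F\<close> define a continuous additive
  function.
\<close>

lemma test_fun_translation_difference:
  obtains \<phi> where "test_fun \<phi>" "\<And>x. deriv \<phi> x = bump a b n x - bump (a + s) (b + s) n x"
proof -
  obtain \<Psi> where \<Psi>: "\<And>x. (\<Psi> has_real_derivative bump a b n x) (at x)"
    using continuous_antiderivative[OF smooth_continuous[OF smooth_bump]]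
    unfolding has_real_derivative_iff_has_vector_derivative by blast
  have sm: "smooth \<Psi>" by (rule smooth_of_derivative[OF \<Psi> smooth_bump])
  define \<phi> where "\<phi> x = \<Psi> x - \<Psi> (1 * x + (- s))" for x
  have shift: "bump a b n (x - s) = bump (a + s) (b + s) n x" for x by (simp add: bump_def algebra_simps)
  have D: "(\<phi> has_real_derivative bump a b n x - bump (a + s) (b + s) n x) (at x)" for x
    unfolding \<phi>_def by (auto intro!: derivative_eq_intros DERIV_chain2[OF \<Psi>] \<Psi> simp: shift)
  have const: "\<Psi> x = \<Psi> y" if S: "convex S" "S \<inter> {a<..<b} = {}" "x \<in> S" "y \<in> S" for S x y
  proof -
    have "(\<Psi> has_real_derivative 0) (at z within S)" if "z \<in> S" for z
    proof -
      have "bump a b n z = 0" using that S(2) by (intro bump_outside) blast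
      then show ?thesis using has_field_derivative_at_within[OF \<Psi>[of z], of S] by simp
    qed
    then have "\<exists>c. \<forall>z\<in>S. \<Psi> z = c" using S(1) by (intro has_field_derivative_zero_constant) auto
    then show ?thesis using S by auto
  qed
  show ?thesis
  proof
    show "test_fun \<phi>" unfolding test_fun_smooth
    proof (intro conjI exI[of _ "\<bar>a\<bar> + \<bar>b\<bar> + \<bar>s\<bar>"] allI impI)
      show "smooth \<phi>" unfolding \<phi>_def by (intro smooth_diff smooth_affine sm)
      fix x assume x: "\<bar>a\<bar> + \<bar>b\<bar> + \<bar>s\<bar> < \<bar>x\<bar>"
      have "\<Psi> x = \<Psi> (x - s)"
      proof (cases "x > 0")
        case True
        then show ?thesis using x by (intro const[of "{b..}"]) auto
      next
        case False
        then show ?thesis using x by (intro const[of "{..a}"]) auto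
      qed
      then show "\<phi> x = 0" by (simp add: \<phi>_def)
    qed
    show "deriv \<phi> x = bump a b n x - bump (a + s) (b + s) n x" for x using D by (rule DERIV_imp_deriv)
  qed
qed

text \<open>
  A primitive \<open>H\<close> of \<open>h\<close> expresses \<open>h\<close> by integration of the functional equation; hence \<open>h\<close> is differentiable, with the
  constant derivative \<open>h 1\<close>.
\<close>

lemma continuous_additive_linear:
  fixes h :: "real \<Rightarrow> complex"
  assumes h: "continuous_on UNIV h" and add: "\<And>s t. h (s + t) = h s + h t"
  shows "h t = t *\<^sub>R h 1"
proof -
  obtain H where H: "\<And>x. (H has_vector_derivative h x) (at x)"
    using continuous_antiderivative[OF h] by blast
  have const: "f x = f y" if "\<And>x. (f has_vector_derivative 0) (at x)" for f :: "real \<Rightarrow> complex" and x y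
    by (rule has_derivative_zero_unique[of UNIV f]) (use that in \<open>simp_all add: has_vector_derivative_def\<close>)
  have shift: "((\<lambda>x. H (x + t)) has_vector_derivative h (x + t)) (at x)" for x t
  proof -
    have "((\<lambda>x. x + t) has_vector_derivative 1) (at x)" by (auto intro!: derivative_eq_intros)
    from vector_diff_chain_at[OF this H] show ?thesis by (simp add: o_def)
  qed
  have eq: "h t = H (1 + t) - H 1 - H t + H 0" for t
  proof -
    have "((\<lambda>s. H (s + t) - H s - s *\<^sub>R h t) has_vector_derivative 0) (at s)" for s
      by (rule has_vector_derivative_eq_rhs, (rule derivative_intros shift H)+) (simp add: add)
    from const[OF this, of 1 0] show ?thesis by (simp add: algebra_simps)
  qed
  have "(h has_vector_derivative h 1) (at t)" for t
  proof -
    have "((\<lambda>t. H (t + 1) - H 1 - H t + H 0) has_vector_derivative h (t + 1) - 0 - h t + 0) (at t)"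
      by (rule derivative_intros shift H)+
    moreover have "(\<lambda>t. H (t + 1) - H 1 - H t + H 0) = h" using eq by (intro ext) (simp only: add.commute)
    moreover have "h (t + 1) - 0 - h t + 0 = h 1" by (simp add: add)
    ultimately show ?thesis by (simp only:)
  qed
  then have "((\<lambda>s. h s - s *\<^sub>R h 1) has_vector_derivative 0) (at s)" for s
    by (auto intro!: derivative_eq_intros)
  from const[OF this, of t 0] show ?thesis using add[of 0 0] by simp
qed

lemma du_Bois_Reymond:
  assumes F: "loc_integrable F" and zero: "\<And>\<phi>. test_fun \<phi> \<Longrightarrow> (\<integral>x. F x * of_real (deriv \<phi> x) \<partial>lborel) = 0"
  shows "\<exists>c. AE x in lborel. F x = c"
proof -
  obtain \<Phi> where \<Phi>: "primitive \<Phi> F" using primitive_exists[OF F] by blast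
  have inc: "\<Phi> b - \<Phi> a = \<Phi> (b + s) - \<Phi> (a + s)" if ab: "a \<le> b" for a b s
  proof -
    have "(\<integral>x. F x * of_real (bump a b n x) \<partial>lborel) = (\<integral>x. F x * of_real (bump (a + s) (b + s) n x) \<partial>lborel)" for n
    proof -
      obtain \<phi> where \<phi>: "test_fun \<phi>" "\<And>x. deriv \<phi> x = bump a b n x - bump (a + s) (b + s) n x"
        using test_fun_translation_difference by blast
      have "(\<integral>x. F x * of_real (bump a b n x) - F x * of_real (bump (a + s) (b + s) n x) \<partial>lborel) = 0"
        using zero[OF \<phi>(1)] unfolding \<phi>(2) by (simp add: right_diff_distrib)
      then show ?thesis
        using Bochner_Integration.integral_diff[OF test_fun_mult_integrable[OF F test_fun_bump] test_fun_mult_integrable[OF F test_fun_bump], of a b n "a+s" "b+s" n]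
        by simp
    qed
    then have "(LINT x:{a..b}|lborel. F x) = (LINT x:{a + s..b + s}|lborel. F x)"
      using integral_bump_tendsto[OF F, of a b] integral_bump_tendsto[OF F, of "a+s" "b+s"] LIMSEQ_unique by simp
    then show ?thesis using primitive_diff_eq[OF \<Phi>, of a b] primitive_diff_eq[OF \<Phi>, of "a+s" "b+s"] ab by simp
  qed
  define h where "h s = \<Phi> s - \<Phi> 0" for s
  have "h (s + t) = h s + h t" for s t
    using inc[of 0 t s] inc[of t 0 s] by (cases "0 \<le> t") (auto simp: h_def add.commute algebra_simps)
  moreover have "continuous_on UNIV h" unfolding h_def by (intro continuous_intros primitive_continuous[OF \<Phi>])
  ultimately have h: "h t = t *\<^sub>R h 1" for t using continuous_additive_linear by blast
  have "AE x in lborel. F x - h 1 = 0"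
  proof (rule AE_zero_if_interval_integrals_zero)
    show "loc_integrable (\<lambda>x. F x - h 1)" by (intro loc_integrable_diff F loc_integrable_continuous continuous_intros)
    fix a b :: real assume ab: "a \<le> b"
    have "(LINT x:{a..b}|lborel. F x - h 1) = (\<Phi> b - \<Phi> a) - (b - a) *\<^sub>R h 1"
      using F primitive_diff_eq[OF \<Phi> ab] ab
      by (subst set_integral_diff) (auto simp: loc_integrable_def set_integrable_def set_lebesgue_integral_def)
    also have "\<dots> = (h b - h a) - (b - a) *\<^sub>R h 1" by (simp add: h_def)
    also have "\<dots> = 0" using h[of a] h[of b] by (simp add: scaleR_left_diff_distrib)
    finally show "(LINT x:{a..b}|lborel. F x - h 1) = 0" .
  qed
  then show ?thesis by (intro exI[of _ "h 1"]) simp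
qed

text \<open>
  The difference of \<open>f\<close> and a primitive of \<open>f'\<close> has weak derivative \<open>0\<close>.
\<close>

theorem weak_deriv_primitive:
  assumes "weak_deriv f f'"
  obtains F where "primitive F f'" "AE x in lborel. f x = F x"
proof -
  have loc: "loc_integrable f" "loc_integrable f'" using assms by (auto simp: weak_deriv_def)
  obtain F where F: "primitive F f'" using primitive_exists[OF loc(2)] by blast
  note wF = primitive_imp_weak_deriv[OF F]
  have lF: "loc_integrable F" using wF by (simp add: weak_deriv_def)
  have "\<exists>c. AE x in lborel. f x - F x = c"
  proof (rule du_Bois_Reymond[OF loc_integrable_diff[OF loc(1) lF]])
    fix \<phi> assume t: "test_fun \<phi>"
    have "(\<integral>x. f x * of_real (deriv \<phi> x) \<partial>lborel) = (\<integral>x. F x * of_real (deriv \<phi> x) \<partial>lborel)"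
      using assms wF t unfolding weak_deriv_def by simp
    then show "(\<integral>x. (f x - F x) * of_real (deriv \<phi> x) \<partial>lborel) = 0"
      using test_fun_mult_integrable[OF loc(1) test_fun_deriv[OF t]] test_fun_mult_integrable[OF lF test_fun_deriv[OF t]]
      by (simp add: left_diff_distrib)
  qed
  then obtain c where c: "AE x in lborel. f x - F x = c" by blast
  have "AE x in lborel. f x = F x + c" using c by eventually_elim (simp add: algebra_simps)
  with primitive_add_const[OF F] show ?thesis by (rule that)
qed

lemma weak_deriv_AE_cong:
  assumes "weak_deriv f f'" "AE x in lborel. g x = f x" "g \<in> borel_measurable borel"
  shows "weak_deriv g f'"
  unfolding weak_deriv_def
proof (intro conjI allI impI)
  have loc: "loc_integrable f" "loc_integrable f'" using assms(1) by (auto simp: weak_deriv_def)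
  show "loc_integrable f'" by fact
  show lg: "loc_integrable g" by (rule loc_integrable_AE_cong[OF loc(1) assms(3,2)])
  fix \<phi> assume t: "test_fun \<phi>"
  have "(\<integral>x. g x * of_real (deriv \<phi> x) \<partial>lborel) = (\<integral>x. f x * of_real (deriv \<phi> x) \<partial>lborel)"
    using test_fun_mult_integrable[OF loc(1) test_fun_deriv[OF t]] test_fun_mult_integrable[OF lg test_fun_deriv[OF t]] assms(2)
    by (intro integral_cong_AE) auto
  then show "(\<integral>x. g x * of_real (deriv \<phi> x) \<partial>lborel) = - (\<integral>x. f' x * of_real (\<phi> x) \<partial>lborel)"
    using assms(1) t by (simp add: weak_deriv_def)
qed

subsection \<open>The operator \<open>D\<close>\<close>

lemma L2_lborel_measurable [measurable_dest]: "f \<in> L2 lborel \<Longrightarrow> f \<in> borel_measurable borel"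
  using L2_measurable[of f lborel] by simp

text \<open>
  The form of the definition in which \<open>D\<close> is used: the elements of the domain have absolutely continuous
  representatives.
\<close>

lemma D_op_iff:
  "(f, g) \<in> D_op \<longleftrightarrow> f \<in> L2 lborel \<and> g \<in> L2 lborel \<and>
     (\<exists>F. primitive F (\<lambda>x. - \<i> * g x) \<and> (AE x in lborel. f x = F x))"
proof
  assume "(f, g) \<in> D_op"
  then obtain f' where L: "f \<in> L2 lborel" "g \<in> L2 lborel" "weak_deriv f f'" "AE x in lborel. g x = \<i> * f' x"
    by (auto simp: D_op_def)
  obtain F where F: "primitive F f'" "AE x in lborel. f x = F x" using weak_deriv_primitive[OF L(3)] .
  have gm: "(\<lambda>x. - \<i> * g x) \<in> borel_measurable borel" using L2_measurable[OF L(2)] by simp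
  have "AE x in lborel. - \<i> * g x = f' x" using L(4) by eventually_elim (simp flip: mult.assoc)
  then have "primitive F (\<lambda>x. - \<i> * g x)" by (rule primitive_AE_cong[OF F(1) gm])
  then show "f \<in> L2 lborel \<and> g \<in> L2 lborel \<and> (\<exists>F. primitive F (\<lambda>x. - \<i> * g x) \<and> (AE x in lborel. f x = F x))"
    using L F(2) by blast
next
  assume "f \<in> L2 lborel \<and> g \<in> L2 lborel \<and> (\<exists>F. primitive F (\<lambda>x. - \<i> * g x) \<and> (AE x in lborel. f x = F x))"
  then obtain F where L: "f \<in> L2 lborel" "g \<in> L2 lborel" and F: "primitive F (\<lambda>x. - \<i> * g x)" "AE x in lborel. f x = F x" by blast
  have fm: "f \<in> borel_measurable borel" using L2_measurable[OF L(1)] by simp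
  have "weak_deriv f (\<lambda>x. - \<i> * g x)"
    by (rule weak_deriv_AE_cong[OF primitive_imp_weak_deriv[OF F(1)] F(2) fm])
  moreover have "AE x in lborel. g x = \<i> * (- \<i> * g x)" by (simp flip: mult.assoc)
  ultimately show "(f, g) \<in> D_op" using L L2_scale[OF L(2), of "- \<i>"] unfolding D_op_def by blast
qed

lemma D_op_L2: "(f, g) \<in> D_op \<Longrightarrow> f \<in> L2 lborel" "(f, g) \<in> D_op \<Longrightarrow> g \<in> L2 lborel"
  by (simp_all add: D_op_iff)

lemma D_op_AE_cong:
  assumes ab: "(a, b) \<in> D_op" and cong: "AE x in lborel. a' x = a x" "AE x in lborel. b' x = b x" "a' \<in> L2 lborel" "b' \<in> L2 lborel"
  shows "(a', b') \<in> D_op"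
proof -
  obtain F where F: "primitive F (\<lambda>x. - \<i> * b x)" "AE x in lborel. a x = F x" using ab by (auto simp: D_op_iff)
  have m: "(\<lambda>x. - \<i> * b' x) \<in> borel_measurable borel" using L2_lborel_measurable[OF cong(4)] by measurable
  have "primitive F (\<lambda>x. - \<i> * b' x)" by (rule primitive_AE_cong[OF F(1) m]) (use cong(2) in \<open>auto elim: eventually_mono\<close>)
  moreover have "AE x in lborel. a' x = F x" using cong(1) F(2) by eventually_elim simp
  ultimately show ?thesis using ab cong(3,4) by (auto simp: D_op_iff)
qed

lemma D_op_symmetric:
  assumes 1: "(f, g) \<in> D_op" and 2: "(f', g') \<in> D_op"
  shows "L2_inner lborel g f' = L2_inner lborel f g'"
proof -
  obtain F where F: "primitive F (\<lambda>x. - \<i> * g x)" "AE x in lborel. f x = F x" using 1 by (auto simp: D_op_iff)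
  obtain F' where F': "primitive F' (\<lambda>x. - \<i> * g' x)" "AE x in lborel. f' x = F' x" using 2 by (auto simp: D_op_iff)
  note L = D_op_L2[OF 1] D_op_L2[OF 2]
  have m: "F \<in> borel_measurable borel" "F' \<in> borel_measurable borel" using F F' primitive_measurable by blast+
  have FL: "F \<in> L2 lborel" by (rule L2_AE_cong[OF L(1)]) (use m F(2) in \<open>auto elim: eventually_mono\<close>)
  have FL': "F' \<in> L2 lborel" by (rule L2_AE_cong[OF L(3)]) (use m F'(2) in \<open>auto elim: eventually_mono\<close>)
  have "(\<integral>x. (- \<i> * g x) * cnj (F' x) \<partial>lborel) = - (\<integral>x. F x * cnj (- \<i> * g' x) \<partial>lborel)"
    by (rule primitive_integration_by_parts[OF F(1) FL _ primitive_cnj[OF F'(1)] L2_cnj[OF FL']])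
       (intro L2_scale L L2_cnj)+
  then have "- \<i> * (\<integral>x. g x * cnj (F' x) \<partial>lborel) = - (\<i> * (\<integral>x. F x * cnj (g' x) \<partial>lborel))"
    by (simp add: mult.assoc mult.left_commute[of _ \<i>])
  then have "L2_inner lborel g F' = L2_inner lborel F g'" by (simp add: L2_inner_def)
  moreover have "L2_inner lborel g F' = L2_inner lborel g f'"
    using F'(2) m L by (intro L2_inner_AE_cong) (auto simp: L2_lborel_measurable elim: eventually_mono)
  moreover have "L2_inner lborel F g' = L2_inner lborel f g'"
    using F(2) m L by (intro L2_inner_AE_cong) (auto simp: L2_lborel_measurable elim: eventually_mono)
  ultimately show ?thesis by simp
qed

section \<open>The Fourier transform on $L^2(\mathbb{R})$\<close>

definition ek :: "real \<Rightarrow> complex" where "ek t = exp (- (\<i> * of_real t))"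

lemma ek_norm [simp]: "cmod (ek t) = 1"
  by (simp add: ek_def norm_exp_eq_Re)

lemma ek_add: "ek (s + t) = ek s * ek t"
  by (simp add: ek_def exp_add[symmetric] algebra_simps)

lemma ek_cnj: "cnj (ek t) = ek (- t)"
  by (simp add: ek_def exp_cnj)

lemma ek_continuous [continuous_intros]: "continuous_on S f \<Longrightarrow> continuous_on S (\<lambda>x. ek (f x))"
  unfolding ek_def by (intro continuous_intros)

lemma ek_measurable [measurable]: "ek \<in> borel_measurable borel"
  unfolding ek_def[abs_def] by (intro borel_measurable_continuous_onI continuous_intros)

definition fc :: real where "fc = (2 * pi) powr (-1/2)"

lemma fc_eq: "fc = 1 / sqrt (2 * pi)"
proof -
  have "(2 * pi) powr (-1/2) = inverse ((2 * pi) powr (1/2))"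
    unfolding powr_minus[symmetric] by simp
  then show ?thesis unfolding fc_def by (subst (asm) powr_half_sqrt) (auto simp: inverse_eq_divide)
qed

lemma fc_pos: "fc > 0"
  by (simp add: fc_def)

definition ft :: "(real \<Rightarrow> complex) \<Rightarrow> real \<Rightarrow> complex" where
  "ft u \<xi> = of_real fc * (\<integral>x. u x * ek (x * \<xi>) \<partial>lborel)"

lemma fourier_op_ft:
  "fourier_op = op_closure lborel lborel (op_restrict (op_of lborel lborel ft) {u. integrable lborel u})"
  unfolding fourier_op_def ft_def[abs_def] fc_def ek_def ..

lemma ek_integrable: "integrable lborel u \<Longrightarrow> integrable lborel (\<lambda>x. u x * ek (x * \<xi>))"
  by (rule Bochner_Integration.integrable_bound) (auto simp: norm_mult)

lemma ft_measurable [measurable]: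
  assumes [measurable]: "u \<in> borel_measurable borel" shows "ft u \<in> borel_measurable borel"
  unfolding ft_def[abs_def] by measurable

lemma ft_bound:
  assumes "integrable lborel u" shows "cmod (ft u \<xi>) \<le> fc * (\<integral>x. cmod (u x) \<partial>lborel)"
proof -
  have "cmod (\<integral>x. u x * ek (x * \<xi>) \<partial>lborel) \<le> (\<integral>x. cmod (u x * ek (x * \<xi>)) \<partial>lborel)"
    by (rule integral_norm_bound)
  then show ?thesis unfolding ft_def using fc_pos by (simp add: norm_mult)
qed

lemma ft_linear:
  assumes "integrable lborel u" "integrable lborel w"
  shows "ft (\<lambda>x. u x + c * w x) \<xi> = ft u \<xi> + c * ft w \<xi>"
proof -
  have "(\<integral>x. (u x + c * w x) * ek (x * \<xi>) \<partial>lborel) = (\<integral>x. u x * ek (x * \<xi>) + c * (w x * ek (x * \<xi>)) \<partial>lborel)"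
    by (simp add: algebra_simps)
  also have "\<dots> = (\<integral>x. u x * ek (x * \<xi>) \<partial>lborel) + c * (\<integral>x. w x * ek (x * \<xi>) \<partial>lborel)"
    using ek_integrable[OF assms(1)] ek_integrable[OF assms(2)] by simp
  finally show ?thesis by (simp add: ft_def algebra_simps)
qed

lemma ft_cnj: "ft (\<lambda>x. cnj (u x)) \<xi> = cnj (ft u (- \<xi>))"
  unfolding ft_def by (simp add: Bochner_Integration.integral_cnj[symmetric] ek_cnj)

text \<open>
  Fubini's theorem, as the kernel $e^{-ix\xi}$ is symmetric in \<open>x\<close> and \<open>\<xi>\<close>.
\<close>

lemma ft_multiplication_formula:
  assumes u: "integrable lborel u" and w: "integrable lborel w"
  shows "(\<integral>\<xi>. ft u \<xi> * w \<xi> \<partial>lborel) = (\<integral>x. u x * ft w x \<partial>lborel)"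
proof -
  have [measurable]: "u \<in> borel_measurable borel" "w \<in> borel_measurable borel" using u w by auto
  have int: "integrable (lborel \<Otimes>\<^sub>M lborel) (\<lambda>(x, \<xi>). u x * w \<xi> * ek (x * \<xi>))"
    by (rule Bochner_Integration.integrable_bound[OF integrable_tensor[OF u w]]) (auto simp: norm_mult)
  have "(\<integral>\<xi>. ft u \<xi> * w \<xi> \<partial>lborel) = of_real fc * (\<integral>\<xi>. (\<integral>x. u x * w \<xi> * ek (x * \<xi>) \<partial>lborel) \<partial>lborel)"
  proof -
    have "ft u \<xi> * w \<xi> = of_real fc * (\<integral>x. u x * w \<xi> * ek (x * \<xi>) \<partial>lborel)" for \<xi>
    proof -
      have "(\<integral>x. u x * w \<xi> * ek (x * \<xi>) \<partial>lborel) = (\<integral>x. (u x * ek (x * \<xi>)) * w \<xi> \<partial>lborel)"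
        by (simp add: mult_ac)
      then show ?thesis by (simp add: ft_def)
    qed
    then show ?thesis by simp
  qed
  also have "\<dots> = of_real fc * (\<integral>x. (\<integral>\<xi>. u x * w \<xi> * ek (x * \<xi>) \<partial>lborel) \<partial>lborel)"
    using lborel_pair.Fubini_integral[OF int] by simp
  also have "\<dots> = (\<integral>x. u x * ft w x \<partial>lborel)"
  proof -
    have "of_real fc * (\<integral>\<xi>. u x * w \<xi> * ek (x * \<xi>) \<partial>lborel) = u x * ft w x" for x
      by (simp add: ft_def mult.assoc mult.left_commute mult.commute[of x])
    then show ?thesis by (simp flip: integral_mult_right_zero)
  qed
  finally show ?thesis .
qed

subsection \<open>Translations\<close>

lemma L2_translate:
  fixes h :: real
  assumes "f \<in> L2 lborel" shows "(\<lambda>x. f (x + h)) \<in> L2 lborel"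
    "L2_norm lborel (\<lambda>x. f (x + h)) = L2_norm lborel f"
proof -
  have [measurable]: "f \<in> borel_measurable borel" using assms by (rule L2_lborel_measurable)
  show "(\<lambda>x. f (x + h)) \<in> L2 lborel"
    using lborel_integrable_real_affine[OF L2_integrable_sq[OF assms], of 1 h] by (intro L2I) (auto simp: add.commute)
  show "L2_norm lborel (\<lambda>x. f (x + h)) = L2_norm lborel f"
    unfolding L2_norm_def using lborel_integral_real_affine[of 1 "\<lambda>x. (cmod (f x))\<^sup>2" h] by (simp add: add.commute)
qed

definition compactly_supported :: "(real \<Rightarrow> complex) set" where
  "compactly_supported = {f. continuous_on UNIV f \<and> (\<exists>R. \<forall>x. R \<le> \<bar>x\<bar> \<longrightarrow> f x = 0)}"

lemma compactly_supported_L2: "f \<in> compactly_supported \<Longrightarrow> f \<in> L2 lborel"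
  using continuous_compact_support_L2(1) by (auto simp: compactly_supported_def)

lemma compactly_supported_dense: "L2_dense lborel compactly_supported"
proof (rule L2_dense_if_orthogonal_zero)
  show "compactly_supported \<subseteq> L2 lborel" using compactly_supported_L2 by blast
  show "(\<lambda>x. 0) \<in> compactly_supported" by (auto simp: compactly_supported_def)
  show "(\<lambda>x. f x + c * g x) \<in> compactly_supported" if fg: "f \<in> compactly_supported" "g \<in> compactly_supported" for f g c
  proof -
    obtain R1 R2 where "\<And>x. R1 \<le> \<bar>x\<bar> \<Longrightarrow> f x = 0" "\<And>x. R2 \<le> \<bar>x\<bar> \<Longrightarrow> g x = 0" using fg by (auto simp: compactly_supported_def)
    then show ?thesis using fg by (auto simp: compactly_supported_def intro!: continuous_intros exI[of _ "max R1 R2"])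
  qed
  show "AE x in lborel. f x = 0" if f: "f \<in> L2 lborel" and orth: "\<And>s. s \<in> compactly_supported \<Longrightarrow> L2_inner lborel s f = 0" for f
  proof -
    have "AE x in lborel. cnj (f x) = 0"
    proof (rule AE_zero_if_test_integrals_zero[OF loc_integrable_L2[OF L2_cnj[OF f]]])
      fix \<phi> assume t: "test_fun \<phi>"
      then obtain R where "\<And>x. R \<le> \<bar>x\<bar> \<Longrightarrow> \<phi> x = 0" using test_fun_support[OF t] by metis
      then have "(\<lambda>x. of_real (\<phi> x)) \<in> compactly_supported"
        using t smooth_continuous by (auto simp: compactly_supported_def test_fun_smooth intro!: continuous_intros exI[of _ R])
      from orth[OF this] show "(\<integral>x. cnj (f x) * of_real (\<phi> x) \<partial>lborel) = 0"
        by (simp add: L2_inner_def mult.commute)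
    qed
    then show ?thesis by simp
  qed
qed

text \<open>
  Dominated convergence for continuous functions with compact support; in general by their density, as translations
  are isometric.
\<close>

lemma L2_translation_continuous:
  fixes h :: "nat \<Rightarrow> real"
  assumes u: "u \<in> L2 lborel" and h: "h \<longlonglongrightarrow> 0"
  shows "(\<lambda>n::nat. L2_norm lborel (\<lambda>x. u (x + h n) - u x)) \<longlonglongrightarrow> 0"
proof -
  have compactly_supported: "(\<lambda>n. L2_norm lborel (\<lambda>x. f (x + h n) - f x)) \<longlonglongrightarrow> 0" if f: "f \<in> compactly_supported" for f
  proof -
    obtain R where R: "\<And>x. R \<le> \<bar>x\<bar> \<Longrightarrow> f x = 0" and cont: "continuous_on UNIV f" using f by (auto simp: compactly_supported_def)
    have [measurable]: "f \<in> borel_measurable borel" by (rule borel_measurable_continuous_onI[OF cont])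
    obtain B where B: "\<And>n. \<bar>h n\<bar> \<le> B"
      using convergent_imp_Bseq[OF convergentI[OF h]] by (auto simp: Bseq_def)
    have "compact (f ` {-R..R})" by (intro compact_continuous_image continuous_on_subset[OF cont]) auto
    from compact_imp_bounded[OF this] obtain C0 where C0: "\<And>x. x \<in> {-R..R} \<Longrightarrow> cmod (f x) \<le> C0"
      by (force simp: bounded_iff)
    define C where "C = max C0 0"
    have C: "cmod (f x) \<le> C" for x
      using C0[of x] R[of x] by (cases "x \<in> {-R..R}") (auto simp: C_def abs_le_iff)
    let ?I = "{- (\<bar>R\<bar> + B)..\<bar>R\<bar> + B}"
    show ?thesis
    proof (rule L2_dominated_convergence)
      show "integrable lborel (\<lambda>x. (2 * C)\<^sup>2 * indicator ?I x :: real)"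
        by (intro integrable_mult_right integrable_real_indicator) (auto simp: emeasure_lborel_Icc_eq)
      show "AE x in lborel. (cmod (f (x + h n) - f x))\<^sup>2 \<le> (2 * C)\<^sup>2 * indicator ?I x" for n
      proof (rule AE_I2)
        fix x
        show "(cmod (f (x + h n) - f x))\<^sup>2 \<le> (2 * C)\<^sup>2 * indicator ?I x"
        proof (cases "x \<in> ?I")
          case True
          have "cmod (f (x + h n) - f x) \<le> 2 * C" using norm_triangle_ineq4[of "f (x + h n)" "f x"] C[of x] C[of "x + h n"] by linarith
          from power_mono[OF this norm_ge_zero, of 2] show ?thesis using True by simp
        next
          case False
          then have "R \<le> \<bar>x + h n\<bar>" "R \<le> \<bar>x\<bar>" using B[of n] by auto
          then show ?thesis using R by simp
        qed
      qed
      show "AE x in lborel. (\<lambda>n. f (x + h n)) \<longlonglongrightarrow> f x"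
      proof (rule AE_I2)
        fix x
        have "(\<lambda>n. x + h n) \<longlonglongrightarrow> x + 0" by (intro tendsto_intros h)
        then show "(\<lambda>n. f (x + h n)) \<longlonglongrightarrow> f x"
          using continuous_on_tendsto_compose[OF cont, of "\<lambda>n. x + h n" x] by simp
      qed
    qed measurable
  qed
  show ?thesis
  proof (rule LIMSEQ_I)
    fix r :: real assume r: "r > 0"
    obtain f where f: "f \<in> compactly_supported" "L2_norm lborel (\<lambda>x. u x - f x) < r / 3"
      using compactly_supported_dense u r unfolding L2_dense_def by (meson divide_pos_pos zero_less_numeral)
    note fL = compactly_supported_L2[OF f(1)]
    have "\<forall>\<^sub>F n in sequentially. L2_norm lborel (\<lambda>x. f (x + h n) - f x) < r / 3"
      by (intro order_tendstoD(2)[OF compactly_supported[OF f(1)]]) (use r in simp)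
    then obtain N where N: "\<And>n. n \<ge> N \<Longrightarrow> L2_norm lborel (\<lambda>x. f (x + h n) - f x) < r / 3"
      by (auto simp: eventually_sequentially)
    have "L2_norm lborel (\<lambda>x. u (x + h n) - u x) < r" if n: "n \<ge> N" for n
    proof -
      have "L2_norm lborel (\<lambda>x. u (x + h n) - u x) \<le> L2_norm lborel (\<lambda>x. u (x + h n) - f (x + h n)) + L2_norm lborel (\<lambda>x. f (x + h n) - u x)"
        by (rule L2_triangle_diff) (intro L2_translate u fL)+
      also have "L2_norm lborel (\<lambda>x. f (x + h n) - u x) \<le> L2_norm lborel (\<lambda>x. f (x + h n) - f x) + L2_norm lborel (\<lambda>x. f x - u x)"
        by (rule L2_triangle_diff) (intro L2_translate u fL)+
      also have "L2_norm lborel (\<lambda>x. u (x + h n) - f (x + h n)) = L2_norm lborel (\<lambda>x. u x - f x)"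
        by (rule L2_translate(2)[OF L2_diff[OF u fL]])
      finally show ?thesis using N[OF n] f(2) L2_norm_minus_commute[of lborel f u] by linarith
    qed
    then show "\<exists>N. \<forall>n\<ge>N. norm (L2_norm lborel (\<lambda>x. u (x + h n) - u x) - 0) < r" by auto
  qed
qed

subsection \<open>Plancherel's theorem\<close>

lemma gaussian_integral:
  fixes \<epsilon> :: real
  assumes "\<epsilon> > 0"
  shows "(\<integral>\<xi>. of_real (exp (- (\<epsilon> * \<xi>)\<^sup>2 / 2)) * ek (y * \<xi>) \<partial>lborel) = of_real (exp (- (y / \<epsilon>)\<^sup>2 / 2) / (fc * \<epsilon>))"
proof -
  have "complex_of_real (exp (- (y / \<epsilon>)\<^sup>2 / 2)) = char std_normal_distribution (- (y / \<epsilon>))"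
    by (simp add: char_std_normal_distribution)
  also have "\<dots> = (\<integral>x. std_normal_density x *\<^sub>R iexp (- (y / \<epsilon>) * x) \<partial>lborel)"
    unfolding char_def by (subst integral_density) auto
  also have "\<dots> = \<bar>\<epsilon>\<bar> *\<^sub>R (\<integral>\<xi>. std_normal_density (0 + \<epsilon> * \<xi>) *\<^sub>R iexp (- (y / \<epsilon>) * (0 + \<epsilon> * \<xi>)) \<partial>lborel)"
    by (rule lborel_integral_real_affine) (use assms in simp)
  also have "\<dots> = of_real \<epsilon> * (\<integral>\<xi>. of_real fc * (of_real (exp (- (\<epsilon> * \<xi>)\<^sup>2 / 2)) * ek (y * \<xi>)) \<partial>lborel)"
  proof -
    have "std_normal_density (0 + \<epsilon> * \<xi>) *\<^sub>R iexp (- (y / \<epsilon>) * (0 + \<epsilon> * \<xi>)) = of_real fc * (of_real (exp (- (\<epsilon> * \<xi>)\<^sup>2 / 2)) * ek (y * \<xi>))" for \<xi>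
      using assms by (simp add: std_normal_density_def fc_eq ek_def scaleR_conv_of_real)
    then show ?thesis using assms by (simp add: scaleR_conv_of_real)
  qed
  also have "\<dots> = of_real (fc * \<epsilon>) * (\<integral>\<xi>. of_real (exp (- (\<epsilon> * \<xi>)\<^sup>2 / 2)) * ek (y * \<xi>) \<partial>lborel)"
    by simp
  finally show ?thesis using assms fc_pos by (simp add: field_simps)
qed

lemma gaussian_integrable:
  fixes \<epsilon> :: real
  assumes "\<epsilon> > 0" shows "integrable lborel (\<lambda>\<xi>. exp (- (\<epsilon> * \<xi>)\<^sup>2 / 2))"
proof -
  have "integrable lborel (\<lambda>x. sqrt (2 * pi) * std_normal_density (0 + \<epsilon> * x))"
    using lborel_integrable_real_affine[OF integrable_std_normal_moment[of 0], of \<epsilon> 0] assms by simp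
  then show ?thesis by (simp add: std_normal_density_def)
qed

text \<open>
  With the weight $e^{-(\epsilon\xi)^2/2}$ the multiplication formula, applied twice, expresses the norm of
  the transform by the average of the autocorrelation of \<open>u\<close> against a Gaussian of width \<open>\<epsilon>\<close>.
\<close>

lemma ft_gaussian_weight:
  assumes u: "integrable lborel u" and uL: "u \<in> L2 lborel" and eps: "\<epsilon> > 0"
  shows "complex_of_real (\<integral>\<xi>. (cmod (ft u \<xi>))\<^sup>2 * exp (- (\<epsilon> * \<xi>)\<^sup>2 / 2) \<partial>lborel)
    = (\<integral>s. of_real (std_normal_density s) * L2_inner lborel u (\<lambda>x. u (x + \<epsilon> * s)) \<partial>lborel)"
    "integrable lborel (\<lambda>\<xi>. (cmod (ft u \<xi>))\<^sup>2 * exp (- (\<epsilon> * \<xi>)\<^sup>2 / 2))"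
proof -
  have [measurable]: "u \<in> borel_measurable borel" using u by auto
  let ?g = "\<lambda>\<xi>. exp (- (\<epsilon> * \<xi>)\<^sup>2 / 2)"
  let ?N = "std_normal_density"
  define B where "B = fc * (\<integral>x. cmod (u x) \<partial>lborel)"
  have B: "cmod (ft u \<xi>) \<le> B" for \<xi> unfolding B_def by (rule ft_bound[OF u])
  have B0: "0 \<le> B" using B[of 0] norm_ge_zero order_trans by blast
  have W: "integrable lborel (\<lambda>\<xi>. cnj (ft u \<xi>) * of_real (?g \<xi>))"
    by (rule Bochner_Integration.integrable_bound[OF integrable_mult_right[OF gaussian_integrable[OF eps], of B]])
       (use B B0 in \<open>auto simp: norm_mult intro!: mult_right_mono\<close>)
  show "integrable lborel (\<lambda>\<xi>. (cmod (ft u \<xi>))\<^sup>2 * ?g \<xi>)"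
    by (rule Bochner_Integration.integrable_bound[OF integrable_mult_right[OF gaussian_integrable[OF eps], of "B\<^sup>2"]])
       (use B B0 in \<open>auto intro!: mult_right_mono power_mono\<close>)
  have V: "integrable lborel (\<lambda>\<xi>. of_real (?g \<xi>) * ek (- x * \<xi>))" for x
    by (rule Bochner_Integration.integrable_bound[OF gaussian_integrable[OF eps]]) (auto simp: norm_mult)
  have ftV: "ft (\<lambda>\<xi>. of_real (?g \<xi>) * ek (- x * \<xi>)) y = of_real (exp (- ((y - x) / \<epsilon>)\<^sup>2 / 2) / \<epsilon>)" for x y
  proof -
    have "(\<integral>\<xi>. of_real (?g \<xi>) * ek (- x * \<xi>) * ek (\<xi> * y) \<partial>lborel) = (\<integral>\<xi>. of_real (?g \<xi>) * ek ((y - x) * \<xi>) \<partial>lborel)"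
    proof -
      have "ek (- x * \<xi>) * ek (\<xi> * y) = ek ((y - x) * \<xi>)" for \<xi>
        unfolding ek_add[symmetric] by (simp add: algebra_simps)
      then show ?thesis by (simp only: mult.assoc)
    qed
    then show ?thesis unfolding ft_def gaussian_integral[OF eps] using fc_pos by simp
  qed
  have ftW: "ft (\<lambda>\<xi>. cnj (ft u \<xi>) * of_real (?g \<xi>)) x = cnj (\<integral>s. u (x + \<epsilon> * s) * of_real (?N s) \<partial>lborel)" for x
  proof -
    have "ft (\<lambda>\<xi>. cnj (ft u \<xi>) * of_real (?g \<xi>)) x = cnj (of_real fc * (\<integral>\<xi>. ft u \<xi> * (of_real (?g \<xi>) * ek (- x * \<xi>)) \<partial>lborel))"
      unfolding ft_def[of "\<lambda>\<xi>. cnj (ft u \<xi>) * of_real (?g \<xi>)"]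
      by (simp add: Bochner_Integration.integral_cnj[symmetric] ek_cnj mult.assoc mult.commute[of x])
    also have "(\<integral>\<xi>. ft u \<xi> * (of_real (?g \<xi>) * ek (- x * \<xi>)) \<partial>lborel) = (\<integral>y. u y * of_real (exp (- ((y - x) / \<epsilon>)\<^sup>2 / 2) / \<epsilon>) \<partial>lborel)"
      unfolding ft_multiplication_formula[OF u V] ftV ..
    also have "\<dots> = \<bar>\<epsilon>\<bar> *\<^sub>R (\<integral>s. u (x + \<epsilon> * s) * of_real (exp (- ((x + \<epsilon> * s - x) / \<epsilon>)\<^sup>2 / 2) / \<epsilon>) \<partial>lborel)"
      by (rule lborel_integral_real_affine) (use eps in simp)
    also have "of_real fc * \<dots> = (\<integral>s. u (x + \<epsilon> * s) * of_real (?N s) \<partial>lborel)"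
    proof -
      have "of_real (fc * \<epsilon>) * (u (x + \<epsilon> * s) * of_real (exp (- ((x + \<epsilon> * s - x) / \<epsilon>)\<^sup>2 / 2) / \<epsilon>)) = u (x + \<epsilon> * s) * of_real (?N s)" for s
        using eps by (simp add: std_normal_density_def fc_eq)
      then have "(\<integral>s. u (x + \<epsilon> * s) * of_real (?N s) \<partial>lborel) = of_real (fc * \<epsilon>) * (\<integral>s. u (x + \<epsilon> * s) * of_real (exp (- ((x + \<epsilon> * s - x) / \<epsilon>)\<^sup>2 / 2) / \<epsilon>) \<partial>lborel)"
        by (simp only: integral_mult_right_zero[symmetric])
      then show ?thesis using eps by (simp add: scaleR_conv_of_real)
    qed
    finally show ?thesis .
  qed
  have inner_le: "(\<integral>x. cmod (u x) * cmod (u (x + \<epsilon> * s)) \<partial>lborel) \<le> (L2_norm lborel u)\<^sup>2" for s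
  proof -
    have "(\<integral>x. cmod (u x) * cmod (u (x + \<epsilon> * s)) \<partial>lborel) = cmod (L2_inner lborel (\<lambda>x. of_real (cmod (u x))) (\<lambda>x. of_real (cmod (u (x + \<epsilon> * s)))))"
      by (simp add: L2_inner_def of_real_mult[symmetric] integral_nonneg del: of_real_mult)
    also have "\<dots> \<le> L2_norm lborel (\<lambda>x. of_real (cmod (u x))) * L2_norm lborel (\<lambda>x. of_real (cmod (u (x + \<epsilon> * s))))"
      using L2_integrable_sq[OF uL] L2_integrable_sq[OF L2_translate(1)[OF uL]] by (intro L2_Cauchy_Schwarz L2I) auto
    also have "\<dots> = L2_norm lborel u * L2_norm lborel (\<lambda>x. u (x + \<epsilon> * s))" by (simp add: L2_norm_def)
    finally show ?thesis using L2_translate(2)[OF uL] by (simp add: power2_eq_square)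
  qed
  let ?K = "\<lambda>s x. u x * cnj (u (x + \<epsilon> * s)) * of_real (?N s)"
  have iK: "integrable (lborel \<Otimes>\<^sub>M lborel) (\<lambda>(s, x). ?K s x)"
  proof (rule lborel_pair.Fubini_integrable)
    show "(\<lambda>(s, x). ?K s x) \<in> borel_measurable (lborel \<Otimes>\<^sub>M lborel)" by measurable
    have eq: "(\<integral>x. norm (case (s, x) of (s, x) \<Rightarrow> ?K s x) \<partial>lborel) = (\<integral>x. cmod (u x) * cmod (u (x + \<epsilon> * s)) \<partial>lborel) * ?N s" for s
      by (simp add: norm_mult)
    show "integrable lborel (\<lambda>s. \<integral>x. norm (case (s, x) of (s, x) \<Rightarrow> ?K s x) \<partial>lborel)"
      unfolding eq
    proof (rule Bochner_Integration.integrable_bound)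
      show "integrable lborel (\<lambda>s. (L2_norm lborel u)\<^sup>2 * ?N s)" using integrable_std_normal_moment[of 0] by simp
      show "AE s in lborel. norm ((\<integral>x. cmod (u x) * cmod (u (x + \<epsilon> * s)) \<partial>lborel) * ?N s) \<le> norm ((L2_norm lborel u)\<^sup>2 * ?N s)"
        using inner_le by (auto simp: abs_mult integral_nonneg intro!: mult_right_mono)
    qed measurable
    show "AE s in lborel. integrable lborel (\<lambda>x. case (s, x) of (s, x) \<Rightarrow> ?K s x)"
      using L2_integrable_inner[OF uL L2_translate(1)[OF uL]] by simp
  qed
  have "complex_of_real (\<integral>\<xi>. (cmod (ft u \<xi>))\<^sup>2 * ?g \<xi> \<partial>lborel) = (\<integral>\<xi>. ft u \<xi> * (cnj (ft u \<xi>) * of_real (?g \<xi>)) \<partial>lborel)"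
    unfolding integral_complex_of_real[symmetric]
    by (intro Bochner_Integration.integral_cong refl) (simp add: complex_norm_square mult.assoc del: of_real_power)
  also have "\<dots> = (\<integral>x. u x * cnj (\<integral>s. u (x + \<epsilon> * s) * of_real (?N s) \<partial>lborel) \<partial>lborel)"
    unfolding ft_multiplication_formula[OF u W] ftW ..
  also have "\<dots> = (\<integral>x. (\<integral>s. ?K s x \<partial>lborel) \<partial>lborel)"
    unfolding Bochner_Integration.integral_cnj[symmetric] by (simp flip: integral_mult_right_zero add: mult.assoc)
  also have "\<dots> = (\<integral>s. (\<integral>x. ?K s x \<partial>lborel) \<partial>lborel)"
    by (rule lborel_pair.Fubini_integral[OF iK])
  also have "\<dots> = (\<integral>s. of_real (?N s) * L2_inner lborel u (\<lambda>x. u (x + \<epsilon> * s)) \<partial>lborel)"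
    unfolding L2_inner_def by (simp add: mult.commute)
  finally show "complex_of_real (\<integral>\<xi>. (cmod (ft u \<xi>))\<^sup>2 * ?g \<xi> \<partial>lborel)
    = (\<integral>s. of_real (?N s) * L2_inner lborel u (\<lambda>x. u (x + \<epsilon> * s)) \<partial>lborel)" .
qed

text \<open>
  As $\epsilon\to0$ the Gaussian averages of the autocorrelation tend to its value at \<open>0\<close>, by the continuity of translations, and
  the weighted norms increase to the norm of the transform.
\<close>

theorem Plancherel:
  assumes u: "integrable lborel u" and uL: "u \<in> L2 lborel"
  shows "ft u \<in> L2 lborel" "L2_norm lborel (ft u) = L2_norm lborel u"
proof -
  have [measurable]: "u \<in> borel_measurable borel" using u by auto
  let ?e = "\<lambda>n. inverse (real (Suc n))"
  let ?f = "\<lambda>n \<xi>. (cmod (ft u \<xi>))\<^sup>2 * exp (- (?e n * \<xi>)\<^sup>2 / 2)"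
  let ?N = "std_normal_density"
  have e: "?e n > 0" for n by simp
  have lim0: "?e \<longlonglongrightarrow> 0" by (rule LIMSEQ_inverse_real_of_nat)
  have "(\<lambda>n. \<integral>s. of_real (?N s) * L2_inner lborel u (\<lambda>x. u (x + ?e n * s)) \<partial>lborel)
      \<longlonglongrightarrow> (\<integral>s. of_real (?N s) * L2_inner lborel u u \<partial>lborel)"
  proof (rule integral_dominated_convergence)
    show "integrable lborel (\<lambda>s. ?N s * (L2_norm lborel u)\<^sup>2)" using integrable_std_normal_moment[of 0] by simp
    show "AE s in lborel. (\<lambda>n. of_real (?N s) * L2_inner lborel u (\<lambda>x. u (x + ?e n * s))) \<longlonglongrightarrow> of_real (?N s) * L2_inner lborel u u"
    proof (rule AE_I2)
      fix s
      have "(\<lambda>n. ?e n * s) \<longlonglongrightarrow> 0 * s" by (intro tendsto_intros lim0)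
      then have h: "(\<lambda>n. ?e n * s) \<longlonglongrightarrow> 0" by simp
      have "(\<lambda>n. L2_inner lborel (\<lambda>x. u (x + ?e n * s)) u) \<longlonglongrightarrow> L2_inner lborel u u"
        by (rule L2_inner_tendsto[OF L2_translate(1)[OF uL] uL uL L2_translation_continuous[OF uL h]])
      from tendsto_cnj[OF this] have "(\<lambda>n. L2_inner lborel u (\<lambda>x. u (x + ?e n * s))) \<longlonglongrightarrow> L2_inner lborel u u"
        unfolding L2_inner_commute[symmetric] .
      then show "(\<lambda>n. of_real (?N s) * L2_inner lborel u (\<lambda>x. u (x + ?e n * s))) \<longlonglongrightarrow> of_real (?N s) * L2_inner lborel u u"
        by (intro tendsto_intros)
    qed
    show "AE s in lborel. norm (of_real (?N s) * L2_inner lborel u (\<lambda>x. u (x + ?e n * s))) \<le> ?N s * (L2_norm lborel u)\<^sup>2" for n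
    proof (rule AE_I2)
      fix s
      have "cmod (L2_inner lborel u (\<lambda>x. u (x + ?e n * s))) \<le> L2_norm lborel u * L2_norm lborel u"
        using L2_Cauchy_Schwarz[OF uL L2_translate(1)[OF uL]] unfolding L2_translate(2)[OF uL] .
      then show "norm (of_real (?N s) * L2_inner lborel u (\<lambda>x. u (x + ?e n * s))) \<le> ?N s * (L2_norm lborel u)\<^sup>2"
        by (simp add: norm_mult power2_eq_square mult_left_mono)
    qed
  qed (unfold L2_inner_def, measurable)
  also have "(\<integral>s. of_real (?N s) * L2_inner lborel u u \<partial>lborel) = L2_inner lborel u u"
    by (simp add: integral_complex_of_real)
  finally have "(\<lambda>n. complex_of_real (\<integral>\<xi>. ?f n \<xi> \<partial>lborel)) \<longlonglongrightarrow> of_real ((L2_norm lborel u)\<^sup>2)"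
    unfolding ft_gaussian_weight(1)[OF u uL e, symmetric] L2_inner_self .
  then have lim: "(\<lambda>n. \<integral>\<xi>. ?f n \<xi> \<partial>lborel) \<longlonglongrightarrow> (L2_norm lborel u)\<^sup>2"
    by (simp only: tendsto_of_real_iff)
  have mono: "AE \<xi> in lborel. mono (\<lambda>n. ?f n \<xi>)"
  proof (rule AE_I2, rule monoI)
    fix \<xi> and m n :: nat assume "m \<le> n"
    then have "?e n \<le> ?e m" by simp
    then have "(?e n)\<^sup>2 \<le> (?e m)\<^sup>2" by (intro power_mono) auto
    then have "(?e n * \<xi>)\<^sup>2 \<le> (?e m * \<xi>)\<^sup>2" unfolding power_mult_distrib by (intro mult_right_mono) auto
    then show "?f m \<xi> \<le> ?f n \<xi>" by (intro mult_left_mono) auto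
  qed
  have ptw: "AE \<xi> in lborel. (\<lambda>n. ?f n \<xi>) \<longlonglongrightarrow> (cmod (ft u \<xi>))\<^sup>2"
  proof (rule AE_I2)
    fix \<xi>
    have "(\<lambda>n. ?f n \<xi>) \<longlonglongrightarrow> (cmod (ft u \<xi>))\<^sup>2 * exp (- (0 * \<xi>)\<^sup>2 / 2)"
      by (intro tendsto_intros lim0) simp
    then show "(\<lambda>n. ?f n \<xi>) \<longlonglongrightarrow> (cmod (ft u \<xi>))\<^sup>2" by simp
  qed
  note mc = integral_monotone_convergence_nonneg[OF ft_gaussian_weight(2)[OF u uL e] mono _ ptw lim]
  have "integrable lborel (\<lambda>\<xi>. (cmod (ft u \<xi>))\<^sup>2)" by (rule mc(1)) auto
  then show "ft u \<in> L2 lborel" by (intro L2I) auto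
  have "(L2_norm lborel (ft u))\<^sup>2 = (L2_norm lborel u)\<^sup>2" unfolding L2_norm_sq[of lborel "ft u"] by (rule mc(2)) auto
  then show "L2_norm lborel (ft u) = L2_norm lborel u" by simp
qed

subsection \<open>The Fourier operator is unitary\<close>

text \<open>A linear isometric relation preserves inner products, by polarization.\<close>

lemma isometric_inner_eq:
  assumes lin: "\<And>f g f' g' c. (f, g) \<in> A \<Longrightarrow> (f', g') \<in> A \<Longrightarrow> ((\<lambda>x. f x + c * f' x), (\<lambda>x. g x + c * g' x)) \<in> A"
    and iso: "\<And>f g. (f, g) \<in> A \<Longrightarrow> f \<in> L2 M \<and> g \<in> L2 N \<and> L2_norm N g = L2_norm M f"
    and 1: "(f, g) \<in> A" and 2: "(f', g') \<in> A"
  shows "L2_inner N g g' = L2_inner M f f'"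
proof -
  have L: "f \<in> L2 M" "f' \<in> L2 M" "g \<in> L2 N" "g' \<in> L2 N" using iso 1 2 by auto
  have "Re (cnj c * L2_inner N g g') = Re (cnj c * L2_inner M f f')" for c
  proof -
    have "(L2_norm N (\<lambda>x. g x + c * g' x))\<^sup>2 = (L2_norm M (\<lambda>x. f x + c * f' x))\<^sup>2"
      using iso[OF lin[OF 1 2, of c]] by simp
    then show ?thesis
      unfolding L2_norm_add_sq[OF L(3) L2_scale[OF L(4)]] L2_norm_add_sq[OF L(1) L2_scale[OF L(2)]]
        L2_norm_scale L2_inner_scale_right using iso[OF 1] iso[OF 2] by simp
  qed
  from this[of 1] this[of \<i>] show ?thesis by (simp add: complex_eq_iff)
qed

lemma cutoff_L1_L2:
  assumes u: "u \<in> L2 lborel"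
  defines "w \<equiv> \<lambda>n x. indicator {- real n..real n} x *\<^sub>R u x"
  shows "w n \<in> L2 lborel" "integrable lborel (w n)" "(\<lambda>n. L2_norm lborel (\<lambda>x. w n x - u x)) \<longlonglongrightarrow> 0"
proof -
  have [measurable]: "u \<in> borel_measurable borel" using u by (rule L2_lborel_measurable)
  show "w n \<in> L2 lborel" for n unfolding w_def
    by (rule L2_dominated[OF L2_integrable_sq[OF u]]) (auto simp: indicator_def)
  show "integrable lborel (w n)" for n
    using loc_integrable_L2[OF u] by (simp add: w_def loc_integrable_def set_integrable_def)
  show "(\<lambda>n. L2_norm lborel (\<lambda>x. w n x - u x)) \<longlonglongrightarrow> 0" unfolding w_def
  proof (rule L2_dominated_convergence[OF L2_integrable_sq[OF u]])
    show "AE x in lborel. (\<lambda>n. indicator {- real n..real n} x *\<^sub>R u x) \<longlonglongrightarrow> u x"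
    proof (rule AE_I2, rule tendsto_eventually)
      fix x :: real
      obtain n where "\<bar>x\<bar> \<le> real n" using real_arch_simple by blast
      then show "\<forall>\<^sub>F n in sequentially. indicator {- real n..real n} x *\<^sub>R u x = u x"
        by (intro eventually_sequentiallyI[of n]) (auto simp: indicator_def)
    qed
  qed (auto simp: indicator_def)
qed

lemma fourier_op_iff:
  "(u, g) \<in> fourier_op \<longleftrightarrow> u \<in> L2 lborel \<and> g \<in> L2 lborel \<and>
    (\<exists>w. (\<forall>n::nat. w n \<in> L2 lborel \<and> integrable lborel (w n)) \<and> (\<lambda>n. L2_norm lborel (\<lambda>x. w n x - u x)) \<longlonglongrightarrow> 0
      \<and> (\<lambda>n. L2_norm lborel (\<lambda>x. ft (w n) x - g x)) \<longlonglongrightarrow> 0)"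
proof
  assume "(u, g) \<in> fourier_op"
  then have L: "u \<in> L2 lborel" "g \<in> L2 lborel" and
    ap: "\<And>\<epsilon>. \<epsilon> > 0 \<Longrightarrow> \<exists>(f', g') \<in> op_restrict (op_of lborel lborel ft) {u. integrable lborel u}.
        L2_norm lborel (\<lambda>x. u x - f' x) < \<epsilon> \<and> L2_norm lborel (\<lambda>x. g x - g' x) < \<epsilon>"
    by (auto simp: fourier_op_ft op_closure_def)
  have "\<exists>w. w \<in> L2 lborel \<and> integrable lborel w \<and> L2_norm lborel (\<lambda>x. w x - u x) < inverse (real (Suc n))
      \<and> L2_norm lborel (\<lambda>x. ft w x - g x) < inverse (real (Suc n))" for n
  proof -
    obtain w k where w: "w \<in> L2 lborel" "k \<in> L2 lborel" "AE x in lborel. k x = ft w x" "integrable lborel w"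
      "L2_norm lborel (\<lambda>x. u x - w x) < inverse (real (Suc n))" "L2_norm lborel (\<lambda>x. g x - k x) < inverse (real (Suc n))"
      using ap[of "inverse (real (Suc n))"] by (auto simp: op_restrict_def op_of_def)
    have "L2_norm lborel (\<lambda>x. ft w x - g x) = L2_norm lborel (\<lambda>x. k x - g x)"
      by (rule L2_norm_AE_cong) (use w L in \<open>auto simp: L2_lborel_measurable elim: eventually_mono\<close>)
    then show ?thesis using w L2_norm_minus_commute[of lborel u w] L2_norm_minus_commute[of lborel g k] by (intro exI[of _ w]) simp
  qed
  then obtain w where w: "\<And>n. w n \<in> L2 lborel" "\<And>n. integrable lborel (w n)"
    "\<And>n. L2_norm lborel (\<lambda>x. w n x - u x) < inverse (real (Suc n))"
    "\<And>n. L2_norm lborel (\<lambda>x. ft (w n) x - g x) < inverse (real (Suc n))" by metis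
  have "(\<lambda>n. L2_norm lborel (\<lambda>x. w n x - u x)) \<longlonglongrightarrow> 0" "(\<lambda>n. L2_norm lborel (\<lambda>x. ft (w n) x - g x)) \<longlonglongrightarrow> 0"
    using less_imp_le[OF w(3)] less_imp_le[OF w(4)]
    by (auto intro!: Lim_null_comparison[OF _ LIMSEQ_inverse_real_of_nat] always_eventually simp del: of_nat_Suc)
  with w(1,2) L show "u \<in> L2 lborel \<and> g \<in> L2 lborel \<and>
    (\<exists>w. (\<forall>n::nat. w n \<in> L2 lborel \<and> integrable lborel (w n)) \<and> (\<lambda>n. L2_norm lborel (\<lambda>x. w n x - u x)) \<longlonglongrightarrow> 0
      \<and> (\<lambda>n. L2_norm lborel (\<lambda>x. ft (w n) x - g x)) \<longlonglongrightarrow> 0)" by blast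
next
  assume "u \<in> L2 lborel \<and> g \<in> L2 lborel \<and>
    (\<exists>w. (\<forall>n::nat. w n \<in> L2 lborel \<and> integrable lborel (w n)) \<and> (\<lambda>n. L2_norm lborel (\<lambda>x. w n x - u x)) \<longlonglongrightarrow> 0
      \<and> (\<lambda>n. L2_norm lborel (\<lambda>x. ft (w n) x - g x)) \<longlonglongrightarrow> 0)"
  then obtain w where L: "u \<in> L2 lborel" "g \<in> L2 lborel" and w: "\<And>n::nat. w n \<in> L2 lborel" "\<And>n. integrable lborel (w n)"
    "(\<lambda>n. L2_norm lborel (\<lambda>x. w n x - u x)) \<longlonglongrightarrow> 0" "(\<lambda>n. L2_norm lborel (\<lambda>x. ft (w n) x - g x)) \<longlonglongrightarrow> 0" by blast
  show "(u, g) \<in> fourier_op" unfolding fourier_op_ft op_closure_def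
  proof (clarsimp simp: L)
    fix e :: real assume e: "e > 0"
    have "\<forall>\<^sub>F n in sequentially. L2_norm lborel (\<lambda>x. w n x - u x) < e \<and> L2_norm lborel (\<lambda>x. ft (w n) x - g x) < e"
      using order_tendstoD(2)[OF w(3) e] order_tendstoD(2)[OF w(4) e] by (rule eventually_conj)
    then obtain n where n: "L2_norm lborel (\<lambda>x. w n x - u x) < e" "L2_norm lborel (\<lambda>x. ft (w n) x - g x) < e"
      by (auto simp: eventually_sequentially)
    have "(w n, ft (w n)) \<in> op_restrict (op_of lborel lborel ft) {u. integrable lborel u}"
      using w(1,2) Plancherel(1)[OF w(2,1)] by (auto simp: op_restrict_def op_of_def)
    then show "\<exists>x\<in>op_restrict (op_of lborel lborel ft) {u. integrable lborel u}.
        case x of (f', g') \<Rightarrow> L2_norm lborel (\<lambda>x. u x - f' x) < e \<and> L2_norm lborel (\<lambda>x. g x - g' x) < e"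
      using n L2_norm_minus_commute[of lborel u "w n"] L2_norm_minus_commute[of lborel g "ft (w n)"]
      by (intro bexI[of _ "(w n, ft (w n))"]) auto
  qed
qed

lemma fourier_op_L1_L2:
  assumes "u \<in> L2 lborel" "integrable lborel u" shows "(u, ft u) \<in> fourier_op"
  unfolding fourier_op_iff using assms Plancherel[OF assms(2,1)]
  by (auto intro!: exI[of _ "\<lambda>_. u"] simp: L2_norm_def)

lemma fourier_op_isometric:
  assumes "(u, g) \<in> fourier_op" shows "u \<in> L2 lborel" "g \<in> L2 lborel" "L2_norm lborel g = L2_norm lborel u"
proof -
  obtain w where L: "u \<in> L2 lborel" "g \<in> L2 lborel" and w: "\<And>n::nat. w n \<in> L2 lborel" "\<And>n. integrable lborel (w n)"
    "(\<lambda>n. L2_norm lborel (\<lambda>x. w n x - u x)) \<longlonglongrightarrow> 0" "(\<lambda>n. L2_norm lborel (\<lambda>x. ft (w n) x - g x)) \<longlonglongrightarrow> 0"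
    using assms unfolding fourier_op_iff by blast
  show "u \<in> L2 lborel" "g \<in> L2 lborel" by fact+
  have "(\<lambda>n. L2_norm lborel (ft (w n))) \<longlonglongrightarrow> L2_norm lborel g"
    by (rule L2_norm_tendsto[OF Plancherel(1)[OF w(2,1)] L(2) w(4)])
  moreover have "(\<lambda>n. L2_norm lborel (ft (w n))) \<longlonglongrightarrow> L2_norm lborel u"
    unfolding Plancherel(2)[OF w(2,1)] by (rule L2_norm_tendsto[OF w(1) L(1) w(3)])
  ultimately show "L2_norm lborel g = L2_norm lborel u" by (rule LIMSEQ_unique)
qed

lemma fourier_op_linear:
  assumes 1: "(u, g) \<in> fourier_op" and 2: "(u', g') \<in> fourier_op"
  shows "((\<lambda>x. u x + c * u' x), (\<lambda>x. g x + c * g' x)) \<in> fourier_op"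
proof -
  obtain w where L: "u \<in> L2 lborel" "g \<in> L2 lborel" and w: "\<And>n::nat. w n \<in> L2 lborel" "\<And>n. integrable lborel (w n)"
    "(\<lambda>n. L2_norm lborel (\<lambda>x. w n x - u x)) \<longlonglongrightarrow> 0" "(\<lambda>n. L2_norm lborel (\<lambda>x. ft (w n) x - g x)) \<longlonglongrightarrow> 0"
    using 1 unfolding fourier_op_iff by blast
  obtain w' where L': "u' \<in> L2 lborel" "g' \<in> L2 lborel" and w': "\<And>n::nat. w' n \<in> L2 lborel" "\<And>n. integrable lborel (w' n)"
    "(\<lambda>n. L2_norm lborel (\<lambda>x. w' n x - u' x)) \<longlonglongrightarrow> 0" "(\<lambda>n. L2_norm lborel (\<lambda>x. ft (w' n) x - g' x)) \<longlonglongrightarrow> 0"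
    using 2 unfolding fourier_op_iff by blast
  have lim: "(\<lambda>n. L2_norm lborel (\<lambda>x. a n x + c * b n x - (p x + c * q x))) \<longlonglongrightarrow> 0"
    if L: "\<And>n. a n \<in> L2 lborel" "\<And>n. b n \<in> L2 lborel" "p \<in> L2 lborel" "q \<in> L2 lborel"
      and lim: "(\<lambda>n. L2_norm lborel (\<lambda>x. a n x - p x)) \<longlonglongrightarrow> 0" "(\<lambda>n. L2_norm lborel (\<lambda>x. b n x - q x)) \<longlonglongrightarrow> 0"
    for a b :: "nat \<Rightarrow> real \<Rightarrow> complex" and p q
  proof (rule Lim_null_comparison)
    show "(\<lambda>n. L2_norm lborel (\<lambda>x. a n x - p x) + cmod c * L2_norm lborel (\<lambda>x. b n x - q x)) \<longlonglongrightarrow> 0"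
      using tendsto_add[OF lim(1) tendsto_mult[OF tendsto_const[of "cmod c"] lim(2)]] by simp
    have "L2_norm lborel (\<lambda>x. a n x + c * b n x - (p x + c * q x))
        = L2_norm lborel (\<lambda>x. (a n x - p x) + c * (b n x - q x))" for n by (simp add: algebra_simps)
    also have "\<dots> n \<le> L2_norm lborel (\<lambda>x. a n x - p x) + cmod c * L2_norm lborel (\<lambda>x. b n x - q x)" for n
      using L2_triangle[OF L2_diff[OF L(1,3)] L2_scale[OF L2_diff[OF L(2,4)]], of n c n] unfolding L2_norm_scale .
    finally show "\<forall>\<^sub>F n in sequentially. norm (L2_norm lborel (\<lambda>x. a n x + c * b n x - (p x + c * q x)))
        \<le> L2_norm lborel (\<lambda>x. a n x - p x) + cmod c * L2_norm lborel (\<lambda>x. b n x - q x)" by simp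
  qed
  have ftl: "ft (\<lambda>x. w n x + c * w' n x) = (\<lambda>x. ft (w n) x + c * ft (w' n) x)" for n
    using ft_linear[OF w(2) w'(2)] by blast
  show ?thesis unfolding fourier_op_iff
  proof (intro conjI exI[of _ "\<lambda>n x. w n x + c * w' n x"] allI)
    show "(\<lambda>x. u x + c * u' x) \<in> L2 lborel" "(\<lambda>x. g x + c * g' x) \<in> L2 lborel"
      "(\<lambda>x. w n x + c * w' n x) \<in> L2 lborel" "integrable lborel (\<lambda>x. w n x + c * w' n x)" for n
      using L L' w w' by (auto intro!: L2_add L2_scale)
    show "(\<lambda>n. L2_norm lborel (\<lambda>x. w n x + c * w' n x - (u x + c * u' x))) \<longlonglongrightarrow> 0"
      by (rule lim[OF w(1) w'(1) L(1) L'(1) w(3) w'(3)])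
    show "(\<lambda>n. L2_norm lborel (\<lambda>x. ft (\<lambda>x. w n x + c * w' n x) x - (g x + c * g' x))) \<longlonglongrightarrow> 0"
      unfolding ftl by (rule lim[OF Plancherel(1)[OF w(2,1)] Plancherel(1)[OF w'(2,1)] L(2) L'(2) w(4) w'(4)])
  qed
qed

lemma L2_Cauchy_of_convergent:
  assumes L: "\<And>n. f n \<in> L2 M" "g \<in> L2 M" and lim: "(\<lambda>n::nat. L2_norm M (\<lambda>x. f n x - g x)) \<longlonglongrightarrow> 0" and e: "e > 0"
  shows "\<exists>N. \<forall>m\<ge>N. \<forall>n\<ge>N. L2_norm M (\<lambda>x. f m x - f n x) < e"
proof -
  have "\<forall>\<^sub>F n in sequentially. L2_norm M (\<lambda>x. f n x - g x) < e / 2" by (intro order_tendstoD(2)[OF lim]) (use e in simp)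
  then obtain N where N: "\<And>n. n \<ge> N \<Longrightarrow> L2_norm M (\<lambda>x. f n x - g x) < e / 2" by (auto simp: eventually_sequentially)
  have "L2_norm M (\<lambda>x. f m x - f n x) < e" if "m \<ge> N" "n \<ge> N" for m n
    using L2_triangle_diff[OF L(1)[of m] L(2) L(1)[of n]] N[OF that(1)] N[OF that(2)] L2_norm_minus_commute[of M g "f n"]
    by linarith
  then show ?thesis by blast
qed

lemma ft_isometric_diff:
  assumes "u \<in> L2 lborel" "integrable lborel u" "w \<in> L2 lborel" "integrable lborel w"
  shows "L2_norm lborel (\<lambda>x. ft u x - ft w x) = L2_norm lborel (\<lambda>x. u x - w x)"
proof -
  have "ft (\<lambda>x. u x - w x) = (\<lambda>x. ft u x - ft w x)" using ft_linear[OF assms(2,4), of "-1"] by (intro ext) simp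
  then show ?thesis using Plancherel(2)[of "\<lambda>x. u x - w x"] assms L2_diff by auto
qed

lemma fourier_op_total:
  assumes u: "u \<in> L2 lborel" shows "\<exists>g. (u, g) \<in> fourier_op"
proof -
  define w where "w n x = indicator {- real n..real n} x *\<^sub>R u x" for n x
  note w = cutoff_L1_L2[OF u, folded w_def]
  have "\<exists>g\<in>L2 lborel. (\<lambda>n. L2_norm lborel (\<lambda>x. ft (w n) x - g x)) \<longlonglongrightarrow> 0"
  proof (rule L2_complete)
    show "ft (w n) \<in> L2 lborel" for n by (rule Plancherel(1)[OF w(2,1)])
    show "\<exists>N. \<forall>m\<ge>N. \<forall>n\<ge>N. L2_norm lborel (\<lambda>x. ft (w m) x - ft (w n) x) < e" if "e > 0" for e
      unfolding ft_isometric_diff[OF w(1,2) w(1,2)] by (rule L2_Cauchy_of_convergent[OF w(1) u w(3) that])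
  qed
  then show ?thesis unfolding fourier_op_iff using u w by blast
qed

lemma L2_mult_integral_tendsto:
  assumes "\<And>n. f n \<in> L2 M" "g \<in> L2 M" "h \<in> L2 M" "(\<lambda>n. L2_norm M (\<lambda>x. f n x - g x)) \<longlonglongrightarrow> 0"
  shows "(\<lambda>n. \<integral>x. f n x * h x \<partial>M) \<longlonglongrightarrow> (\<integral>x. g x * h x \<partial>M)"
  using L2_inner_tendsto[OF assms(1,2) L2_cnj[OF assms(3)] assms(4)] by (simp add: L2_inner_def)

lemma fourier_multiplication_formula:
  assumes wh: "(w, h) \<in> fourier_op" and u: "u \<in> L2 lborel" "integrable lborel u"
  shows "(\<integral>x. w x * ft u x \<partial>lborel) = (\<integral>x. h x * u x \<partial>lborel)"
proof -
  obtain s where L: "w \<in> L2 lborel" "h \<in> L2 lborel" and s: "\<And>n::nat. s n \<in> L2 lborel" "\<And>n. integrable lborel (s n)"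
    "(\<lambda>n. L2_norm lborel (\<lambda>x. s n x - w x)) \<longlonglongrightarrow> 0" "(\<lambda>n. L2_norm lborel (\<lambda>x. ft (s n) x - h x)) \<longlonglongrightarrow> 0"
    using wh unfolding fourier_op_iff by blast
  have "(\<lambda>n. \<integral>x. s n x * ft u x \<partial>lborel) \<longlonglongrightarrow> (\<integral>x. w x * ft u x \<partial>lborel)"
    by (rule L2_mult_integral_tendsto[OF s(1) L(1) Plancherel(1)[OF u(2,1)] s(3)])
  moreover have "(\<lambda>n. \<integral>x. s n x * ft u x \<partial>lborel) \<longlonglongrightarrow> (\<integral>x. h x * u x \<partial>lborel)"
    unfolding ft_multiplication_formula[OF s(2) u(2), symmetric]
    by (rule L2_mult_integral_tendsto[OF Plancherel(1)[OF s(2,1)] L(2) u(1) s(4)])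
  ultimately show ?thesis by (rule LIMSEQ_unique)
qed

text \<open>
  Surjectivity: the range is closed, and \<open>w\<close> is orthogonal to the transforms of all test functions only
  if the transform of the conjugate of \<open>w\<close> vanishes, by the multiplication formula.
\<close>

lemma fourier_range_dense: "L2_dense lborel {ft u | u. u \<in> L2 lborel \<and> integrable lborel u}"
proof (rule L2_dense_if_orthogonal_zero)
  let ?S = "{ft u | u. u \<in> L2 lborel \<and> integrable lborel u}"
  show "?S \<subseteq> L2 lborel" using Plancherel(1) by blast
  have "ft (\<lambda>x. 0) = (\<lambda>x. 0)" by (simp add: ft_def[abs_def])
  then show "(\<lambda>x. 0) \<in> ?S" by (intro CollectI exI[of _ "\<lambda>x. 0"]) auto
  show "(\<lambda>x. f x + c * g x) \<in> ?S" if fg: "f \<in> ?S" "g \<in> ?S" for f g c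
  proof -
    obtain u w where uw: "f = ft u" "u \<in> L2 lborel" "integrable lborel u" "g = ft w" "w \<in> L2 lborel" "integrable lborel w"
      using fg by blast
    then have "(\<lambda>x. f x + c * g x) = ft (\<lambda>x. u x + c * w x)" using ft_linear[OF uw(3,6)] by auto
    then show ?thesis using uw by (auto intro!: L2_add L2_scale)
  qed
  show "AE x in lborel. w x = 0" if w: "w \<in> L2 lborel" and orth: "\<And>s. s \<in> ?S \<Longrightarrow> L2_inner lborel s w = 0" for w
  proof -
    have cw: "(\<lambda>x. cnj (w x)) \<in> L2 lborel" by (rule L2_cnj[OF w])
    obtain h where h: "((\<lambda>x. cnj (w x)), h) \<in> fourier_op" using fourier_op_total[OF cw] by blast
    note iso = fourier_op_isometric[OF h]
    have "AE x in lborel. h x = 0"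
    proof (rule AE_zero_if_test_integrals_zero[OF loc_integrable_L2[OF iso(2)]])
      fix \<phi> assume "test_fun \<phi>"
      note t = test_fun_L2[OF this]
      have "L2_inner lborel (ft (\<lambda>x. of_real (\<phi> x))) w = 0" using t by (intro orth) blast
      then show "(\<integral>x. h x * of_real (\<phi> x) \<partial>lborel) = 0"
        unfolding fourier_multiplication_formula[OF h t, symmetric] by (simp add: L2_inner_def mult.commute)
    qed
    then have "L2_norm lborel (\<lambda>x. cnj (w x)) = 0" using L2_norm_eq_0[OF iso(2)] iso(3) by simp
    then show ?thesis using L2_norm_eq_0[OF cw] by simp
  qed
qed

lemma fourier_op_surjective:
  assumes g: "g \<in> L2 lborel" shows "\<exists>u. (u, g) \<in> fourier_op"
proof -
  obtain s where s: "\<And>n::nat. s n \<in> {ft u | u. u \<in> L2 lborel \<and> integrable lborel u}" "(\<lambda>n. L2_norm lborel (\<lambda>x. s n x - g x)) \<longlonglongrightarrow> 0"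
    using L2_dense_sequence[OF fourier_range_dense g] by blast
  have "\<forall>n. \<exists>w. s n = ft w \<and> w \<in> L2 lborel \<and> integrable lborel w" using s(1) by blast
  then obtain w where w: "\<And>n. s n = ft (w n)" "\<And>n. w n \<in> L2 lborel" "\<And>n. integrable lborel (w n)" by metis
  have "\<exists>u\<in>L2 lborel. (\<lambda>n. L2_norm lborel (\<lambda>x. w n x - u x)) \<longlonglongrightarrow> 0"
  proof (rule L2_complete)
    show "\<exists>N. \<forall>m\<ge>N. \<forall>n\<ge>N. L2_norm lborel (\<lambda>x. w m x - w n x) < e" if "e > 0" for e
      unfolding ft_isometric_diff[OF w(2,3) w(2,3), symmetric] w(1)[symmetric]
      by (rule L2_Cauchy_of_convergent[OF _ g s(2) that]) (simp add: w(1) Plancherel(1)[OF w(3,2)])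
  qed (rule w(2))
  then show ?thesis unfolding fourier_op_iff using g w(2,3) s(2) unfolding w(1) by blast
qed

theorem l2_unitary_fourier: "l2_unitary lborel lborel fourier_op"
proof
  show "unitary_op lborel lborel fourier_op"
    unfolding unitary_op_def
  proof (intro conjI)
    show "Domain fourier_op = L2 lborel" using fourier_op_total fourier_op_isometric(1) by blast
    show "Range fourier_op = L2 lborel" using fourier_op_surjective fourier_op_isometric(2) by blast
    show "\<forall>(f, g)\<in>fourier_op. \<forall>(f', g')\<in>fourier_op. L2_inner lborel g g' = L2_inner lborel f f'"
      using isometric_inner_eq[of fourier_op lborel lborel] fourier_op_linear fourier_op_isometric by blast
  qed
  show "ae_closed lborel lborel fourier_op"
    unfolding ae_closed_def
  proof (intro conjI allI impI)
    show "fourier_op \<subseteq> L2 lborel \<times> L2 lborel" using fourier_op_isometric by auto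
    fix f g f' g' :: "real \<Rightarrow> complex"
    assume fg: "(f, g) \<in> fourier_op" and m: "f' \<in> borel_measurable lborel" "g' \<in> borel_measurable lborel"
      and ae: "AE x in lborel. f' x = f x" "AE x in lborel. g' x = g x"
    obtain w where L: "f \<in> L2 lborel" "g \<in> L2 lborel" and w: "\<And>n::nat. w n \<in> L2 lborel" "\<And>n. integrable lborel (w n)"
      "(\<lambda>n. L2_norm lborel (\<lambda>x. w n x - f x)) \<longlonglongrightarrow> 0" "(\<lambda>n. L2_norm lborel (\<lambda>x. ft (w n) x - g x)) \<longlonglongrightarrow> 0"
      using fg unfolding fourier_op_iff by blast
    note [measurable] = L[THEN L2_lborel_measurable] w(1)[THEN L2_lborel_measurable] m
    have "L2_norm lborel (\<lambda>x. w n x - f x) = L2_norm lborel (\<lambda>x. w n x - f' x)" for n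
      by (rule L2_norm_AE_cong) (use ae(1) in \<open>auto elim: eventually_mono\<close>)
    moreover have "L2_norm lborel (\<lambda>x. ft (w n) x - g x) = L2_norm lborel (\<lambda>x. ft (w n) x - g' x)" for n
      by (rule L2_norm_AE_cong) (use ae(2) in \<open>auto elim: eventually_mono\<close>)
    ultimately have "(\<lambda>n. L2_norm lborel (\<lambda>x. w n x - f' x)) \<longlonglongrightarrow> 0" "(\<lambda>n. L2_norm lborel (\<lambda>x. ft (w n) x - g' x)) \<longlonglongrightarrow> 0"
      using w(3,4) by simp_all
    then show "(f', g') \<in> fourier_op"
      unfolding fourier_op_iff using w(1,2) L2_AE_cong[OF L(1) m(1) ae(1)] L2_AE_cong[OF L(2) m(2) ae(2)] by blast
  qed
qed

interpretation Fourier: l2_unitary lborel lborel fourier_op by (rule l2_unitary_fourier)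

text \<open>
  Tested with \<open>\<phi>\<close>, the left-hand side becomes by the multiplication formula an inner product of two transforms, and
  unitarity removes them.
\<close>

lemma fourier_inversion:
  assumes p: "\<psi> \<in> L2 lborel" "integrable lborel \<psi>"
    and u: "(\<lambda>x. ft \<psi> (- x)) \<in> L2 lborel" "integrable lborel (\<lambda>x. ft \<psi> (- x))"
  shows "AE x in lborel. ft (\<lambda>x. ft \<psi> (- x)) x = \<psi> x"
proof -
  let ?u = "\<lambda>x. ft \<psi> (- x)"
  have c: "(\<lambda>x. cnj (\<psi> x)) \<in> L2 lborel" "integrable lborel (\<lambda>x. cnj (\<psi> x))" using p by (auto intro: L2_cnj)
  have ftc: "cnj (ft (\<lambda>x. cnj (\<psi> x)) x) = ?u x" for x by (simp add: ft_cnj)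
  have L: "ft ?u \<in> L2 lborel" by (rule Plancherel(1)[OF u(2,1)])
  have "AE x in lborel. ft ?u x - \<psi> x = 0"
  proof (rule AE_zero_if_test_integrals_zero[OF loc_integrable_L2[OF L2_diff[OF L p(1)]]])
    fix \<phi> assume "test_fun \<phi>"
    note t = test_fun_L2[OF this]
    have "(\<integral>x. ft ?u x * of_real (\<phi> x) \<partial>lborel) = (\<integral>x. ft (\<lambda>x. of_real (\<phi> x)) x * ?u x \<partial>lborel)"
      unfolding ft_multiplication_formula[OF u(2) t(2)] by (simp add: mult.commute)
    also have "\<dots> = L2_inner lborel (ft (\<lambda>x. of_real (\<phi> x))) (ft (\<lambda>x. cnj (\<psi> x)))"
      unfolding L2_inner_def ftc ..
    also have "\<dots> = L2_inner lborel (\<lambda>x. of_real (\<phi> x)) (\<lambda>x. cnj (\<psi> x))"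
      by (rule Fourier.inner_eq[OF fourier_op_L1_L2[OF t] fourier_op_L1_L2[OF c]])
    also have "\<dots> = (\<integral>x. \<psi> x * of_real (\<phi> x) \<partial>lborel)" by (simp add: L2_inner_def mult.commute)
    finally show "(\<integral>x. (ft ?u x - \<psi> x) * of_real (\<phi> x) \<partial>lborel) = 0"
      using L2_integrable_mult[OF L t(1)] L2_integrable_mult[OF p(1) t(1)] by (simp add: left_diff_distrib)
  qed
  then show ?thesis by simp
qed

subsection \<open>The spectral representation of \<open>D\<close>\<close>

lemma ek_has_derivative: "((\<lambda>x. ek (a * x)) has_vector_derivative - \<i> * of_real a * ek (a * x)) (at x)"
proof -
  have "((\<lambda>z. exp (- (\<i> * (of_real a * z)))) has_field_derivative - (\<i> * of_real a) * exp (- (\<i> * (of_real a * of_real x)))) (at (of_real x))"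
    by (auto intro!: derivative_eq_intros)
  from has_vector_derivative_real_field[OF this] show ?thesis by (simp add: ek_def)
qed

lemma ek_primitive: "primitive (\<lambda>x. ek (a * x)) (\<lambda>x. - \<i> * of_real a * ek (a * x))"
  by (rule primitive_of_C1[OF ek_has_derivative]) (intro continuous_intros)

lemma ft_derivative:
  assumes F: "primitive F f" and i: "integrable lborel F" "integrable lborel f"
  shows "ft f \<xi> = \<i> * of_real \<xi> * ft F \<xi>"
proof -
  have P: "primitive (\<lambda>x. F x * ek (\<xi> * x)) (\<lambda>x. F x * (- \<i> * of_real \<xi> * ek (\<xi> * x)) + f x * ek (\<xi> * x))"
    by (rule primitive_mult[OF F ek_primitive])
  have i1: "integrable lborel (\<lambda>x. F x * ek (\<xi> * x))" "integrable lborel (\<lambda>x. f x * ek (\<xi> * x))"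
    using ek_integrable[OF i(1)] ek_integrable[OF i(2)] by (simp_all add: mult.commute[of \<xi>])
  have eq: "F x * (- \<i> * of_real \<xi> * ek (\<xi> * x)) + f x * ek (\<xi> * x) = (- \<i> * of_real \<xi>) * (F x * ek (\<xi> * x)) + f x * ek (\<xi> * x)" for x
    by (simp add: mult_ac)
  let ?A = "\<integral>x. F x * ek (\<xi> * x) \<partial>lborel" and ?B = "\<integral>x. f x * ek (\<xi> * x) \<partial>lborel"
  have i2: "integrable lborel (\<lambda>x. (- \<i> * of_real \<xi>) * (F x * ek (\<xi> * x)))" by (rule integrable_mult_right[OF i1(1)])
  have "0 = (\<integral>x. (- \<i> * of_real \<xi>) * (F x * ek (\<xi> * x)) + f x * ek (\<xi> * x) \<partial>lborel)"
    by (rule primitive_integral_zero[OF P[unfolded eq] i1(1) Bochner_Integration.integrable_add[OF i2 i1(2)], symmetric])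
  also have "\<dots> = (- \<i> * of_real \<xi>) * ?A + ?B"
    by (simp only: Bochner_Integration.integral_add[OF i2 i1(2)] integral_mult_right_zero)
  finally have "?B = \<i> * of_real \<xi> * ?A" by (simp add: algebra_simps)
  moreover have "ft f \<xi> = of_real fc * ?B" "ft F \<xi> = of_real fc * ?A"
    unfolding ft_def by (simp_all add: mult.commute[of \<xi>])
  ultimately show ?thesis by (simp only: mult.left_commute mult.assoc)
qed

lemma selfadjoint_fourier_mult:
  "op_adj lborel lborel (fourier_op\<inverse> O mult_op lborel (\<lambda>x. x) O fourier_op) = fourier_op\<inverse> O mult_op lborel (\<lambda>x. x) O fourier_op"
  using l2_unitary.selfadjoint_conj[OF Fourier.converse mult_op_subset selfadjoint_mult_op[of "\<lambda>x. x" lborel]]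
  by (simp add: selfadjoint_def)

text \<open>
  The conjugated multiplication is contained in \<open>D\<close>, since the transform of the derivative of a test function is
  $i\xi$ times its transform.  Being self-adjoint, it has no proper symmetric extension.
\<close>

theorem D_op_eq_fourier: "D_op = fourier_op\<inverse> O mult_op lborel (\<lambda>x. x) O fourier_op"
proof -
  let ?A = "fourier_op\<inverse> O mult_op lborel (\<lambda>x. x) O fourier_op"
  have sub: "?A \<subseteq> D_op"
  proof clarify
    fix f g u h assume uf: "(u, f) \<in> fourier_op" and m: "(u, h) \<in> mult_op lborel (\<lambda>x. x)" and hg: "(h, g) \<in> fourier_op"
    note L = Fourier.in_L2[OF uf] Fourier.in_L2[OF hg]
    have ae: "AE x in lborel. h x = of_real x * u x" using m by (simp add: mult_op_iff)
    note [measurable] = L[THEN L2_lborel_measurable]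
    have "weak_deriv f (\<lambda>x. - \<i> * g x)" unfolding weak_deriv_def
    proof (intro conjI allI impI)
      show "loc_integrable f" "loc_integrable (\<lambda>x. - \<i> * g x)" using L loc_integrable_L2 loc_integrable_cmult by blast+
      fix \<phi> assume t: "test_fun \<phi>"
      note t0 = test_fun_L2[OF t] and t1 = test_fun_L2[OF test_fun_deriv[OF t]]
      have [measurable]: "(\<lambda>x. complex_of_real (\<phi> x)) \<in> borel_measurable borel" using t0(1) by (rule L2_lborel_measurable)
      have [measurable]: "ft (\<lambda>x. of_real (\<phi> x)) \<in> borel_measurable borel" by measurable
      have "(\<integral>x. f x * of_real (deriv \<phi> x) \<partial>lborel) = (\<integral>x. u x * ft (\<lambda>x. of_real (deriv \<phi> x)) x \<partial>lborel)"
        by (rule fourier_multiplication_formula[OF uf t1, symmetric])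
      also have "\<dots> = (\<integral>x. \<i> * (h x * ft (\<lambda>x. of_real (\<phi> x)) x) \<partial>lborel)"
        unfolding ft_derivative[OF test_fun_primitive[OF t] t0(2) t1(2)]
        by (rule integral_cong_AE) (use ae in \<open>auto elim!: eventually_mono simp: mult_ac\<close>)
      also have "\<dots> = \<i> * (\<integral>x. g x * of_real (\<phi> x) \<partial>lborel)"
        using fourier_multiplication_formula[OF hg t0] by simp
      finally show "(\<integral>x. f x * of_real (deriv \<phi> x) \<partial>lborel) = - (\<integral>x. - \<i> * g x * of_real (\<phi> x) \<partial>lborel)"
        by (simp add: mult.assoc)
    qed
    moreover have "AE x in lborel. g x = \<i> * (- \<i> * g x)" by (simp flip: mult.assoc)
    ultimately show "(f, g) \<in> D_op" unfolding D_op_def using L L2_scale[OF L(4), of "- \<i>"] by blast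
  qed
  moreover have "D_op \<subseteq> ?A"
  proof clarify
    fix f g assume fg: "(f, g) \<in> D_op"
    have "(f, g) \<in> op_adj lborel lborel ?A"
      unfolding op_adj_def using sub D_op_symmetric[OF _ fg] D_op_L2[OF fg] by blast
    then show "(f, g) \<in> ?A" unfolding selfadjoint_fourier_mult .
  qed
  ultimately show ?thesis by blast
qed

lemma selfadjoint_D: "selfadjoint lborel D_op"
  unfolding D_op_eq_fourier
  using l2_unitary.selfadjoint_conj[OF Fourier.converse mult_op_subset selfadjoint_mult_op[of "\<lambda>x. x" lborel]] by simp

subsection \<open>Test functions form a core of \<open>D\<close>\<close>

text \<open>
  The second argument is the derivative of the first; the definition of test functions is limited to real values.
\<close>

definition complex_test :: "(real \<Rightarrow> complex) \<Rightarrow> (real \<Rightarrow> complex) \<Rightarrow> bool" where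
  "complex_test \<tau> \<tau>' \<longleftrightarrow> (\<exists>\<phi> \<psi>. test_fun \<phi> \<and> test_fun \<psi> \<and> \<tau> = (\<lambda>x. of_real (\<phi> x) + \<i> * of_real (\<psi> x)) \<and>
     \<tau>' = (\<lambda>x. of_real (deriv \<phi> x) + \<i> * of_real (deriv \<psi> x)))"

lemma test_fun_lincomb:
  assumes "test_fun \<phi>" "test_fun \<psi>"
  shows "test_fun (\<lambda>x. a * \<phi> x + b * \<psi> x)" "deriv (\<lambda>x. a * \<phi> x + b * \<psi> x) x = a * deriv \<phi> x + b * deriv \<psi> x"
proof -
  have s: "smooth \<phi>" "smooth \<psi>" using assms by (auto simp: test_fun_smooth)
  obtain R1 where R1: "\<And>x. R1 \<le> \<bar>x\<bar> \<Longrightarrow> \<phi> x = 0" using test_fun_support[OF assms(1)] by metis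
  obtain R2 where R2: "\<And>x. R2 \<le> \<bar>x\<bar> \<Longrightarrow> \<psi> x = 0" using test_fun_support[OF assms(2)] by metis
  show "test_fun (\<lambda>x. a * \<phi> x + b * \<psi> x)" unfolding test_fun_smooth
    using smooth_lincomb[OF s] R1 R2 by (intro conjI exI[of _ "max R1 R2"]) auto
  show "deriv (\<lambda>x. a * \<phi> x + b * \<psi> x) x = a * deriv \<phi> x + b * deriv \<psi> x"
    by (rule DERIV_imp_deriv) (intro DERIV_add DERIV_cmult smooth_has_derivative s)
qed

lemma complex_test_linear:
  assumes "complex_test f f'" "complex_test g g'"
  shows "complex_test (\<lambda>x. f x + c * g x) (\<lambda>x. f' x + c * g' x)"
proof -
  obtain \<phi> \<psi> where f: "test_fun \<phi>" "test_fun \<psi>" "f = (\<lambda>x. of_real (\<phi> x) + \<i> * of_real (\<psi> x))"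
    "f' = (\<lambda>x. of_real (deriv \<phi> x) + \<i> * of_real (deriv \<psi> x))" using assms(1) by (auto simp: complex_test_def)
  obtain \<phi>2 \<psi>2 where g: "test_fun \<phi>2" "test_fun \<psi>2" "g = (\<lambda>x. of_real (\<phi>2 x) + \<i> * of_real (\<psi>2 x))"
    "g' = (\<lambda>x. of_real (deriv \<phi>2 x) + \<i> * of_real (deriv \<psi>2 x))" using assms(2) by (auto simp: complex_test_def)
  let ?a = "\<lambda>x. Re c * \<phi>2 x + (- Im c) * \<psi>2 x" and ?b = "\<lambda>x. Re c * \<psi>2 x + Im c * \<phi>2 x"
  note a = test_fun_lincomb[OF g(1,2), of "Re c" "- Im c"] and b = test_fun_lincomb[OF g(2,1), of "Re c" "Im c"]
  note A = test_fun_lincomb[OF f(1) a(1), of 1 1] and B = test_fun_lincomb[OF f(2) b(1), of 1 1]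
  show ?thesis unfolding complex_test_def
    by (intro exI[of _ "\<lambda>x. 1 * \<phi> x + 1 * ?a x"] exI[of _ "\<lambda>x. 1 * \<psi> x + 1 * ?b x"] conjI A(1) B(1) ext)
       (simp_all only: A(2) B(2) a(2) b(2), simp_all add: f g complex_eq_iff algebra_simps)
qed

lemma complex_test_D:
  assumes "complex_test \<tau> \<tau>'" shows "(\<tau>, \<lambda>x. \<i> * \<tau>' x) \<in> D_op"
proof -
  obtain \<phi> \<psi> where t: "test_fun \<phi>" "test_fun \<psi>" "\<tau> = (\<lambda>x. of_real (\<phi> x) + \<i> * of_real (\<psi> x))"
    "\<tau>' = (\<lambda>x. of_real (deriv \<phi> x) + \<i> * of_real (deriv \<psi> x))" using assms by (auto simp: complex_test_def)
  have P: "primitive \<tau> \<tau>'" unfolding t(3,4) by (intro primitive_add primitive_cmult test_fun_primitive t)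
  have L: "\<tau> \<in> L2 lborel" "\<tau>' \<in> L2 lborel" unfolding t(3,4) by (intro L2_add L2_scale test_fun_L2 test_fun_deriv t)+
  have "(\<lambda>x. - \<i> * (\<i> * \<tau>' x)) = \<tau>'" by (auto simp flip: mult.assoc)
  then show ?thesis unfolding D_op_iff using P L L2_scale by auto
qed

lemma D_op_linear:
  assumes "(f, g) \<in> D_op" "(f', g') \<in> D_op" shows "((\<lambda>x. f x + c * f' x), (\<lambda>x. g x + c * g' x)) \<in> D_op"
proof -
  obtain F where F: "primitive F (\<lambda>x. - \<i> * g x)" "AE x in lborel. f x = F x" using assms(1) by (auto simp: D_op_iff)
  obtain F' where F': "primitive F' (\<lambda>x. - \<i> * g' x)" "AE x in lborel. f' x = F' x" using assms(2) by (auto simp: D_op_iff)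
  have "primitive (\<lambda>x. F x + c * F' x) (\<lambda>x. - \<i> * g x + c * (- \<i> * g' x))" by (intro primitive_add primitive_cmult F F')
  moreover have "(\<lambda>x. - \<i> * g x + c * (- \<i> * g' x)) = (\<lambda>x. - \<i> * (g x + c * g' x))" by (auto simp: algebra_simps)
  moreover have "AE x in lborel. f x + c * f' x = F x + c * F' x" using F(2) F'(2) by eventually_elim simp
  ultimately show ?thesis using D_op_L2[OF assms(1)] D_op_L2[OF assms(2)] unfolding D_op_iff by (auto intro!: L2_add L2_scale)
qed

text \<open>
  As \<open>D\<close> is symmetric, $\|(D + i)f\|^2 = \|Df\|^2 + \|f\|^2$.  Hence test functions form a core as soon as
  their images under \<open>D + i\<close> are dense, and a function orthogonal to all these images is an eigenvector of
  \<open>D\<close> with a non-real eigenvalue.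
\<close>

theorem test_functions_core:
  assumes fg: "(f, g) \<in> D_op" and e: "e > 0"
  obtains \<tau> \<tau>' where "complex_test \<tau> \<tau>'" "L2_norm lborel (\<lambda>x. f x - \<tau> x) < e" "L2_norm lborel (\<lambda>x. g x - \<i> * \<tau>' x) < e"
proof -
  let ?S = "{(\<lambda>x. \<i> * \<tau>' x + \<i> * \<tau> x) | \<tau> \<tau>'. complex_test \<tau> \<tau>'}"
  have dense: "L2_dense lborel ?S"
  proof (rule L2_dense_if_orthogonal_zero)
    show "?S \<subseteq> L2 lborel" using complex_test_D D_op_L2 by (fastforce intro: L2_add L2_scale)
    have "bump 0 0 0 = (\<lambda>x. 0)" using bump_outside by auto
    then have z: "test_fun (\<lambda>x. 0)" using test_fun_bump[of 0 0 0] by simp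
    show "(\<lambda>x. 0) \<in> ?S"
      using z by (intro CollectI exI[of _ "\<lambda>x. 0"]) (auto simp: complex_test_def intro!: exI[of _ "\<lambda>x. 0"])
    show "(\<lambda>x. a x + c * b x) \<in> ?S" if ab: "a \<in> ?S" "b \<in> ?S" for a b c
    proof -
      obtain \<tau> \<tau>' \<eta> \<eta>' where t: "complex_test \<tau> \<tau>'" "a = (\<lambda>x. \<i> * \<tau>' x + \<i> * \<tau> x)"
        "complex_test \<eta> \<eta>'" "b = (\<lambda>x. \<i> * \<eta>' x + \<i> * \<eta> x)" using ab by blast
      have "(\<lambda>x. a x + c * b x) = (\<lambda>x. \<i> * (\<tau>' x + c * \<eta>' x) + \<i> * (\<tau> x + c * \<eta> x))"
        unfolding t by (auto simp: algebra_simps)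
      then show ?thesis using complex_test_linear[OF t(1,3), of c]
        by (intro CollectI exI[of _ "\<lambda>x. \<tau> x + c * \<eta> x"] exI[of _ "\<lambda>x. \<tau>' x + c * \<eta>' x"]) simp
    qed
    show "AE x in lborel. w x = 0" if w: "w \<in> L2 lborel" and orth: "\<And>s. s \<in> ?S \<Longrightarrow> L2_inner lborel s w = 0" for w
    proof -
      let ?G = "\<lambda>x. cnj (w x)"
      have G: "?G \<in> L2 lborel" by (rule L2_cnj[OF w])
      have "weak_deriv ?G ?G" unfolding weak_deriv_def
      proof (intro conjI allI impI)
        show "loc_integrable ?G" "loc_integrable ?G" by (rule loc_integrable_L2[OF G])+
        fix \<phi> assume t: "test_fun \<phi>"
        have "complex_test (\<lambda>x. of_real (\<phi> x)) (\<lambda>x. of_real (deriv \<phi> x))"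
          unfolding complex_test_def using t z by (intro exI[of _ \<phi>] exI[of _ "\<lambda>x. 0"]) auto
        then have "(\<lambda>x. \<i> * of_real (deriv \<phi> x) + \<i> * of_real (\<phi> x)) \<in> ?S"
          by (intro CollectI exI[of _ "\<lambda>x. of_real (\<phi> x)"] exI[of _ "\<lambda>x. of_real (deriv \<phi> x)"]) simp
        then have "L2_inner lborel (\<lambda>x. \<i> * of_real (deriv \<phi> x) + \<i> * of_real (\<phi> x)) w = 0" by (rule orth)
        moreover have "L2_inner lborel (\<lambda>x. \<i> * of_real (deriv \<phi> x) + \<i> * of_real (\<phi> x)) w
            = \<i> * (\<integral>x. ?G x * of_real (deriv \<phi> x) \<partial>lborel) + \<i> * (\<integral>x. ?G x * of_real (\<phi> x) \<partial>lborel)"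
          using L2_inner_add_left[OF L2_scale[OF test_fun_L2(1)[OF test_fun_deriv[OF t]]] L2_scale[OF test_fun_L2(1)[OF t]] w, of \<i> \<i>]
          unfolding L2_inner_scale_left by (simp add: L2_inner_def mult.commute)
        ultimately have "\<i> * ((\<integral>x. ?G x * of_real (deriv \<phi> x) \<partial>lborel) + (\<integral>x. ?G x * of_real (\<phi> x) \<partial>lborel)) = 0"
          by (simp add: distrib_left)
        then show "(\<integral>x. ?G x * of_real (deriv \<phi> x) \<partial>lborel) = - (\<integral>x. ?G x * of_real (\<phi> x) \<partial>lborel)"
          by (simp add: eq_neg_iff_add_eq_0)
      qed
      then have "(?G, \<lambda>x. \<i> * ?G x) \<in> D_op" unfolding D_op_def using G L2_scale[OF G] by auto
      from D_op_symmetric[OF this this] have "\<i> * L2_inner lborel ?G ?G = - \<i> * L2_inner lborel ?G ?G"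
        unfolding L2_inner_scale_left L2_inner_scale_right by simp
      then have "L2_norm lborel ?G = 0" by (simp add: L2_inner_self)
      then show ?thesis using L2_norm_eq_0[OF G] by simp
    qed
  qed
  note L = D_op_L2[OF fg]
  have "(\<lambda>x. g x + \<i> * f x) \<in> L2 lborel" using L by (intro L2_add L2_scale)
  then obtain s where s: "s \<in> ?S" "L2_norm lborel (\<lambda>x. g x + \<i> * f x - s x) < e"
    using dense e unfolding L2_dense_def by meson
  then obtain \<tau> \<tau>' where t: "complex_test \<tau> \<tau>'" and lt: "L2_norm lborel (\<lambda>x. g x + \<i> * f x - (\<i> * \<tau>' x + \<i> * \<tau> x)) < e"
    by blast
  let ?d = "\<lambda>x. f x - \<tau> x" and ?k = "\<lambda>x. g x - \<i> * \<tau>' x"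
  have dk: "(?d, ?k) \<in> D_op" using D_op_linear[OF fg complex_test_D[OF t], of "-1"] by simp
  note L' = D_op_L2[OF dk]
  have "L2_inner lborel ?k ?d = cnj (L2_inner lborel ?k ?d)"
    using D_op_symmetric[OF dk dk] L2_inner_commute[of lborel ?d ?k] by simp
  then have "Im (L2_inner lborel ?k ?d) = 0" by (simp add: complex_eq_iff)
  then have "(L2_norm lborel (\<lambda>x. ?k x + \<i> * ?d x))\<^sup>2 = (L2_norm lborel ?k)\<^sup>2 + (L2_norm lborel ?d)\<^sup>2"
    unfolding L2_norm_add_sq[OF L'(2) L2_scale[OF L'(1)]] L2_inner_scale_right L2_norm_scale by simp
  moreover have "(\<lambda>x. ?k x + \<i> * ?d x) = (\<lambda>x. g x + \<i> * f x - (\<i> * \<tau>' x + \<i> * \<tau> x))" by (auto simp: algebra_simps)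
  ultimately have eq: "(L2_norm lborel (\<lambda>x. g x + \<i> * f x - (\<i> * \<tau>' x + \<i> * \<tau> x)))\<^sup>2 = (L2_norm lborel ?k)\<^sup>2 + (L2_norm lborel ?d)\<^sup>2"
    by simp
  have lt2: "(L2_norm lborel (\<lambda>x. g x + \<i> * f x - (\<i> * \<tau>' x + \<i> * \<tau> x)))\<^sup>2 < e\<^sup>2"
    using lt e by (intro power_strict_mono) auto
  have "L2_norm lborel ?d < e"
    by (rule power2_less_imp_less) (use eq lt2 e zero_le_power2[of "L2_norm lborel ?k"] in linarith)+
  moreover have "L2_norm lborel ?k < e"
    by (rule power2_less_imp_less) (use eq lt2 e zero_le_power2[of "L2_norm lborel ?d"] in linarith)+
  ultimately show ?thesis using that t by blast
qed

section \<open>Changes of variables\<close>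

text \<open>
  The substitution rule for bounded intervals gives the statement for $X[-n, n]$, and these sets exhaust the range
  of \<open>X\<close>.  The range need not be the whole line, as for the exponential function.
\<close>

lemma emeasure_substitution:
  fixes X X' :: "real \<Rightarrow> real"
  assumes X: "\<And>x. (X has_real_derivative X' x) (at x)" and X': "continuous_on UNIV X'" and nonneg: "\<And>x. 0 \<le> X' x"
    and A: "A \<in> sets borel"
  shows "emeasure lborel (A \<inter> range X) = (\<integral>\<^sup>+x. ennreal (X' x) * indicator (X -` A) x \<partial>lborel)"
proof -
  have mono: "X a \<le> X b" if "a \<le> b" for a b
    using DERIV_nonneg_imp_nondecreasing[OF that, of X] X nonneg by blast
  have cont: "continuous_on S X" for S
    by (intro continuous_at_imp_continuous_on ballI DERIV_isCont[OF X])
  have [measurable]: "X \<in> borel_measurable borel" "X' \<in> borel_measurable borel"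
    using borel_measurable_continuous_onI cont X' by blast+
  note [measurable] = A
  let ?J = "\<lambda>n::nat. {X (- real n)..X (real n)}" and ?I = "\<lambda>n::nat. {- real n..real n}"
  have sub: "emeasure lborel (A \<inter> ?J n) = (\<integral>\<^sup>+x. ennreal (X' x) * indicator (X -` A) x * indicator (?I n) x \<partial>lborel)" for n
  proof -
    have "emeasure lborel (A \<inter> ?J n) = (\<integral>\<^sup>+x. indicator (A \<inter> ?J n) x \<partial>lborel)"
      by (rule nn_integral_indicator[symmetric]) simp
    also have "\<dots> = (\<integral>\<^sup>+x. ennreal (indicator A x * indicator (?J n) x) \<partial>lborel)"
      by (intro nn_integral_cong) (auto simp: indicator_def)
    also have "\<dots> = (\<integral>\<^sup>+x. ennreal (indicator A (X x) * X' x * indicator (?I n) x) \<partial>lborel)"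
      by (rule nn_integral_substitution[OF _ X continuous_on_subset[OF X'] nonneg])
         (auto simp: set_borel_measurable_def)
    also have "\<dots> = (\<integral>\<^sup>+x. ennreal (X' x) * indicator (X -` A) x * indicator (?I n) x \<partial>lborel)"
      by (intro nn_integral_cong) (auto simp: indicator_def)
    finally show ?thesis .
  qed
  have "range X = (\<Union>n. ?J n)"
  proof (intro equalityI subsetI)
    fix y assume "y \<in> range X"
    then obtain x where x: "y = X x" by blast
    obtain n where "\<bar>x\<bar> \<le> real n" using real_arch_simple by blast
    then have "y \<in> ?J n" unfolding x using mono by auto
    then show "y \<in> (\<Union>n. ?J n)" by blast
  next
    fix y assume "y \<in> (\<Union>n. ?J n)"
    then obtain n where n: "X (- real n) \<le> y" "y \<le> X (real n)" by auto
    have "- real n \<le> real n" by simp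
    from IVT'[OF n this cont] show "y \<in> range X" by blast
  qed
  then have "emeasure lborel (A \<inter> range X) = emeasure lborel (\<Union>n. A \<inter> ?J n)" by simp
  also have "\<dots> = (SUP n. emeasure lborel (A \<inter> ?J n))"
  proof (rule SUP_emeasure_incseq[symmetric])
    show "incseq (\<lambda>n. A \<inter> ?J n)"
    proof (rule incseq_SucI)
      fix n
      have "X (- real (Suc n)) \<le> X (- real n)" "X (real n) \<le> X (real (Suc n))" by (rule mono; simp)+
      then show "A \<inter> ?J n \<subseteq> A \<inter> ?J (Suc n)" by auto
    qed
  qed auto
  also have "\<dots> = (SUP n. \<integral>\<^sup>+x. ennreal (X' x) * indicator (X -` A) x * indicator (?I n) x \<partial>lborel)" unfolding sub ..
  also have "\<dots> = (\<integral>\<^sup>+x. (SUP n. ennreal (X' x) * indicator (X -` A) x * indicator (?I n) x) \<partial>lborel)"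
  proof (rule nn_integral_monotone_convergence_SUP[symmetric])
    show "incseq (\<lambda>n x. ennreal (X' x) * indicator (X -` A) x * indicator (?I n) x)"
      by (intro incseq_SucI le_funI mult_left_mono) (auto simp: indicator_def)
  qed measurable
  also have "\<dots> = (\<integral>\<^sup>+x. ennreal (X' x) * indicator (X -` A) x \<partial>lborel)"
  proof (intro nn_integral_cong)
    fix x
    obtain n where n: "\<bar>x\<bar> \<le> real n" using real_arch_simple by blast
    show "(SUP n. ennreal (X' x) * indicator (X -` A) x * indicator (?I n) x) = ennreal (X' x) * indicator (X -` A) x"
    proof (rule antisym)
      show "(SUP n. ennreal (X' x) * indicator (X -` A) x * indicator (?I n) x) \<le> ennreal (X' x) * indicator (X -` A) x"
        by (intro SUP_least) (auto simp: indicator_def)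
      show "ennreal (X' x) * indicator (X -` A) x \<le> (SUP n. ennreal (X' x) * indicator (X -` A) x * indicator (?I n) x)"
        using n by (intro SUP_upper2[of n]) (auto simp: indicator_def)
    qed
  qed
  finally show ?thesis .
qed

text \<open>
  A function multiplied by \<open>\<rho>\<close> and composed with \<open>X\<close>: this is unitary if the image under \<open>X\<close> of the measure
  with density $|\rho|^2$ is the given measure.  The operators \<open>U\<close> and \<open>T\<close> and the multiplication by the phase
  of the gamma function are of this form.
\<close>

locale weighted_composition =
  fixes M :: "'a measure" and N :: "'b measure" and X :: "'b \<Rightarrow> 'a" and Y :: "'a \<Rightarrow> 'b" and \<rho> :: "'b \<Rightarrow> complex"
  assumes X [measurable]: "X \<in> measurable N M" and Y [measurable]: "Y \<in> measurable M N"
    and YX: "\<And>x. x \<in> space N \<Longrightarrow> Y (X x) = x" and XY: "\<And>y. y \<in> space M \<Longrightarrow> X (Y y) = y"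
    and \<rho> [measurable]: "\<rho> \<in> borel_measurable N" and \<rho>_nonzero: "\<And>x. x \<in> space N \<Longrightarrow> \<rho> x \<noteq> 0"
    and image: "distr (density N (\<lambda>x. ennreal ((cmod (\<rho> x))\<^sup>2))) M X = M"
begin

definition W :: "('a, 'b) l2op" where "W = op_of M N (\<lambda>g x. \<rho> x * g (X x))"

lemma integrable_iff:
  fixes h :: "'a \<Rightarrow> 'c :: {banach, second_countable_topology}"
  assumes [measurable]: "h \<in> borel_measurable M"
  shows "integrable M h \<longleftrightarrow> integrable N (\<lambda>x. (cmod (\<rho> x))\<^sup>2 *\<^sub>R h (X x))"
    and "integral\<^sup>L M h = (\<integral>x. (cmod (\<rho> x))\<^sup>2 *\<^sub>R h (X x) \<partial>N)"
proof -
  let ?D = "distr (density N (\<lambda>x. ennreal ((cmod (\<rho> x))\<^sup>2))) M X"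
  have "integrable ?D h \<longleftrightarrow> integrable N (\<lambda>x. (cmod (\<rho> x))\<^sup>2 *\<^sub>R h (X x))"
    by (subst integrable_distr_eq) (auto simp: integrable_density)
  then show "integrable M h \<longleftrightarrow> integrable N (\<lambda>x. (cmod (\<rho> x))\<^sup>2 *\<^sub>R h (X x))" unfolding image .
  have "integral\<^sup>L ?D h = (\<integral>x. (cmod (\<rho> x))\<^sup>2 *\<^sub>R h (X x) \<partial>N)"
    by (subst integral_distr) (auto simp: integral_density)
  then show "integral\<^sup>L M h = (\<integral>x. (cmod (\<rho> x))\<^sup>2 *\<^sub>R h (X x) \<partial>N)" unfolding image .
qed

lemma AE_compose:
  assumes "AE y in M. P y" shows "AE x in N. P (X x)"
proof -
  let ?d = "density N (\<lambda>x. ennreal ((cmod (\<rho> x))\<^sup>2))"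
  have "AE y in distr ?d M X. P y" unfolding image by (rule assms)
  then have "AE x in ?d. P (X x)" by (rule AE_distrD[rotated]) measurable
  then have "AE x in N. 0 < ennreal ((cmod (\<rho> x))\<^sup>2) \<longrightarrow> P (X x)" by (subst (asm) AE_density) auto
  with AE_space show ?thesis by eventually_elim (use \<rho>_nonzero in auto)
qed

lemma W_in_L2: assumes g: "g \<in> L2 M" shows "(\<lambda>x. \<rho> x * g (X x)) \<in> L2 N"
proof (rule L2I)
  have [measurable]: "g \<in> borel_measurable M" by (rule L2_measurable[OF g])
  show "integrable N (\<lambda>x. (cmod (\<rho> x * g (X x)))\<^sup>2)"
    using L2_integrable_sq[OF g] by (subst (asm) integrable_iff) (auto simp: norm_mult power_mult_distrib)
  show "(\<lambda>x. \<rho> x * g (X x)) \<in> borel_measurable N" by measurable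
qed

lemma W_iff: "(g, k) \<in> W \<longleftrightarrow> g \<in> L2 M \<and> k \<in> L2 N \<and> (AE x in N. k x = \<rho> x * g (X x))"
  by (simp add: W_def op_of_def)

lemma W_preimage:
  assumes k: "k \<in> L2 N" defines "g \<equiv> \<lambda>y. k (Y y) / \<rho> (Y y)"
  shows "(g, k) \<in> W"
proof -
  note [measurable] = L2_measurable[OF k]
  have gm[measurable]: "g \<in> borel_measurable M" unfolding g_def by measurable
  have eq: "\<rho> x * g (X x) = k x" if "x \<in> space N" for x
    using that YX \<rho>_nonzero by (simp add: g_def)
  have "integrable N (\<lambda>x. (cmod (\<rho> x))\<^sup>2 *\<^sub>R (cmod (g (X x)))\<^sup>2) \<longleftrightarrow> integrable N (\<lambda>x. (cmod (k x))\<^sup>2)"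
    by (rule Bochner_Integration.integrable_cong[OF refl]) (simp add: eq[symmetric] norm_mult power_mult_distrib)
  then have "integrable M (\<lambda>y. (cmod (g y))\<^sup>2)"
    using L2_integrable_sq[OF k] by (subst integrable_iff) auto
  then have "g \<in> L2 M" using gm by (intro L2I)
  then show ?thesis unfolding W_iff using k eq by auto
qed

lemma l2_unitary: "l2_unitary M N W"
proof
  show "unitary_op M N W" unfolding unitary_op_def
  proof (intro conjI)
    have "(f, \<lambda>x. \<rho> x * f (X x)) \<in> W" if "f \<in> L2 M" for f using W_in_L2[OF that] that by (simp add: W_iff)
    moreover have sub: "W \<subseteq> L2 M \<times> L2 N" by (auto simp: W_iff)
    ultimately show "Domain W = L2 M" by blast
    show "Range W = L2 N" using W_preimage sub by blast
    show "\<forall>(f, g)\<in>W. \<forall>(f', g')\<in>W. L2_inner N g g' = L2_inner M f f'"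
    proof clarify
      fix f g f' g' assume "(f, g) \<in> W" "(f', g') \<in> W"
      then have L: "f \<in> L2 M" "g \<in> L2 N" "f' \<in> L2 M" "g' \<in> L2 N"
        and ae: "AE x in N. g x = \<rho> x * f (X x)" "AE x in N. g' x = \<rho> x * f' (X x)" by (auto simp: W_iff)
      note [measurable] = L[THEN L2_measurable]
      have "L2_inner N g g' = (\<integral>x. (cmod (\<rho> x))\<^sup>2 *\<^sub>R (f (X x) * cnj (f' (X x))) \<partial>N)"
        unfolding L2_inner_def
      proof (rule integral_cong_AE)
        show "AE x in N. g x * cnj (g' x) = (cmod (\<rho> x))\<^sup>2 *\<^sub>R (f (X x) * cnj (f' (X x)))"
          using ae by eventually_elim (simp add: scaleR_conv_of_real complex_norm_square mult_ac del: of_real_power)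
      qed measurable
      also have "\<dots> = L2_inner M f f'" unfolding L2_inner_def by (subst integrable_iff(2)) auto
      finally show "L2_inner N g g' = L2_inner M f f'" .
    qed
  qed
  show "ae_closed M N W" unfolding ae_closed_def
  proof (intro conjI allI impI)
    show "W \<subseteq> L2 M \<times> L2 N" by (auto simp: W_iff)
    fix f g f' g' assume "(f, g) \<in> W" and m: "f' \<in> borel_measurable M" "g' \<in> borel_measurable N"
      and ae: "AE x in M. f' x = f x" "AE x in N. g' x = g x"
    then have L: "f \<in> L2 M" "g \<in> L2 N" "AE x in N. g x = \<rho> x * f (X x)" by (auto simp: W_iff)
    have "AE x in N. g' x = \<rho> x * f' (X x)" using ae(2) AE_compose[OF ae(1)] L(3) by eventually_elim simp
    then show "(f', g') \<in> W" unfolding W_iff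
      using L2_AE_cong[OF L(1) m(1) ae(1)] L2_AE_cong[OF L(2) m(2) ae(2)] by simp
  qed
qed

end

subsection \<open>The operator \<open>U\<close>\<close>

lemma space_lborel_plus [simp]: "space lborel_plus = {0<..}"
  by (simp add: lborel_plus_def space_restrict_space)

lemma measurable_lborel_plus_iff: "f \<in> borel_measurable lborel_plus \<longleftrightarrow> (\<lambda>x. indicator {0<..} x *\<^sub>R f x) \<in> borel_measurable borel"
  for f :: "real \<Rightarrow> complex"
  unfolding lborel_plus_def by (subst borel_measurable_restrict_space_iff) auto

lemma measurable_exp_lborel_plus [measurable]: "exp \<in> measurable borel lborel_plus"
  unfolding lborel_plus_def by (rule measurable_restrict_space2) auto

lemma measurable_ln_lborel_plus [measurable]: "ln \<in> borel_measurable lborel_plus"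
  unfolding lborel_plus_def by (intro measurable_restrict_space1) measurable

lemma distr_exp: "distr (density lborel (\<lambda>x. ennreal (exp x))) lborel_plus exp = lborel_plus"
proof (rule measure_eqI)
  fix A assume "A \<in> sets (distr (density lborel (\<lambda>x. ennreal (exp x))) lborel_plus exp)"
  then have A: "A \<in> sets lborel_plus" by simp
  then have Ab: "A \<in> sets borel" "A \<subseteq> {0<..}" by (auto simp: lborel_plus_def sets_restrict_space)
  have "range exp = ({0<..} :: real set)" by (auto simp: image_iff) (metis exp_ln)
  have m: "exp -` A \<in> sets borel" using measurable_sets[of exp borel borel A] Ab by simp
  have "emeasure (distr (density lborel (\<lambda>x. ennreal (exp x))) lborel_plus exp) A
      = (\<integral>\<^sup>+x. ennreal (exp x) * indicator (exp -` A) x \<partial>lborel)"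
    using A m by (subst emeasure_distr) (auto simp: emeasure_density)
  also have "\<dots> = emeasure lborel (A \<inter> range exp)"
    by (rule emeasure_substitution[symmetric]) (auto intro!: derivative_eq_intros continuous_intros Ab)
  also have "\<dots> = emeasure lborel_plus A"
    using A Ab \<open>range exp = {0<..}\<close> by (simp add: lborel_plus_def emeasure_restrict_space Int_absorb2)
  finally show "emeasure (distr (density lborel (\<lambda>x. ennreal (exp x))) lborel_plus exp) A = emeasure lborel_plus A" .
qed simp

interpretation Uw: weighted_composition lborel_plus lborel exp ln "\<lambda>x. of_real (exp (x / 2))"
proof
  have "(cmod (complex_of_real (exp (x / 2))))\<^sup>2 = exp x" for x
    by (simp add: exp_double[symmetric])
  then show "distr (density lborel (\<lambda>x. ennreal ((cmod (complex_of_real (exp (x / 2))))\<^sup>2))) lborel_plus exp = lborel_plus"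
    using distr_exp by simp
qed auto

lemma U_op_eq: "U_op = Uw.W"
  unfolding U_op_def Uw.W_def ..

subsection \<open>The operator \<open>T\<close>\<close>

text \<open>
  The change of variable $\int_0^\xi v^{-2}$ of \<open>T\<close> in closed form, and its inverse.
\<close>

definition Xf :: "real \<Rightarrow> real" where "Xf \<xi> = sinh (pi * \<xi>) / pi\<^sup>2"
definition Yf :: "real \<Rightarrow> real" where "Yf y = arsinh (pi\<^sup>2 * y) / pi"

lemma v_pos: "v_fun \<xi> > 0"
  by (simp add: v_fun_def cosh_real_pos)

lemma v_sq: "(v_fun \<xi>)\<^sup>2 = pi / cosh (pi * \<xi>)"
  using cosh_real_pos[of "pi * \<xi>"] by (simp add: v_fun_def power_divide)

lemma v_inverse_sq: "inverse ((v_fun \<xi>)\<^sup>2) = cosh (pi * \<xi>) / pi"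
  by (simp add: v_sq)

lemma inverse_v: "inverse (v_fun \<xi>) = sqrt (cosh (pi * \<xi>) / pi)"
  by (simp add: v_fun_def real_sqrt_divide)

lemma inverse_v_has_derivative: "((\<lambda>\<xi>. inverse (v_fun \<xi>)) has_real_derivative sinh (pi * \<xi>) * v_fun \<xi> / 2) (at \<xi>)"
proof -
  have "((\<lambda>\<xi>. cosh (pi * \<xi>)) has_real_derivative sinh (pi * \<xi>) * pi) (at \<xi>)"
    by (auto intro!: derivative_eq_intros)
  from DERIV_cdivide[OF this, of pi] have D: "((\<lambda>\<xi>. cosh (pi * \<xi>) / pi) has_real_derivative sinh (pi * \<xi>)) (at \<xi>)"
    by simp
  have "cosh (pi * \<xi>) / pi > 0" by (simp add: cosh_real_pos)
  from DERIV_chain2[OF DERIV_real_sqrt[OF this] D] show ?thesis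
    unfolding inverse_v[symmetric] by (simp add: mult.commute)
qed

lemma v_continuous: "continuous_on S v_fun"
  unfolding v_fun_def[abs_def] by (intro continuous_intros) (auto simp: cosh_real_pos intro: less_imp_neq[symmetric])

lemma Xf_has_derivative: "(Xf has_real_derivative inverse ((v_fun \<xi>)\<^sup>2)) (at \<xi>)"
proof -
  have "((\<lambda>\<xi>. sinh (pi * \<xi>)) has_real_derivative cosh (pi * \<xi>) * pi) (at \<xi>)"
    by (auto intro!: derivative_eq_intros)
  from DERIV_cdivide[OF this, of "pi\<^sup>2"] show ?thesis
    unfolding Xf_def[abs_def] v_inverse_sq by (simp add: power2_eq_square)
qed

lemma inverse_v_sq_continuous: "continuous_on S (\<lambda>\<xi>. inverse ((v_fun \<xi>)\<^sup>2))"
  unfolding v_inverse_sq by (intro continuous_intros) auto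

lemma Xf_integral: "(LBINT \<eta>=0..\<xi>. inverse ((v_fun \<eta>)\<^sup>2)) = Xf \<xi>"
proof -
  have "(LBINT \<eta>=0..\<xi>. inverse ((v_fun \<eta>)\<^sup>2)) = Xf \<xi> - Xf 0"
    unfolding zero_ereal_def
    by (rule interval_integral_FTC_finite[OF inverse_v_sq_continuous])
       (use Xf_has_derivative in \<open>auto simp: has_real_derivative_iff_has_vector_derivative intro: has_vector_derivative_at_within\<close>)
  then show ?thesis by (simp add: Xf_def)
qed

lemma Yf_Xf [simp]: "Yf (Xf \<xi>) = \<xi>"
  by (simp add: Xf_def Yf_def arsinh_sinh_real)

lemma Xf_Yf [simp]: "Xf (Yf y) = y"
  by (simp add: Xf_def Yf_def)

lemma Yf_has_derivative: "(Yf has_real_derivative (v_fun (Yf y))\<^sup>2) (at y)"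
proof -
  have "((\<lambda>y. pi\<^sup>2 * y) has_real_derivative pi\<^sup>2) (at y)" by (auto intro!: derivative_eq_intros)
  from DERIV_cdivide[OF DERIV_chain2[OF arsinh_real_has_field_derivative this], of pi]
  have "(Yf has_real_derivative 1 / sqrt ((pi\<^sup>2 * y)\<^sup>2 + 1) * pi\<^sup>2 / pi) (at y)" unfolding Yf_def[abs_def] .
  moreover have "1 / sqrt ((pi\<^sup>2 * y)\<^sup>2 + 1) * pi\<^sup>2 / pi = (v_fun (Yf y))\<^sup>2"
    unfolding v_sq by (simp add: Yf_def cosh_arsinh_real) (simp add: power2_eq_square)
  ultimately show ?thesis by simp
qed

lemma Yf_continuous: "continuous_on S Yf"
  unfolding Yf_def[abs_def] by (intro continuous_intros) auto

lemma Xf_continuous: "continuous_on S Xf"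
  unfolding Xf_def[abs_def] by (intro continuous_intros) auto

lemma Xf_Yf_measurable [measurable]: "Xf \<in> borel_measurable borel" "Yf \<in> borel_measurable borel" "v_fun \<in> borel_measurable borel"
  using borel_measurable_continuous_onI Xf_continuous Yf_continuous v_continuous by blast+

definition T_weight :: "real \<Rightarrow> real \<Rightarrow> complex" where
  "T_weight c \<xi> = of_real (inverse (v_fun \<xi>)) * exp (\<i> * of_real (c * \<xi>))"

lemma T_weight_norm: "(cmod (T_weight c \<xi>))\<^sup>2 = inverse ((v_fun \<xi>)\<^sup>2)"
  using v_pos[of \<xi>] by (simp add: T_weight_def norm_mult norm_exp_eq_Re norm_inverse power_inverse)

lemma distr_Xf: "distr (density lborel (\<lambda>\<xi>. ennreal (inverse ((v_fun \<xi>)\<^sup>2)))) lborel Xf = lborel"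
proof (rule measure_eqI)
  fix A assume "A \<in> sets (distr (density lborel (\<lambda>\<xi>. ennreal (inverse ((v_fun \<xi>)\<^sup>2)))) lborel Xf)"
  then have A[measurable]: "A \<in> sets borel" by simp
  have "range Xf = UNIV" by (rule surjI[of Xf Yf]) simp
  have m: "Xf -` A \<in> sets borel" using measurable_sets[of Xf borel borel A] A by simp
  have "emeasure (distr (density lborel (\<lambda>\<xi>. ennreal (inverse ((v_fun \<xi>)\<^sup>2)))) lborel Xf) A
      = (\<integral>\<^sup>+x. ennreal (inverse ((v_fun x)\<^sup>2)) * indicator (Xf -` A) x \<partial>lborel)"
    using m by (subst emeasure_distr) (auto simp: emeasure_density)
  also have "\<dots> = emeasure lborel (A \<inter> range Xf)"
    by (rule emeasure_substitution[OF Xf_has_derivative inverse_v_sq_continuous _ A, symmetric]) simp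
  finally show "emeasure (distr (density lborel (\<lambda>\<xi>. ennreal (inverse ((v_fun \<xi>)\<^sup>2)))) lborel Xf) A = emeasure lborel A"
    using \<open>range Xf = UNIV\<close> by simp
qed simp

lemma T_weighted_composition: "weighted_composition lborel lborel Xf Yf (T_weight c)"
proof
  show "T_weight c \<in> borel_measurable lborel" unfolding T_weight_def[abs_def] by measurable
  show "T_weight c x \<noteq> 0" for x using v_pos[of x] by (simp add: T_weight_def)
  show "distr (density lborel (\<lambda>x. ennreal ((cmod (T_weight c x))\<^sup>2))) lborel Xf = lborel"
    unfolding T_weight_norm by (rule distr_Xf)
qed auto

lemma T_op_eq: "T_op q0 q1 = weighted_composition.W lborel lborel Xf (T_weight (q0 / q1))"
  unfolding T_op_def weighted_composition.W_def[OF T_weighted_composition] T_weight_def Xf_integral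
  by (simp add: divide_inverse)

subsection \<open>The gamma function on the line \<open>Re z = 1/2\<close>\<close>

definition Gh :: "real \<Rightarrow> complex" where "Gh \<xi> = Gamma (1/2 + \<i> * of_real \<xi>)"

lemma half_not_nonpos: "1/2 + \<i> * of_real \<xi> \<notin> \<int>\<^sub>\<le>\<^sub>0"
proof
  assume "1/2 + \<i> * complex_of_real \<xi> \<in> \<int>\<^sub>\<le>\<^sub>0"
  then obtain n where n: "1/2 + \<i> * complex_of_real \<xi> = of_int n" "n \<le> 0" by (elim nonpos_Ints_cases)
  have "1/2 = real_of_int n" using arg_cong[OF n(1), of Re] by simp
  moreover have "real_of_int n \<le> 0" using n(2) by simp
  ultimately show False by linarith
qed

lemma Gh_cnj: "cnj (Gh \<xi>) = Gh (- \<xi>)"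
  by (simp add: Gh_def cnj_Gamma)

text \<open>
  This is $\Gamma(z)\Gamma(1 - z) = \pi/\sin(\pi z)$ on the line $z = 1/2 + i\xi$, where $1 - z = \overline{z}$ and
  $\sin(\pi z) = \cosh(\pi\xi)$.
\<close>

lemma Gh_reflection: "Gh \<xi> * Gh (- \<xi>) = of_real ((v_fun \<xi>)\<^sup>2)"
proof -
  have "of_real pi * (1/2 + \<i> * of_real \<xi>) = complex_of_real (pi / 2) + \<i> * of_real (pi * \<xi>)"
    by (simp add: distrib_left mult.left_commute)
  then have "sin (of_real pi * (1/2 + \<i> * of_real \<xi>)) = cos (\<i> * of_real (pi * \<xi>))"
    unfolding sin_add sin_of_real cos_of_real sin_pi_half cos_pi_half by (simp only: sin_add sin_of_real cos_of_real sin_pi_half cos_pi_half) simp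
  also have "\<dots> = cosh (of_real (pi * \<xi>))" by (rule cosh_conv_cos[symmetric])
  also have "\<dots> = of_real (cosh (pi * \<xi>))"
    by (simp add: cosh_def exp_of_real[symmetric] scaleR_conv_of_real del: of_real_mult)
  finally show ?thesis
    using Gamma_reflection_complex[of "1/2 + \<i> * of_real \<xi>"] by (simp add: Gh_def v_sq)
qed

lemma Gh_norm: "cmod (Gh \<xi>) = v_fun \<xi>"
proof -
  have "of_real ((cmod (Gh \<xi>))\<^sup>2) = complex_of_real ((v_fun \<xi>)\<^sup>2)"
    using Gh_reflection[of \<xi>] unfolding Gh_cnj[symmetric] complex_norm_square .
  then have "(cmod (Gh \<xi>))\<^sup>2 = (v_fun \<xi>)\<^sup>2" using of_real_eq_iff by blast
  then show ?thesis using v_pos[of \<xi>] by (simp add: power2_eq_iff_nonneg)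
qed

lemma Gh_nonzero: "Gh \<xi> \<noteq> 0"
  using Gh_norm[of \<xi>] v_pos[of \<xi>] by auto

lemma Gh_continuous [continuous_intros]: "continuous_on S f \<Longrightarrow> continuous_on S (\<lambda>x. Gh (f x))"
  unfolding Gh_def
  by (rule continuous_on_compose2[OF continuous_on_Gamma[of "- \<int>\<^sub>\<le>\<^sub>0"]]) (use half_not_nonpos in \<open>auto intro!: continuous_intros\<close>)

lemma Gh_measurable [measurable]: "Gh \<in> borel_measurable borel"
  by (intro borel_measurable_continuous_onI) (intro continuous_intros)

definition phase :: "real \<Rightarrow> complex" where "phase \<xi> = Gh \<xi> / of_real (v_fun \<xi>)"

lemma phase_norm [simp]: "cmod (phase \<xi>) = 1"
  using v_pos[of \<xi>] by (simp add: phase_def norm_divide Gh_norm)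

interpretation Pw: weighted_composition lborel lborel "\<lambda>x. x" "\<lambda>x. x" phase
proof
  show "phase \<in> borel_measurable lborel" unfolding phase_def[abs_def] by measurable
  show "phase x \<noteq> 0" for x using phase_norm[of x] by (metis norm_zero zero_neq_one)
  show "distr (density lborel (\<lambda>x. ennreal ((cmod (phase x))\<^sup>2))) lborel (\<lambda>x. x) = lborel"
    by (simp add: density_1 distr_id2)
qed auto

lemma gamma_phase_op_eq: "gamma_phase_op = Pw.W"
  unfolding gamma_phase_op_def Pw.W_def phase_def Gh_def[symmetric] Gh_norm ..

theorem l2_unitary_F: "l2_unitary lborel_plus lborel F_op"
proof -
  have "F_op = (Uw.W O fourier_op) O Pw.W" unfolding F_op_def U_op_eq gamma_phase_op_eq by (simp only: O_assoc)
  then show ?thesis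
    using l2_unitary_comp[OF l2_unitary_comp[OF Uw.l2_unitary l2_unitary_fourier] Pw.l2_unitary] by simp
qed

lemma l2_unitary_T: "l2_unitary lborel lborel (T_op q0 q1)"
  unfolding T_op_eq by (rule weighted_composition.l2_unitary[OF T_weighted_composition])

section \<open>The kernel and the gamma function\<close>

text \<open>
  Euler's integral in the variable $t = e^x$.
\<close>

lemma Gamma_log_integral:
  assumes z: "Re z > 0"
  shows "integrable lborel (\<lambda>x. exp (z * of_real x - of_real (exp x)))"
    "(\<integral>x. exp (z * of_real x - of_real (exp x)) \<partial>lborel) = Gamma z"
proof -
  let ?f = "\<lambda>t. complex_of_real t powr (z - 1) / of_real (exp t)"
  have ae: "?f absolutely_integrable_on {0<..}" by (rule absolutely_integrable_Gamma_integral'[OF z])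
  have m: "(\<lambda>t. indicator {0<..} t *\<^sub>R ?f t) \<in> borel_measurable borel"
  proof (rule borel_measurable_continuous_on_indicator)
    show "continuous_on {0<..} ?f" by (intro continuous_intros) auto
  qed auto
  have iL: "integrable lborel (\<lambda>t. indicator {0<..} t *\<^sub>R ?f t)"
  proof (rule integrable_completion[THEN iffD1])
    show "(\<lambda>t. indicator {0<..} t *\<^sub>R ?f t) \<in> borel_measurable lborel" using m by simp
  qed (use ae in \<open>simp only: set_integrable_def\<close>)
  have fm: "?f \<in> borel_measurable lborel_plus" unfolding measurable_lborel_plus_iff by (rule m)
  have iP: "integrable lborel_plus ?f" unfolding lborel_plus_def by (subst integrable_restrict_space) (use iL in auto)
  have "((\<lambda>t. if t \<in> {0<..} then ?f t else 0) has_integral Gamma z) UNIV"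
    unfolding has_integral_restrict_UNIV by (rule Gamma_integral_complex'[OF z])
  moreover have "(\<lambda>t. if t \<in> {0<..} then ?f t else 0) = (\<lambda>t. indicator {0<..} t *\<^sub>R ?f t)" by (auto simp: indicator_def)
  ultimately have "((\<lambda>t. indicator {0<..} t *\<^sub>R ?f t) has_integral Gamma z) UNIV" by simp
  from has_integral_unique[OF has_integral_integral_lborel[OF iL] this]
  have "(\<integral>t. indicator {0<..} t *\<^sub>R ?f t \<partial>lborel) = Gamma z" .
  then have int: "(\<integral>t. ?f t \<partial>lborel_plus) = Gamma z"
    unfolding lborel_plus_def by (subst integral_restrict_space) auto
  have eq: "(cmod (complex_of_real (exp (x / 2))))\<^sup>2 *\<^sub>R ?f (exp x) = exp (z * of_real x - of_real (exp x))" for x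
  proof -
    have 1: "(cmod (complex_of_real (exp (x / 2))))\<^sup>2 = exp x" by (simp add: exp_double[symmetric])
    have 2: "complex_of_real (exp x) powr (z - 1) = exp ((z - 1) * of_real x)"
      by (simp add: powr_def Ln_of_real)
    have "exp (z * of_real x - of_real (exp x)) = exp (of_real x + (z - 1) * of_real x - of_real (exp x))"
      by (simp add: algebra_simps)
    also have "\<dots> = of_real (exp x) * exp ((z - 1) * of_real x) / of_real (exp (exp x))"
      unfolding exp_diff exp_add exp_of_real ..
    finally show ?thesis unfolding 1 2 by (simp add: scaleR_conv_of_real)
  qed
  show "integrable lborel (\<lambda>x. exp (z * of_real x - of_real (exp x)))"
    using Uw.integrable_iff(1)[OF fm] iP unfolding eq by simp
  show "(\<integral>x. exp (z * of_real x - of_real (exp x)) \<partial>lborel) = Gamma z"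
    using Uw.integrable_iff(2)[OF fm] int unfolding eq by simp
qed

lemma exp_exp_integrable:
  assumes "a > 0" shows "integrable lborel (\<lambda>x::real. exp (a * x - exp x))"
    "(\<integral>x. exp (a * x - exp x) \<partial>lborel) = Gamma a"
proof -
  have eq: "exp (complex_of_real a * of_real x - of_real (exp x)) = of_real (exp (a * x - exp x))" for x
    by (simp add: exp_of_real[symmetric] del: exp_of_real)
  note G = Gamma_log_integral[of "complex_of_real a", unfolded eq]
  have i: "integrable lborel (\<lambda>x. complex_of_real (exp (a * x - exp x)))" using G(1) assms by simp
  from integrable_Re[OF i] show "integrable lborel (\<lambda>x::real. exp (a * x - exp x))" by simp
  have "complex_of_real (\<integral>x. exp (a * x - exp x) \<partial>lborel) = of_real (Gamma a)"
    using G(2) assms by (simp add: Gamma_complex_of_real integral_complex_of_real)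
  then show "(\<integral>x. exp (a * x - exp x) \<partial>lborel) = Gamma a" using of_real_eq_iff by blast
qed

lemma abs_le_exp: "\<bar>x\<bar> \<le> 2 * exp (x / 2) + 2 * exp (- x / 2)" for x :: real
proof -
  have "x / 2 \<le> exp (x / 2)" "- x / 2 \<le> exp (- x / 2)"
    using exp_ge_add_one_self[of "x / 2"] exp_ge_add_one_self[of "- x / 2"] by linarith+
  moreover have "0 \<le> exp (x / 2)" "0 \<le> exp (- x / 2)" by simp_all
  ultimately show ?thesis by linarith
qed

lemma x_exp_exp_integrable:
  assumes "a > 1/2" shows "integrable lborel (\<lambda>x::real. x * exp (a * x - exp x))"
proof (rule Bochner_Integration.integrable_bound)
  have "a - 1/2 > 0" "a + 1/2 > 0" using assms by simp_all
  then show "integrable lborel (\<lambda>x. 2 * exp ((a + 1/2) * x - exp x) + 2 * exp ((a - 1/2) * x - exp x))"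
    by (intro Bochner_Integration.integrable_add integrable_mult_right exp_exp_integrable)
  have "\<bar>x * exp (a * x - exp x)\<bar> \<le> 2 * exp ((a + 1/2) * x - exp x) + 2 * exp ((a - 1/2) * x - exp x)" for x
  proof -
    have "\<bar>x * exp (a * x - exp x)\<bar> \<le> (2 * exp (x / 2) + 2 * exp (- x / 2)) * exp (a * x - exp x)"
      unfolding abs_mult using abs_le_exp[of x] by (simp add: mult_right_mono)
    also have "\<dots> = 2 * exp ((a + 1/2) * x - exp x) + 2 * exp ((a - 1/2) * x - exp x)"
      by (simp add: distrib_right mult.assoc exp_add[symmetric]) (simp add: algebra_simps)
    finally show ?thesis .
  qed
  then show "AE x in lborel. norm (x * exp (a * x - exp x)) \<le> norm (2 * exp ((a + 1/2) * x - exp x) + 2 * exp ((a - 1/2) * x - exp x))"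
    by (intro AE_I2) (simp add: order_trans[OF _ abs_ge_self])
qed measurable

text \<open>
  A bound that is uniform in \<open>s\<close>, for differentiating $\int e^{sx}e^{x - e^x}\,dx$ at $s = 0$ under the integral.
\<close>

lemma difference_quotient_bound:
  fixes x s :: real
  assumes s: "0 < s" "s \<le> 1" shows "\<bar>(exp (s * x) - 1) / s\<bar> \<le> \<bar>x\<bar> * (1 + exp x)"
proof -
  have ge: "x \<le> (exp (s * x) - 1) / s" using exp_ge_add_one_self[of "s * x"] s by (simp add: field_simps)
  have "1 - s * x \<le> exp (- (s * x))" using exp_ge_add_one_self[of "- (s * x)"] by simp
  then have "(1 - s * x) * exp (s * x) \<le> exp (- (s * x)) * exp (s * x)" by (intro mult_right_mono) auto
  also have "\<dots> = 1" by (simp add: exp_add[symmetric])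
  finally have le: "(exp (s * x) - 1) / s \<le> x * exp (s * x)" using s by (simp add: field_simps)
  show ?thesis
  proof (cases "x \<ge> 0")
    case True
    have "exp (s * x) \<le> exp x" using s True by (simp add: mult_left_le_one_le)
    then have "x * exp (s * x) \<le> x * exp x" using True by (rule mult_left_mono)
    then show ?thesis using ge le True by (simp add: distrib_left abs_le_iff)
  next
    case False
    then have "x * exp (s * x) \<le> 0" by (simp add: mult_nonpos_nonneg)
    then have "\<bar>(exp (s * x) - 1) / s\<bar> \<le> - x" using ge le by (simp add: abs_le_iff)
    also have "\<dots> \<le> \<bar>x\<bar> * (1 + exp x)" using False mult_nonpos_nonneg[of x "exp x"] by (simp add: distrib_left)
    finally show ?thesis .
  qed
qed

text \<open>This is $\Gamma'(1) = -\gamma$, with the derivative taken under the integral in logarithmic coordinates.\<close>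

lemma integral_x_exp_exp: "(\<integral>x. x * exp (x - exp x) \<partial>(lborel :: real measure)) = - euler_mascheroni"
proof -
  let ?s = "\<lambda>n. inverse (real (Suc n))"
  let ?q = "\<lambda>n x. (exp (?s n * x) - 1) / ?s n * exp (x - exp x)"
  have q: "?q n x = (exp ((1 + ?s n) * x - exp x) - exp (1 * x - exp x)) / ?s n" for n x
  proof -
    have "exp ((1 + ?s n) * x - exp x) = exp (?s n * x) * exp (x - exp x)"
      unfolding exp_add[symmetric] by (simp add: algebra_simps)
    then show ?thesis by (simp add: left_diff_distrib diff_divide_distrib)
  qed
  have s0: "?s \<longlonglongrightarrow> 0" by (rule LIMSEQ_inverse_real_of_nat)
  have f0: "filterlim ?s (at 0) sequentially"
    by (rule filterlim_atI[OF s0]) auto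
  have i1: "integrable lborel (\<lambda>x. exp ((1 + ?s n) * x - exp x))" for n by (rule exp_exp_integrable) (simp add: add_pos_pos)
  have "(\<integral>x. ?q n x \<partial>lborel) = (Gamma (1 + ?s n) - Gamma 1) / ?s n" for n
    unfolding q integral_divide_zero using i1[of n] exp_exp_integrable[of 1] exp_exp_integrable(2)[of "1 + ?s n"]
    by (simp add: add_pos_pos)
  moreover have "(\<lambda>n. (Gamma (1 + ?s n) - Gamma 1) / ?s n) \<longlonglongrightarrow> - euler_mascheroni"
  proof -
    have "(Gamma has_real_derivative Gamma 1 * Digamma 1) (at (1::real))"
      by (rule has_field_derivative_Gamma) auto
    then have "((\<lambda>h. (Gamma (1 + h) - Gamma (1::real)) / h) \<longlongrightarrow> - euler_mascheroni) (at 0)"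
      by (simp add: DERIV_def)
    from filterlim_compose[OF this f0] show ?thesis .
  qed
  ultimately have L1: "(\<lambda>n. \<integral>x. ?q n x \<partial>lborel) \<longlonglongrightarrow> - euler_mascheroni" by simp
  have L2: "(\<lambda>n. \<integral>x. ?q n x \<partial>lborel) \<longlonglongrightarrow> (\<integral>x. x * exp (x - exp x) \<partial>(lborel :: real measure))"
  proof (rule integral_dominated_convergence)
    have "integrable lborel (\<lambda>x::real. \<bar>x * exp (1 * x - exp x)\<bar> + \<bar>x * exp (2 * x - exp x)\<bar>)"
      by (intro Bochner_Integration.integrable_add integrable_abs x_exp_exp_integrable) auto
    moreover have "\<bar>x * exp (1 * x - exp x)\<bar> + \<bar>x * exp (2 * x - exp x)\<bar> = \<bar>x\<bar> * (1 + exp x) * exp (x - exp x)" for x :: real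
    proof -
      have "exp (2 * x - exp x) = exp x * exp (x - exp x)" by (simp add: exp_add[symmetric])
      then show ?thesis by (simp add: abs_mult distrib_left distrib_right)
    qed
    ultimately show "integrable lborel (\<lambda>x::real. \<bar>x\<bar> * (1 + exp x) * exp (x - exp x))" by simp
    show "AE x in lborel. norm (?q n x) \<le> \<bar>x\<bar> * (1 + exp x) * exp (x - exp x)" for n
    proof (rule AE_I2)
      fix x
      have "\<bar>(exp (?s n * x) - 1) / ?s n\<bar> \<le> \<bar>x\<bar> * (1 + exp x)"
        by (rule difference_quotient_bound) (auto simp: inverse_le_1_iff)
      from mult_right_mono[OF this exp_ge_zero[of "x - exp x"]]
      show "norm (?q n x) \<le> \<bar>x\<bar> * (1 + exp x) * exp (x - exp x)"
        unfolding real_norm_def abs_mult abs_exp_cancel .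
    qed
    show "AE x in lborel. (\<lambda>n. ?q n x) \<longlonglongrightarrow> x * exp (x - exp x)"
    proof (rule AE_I2)
      fix x :: real
      have "((\<lambda>s. exp (s * x)) has_real_derivative x) (at 0)" by (auto intro!: derivative_eq_intros)
      then have "((\<lambda>s. (exp (s * x) - 1) / s) \<longlongrightarrow> x) (at 0)" by (simp add: DERIV_def)
      from filterlim_compose[OF this f0] show "(\<lambda>n. ?q n x) \<longlonglongrightarrow> x * exp (x - exp x)" by (intro tendsto_intros)
    qed
  qed measurable
  from LIMSEQ_unique[OF L2 L1] show ?thesis .
qed

text \<open>
  The kernel $e^{-t\lambda}$ of the Laplace transform at $t = e^x$, $\lambda = e^z$ is $\kappa(x + z)$, up to the square roots
  $e^{x/2}$ and $e^{z/2}$ of the densities of the measures $dt$ and $d\lambda$.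
\<close>

definition kap :: "real \<Rightarrow> real" where "kap x = exp (x / 2 - exp x)"

lemma kap_measurable [measurable]: "kap \<in> borel_measurable borel"
  unfolding kap_def[abs_def] by measurable

lemma kap_mult: "kap a * kap b = exp (a / 2 + b / 2 - (exp a + exp b))"
proof -
  have "kap a * kap b = exp ((a / 2 - exp a) + (b / 2 - exp b))" unfolding kap_def by (rule exp_add[symmetric])
  also have "(a / 2 - exp a) + (b / 2 - exp b) = a / 2 + b / 2 - (exp a + exp b)" by simp
  finally show ?thesis .
qed

lemma kap_bounds: "0 \<le> kap x" "kap x \<le> 1"
proof -
  have "x / 2 \<le> exp x"
  proof (cases "x \<ge> 0")
    case True then show ?thesis using exp_ge_add_one_self[of x] by linarith
  next
    case False
    have "0 < exp x" by simp
    then show ?thesis using False by linarith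
  qed
  then show "0 \<le> kap x" "kap x \<le> 1" by (simp_all add: kap_def)
qed

lemma kap_integrable: "integrable lborel kap" "integrable lborel (\<lambda>x. x * kap x)"
proof -
  show "integrable lborel kap" using exp_exp_integrable(1)[of "1/2"] unfolding kap_def[abs_def] by simp
  show "integrable lborel (\<lambda>x. x * kap x)"
  proof (rule Bochner_Integration.integrable_bound)
    have "integrable lborel (\<lambda>x::real. 4 * exp (3/4 * x - exp x) + 4 * exp (1/4 * x - exp x))"
      by (intro Bochner_Integration.integrable_add integrable_mult_right exp_exp_integrable) auto
    then show "integrable lborel (\<lambda>x::real. 4 * exp (3/4 * x - exp x) + 4 * exp (1/4 * x - exp x))" .
    have "\<bar>x * kap x\<bar> \<le> 4 * exp (3/4 * x - exp x) + 4 * exp (1/4 * x - exp x)" for x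
    proof -
      have "\<bar>x\<bar> \<le> 4 * exp (x / 4) + 4 * exp (- x / 4)" using abs_le_exp[of "x / 2"] by (simp add: field_simps)
      then have "\<bar>x * kap x\<bar> \<le> (4 * exp (x / 4) + 4 * exp (- x / 4)) * kap x"
        unfolding abs_mult using kap_bounds(1)[of x] by (simp add: mult_right_mono)
      also have "\<dots> = 4 * exp (3/4 * x - exp x) + 4 * exp (1/4 * x - exp x)"
        by (simp add: kap_def distrib_right mult.assoc exp_add[symmetric])
      finally show ?thesis .
    qed
    then show "AE x in lborel. norm (x * kap x) \<le> norm (4 * exp (3/4 * x - exp x) + 4 * exp (1/4 * x - exp x))"
      by (intro AE_I2) (simp add: order_trans[OF _ abs_ge_self])
  qed measurable
qed

lemma ft_kap: "ft (\<lambda>x. of_real (kap x)) \<xi> = of_real fc * Gh (- \<xi>)"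
proof -
  have eq: "of_real (kap x) * ek (x * \<xi>) = exp ((1/2 + \<i> * of_real (- \<xi>)) * of_real x - of_real (exp x))" for x
    by (simp add: kap_def ek_def exp_of_real[symmetric] exp_add[symmetric] algebra_simps del: exp_of_real)
  show ?thesis unfolding ft_def eq using Gamma_log_integral(2)[of "1/2 + \<i> * of_real (- \<xi>)"] by (simp add: Gh_def)
qed

text \<open>
  The representation of the Hankel kernel as a Laplace transform, $P(\ln t)/t = \int_0^\infty e^{-t\lambda}(q_0 - q_1\ln\lambda)\,d\lambda$,
  in logarithmic coordinates.  The integral of the logarithm contributes $\Gamma'(1) = -\gamma$, whence the difference
  between $p_0$ and $q_0$.
\<close>

lemma kernel_factorization:
  assumes q: "q0 = p0 - euler_mascheroni * q1"
  shows "(\<integral>z. kap (x + z) * ((q0 - q1 * z) * kap (z + y)) \<partial>lborel)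
     = exp (x / 2) * exp (y / 2) * ((p0 + q1 * ln (exp x + exp y)) * inverse (exp x + exp y))"
proof -
  define t where "t = exp x + exp y"
  have t: "t > 0" by (simp add: t_def add_pos_pos)
  have et: "exp (ln t) = t" using t by simp
  \<comment> \<open>The shift of \<open>z\<close> by $\ln t$ is the substitution $\lambda\mapsto\lambda/t$ in the Laplace integral.\<close>
  have "(\<integral>z. kap (x + z) * ((q0 - q1 * z) * kap (z + y)) \<partial>lborel)
      = \<bar>1\<bar> *\<^sub>R (\<integral>z. kap (x + (- ln t + 1 * z)) * ((q0 - q1 * (- ln t + 1 * z)) * kap (- ln t + 1 * z + y)) \<partial>lborel)"
    by (rule lborel_integral_real_affine) simp
  also have "\<dots> = (\<integral>z. exp (x / 2) * exp (y / 2) / t * ((q0 + q1 * ln t) * exp (1 * z - exp z) - q1 * (z * exp (z - exp z))) \<partial>lborel)"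
  proof -
    have "kap (x + (- ln t + 1 * z)) * ((q0 - q1 * (- ln t + 1 * z)) * kap (- ln t + 1 * z + y))
      = exp (x / 2) * exp (y / 2) / t * ((q0 + q1 * ln t) * exp (1 * z - exp z) - q1 * (z * exp (z - exp z)))" for z
    proof -
      have 1: "exp (x + (- ln t + z)) + exp (- ln t + z + y) = exp z"
      proof -
        have "exp (x + (- ln t + z)) + exp (- ln t + z + y) = (exp x + exp y) * exp z / t"
          unfolding exp_add exp_minus et by (simp add: divide_inverse distrib_right distrib_left mult_ac)
        then show ?thesis using t by (simp add: t_def)
      qed
      have 2: "(x + (- ln t + z)) / 2 + (- ln t + z + y) / 2 - exp z = x / 2 + y / 2 + (- ln t) + (z - exp z)"
        by (simp add: field_simps)
      have "kap (x + (- ln t + z)) * kap (- ln t + z + y) = exp (x / 2 + y / 2 + (- ln t) + (z - exp z))"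
        unfolding kap_mult 1 2 ..
      also have "\<dots> = exp (x / 2) * exp (y / 2) / t * exp (z - exp z)"
        unfolding exp_add exp_minus[of "ln t"] et by (simp only: divide_inverse)
      finally have "kap (x + (- ln t + z)) * kap (- ln t + z + y) = exp (x / 2) * exp (y / 2) / t * exp (z - exp z)" .
      then have "kap (x + (- ln t + z)) * ((q0 - q1 * (- ln t + z)) * kap (- ln t + z + y))
          = (q0 - q1 * (- ln t + z)) * (exp (x / 2) * exp (y / 2) / t * exp (z - exp z))"
        by (subst mult.left_commute) (rule arg_cong)
      moreover have "(q0 - q1 * (- L + z)) * (B * E) = B * ((q0 + q1 * L) * E - q1 * (z * E))" for L B E :: real
        by (simp add: algebra_simps)
      ultimately show ?thesis by (simp only: mult_1)
    qed
    then show ?thesis by simp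
  qed
  also have "\<dots> = exp (x / 2) * exp (y / 2) / t * ((q0 + q1 * ln t) * Gamma 1 - q1 * (- euler_mascheroni))"
    using exp_exp_integrable[of 1] x_exp_exp_integrable[of 1] by (simp add: integral_x_exp_exp)
  also have "\<dots> = exp (x / 2) * exp (y / 2) * ((p0 + q1 * ln t) * inverse t)"
  proof -
    have "(q0 + q1 * ln t) * Gamma 1 - q1 * (- euler_mascheroni) = p0 + q1 * ln t" using q by simp
    then show ?thesis by (simp add: inverse_eq_divide)
  qed
  finally show ?thesis unfolding t_def .
qed

section \<open>The Hankel operator on $\mathcal{D}_0$\<close>

definition hconv :: "(real \<Rightarrow> complex) \<Rightarrow> (real \<Rightarrow> complex) \<Rightarrow> real \<Rightarrow> complex" where
  "hconv k u x = (\<integral>y. k (x + y) * u y \<partial>lborel)"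

lemma integrable_shift:
  fixes k :: "real \<Rightarrow> complex"
  assumes "integrable lborel k" shows "integrable lborel (\<lambda>x. k (x + y))" "(\<integral>x. k (x + y) \<partial>lborel) = (\<integral>x. k x \<partial>lborel)"
  using lborel_integrable_real_affine[OF assms, of 1 y] lborel_integral_real_affine[of 1 k y] by (simp_all add: add.commute)

lemma hconv_product_integrable:
  fixes k u :: "real \<Rightarrow> complex"
  assumes k: "integrable lborel k" and u: "integrable lborel u"
  shows "integrable (lborel \<Otimes>\<^sub>M lborel) (\<lambda>(y, x). k (x + y) * u y)"
proof (rule lborel_pair.Fubini_integrable)
  have [measurable]: "k \<in> borel_measurable borel" "u \<in> borel_measurable borel"
    using borel_measurable_integrable[OF k] borel_measurable_integrable[OF u] by simp_all
  show "(\<lambda>(y, x). k (x + y) * u y) \<in> borel_measurable (lborel \<Otimes>\<^sub>M lborel)" by measurable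
  have n: "(\<integral>x. cmod (k (x + y)) \<partial>lborel) = (\<integral>x. cmod (k x) \<partial>lborel)" for y
    using lborel_integral_real_affine[of 1 "\<lambda>x. cmod (k x)" y] by (simp add: add.commute)
  show "integrable lborel (\<lambda>y. \<integral>x. norm (case (y, x) of (y, x) \<Rightarrow> k (x + y) * u y) \<partial>lborel)"
    using u by (simp add: norm_mult n)
  show "AE y in lborel. integrable lborel (\<lambda>x. case (y, x) of (y, x) \<Rightarrow> k (x + y) * u y)"
    using integrable_shift(1)[OF k] by simp
qed

lemma hconv_measurable [measurable]:
  assumes [measurable]: "k \<in> borel_measurable borel" "u \<in> borel_measurable borel"
  shows "hconv k u \<in> borel_measurable borel"
  unfolding hconv_def[abs_def] by measurable

lemma hconv_integrable:
  assumes k: "integrable lborel k" and u: "integrable lborel u"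
  shows "integrable lborel (hconv k u)"
  using lborel_pair.integrable_snd[OF hconv_product_integrable[OF k u]] by (simp add: hconv_def[abs_def])

text \<open>
  With $x + y$ in place of $x - y$ in the convolution, one of the two transforms is reflected.
\<close>

lemma ft_hconv:
  assumes k: "integrable lborel k" and u: "integrable lborel u"
  shows "of_real fc * ft (hconv k u) \<xi> = ft k \<xi> * ft u (- \<xi>)"
proof -
  have [measurable]: "k \<in> borel_measurable borel" "u \<in> borel_measurable borel"
    using borel_measurable_integrable[OF k] borel_measurable_integrable[OF u] by simp_all
  have int: "integrable (lborel \<Otimes>\<^sub>M lborel) (\<lambda>(y, x). k (x + y) * u y * ek (x * \<xi>))"
    by (rule Bochner_Integration.integrable_bound[OF hconv_product_integrable[OF k u]])
       (measurable, intro AE_I2, simp add: norm_mult case_prod_beta)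
  have "(\<integral>x. hconv k u x * ek (x * \<xi>) \<partial>lborel) = (\<integral>x. (\<integral>y. k (x + y) * u y * ek (x * \<xi>) \<partial>lborel) \<partial>lborel)"
    by (simp add: hconv_def)
  also have "\<dots> = (\<integral>y. (\<integral>x. k (x + y) * u y * ek (x * \<xi>) \<partial>lborel) \<partial>lborel)"
    using lborel_pair.Fubini_integral[OF int] by simp
  also have "\<dots> = (\<integral>y. (u y * ek (y * (- \<xi>))) * (\<integral>x. k x * ek (x * \<xi>) \<partial>lborel) \<partial>lborel)"
  proof (rule Bochner_Integration.integral_cong[OF refl])
    fix y
    have e: "ek (y * (- \<xi>)) * ek ((x + y) * \<xi>) = ek (x * \<xi>)" for x
      unfolding ek_add[symmetric] by (simp add: algebra_simps)
    have "k (x + y) * u y * ek (x * \<xi>) = (u y * ek (y * (- \<xi>))) * (k (x + y) * ek ((x + y) * \<xi>))" for x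
      unfolding e[of x, symmetric] by (simp only: mult_ac)
    then have "(\<integral>x. k (x + y) * u y * ek (x * \<xi>) \<partial>lborel) = (u y * ek (y * (- \<xi>))) * (\<integral>x. k (x + y) * ek ((x + y) * \<xi>) \<partial>lborel)"
      by (simp only: integral_mult_right_zero)
    also have "(\<integral>x. k (x + y) * ek ((x + y) * \<xi>) \<partial>lborel) = (\<integral>x. k x * ek (x * \<xi>) \<partial>lborel)"
      by (rule integrable_shift(2)[OF ek_integrable[OF k]])
    finally show "(\<integral>x. k (x + y) * u y * ek (x * \<xi>) \<partial>lborel) = (u y * ek (y * (- \<xi>))) * (\<integral>x. k x * ek (x * \<xi>) \<partial>lborel)" .
  qed
  finally have "(\<integral>x. hconv k u x * ek (x * \<xi>) \<partial>lborel) = (\<integral>y. u y * ek (y * (- \<xi>)) \<partial>lborel) * (\<integral>x. k x * ek (x * \<xi>) \<partial>lborel)"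
    by (simp only: integral_mult_left_zero)
  then show ?thesis unfolding ft_def by (simp only: mult_ac)
qed

definition K :: "real \<Rightarrow> complex" where "K x = of_real (kap x)"

lemma K_integrable: "integrable lborel K" "integrable lborel (\<lambda>x. of_real x * K x)"
proof -
  show "integrable lborel K" unfolding K_def[abs_def] using kap_integrable(1) by simp
  have "integrable lborel (\<lambda>x. complex_of_real (x * kap x))" by (rule integrable_of_real[OF kap_integrable(2)])
  then show "integrable lborel (\<lambda>x. of_real x * K x)" by (simp add: K_def)
qed

lemma K_measurable [measurable]: "K \<in> borel_measurable borel"
  unfolding K_def[abs_def] by measurable

lemma K_bound: "cmod (K x) \<le> 1"
  using kap_bounds[of x] by (simp add: K_def)

lemma ft_hconv_K:
  assumes "integrable lborel u" shows "ft (hconv K u) \<xi> = Gh (- \<xi>) * ft u (- \<xi>)"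
proof -
  have "of_real fc * ft (hconv K u) \<xi> = of_real fc * (Gh (- \<xi>) * ft u (- \<xi>))"
    using ft_hconv[OF K_integrable(1) assms, of \<xi>] ft_kap[of \<xi>] by (simp add: K_def[abs_def] mult.assoc)
  then show ?thesis using fc_pos by simp
qed

lemma K_mult_integrable:
  assumes u: "integrable lborel u" shows "integrable lborel (\<lambda>y. K (x + y) * u y)"
proof -
  have [measurable]: "u \<in> borel_measurable borel" using borel_measurable_integrable[OF u] by simp
  show ?thesis
    by (rule Bochner_Integration.integrable_bound[OF u]) (auto simp: norm_mult mult_left_le_one_le K_bound)
qed

lemma hconv_K_bound:
  assumes u: "integrable lborel u" shows "cmod (hconv K u x) \<le> (\<integral>y. cmod (u y) \<partial>lborel)"
proof -
  have "cmod (hconv K u x) \<le> (\<integral>y. cmod (K (x + y) * u y) \<partial>lborel)" unfolding hconv_def by (rule integral_norm_bound)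
  also have "\<dots> \<le> (\<integral>y. cmod (u y) \<partial>lborel)"
    by (intro integral_mono integrable_norm K_mult_integrable u) (auto simp: norm_mult mult_left_le_one_le K_bound)
  finally show ?thesis .
qed

lemma hconv_K_L2:
  assumes u: "integrable lborel u" shows "hconv K u \<in> L2 lborel"
proof (rule L2_dominated)
  let ?C = "\<integral>y. cmod (u y) \<partial>lborel"
  have [measurable]: "u \<in> borel_measurable borel" using borel_measurable_integrable[OF u] by simp
  show "integrable lborel (\<lambda>x. ?C * cmod (hconv K u x))"
    by (intro integrable_mult_right integrable_norm hconv_integrable K_integrable u)
  show "AE x in lborel. (cmod (hconv K u x))\<^sup>2 \<le> ?C * cmod (hconv K u x)"
    unfolding power2_eq_square by (intro AE_I2 mult_right_mono hconv_K_bound u) auto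
  show "hconv K u \<in> borel_measurable lborel" by measurable
qed

text \<open>
  Writing $x = (x + y) - y$ distributes the weight over the kernel and the function; this is how the integrability of
  $xu(x)$ passes to $Ku$.
\<close>

lemma x_hconv_K:
  assumes u: "integrable lborel u" "integrable lborel (\<lambda>y. of_real y * u y)"
  shows "of_real x * hconv K u x = hconv (\<lambda>z. of_real z * K z) u x - hconv K (\<lambda>y. of_real y * u y) x"
proof -
  have i1: "integrable lborel (\<lambda>y. of_real x * (K (x + y) * u y))" by (rule integrable_mult_right[OF K_mult_integrable[OF u(1)]])
  have i2: "integrable lborel (\<lambda>y. K (x + y) * (of_real y * u y))" by (rule K_mult_integrable[OF u(2)])
  have eq: "of_real (x + y) * K (x + y) * u y = of_real x * (K (x + y) * u y) + K (x + y) * (of_real y * u y)" for y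
    by (simp add: algebra_simps)
  have "hconv (\<lambda>z. of_real z * K z) u x = of_real x * hconv K u x + hconv K (\<lambda>y. of_real y * u y) x"
    unfolding hconv_def eq by (simp only: Bochner_Integration.integral_add[OF i1 i2] integral_mult_right_zero)
  then show ?thesis by simp
qed

lemma x_hconv_K_integrable:
  assumes u: "integrable lborel u" "integrable lborel (\<lambda>y. of_real y * u y)"
  shows "integrable lborel (\<lambda>x. of_real x * hconv K u x)"
  unfolding x_hconv_K[OF u] by (intro Bochner_Integration.integrable_diff hconv_integrable K_integrable u)

text \<open>
  The transform of $xr(x)$ is $i$ times the derivative of that of \<open>r\<close>, in integrated form: Fubini's theorem
  and $\int_a^b(-ix)e^{-ix\xi}\,d\xi = e^{-ixb} - e^{-ixa}$.
\<close>

lemma ft_primitive: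
  assumes r: "integrable lborel r" and xr: "integrable lborel (\<lambda>x. of_real x * r x)"
  shows "primitive (ft r) (ft (\<lambda>x. - \<i> * (of_real x * r x)))"
  unfolding primitive_def
proof (intro conjI allI impI)
  let ?s = "\<lambda>x. - \<i> * (of_real x * r x)"
  have s: "integrable lborel ?s" by (rule integrable_mult_right[OF xr])
  have [measurable]: "r \<in> borel_measurable borel" "?s \<in> borel_measurable borel"
    using borel_measurable_integrable[OF r] borel_measurable_integrable[OF s] by simp_all
  show "loc_integrable (ft ?s)"
    unfolding loc_integrable_def set_integrable_def
  proof (intro allI)
    fix a b :: real
    have "integrable lborel (\<lambda>\<xi>. indicator {a..b} \<xi> *\<^sub>R (fc * (\<integral>x. cmod (?s x) \<partial>lborel)))"
      using borel_integrable_atLeastAtMost'[of a b "\<lambda>_. fc * (\<integral>x. cmod (?s x) \<partial>lborel)"] by (simp add: set_integrable_def)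
    then show "integrable lborel (\<lambda>\<xi>. indicator {a..b} \<xi> *\<^sub>R ft ?s \<xi>)"
    proof (rule Bochner_Integration.integrable_bound)
      show "AE \<xi> in lborel. norm (indicator {a..b} \<xi> *\<^sub>R ft ?s \<xi>) \<le> norm (indicator {a..b} \<xi> *\<^sub>R (fc * (\<integral>x. cmod (?s x) \<partial>lborel)))"
        using ft_bound[OF s] by (intro AE_I2) (auto simp: indicator_def order_trans[OF _ abs_ge_self])
    qed measurable
  qed
  fix a b :: real assume ab: "a \<le> b"
  have inner: "(LINT \<xi>:{a..b}|lborel. - \<i> * of_real x * ek (x * \<xi>)) = ek (x * b) - ek (x * a)" for x
    using primitive_diff_eq[OF ek_primitive[of x] ab] by simp
  have int: "integrable (lborel \<Otimes>\<^sub>M lborel) (\<lambda>(\<xi>, x). indicator {a..b} \<xi> *\<^sub>R (?s x * ek (x * \<xi>)))"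
  proof (rule Bochner_Integration.integrable_bound)
    show "integrable (lborel \<Otimes>\<^sub>M lborel) (\<lambda>(\<xi>, x). complex_of_real (indicator {a..b} \<xi>) * ?s x)"
      by (intro integrable_tensor[OF _ s] integrable_of_real integrable_real_indicator) (auto simp: emeasure_lborel_Icc_eq)
    show "(\<lambda>(\<xi>, x). indicator {a..b} \<xi> *\<^sub>R (?s x * ek (x * \<xi>))) \<in> borel_measurable (lborel \<Otimes>\<^sub>M lborel)" by measurable
  qed (auto simp: norm_mult)
  have "(LINT \<xi>:{a..b}|lborel. ft ?s \<xi>) = of_real fc * (\<integral>\<xi>. (\<integral>x. indicator {a..b} \<xi> *\<^sub>R (?s x * ek (x * \<xi>)) \<partial>lborel) \<partial>lborel)"
  proof -
    have "indicator {a..b} \<xi> *\<^sub>R ft ?s \<xi> = of_real fc * (\<integral>x. indicator {a..b} \<xi> *\<^sub>R (?s x * ek (x * \<xi>)) \<partial>lborel)" for \<xi>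
      unfolding ft_def integral_scaleR_right by simp
    then show ?thesis unfolding set_lebesgue_integral_def by (simp only: integral_mult_right_zero)
  qed
  also have "\<dots> = of_real fc * (\<integral>x. (\<integral>\<xi>. indicator {a..b} \<xi> *\<^sub>R (?s x * ek (x * \<xi>)) \<partial>lborel) \<partial>lborel)"
    using lborel_pair.Fubini_integral[OF int] by simp
  also have "\<dots> = of_real fc * (\<integral>x. r x * ek (x * b) - r x * ek (x * a) \<partial>lborel)"
  proof -
    have "(\<integral>\<xi>. indicator {a..b} \<xi> *\<^sub>R (?s x * ek (x * \<xi>)) \<partial>lborel) = r x * ek (x * b) - r x * ek (x * a)" for x
    proof -
      have "indicator {a..b} \<xi> *\<^sub>R (?s x * ek (x * \<xi>)) = r x * (indicator {a..b} \<xi> *\<^sub>R (- \<i> * of_real x * ek (x * \<xi>)))" for \<xi>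
        by (simp add: scaleR_conv_of_real mult_ac)
      then show ?thesis using inner[of x] unfolding set_lebesgue_integral_def
        by (simp only: integral_mult_right_zero) (simp add: right_diff_distrib)
    qed
    then show ?thesis by simp
  qed
  also have "\<dots> = ft r b - ft r a"
    unfolding ft_def using ek_integrable[OF r] by (simp add: right_diff_distrib)
  finally show "ft r b - ft r a = (LINT \<xi>:{a..b}|lborel. ft ?s \<xi>)" ..
qed

lemma ft_reflect: "ft (\<lambda>x. u (- x)) \<xi> = ft u (- \<xi>)"
  unfolding ft_def using lborel_integral_real_affine[of "-1" "\<lambda>x. u x * ek (x * - \<xi>)" 0] by simp

lemma integrable_reflect:
  fixes u :: "real \<Rightarrow> complex"
  assumes "integrable lborel u" shows "integrable lborel (\<lambda>x. u (- x))"
  using lborel_integrable_real_affine[OF assms, of "-1" 0] by simp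

subsection \<open>Functions in $\mathcal{D}_0$ in logarithmic coordinates\<close>

lemma powr_integrable:
  fixes a :: real
  assumes a: "a > 1" shows "integrable lborel (\<lambda>x::real. (1 + \<bar>x\<bar>) powr (- a))"
proof -
  let ?g = "\<lambda>x::real. indicator {0..} x * (1 + x) powr (- a)"
  have lim: "((\<lambda>x::real. (1 + x) powr (1 - a) / (1 - a)) \<longlongrightarrow> 0) at_top"
  proof -
    have "((\<lambda>x::real. (1 + x) powr (1 - a)) \<longlongrightarrow> 0) at_top"
      by (rule tendsto_neg_powr) (use a in \<open>auto intro!: filterlim_tendsto_add_at_top[OF tendsto_const] filterlim_ident\<close>)
    from tendsto_divide[OF this tendsto_const[of "1 - a"]] show ?thesis using a by simp
  qed
  have "(\<integral>\<^sup>+x. ennreal ((1 + x) powr (- a)) * indicator {0..} x \<partial>(lborel :: real measure)) = ennreal (0 - (1 + 0) powr (1 - a) / (1 - a))"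
  proof (rule nn_integral_FTC_atLeast[OF _ _ _ lim])
    fix x :: real assume x: "0 \<le> x"
    have "((\<lambda>x. (1 + x) powr (1 - a)) has_real_derivative (1 - a) * (1 + x) powr (1 - a - 1)) (at x)"
      using x by (auto intro!: derivative_eq_intros)
    from DERIV_cdivide[OF this, of "1 - a"] show "((\<lambda>x. (1 + x) powr (1 - a) / (1 - a)) has_real_derivative (1 + x) powr - a) (at x)"
      using a by simp
  qed auto
  then have fin: "(\<integral>\<^sup>+x. ennreal ((1 + x) powr (- a)) * indicator {0..} x \<partial>(lborel :: real measure)) < \<infinity>" by simp
  have g: "integrable lborel ?g"
  proof (rule integrableI_bounded)
    have "(\<integral>\<^sup>+x. ennreal (norm (?g x)) \<partial>lborel) = (\<integral>\<^sup>+x. ennreal ((1 + x) powr (- a)) * indicator {0..} x \<partial>lborel)"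
      by (intro nn_integral_cong) (auto simp: indicator_def)
    then show "(\<integral>\<^sup>+x. ennreal (norm (?g x)) \<partial>lborel) < \<infinity>" using fin by simp
  qed measurable
  have "integrable lborel (\<lambda>x. ?g (0 + (-1) * x))" by (rule lborel_integrable_real_affine[OF g]) simp
  then have g': "integrable lborel (\<lambda>x. ?g (- x))" by simp
  show ?thesis
    by (rule Bochner_Integration.integrable_bound[OF Bochner_Integration.integrable_add[OF g g']])
       (auto simp: indicator_def)
qed

text \<open>
  In logarithmic coordinates the defining bound is $|u(x)|\le C(1 + |x|)^{-n}$.  As $n > 2$, both \<open>u\<close> and $xu(x)$ are
  integrable.
\<close>

lemma D0_log_coordinates:
  assumes f: "f \<in> D0_set 1"
  defines "u \<equiv> \<lambda>x. of_real (exp (x / 2)) * f (exp x)"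
  shows "(f, u) \<in> U_op" "u \<in> L2 lborel" "integrable lborel u" "integrable lborel (\<lambda>x. of_real x * u x)"
proof -
  obtain C n where fm[measurable]: "f \<in> borel_measurable lborel_plus" and n: "n > 2"
    and le: "AE t in lborel_plus. cmod (f t) \<le> C * t powr (-1/2) * (1 + \<bar>ln t\<bar>) powr (- n)"
    using f by (auto simp: D0_set_def)
  have um[measurable]: "u \<in> borel_measurable borel" unfolding u_def by measurable
  have ae: "AE x in lborel. cmod (u x) \<le> C * (1 + \<bar>x\<bar>) powr (- n)"
    using Uw.AE_compose[OF le]
  proof eventually_elim
    case (elim x)
    have "exp x powr (-1/2) = exp (- x / 2)" by (simp add: powr_def)
    then have "cmod (u x) \<le> exp (x / 2) * (C * exp (- x / 2) * (1 + \<bar>x\<bar>) powr (- n))"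
      using elim by (simp add: u_def norm_mult mult_left_mono)
    also have "\<dots> = C * (1 + \<bar>x\<bar>) powr (- n)" by (simp add: mult_ac exp_minus)
    finally show ?case .
  qed
  have ae_x: "AE x in lborel. \<bar>x\<bar> * cmod (u x) \<le> C * (1 + \<bar>x\<bar>) powr (- (n - 1))"
    using ae
  proof eventually_elim
    case (elim x)
    have C0: "0 \<le> C * (1 + \<bar>x\<bar>) powr (- n)" using elim norm_ge_zero order_trans by blast
    have "\<bar>x\<bar> * cmod (u x) \<le> (1 + \<bar>x\<bar>) * (C * (1 + \<bar>x\<bar>) powr (- n))" using elim C0 by (intro mult_mono) auto
    also have "\<dots> = C * ((1 + \<bar>x\<bar>) powr 1 * (1 + \<bar>x\<bar>) powr (- n))" by simp
    also have "\<dots> = C * (1 + \<bar>x\<bar>) powr (- (n - 1))" unfolding powr_add[symmetric] by simp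
    finally show ?case .
  qed
  show u1: "integrable lborel u"
    by (rule Bochner_Integration.integrable_bound[OF integrable_mult_right[OF powr_integrable[of n], of C]])
       (use ae n in \<open>auto elim!: eventually_mono intro: order_trans[OF _ abs_ge_self]\<close>)
  show "integrable lborel (\<lambda>x. of_real x * u x)"
    by (rule Bochner_Integration.integrable_bound[OF integrable_mult_right[OF powr_integrable[of "n - 1"], of C]])
       (use ae_x n in \<open>auto elim!: eventually_mono simp: norm_mult intro: order_trans[OF _ abs_ge_self]\<close>)
  show uL: "u \<in> L2 lborel"
  proof (rule L2_dominated)
    show "integrable lborel (\<lambda>x. \<bar>C\<bar> * cmod (u x))" using u1 by simp
    show "AE x in lborel. (cmod (u x))\<^sup>2 \<le> \<bar>C\<bar> * cmod (u x)"
      using ae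
    proof eventually_elim
      case (elim x)
      have "(1 + \<bar>x\<bar>) powr (- n) \<le> 1" using powr_mono[of "- n" 0 "1 + \<bar>x\<bar>"] n by (auto split: if_splits)
      then have "C * (1 + \<bar>x\<bar>) powr (- n) \<le> \<bar>C\<bar> * 1" by (intro mult_mono) auto
      then show ?case using elim unfolding power2_eq_square by (intro mult_right_mono) auto
    qed
  qed measurable
  have "(\<lambda>y. u (ln y) / of_real (exp (ln y / 2)), u) \<in> Uw.W" by (rule Uw.W_preimage[OF uL])
  then have L: "(\<lambda>y. u (ln y) / of_real (exp (ln y / 2))) \<in> L2 lborel_plus" by (simp add: Uw.W_iff)
  have "f \<in> L2 lborel_plus"
    by (rule L2_AE_cong[OF L fm], rule AE_I2) (simp add: u_def)
  then show "(f, u) \<in> U_op" unfolding U_op_eq Uw.W_iff using uL by (simp add: u_def)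
qed

text \<open>On $\mathcal{D}_0$, in logarithmic coordinates, the Hankel operator is the composition of \<open>K\<close>, the
  multiplication by \<open>q\<^sub>0 - q\<^sub>1 x\<close>, and \<open>K\<close> again, by the factorization of the kernel and Fubini's theorem.\<close>

lemma hankel_log_coordinates:
  fixes p0 q0 q1 :: real
  assumes f: "f \<in> D0_set 1" and q: "q0 = p0 - euler_mascheroni * q1"
  defines "u \<equiv> \<lambda>x. of_real (exp (x / 2)) * f (exp x)"
  defines "w \<equiv> \<lambda>z. (of_real q0 - of_real q1 * of_real z) * hconv K u z"
  shows "of_real (exp (x / 2)) * (\<integral>s. of_real ((p0 + q1 * ln (exp x + s)) * inverse (exp x + s)) * f s \<partial>lborel_plus) = hconv K w x"
    "integrable lborel w"
proof -
  have u: "(f, u) \<in> U_op" "u \<in> L2 lborel" "integrable lborel u" "integrable lborel (\<lambda>x. of_real x * u x)"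
    unfolding u_def by (rule D0_log_coordinates[OF f])+
  have fm[measurable]: "f \<in> borel_measurable lborel_plus" using f by (simp add: D0_set_def)
  have um[measurable]: "u \<in> borel_measurable borel" using borel_measurable_integrable[OF u(3)] by simp
  let ?h = "\<lambda>t. (p0 + q1 * ln t) * inverse t"
  have idm[measurable]: "(\<lambda>s. s) \<in> borel_measurable lborel_plus" unfolding lborel_plus_def by (intro measurable_restrict_space1) simp
  have hm: "(\<lambda>s. of_real (?h (exp x + s)) * f s) \<in> borel_measurable lborel_plus" by measurable
  have wi: "w = (\<lambda>z. of_real q0 * hconv K u z - of_real q1 * (of_real z * hconv K u z))"
    unfolding w_def by (auto simp: algebra_simps)
  show "integrable lborel w" unfolding wi
    by (intro Bochner_Integration.integrable_diff integrable_mult_right x_hconv_K_integrable hconv_integrable K_integrable u)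
  have "of_real (exp (x / 2)) * (\<integral>s. of_real (?h (exp x + s)) * f s \<partial>lborel_plus)
      = (\<integral>y. of_real (exp (x / 2)) * ((cmod (complex_of_real (exp (y / 2))))\<^sup>2 *\<^sub>R (of_real (?h (exp x + exp y)) * f (exp y))) \<partial>lborel)"
    unfolding Uw.integrable_iff(2)[OF hm] by (rule integral_mult_right_zero[symmetric])
  also have "\<dots> = (\<integral>y. of_real (exp (x / 2) * exp (y / 2) * ?h (exp x + exp y)) * u y \<partial>lborel)"
  proof (rule Bochner_Integration.integral_cong[OF refl])
    fix y
    have "(cmod (complex_of_real (exp (y / 2))))\<^sup>2 = exp (y / 2) * exp (y / 2)" by (simp add: power2_eq_square)
    then show "of_real (exp (x / 2)) * ((cmod (complex_of_real (exp (y / 2))))\<^sup>2 *\<^sub>R (of_real (?h (exp x + exp y)) * f (exp y)))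
        = of_real (exp (x / 2) * exp (y / 2) * ?h (exp x + exp y)) * u y"
      by (simp add: u_def scaleR_conv_of_real)
  qed
  also have "\<dots> = (\<integral>y. (\<integral>z. K (x + z) * (of_real q0 - of_real q1 * of_real z) * (K (z + y) * u y) \<partial>lborel) \<partial>lborel)"
  proof (rule Bochner_Integration.integral_cong[OF refl])
    fix y
    have "(\<integral>z. K (x + z) * (of_real q0 - of_real q1 * of_real z) * (K (z + y) * u y) \<partial>lborel)
        = (\<integral>z. complex_of_real (kap (x + z) * ((q0 - q1 * z) * kap (z + y))) * u y \<partial>lborel)"
      by (intro Bochner_Integration.integral_cong) (simp_all add: K_def mult_ac)
    also have "\<dots> = of_real (\<integral>z. kap (x + z) * ((q0 - q1 * z) * kap (z + y)) \<partial>lborel) * u y"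
      by (simp only: integral_mult_left_zero integral_complex_of_real)
    finally show "of_real (exp (x / 2) * exp (y / 2) * ?h (exp x + exp y)) * u y
        = (\<integral>z. K (x + z) * (of_real q0 - of_real q1 * of_real z) * (K (z + y) * u y) \<partial>lborel)"
      unfolding kernel_factorization[OF q] by simp
  qed
  also have "\<dots> = (\<integral>z. (\<integral>y. K (x + z) * (of_real q0 - of_real q1 * of_real z) * (K (z + y) * u y) \<partial>lborel) \<partial>lborel)"
  \<comment> \<open>The factor \<open>z\<close> is not bounded; it is split as $(z + y) - y$ to obtain three integrable products.\<close>
  proof (rule lborel_pair.Fubini_integral[symmetric])
    let ?P = "lborel \<Otimes>\<^sub>M lborel :: (real \<times> real) measure"
    let ?zu = "\<lambda>y. of_real y * u y"
    note i1 = hconv_product_integrable[OF K_integrable(1) u(3)]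
    note i2 = hconv_product_integrable[OF K_integrable(2) u(3)]
    note i3 = hconv_product_integrable[OF K_integrable(1) u(4)]
    have "integrable ?P (\<lambda>p. of_real q0 * (case p of (y, z) \<Rightarrow> K (z + y) * u y)
        - of_real q1 * ((case p of (y, z) \<Rightarrow> of_real (z + y) * K (z + y) * u y) - (case p of (y, z) \<Rightarrow> K (z + y) * (of_real y * u y))))"
      by (intro Bochner_Integration.integrable_diff integrable_mult_right i1 i2 i3)
    then have i: "integrable ?P (\<lambda>(y, z). (of_real q0 - of_real q1 * of_real z) * (K (z + y) * u y))"
      by (rule Bochner_Integration.integrable_cong[THEN iffD1, rotated -1]) (auto simp: algebra_simps)
    show "integrable ?P (\<lambda>(y, z). K (x + z) * (of_real q0 - of_real q1 * of_real z) * (K (z + y) * u y))"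
      by (rule Bochner_Integration.integrable_bound[OF i])
         (measurable, intro AE_I2, simp add: norm_mult mult_left_le_one_le K_bound mult.assoc case_prod_beta)
  qed
  also have "\<dots> = hconv K w x"
    unfolding w_def hconv_def
    by (simp only: integral_mult_right_zero mult.assoc)
  finally show "of_real (exp (x / 2)) * (\<integral>s. of_real (?h (exp x + s)) * f s \<partial>lborel_plus) = hconv K w x" .
qed

section \<open>Test functions in the image of $\mathcal{D}_0$\<close>

text \<open>
  Functions of class $C^n$ on the real line, with complex values.
\<close>

primrec Cn :: "nat \<Rightarrow> (real \<Rightarrow> complex) \<Rightarrow> bool" where
  "Cn 0 f \<longleftrightarrow> continuous_on UNIV f"
| "Cn (Suc n) f \<longleftrightarrow> (\<exists>f'. (\<forall>x. (f has_vector_derivative f' x) (at x)) \<and> Cn n f')"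

lemma Cn_SucI: "(\<And>x. (f has_vector_derivative f' x) (at x)) \<Longrightarrow> Cn n f' \<Longrightarrow> Cn (Suc n) f"
  by auto

lemma Cn_continuous: "Cn n f \<Longrightarrow> continuous_on UNIV f"
proof (cases n)
  case (Suc m)
  moreover assume "Cn n f"
  ultimately show ?thesis
    by (auto intro!: continuous_at_imp_continuous_on dest: has_vector_derivative_continuous)
qed simp

lemma Cn_Suc: "Cn (Suc n) f \<Longrightarrow> Cn n f"
proof (induction n arbitrary: f)
  case 0 then show ?case using Cn_continuous by (metis Cn.simps(1))
next
  case (Suc n)
  then obtain f' where "\<And>x. (f has_vector_derivative f' x) (at x)" "Cn (Suc n) f'" unfolding Cn.simps(2)[of "Suc n"] by blast
  then show ?case using Suc.IH by (intro Cn_SucI[of f f'])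
qed

lemma Cn_add: "Cn n f \<Longrightarrow> Cn n g \<Longrightarrow> Cn n (\<lambda>x. f x + g x)"
proof (induction n arbitrary: f g)
  case 0 then show ?case by (auto intro: continuous_intros)
next
  case (Suc n)
  then obtain f' g' where "\<And>x. (f has_vector_derivative f' x) (at x)" "Cn n f'" "\<And>x. (g has_vector_derivative g' x) (at x)" "Cn n g'"
    by auto
  then show ?case using Suc.IH by (intro Cn_SucI[of _ "\<lambda>x. f' x + g' x"] has_vector_derivative_add)
qed

lemma Cn_mult: "Cn n f \<Longrightarrow> Cn n g \<Longrightarrow> Cn n (\<lambda>x. f x * g x)"
proof (induction n arbitrary: f g)
  case 0 then show ?case by (auto intro: continuous_intros)
next
  case (Suc n)
  then obtain f' g' where d: "\<And>x. (f has_vector_derivative f' x) (at x)" "Cn n f'" "\<And>x. (g has_vector_derivative g' x) (at x)" "Cn n g'"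
    by auto
  have "Cn n (\<lambda>x. f x * g' x + f' x * g x)" using d Cn_Suc Suc.prems by (intro Cn_add Suc.IH) auto
  then show ?case by (rule Cn_SucI[OF has_vector_derivative_mult[OF d(1,3)]])
qed

lemma Cn_const: "Cn n (\<lambda>x. c)"
proof (induction n arbitrary: c)
  case (Suc n) show ?case by (rule Cn_SucI[OF has_vector_derivative_const Suc.IH])
qed simp

lemma Cn_ek: "Cn n (\<lambda>x. ek (a * x))"
proof (induction n)
  case 0 then show ?case by (auto intro: continuous_intros)
next
  case (Suc n)
  then show ?case by (intro Cn_SucI[OF ek_has_derivative] Cn_mult Cn_const)
qed

lemma line_has_vector_derivative:
  assumes "(g has_field_derivative g') (at (1/2 + \<i> * of_real x))"
  shows "((\<lambda>x. g (1/2 + \<i> * of_real x)) has_vector_derivative g' * \<i>) (at x)"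
proof -
  have "((\<lambda>x. 1/2 + \<i> * complex_of_real x) has_vector_derivative \<i>) (at x)"
    by (auto intro!: derivative_eq_intros)
  from field_vector_diff_chain_at[OF this assms] show ?thesis by (simp add: o_def mult.commute)
qed

lemma Cn_Polygamma: "Cn n (\<lambda>x. Polygamma k (1/2 + \<i> * of_real x))"
proof (induction n arbitrary: k)
  case 0
  have "isCont (\<lambda>x. Polygamma k (1/2 + \<i> * of_real x)) x" for x
    using has_vector_derivative_continuous[OF line_has_vector_derivative[OF has_field_derivative_Polygamma[OF half_not_nonpos]]] .
  then show ?case by (simp add: continuous_at_imp_continuous_on)
next
  case (Suc n)
  show ?case
    by (rule Cn_SucI[OF line_has_vector_derivative[OF has_field_derivative_Polygamma[OF half_not_nonpos]]])
       (intro Cn_mult Cn_const Suc.IH)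
qed

lemma Cn_rGamma: "Cn n (\<lambda>x. rGamma (1/2 + \<i> * of_real x))"
proof (induction n)
  case 0
  have "(rGamma has_field_derivative - rGamma z * Digamma z) (at z)" if "z \<notin> \<int>\<^sub>\<le>\<^sub>0" for z :: complex
    using has_field_derivative_rGamma[of z UNIV] that by simp
  from has_vector_derivative_continuous[OF line_has_vector_derivative[OF this[OF half_not_nonpos]]]
  have "isCont (\<lambda>x. rGamma (1/2 + \<i> * of_real x)) x" for x .
  then show ?case by (simp add: continuous_at_imp_continuous_on)
next
  case (Suc n)
  have D: "(rGamma has_field_derivative - rGamma z * Digamma z) (at z)" if "z \<notin> \<int>\<^sub>\<le>\<^sub>0" for z :: complex
    using has_field_derivative_rGamma[of z UNIV] that by simp
  have "Cn n (\<lambda>x. (- 1) * rGamma (1/2 + \<i> * of_real x) * Digamma (1/2 + \<i> * of_real x) * \<i>)"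
    by (intro Cn_mult Cn_const Suc.IH Cn_Polygamma)
  then have "Cn n (\<lambda>x. - rGamma (1/2 + \<i> * of_real x) * Digamma (1/2 + \<i> * of_real x) * \<i>)" by simp
  then show ?case by (rule Cn_SucI[OF line_has_vector_derivative[OF D[OF half_not_nonpos]]])
qed

lemma Cn_hyperbolic: "Cn n (\<lambda>x. of_real (cosh (pi * x))) \<and> Cn n (\<lambda>x. of_real (sinh (pi * x)))"
proof (induction n)
  case 0 show ?case by (auto intro!: continuous_intros)
next
  case (Suc n)
  have d: "((\<lambda>x. cosh (pi * x)) has_real_derivative pi * sinh (pi * x)) (at x)"
    "((\<lambda>x. sinh (pi * x)) has_real_derivative pi * cosh (pi * x)) (at x)" for x
    by (auto intro!: derivative_eq_intros)
  have "Cn n (\<lambda>x. of_real pi * of_real (sinh (pi * x)))" "Cn n (\<lambda>x. of_real pi * of_real (cosh (pi * x)))"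
    using Suc by (auto intro!: Cn_mult Cn_const)
  then have c: "Cn n (\<lambda>x. of_real (pi * sinh (pi * x)))" "Cn n (\<lambda>x. of_real (pi * cosh (pi * x)))" by simp_all
  show ?case
    by (intro conjI Cn_SucI[OF has_vector_derivative_of_real[OF d(1)] c(1)] Cn_SucI[OF has_vector_derivative_of_real[OF d(2)] c(2)])
qed

lemma Cn_compose:
  assumes X: "\<And>x. (X has_real_derivative X' x) (at x)" and X': "\<And>n. Cn n (\<lambda>x. of_real (X' x))"
  shows "Cn n f \<Longrightarrow> Cn n (\<lambda>x. f (X x))"
proof (induction n arbitrary: f)
  case 0
  have "continuous_on UNIV X" by (intro continuous_at_imp_continuous_on ballI DERIV_isCont[OF X])
  then show ?case using 0 by (auto intro: continuous_on_compose2)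
next
  case (Suc n)
  then obtain f' where f: "\<And>x. (f has_vector_derivative f' x) (at x)" "Cn n f'" by auto
  have "((\<lambda>x. f (X x)) has_vector_derivative of_real (X' x) * f' (X x)) (at x)" for x
    using vector_diff_chain_at[OF X[unfolded has_real_derivative_iff_has_vector_derivative] f(1)[of "X x"]]
    by (simp add: o_def scaleR_conv_of_real)
  then show ?case by (rule Cn_SucI) (intro Cn_mult X' Suc.IH f(2))
qed

lemma Cn_test_fun: "smooth \<phi> \<Longrightarrow> Cn n (\<lambda>x. of_real (\<phi> x))"
proof (induction n arbitrary: \<phi>)
  case 0 then show ?case using smooth_continuous by (auto intro!: continuous_intros)
next
  case (Suc n)
  show ?case
    by (rule Cn_SucI[OF has_vector_derivative_of_real[OF smooth_has_derivative[OF Suc.prems]] Suc.IH[OF smooth_deriv[OF Suc.prems]]])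
qed

lemma derivative_outside_support:
  fixes f :: "real \<Rightarrow> complex"
  assumes f: "\<And>x. (f has_vector_derivative f' x) (at x)" and R: "\<And>x. R \<le> \<bar>x\<bar> \<Longrightarrow> f x = 0" and x: "R < \<bar>x\<bar>"
  shows "f' x = 0"
proof -
  have "((\<lambda>_. 0) has_vector_derivative (0::complex)) (at x)" by simp
  then have "(f has_vector_derivative 0) (at x)"
  proof (rule has_vector_derivative_transform_within_open)
    show "open {y::real. R < \<bar>y\<bar>}" by (intro open_Collect_less continuous_intros)
  qed (use R x in auto)
  then show ?thesis using vector_derivative_unique_at[OF f] by blast
qed

text \<open>
  Each derivative contributes a factor $\xi$ to the transform and keeps the compact support.
\<close>

lemma ft_compact_support_decay:
  assumes "Cn n f" "\<And>x. R \<le> \<bar>x\<bar> \<Longrightarrow> f x = 0"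
  shows "\<exists>B. \<forall>\<xi>. \<bar>\<xi>\<bar> ^ n * cmod (ft f \<xi>) \<le> B"
  using assms
proof (induction n arbitrary: f R)
  case 0
  have "integrable lborel f" by (rule continuous_compact_support_L2(2)[of f R]) (use 0 in auto)
  then show ?case using ft_bound by auto
next
  case (Suc n)
  then obtain f' where f: "\<And>x. (f has_vector_derivative f' x) (at x)" "Cn n f'" by auto
  have z: "f x = 0" if "R + 1 \<le> \<bar>x\<bar>" for x using that Suc.prems(2) by simp
  have z': "f' x = 0" if "R + 1 \<le> \<bar>x\<bar>" for x by (rule derivative_outside_support[OF f(1) Suc.prems(2)]) (use that in auto)
  have i: "integrable lborel f" "integrable lborel f'"
    using continuous_compact_support_L2(2)[OF Cn_continuous[OF Suc.prems(1)] z] continuous_compact_support_L2(2)[OF Cn_continuous[OF f(2)] z'] by auto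
  obtain B where B: "\<And>\<xi>. \<bar>\<xi>\<bar> ^ n * cmod (ft f' \<xi>) \<le> B" using Suc.IH[OF f(2) z'] by blast
  have "ft f' \<xi> = \<i> * of_real \<xi> * ft f \<xi>" for \<xi>
    by (rule ft_derivative[OF primitive_of_C1[OF f(1) Cn_continuous[OF f(2)]] i])
  then have "\<bar>\<xi>\<bar> ^ Suc n * cmod (ft f \<xi>) \<le> B" for \<xi> using B[of \<xi>] by (simp add: norm_mult mult_ac)
  then show ?case by blast
qed

lemma Xf_mono: "x \<le> y \<Longrightarrow> Xf x \<le> Xf y"
  using DERIV_nonneg_imp_nondecreasing[of x y Xf] Xf_has_derivative by (metis inverse_nonnegative_iff_nonnegative zero_le_power2)

lemma Xf_minus: "Xf (- x) = - Xf x"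
  by (simp add: Xf_def)

text \<open>
  The image of a test function under \<open>T\<close> is the image under \<open>F\<close> of an element of $\mathcal{D}_0$.  Divided
  by the phase $\Gamma(1/2 + i\xi)/v(\xi)$ of \<open>F\<close> it is $e^{ic\xi}\tau(X(\xi))/\Gamma(1/2 + i\xi)$ with the change of variable \<open>X\<close> of
  \<open>T\<close>, which is smooth with compact support; its inverse Fourier transform, the element in logarithmic
  coordinates, decays faster than $(1 + |x|)^{-2}$.
\<close>

lemma test_function_in_D0_image:
  assumes t: "complex_test \<tau> \<tau>'"
  shows "\<exists>f\<in>D0_set 1. (f, \<lambda>\<xi>. T_weight c \<xi> * \<tau> (Xf \<xi>)) \<in> F_op"
proof -
  obtain \<phi> \<psi> where ph: "test_fun \<phi>" "test_fun \<psi>" and \<tau>: "\<tau> = (\<lambda>x. of_real (\<phi> x) + \<i> * of_real (\<psi> x))"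
    using t by (auto simp: complex_test_def)
  have C\<tau>: "Cn n \<tau>" for n unfolding \<tau> using ph by (intro Cn_add Cn_mult Cn_const Cn_test_fun) (auto simp: test_fun_smooth)
  obtain R1 where R1: "\<And>x. R1 \<le> \<bar>x\<bar> \<Longrightarrow> \<phi> x = 0" using test_fun_support[OF ph(1)] by metis
  obtain R2 where R2: "\<And>x. R2 \<le> \<bar>x\<bar> \<Longrightarrow> \<psi> x = 0" using test_fun_support[OF ph(2)] by metis
  define R where "R = \<bar>R1\<bar> + \<bar>R2\<bar>"
  have supp: "\<tau> x = 0" if "R \<le> \<bar>x\<bar>" for x using that R1 R2 by (simp add: \<tau> R_def)
  define p where "p \<xi> = ek (- c * \<xi>) * \<tau> (Xf \<xi>) * rGamma (1/2 + \<i> * of_real \<xi>)" for \<xi>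
  have "Cn n (\<lambda>\<xi>. complex_of_real (inverse ((v_fun \<xi>)\<^sup>2)))" for n
  proof -
    have "Cn n (\<lambda>\<xi>. of_real (inverse pi) * complex_of_real (cosh (pi * \<xi>)))" using Cn_hyperbolic by (intro Cn_mult Cn_const) blast
    then show ?thesis unfolding v_inverse_sq by (simp add: divide_inverse mult.commute)
  qed
  then have "Cn n (\<lambda>\<xi>. \<tau> (Xf \<xi>))" for n by (rule Cn_compose[OF Xf_has_derivative]) (rule C\<tau>)
  then have Cp: "Cn n p" for n unfolding p_def[abs_def] by (intro Cn_mult Cn_ek Cn_rGamma)
  have psupp: "p x = 0" if "\<bar>Yf R\<bar> \<le> \<bar>x\<bar>" for x
  proof -
    have "R \<le> Xf \<bar>x\<bar>" using Xf_mono[of "Yf R" "\<bar>x\<bar>"] that by simp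
    then have "R \<le> \<bar>Xf x\<bar>" using Xf_minus[of x] by (cases "x \<ge> 0") auto
    then show ?thesis using supp by (simp add: p_def)
  qed
  have pL: "p \<in> L2 lborel" "integrable lborel p" using continuous_compact_support_L2[OF Cn_continuous[OF Cp] psupp] by auto
  \<comment> \<open>The exponents \<open>0\<close> and \<open>3\<close> together give decay like $(1 + |x|)^{-3}$, and $\mathcal{D}_0$ requires an exponent above
    \<open>2\<close>.\<close>
  obtain B0 where B0: "\<And>\<xi>. cmod (ft p \<xi>) \<le> B0" using ft_compact_support_decay[OF Cp[of 0] psupp] by auto
  obtain B3 where B3: "\<And>\<xi>. \<bar>\<xi>\<bar> ^ 3 * cmod (ft p \<xi>) \<le> B3" using ft_compact_support_decay[OF Cp[of 3] psupp] by auto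
  define u where "u x = ft p (- x)" for x
  define C where "C = 8 * (B0 + B3)"
  have dec: "cmod (u x) \<le> C * (1 + \<bar>x\<bar>) powr (- 3)" for x
  proof -
    have "(1 + \<bar>x\<bar>) ^ 3 \<le> 8 * (1 + \<bar>x\<bar> ^ 3)"
    proof (cases "\<bar>x\<bar> \<le> 1")
      case True
      then have "(1 + \<bar>x\<bar>) ^ 3 \<le> 2 ^ 3" by (intro power_mono) auto
      also have "(2::real) ^ 3 = 8 * 1" by simp
      also have "8 * (1::real) \<le> 8 * (1 + \<bar>x\<bar> ^ 3)" by (intro mult_left_mono) simp_all
      finally show ?thesis .
    next
      case False
      then have "(1 + \<bar>x\<bar>) ^ 3 \<le> (2 * \<bar>x\<bar>) ^ 3" by (intro power_mono) auto
      then show ?thesis by (simp add: power_mult_distrib)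
    qed
    then have "(1 + \<bar>x\<bar>) ^ 3 * cmod (u x) \<le> 8 * (1 + \<bar>x\<bar> ^ 3) * cmod (u x)" by (rule mult_right_mono) simp
    also have "\<dots> \<le> C" using B0[of "- x"] B3[of "- x"] by (simp add: u_def C_def algebra_simps)
    finally have "cmod (u x) \<le> C / (1 + \<bar>x\<bar>) ^ 3" by (simp add: pos_le_divide_eq mult.commute)
    also have "\<dots> = C * (1 + \<bar>x\<bar>) powr (- 3)" by (simp add: powr_minus divide_inverse powr_numeral)
    finally show ?thesis .
  qed
  have um[measurable]: "u \<in> borel_measurable borel" unfolding u_def[abs_def] using L2_lborel_measurable[OF pL(1)] by measurable
  have ui: "integrable lborel u"
    by (rule Bochner_Integration.integrable_bound[OF integrable_mult_right[OF powr_integrable[of 3], of C]])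
       (use dec in \<open>auto intro: order_trans[OF _ abs_ge_self]\<close>)
  have uL: "u \<in> L2 lborel"
  proof (rule L2_dominated)
    show "integrable lborel (\<lambda>x. B0 * cmod (u x))" using ui by simp
    show "AE x in lborel. (cmod (u x))\<^sup>2 \<le> B0 * cmod (u x)"
      unfolding power2_eq_square u_def by (intro AE_I2 mult_right_mono B0) simp
  qed measurable
  have inv: "AE x in lborel. ft u x = p x"
    using fourier_inversion[OF pL] uL ui unfolding u_def[abs_def] by blast
  define f where "f y = u (ln y) / complex_of_real (exp (ln y / 2))" for y
  have fU: "(f, u) \<in> U_op" unfolding U_op_eq f_def[abs_def] by (rule Uw.W_preimage[OF uL])
  then have fm: "f \<in> borel_measurable lborel_plus" unfolding U_op_eq Uw.W_iff using L2_measurable by blast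
  have "f \<in> D0_set 1" unfolding D0_set_def
  proof (rule CollectI, rule conjI[OF fm], rule exI[of _ C], rule exI[of _ 3], rule conjI)
    show "AE t in lborel_plus. cmod (f t) \<le> C * t powr (-1/2) * (1 + \<bar>ln t\<bar>) powr (- 3)"
    proof (rule AE_I2)
      fix t assume "t \<in> space lborel_plus"
      then have t: "t > 0" by simp
      have tp: "t powr (-1/2) = inverse (exp (ln t / 2))" using t by (simp add: powr_def exp_minus[symmetric])
      have n: "cmod (f t) = cmod (u (ln t)) * inverse (exp (ln t / 2))" by (simp add: f_def norm_divide inverse_eq_divide)
      have "cmod (f t) \<le> C * (1 + \<bar>ln t\<bar>) powr (- 3) * inverse (exp (ln t / 2))"
        unfolding n by (rule mult_right_mono[OF dec]) simp
      then show "cmod (f t) \<le> C * t powr (-1/2) * (1 + \<bar>ln t\<bar>) powr (- 3)"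
        unfolding tp by (simp only: mult_ac)
    qed
  qed simp
  moreover have "(f, \<lambda>\<xi>. T_weight c \<xi> * \<tau> (Xf \<xi>)) \<in> F_op"
  proof -
    have eq: "phase \<xi> * p \<xi> = T_weight c \<xi> * \<tau> (Xf \<xi>)" for \<xi>
    proof -
      have 1: "Gh \<xi> * rGamma (1/2 + \<i> * of_real \<xi>) = 1"
        using Gh_nonzero[of \<xi>] by (simp add: Gh_def Gamma_def)
      have "phase \<xi> * p \<xi> = (Gh \<xi> * rGamma (1/2 + \<i> * of_real \<xi>)) * (of_real (inverse (v_fun \<xi>)) * ek (- c * \<xi>) * \<tau> (Xf \<xi>))"
        by (simp only: phase_def p_def divide_inverse[of "Gh \<xi>"] of_real_inverse mult_ac)
      then have "phase \<xi> * p \<xi> = of_real (inverse (v_fun \<xi>)) * ek (- c * \<xi>) * \<tau> (Xf \<xi>)"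
        unfolding 1 by simp
      then show ?thesis by (simp add: T_weight_def ek_def)
    qed
    have ftu: "ft u \<in> L2 lborel" by (rule Plancherel(1)[OF ui uL])
    have "AE x in lborel. T_weight c x * \<tau> (Xf x) = phase x * ft u x"
      using inv by eventually_elim (simp add: eq[symmetric])
    moreover have "(\<lambda>\<xi>. T_weight c \<xi> * \<tau> (Xf \<xi>)) \<in> L2 lborel"
      unfolding eq[symmetric] using Pw.W_in_L2[OF pL(1)] .
    ultimately have "(ft u, \<lambda>\<xi>. T_weight c \<xi> * \<tau> (Xf \<xi>)) \<in> gamma_phase_op"
      unfolding gamma_phase_op_eq Pw.W_iff using ftu by simp
    then show ?thesis unfolding F_op_def using fU fourier_op_L1_L2[OF uL ui] by blast
  qed
  ultimately show ?thesis by blast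
qed

section \<open>The diagonalization\<close>

definition hankel_on_D0 :: "real \<Rightarrow> real \<Rightarrow> (real, real) l2op" where
  "hankel_on_D0 p0 p1 = op_restrict (op_of lborel_plus lborel_plus
     (\<lambda>f t. \<integral>s. of_real ((p0 + p1 * ln (t + s)) * inverse (t + s)) * f s \<partial>lborel_plus)) (D0_set 1)"

lemma hankel_op_closure:
  "hankel_op 1 (\<lambda>t. (p0 + p1 * ln t) * inverse t) = op_closure lborel_plus lborel_plus (hankel_on_D0 p0 p1)"
  unfolding hankel_op_def hankel_on_D0_def ..

text \<open>The unitary operator $T^*F$, which takes \<open>H\<close> to \<open>q\<^sub>1 D\<close>.\<close>

definition S_op :: "real \<Rightarrow> real \<Rightarrow> (real, real) l2op" where
  "S_op q0 q1 = F_op O (T_op q0 q1)\<inverse>"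

lemma l2_unitary_S: "l2_unitary lborel_plus lborel (S_op q0 q1)"
  unfolding S_op_def by (rule l2_unitary_comp[OF l2_unitary_F l2_unitary.converse[OF l2_unitary_T]])

text \<open>
  The identity $vQ(D)v = q_1TDT^*$.  Here \<open>P\<close> stands for $vw$, with the derivative \<open>p\<close>, so that the second function
  is $q_1^{-1}vQ(D)vw$.  If \<open>X\<close> is the change of variable of \<open>T\<close>, then $w = Ta$ means
  $a(X(\xi)) = P(\xi)e^{-iq_0q_1^{-1}\xi}$.  Applying $i\,d/d\xi$ to the right-hand side produces
  $(q_0q_1^{-1}P + ip)e^{-iq_0q_1^{-1}\xi}$, and $v^{-2}(Da)(X(\xi))$ to the left.
\<close>

lemma T_intertwines:
  fixes q0 q1 :: real
  assumes P: "primitive P p"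
    and w: "(\<lambda>\<xi>. inverse (of_real (v_fun \<xi>)) * P \<xi>) \<in> L2 lborel"
    and z: "(\<lambda>\<xi>. of_real (v_fun \<xi>) * (of_real (q0 / q1) * P \<xi> + \<i> * p \<xi>)) \<in> L2 lborel"
  obtains a b where "(a, \<lambda>\<xi>. inverse (of_real (v_fun \<xi>)) * P \<xi>) \<in> T_op q0 q1"
    "(b, \<lambda>\<xi>. of_real (v_fun \<xi>) * (of_real (q0 / q1) * P \<xi> + \<i> * p \<xi>)) \<in> T_op q0 q1" "(a, b) \<in> D_op"
proof -
  define c where "c = q0 / q1"
  interpret T: weighted_composition lborel lborel Xf Yf "T_weight c" by (rule T_weighted_composition)
  interpret Tu: l2_unitary lborel lborel "T_op q0 q1" by (rule l2_unitary_T)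
  let ?w = "\<lambda>\<xi>. inverse (of_real (v_fun \<xi>)) * P \<xi>"
  let ?z = "\<lambda>\<xi>. of_real (v_fun \<xi>) * (of_real c * P \<xi> + \<i> * p \<xi>)"
  define a where "a y = ?w (Yf y) / T_weight c (Yf y)" for y
  define b where "b y = ?z (Yf y) / T_weight c (Yf y)" for y
  have Ta: "(a, ?w) \<in> T_op q0 q1" and Tb: "(b, ?z) \<in> T_op q0 q1"
    unfolding T_op_eq c_def[symmetric] a_def[abs_def] b_def[abs_def]
    by (rule T.W_preimage[OF w], rule T.W_preimage[OF z[folded c_def]])
  have vnz: "complex_of_real (v_fun \<xi>) \<noteq> 0" for \<xi> using v_pos[of \<xi>] by simp
  have Tw: "inverse (T_weight c \<xi>) = of_real (v_fun \<xi>) * ek (c * \<xi>)" for \<xi>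
    using vnz[of \<xi>] by (simp add: T_weight_def ek_def exp_minus)
  have a_eq: "a y = P (Yf y) * ek (c * Yf y)" for y
    using vnz[of "Yf y"] by (simp add: a_def divide_inverse[of _ "T_weight _ _"] Tw)
  have b_eq: "b y = of_real ((v_fun (Yf y))\<^sup>2) * ((of_real c * P (Yf y) + \<i> * p (Yf y)) * ek (c * Yf y))" for y
    unfolding b_def divide_inverse[of _ "T_weight _ _"] Tw by (simp add: power2_eq_square)
  let ?p = "\<lambda>\<xi>. P \<xi> * (- \<i> * of_real c * ek (c * \<xi>)) + p \<xi> * ek (c * \<xi>)"
  have "primitive (\<lambda>y. P (Yf y) * ek (c * Yf y)) (\<lambda>y. of_real ((v_fun (Yf y))\<^sup>2) * ?p (Yf y))"
    by (rule primitive_compose[OF primitive_mult[OF P ek_primitive] Yf_has_derivative])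
       (auto intro!: continuous_intros continuous_on_compose2[OF v_continuous[of UNIV] Yf_continuous])
  moreover have "(\<lambda>y. P (Yf y) * ek (c * Yf y)) = a" by (simp add: a_eq[abs_def])
  moreover have "(\<lambda>y. of_real ((v_fun (Yf y))\<^sup>2) * ?p (Yf y)) = (\<lambda>y. - \<i> * b y)"
  proof (intro ext)
    fix y
    have "- \<i> * (X * ((C * M + \<i> * M') * e)) = X * (M * (- \<i> * C * e) + M' * e)" for X C M M' e :: complex
      by (simp add: algebra_simps)
    then show "of_real ((v_fun (Yf y))\<^sup>2) * ?p (Yf y) = - \<i> * b y" unfolding b_eq by (simp only:)
  qed
  ultimately have "primitive a (\<lambda>y. - \<i> * b y)" by simp
  then have "(a, b) \<in> D_op" unfolding D_op_iff using Tu.in_L2(1)[OF Ta] Tu.in_L2(1)[OF Tb] by auto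
  with Ta Tb show ?thesis unfolding c_def by (rule that)
qed

text \<open>
  By the transform of \<open>K\<close>, the operator \<open>F\<close> takes \<open>f\<close> to $v^{-1}m$ and the Hankel transform of \<open>f\<close> to $vQ(D)m$, where
  $m(\xi) = \Gamma(1/2 + i\xi)(\Phi u)(\xi)$ and \<open>u\<close> is \<open>f\<close> in logarithmic coordinates.
\<close>

lemma hankel_on_D0_maps_to_D:
  fixes p0 q0 q1 :: real
  assumes f: "f \<in> D0_set 1" and q: "q0 = p0 - euler_mascheroni * q1" and q1: "q1 \<noteq> 0"
  obtains g a b where "(f, g) \<in> hankel_on_D0 p0 q1" "(f, a) \<in> S_op q0 q1" "(g, \<lambda>x. of_real q1 * b x) \<in> S_op q0 q1" "(a, b) \<in> D_op"
proof -
  interpret F: l2_unitary lborel_plus lborel F_op by (rule l2_unitary_F)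
  interpret Tu: l2_unitary lborel lborel "T_op q0 q1" by (rule l2_unitary_T)
  define u where "u x = of_real (exp (x / 2)) * f (exp x)" for x
  have u: "(f, u) \<in> U_op" "u \<in> L2 lborel" "integrable lborel u" "integrable lborel (\<lambda>x. of_real x * u x)"
    unfolding u_def by (rule D0_log_coordinates[OF f])+
  define w where "w z = (of_real q0 - of_real q1 * of_real z) * hconv K u z" for z
  have w: "integrable lborel w" unfolding w_def u_def by (rule hankel_log_coordinates(2)[OF f q])
  have hank: "of_real (exp (x / 2)) * (\<integral>s. of_real ((p0 + q1 * ln (exp x + s)) * inverse (exp x + s)) * f s \<partial>lborel_plus) = hconv K w x" for x
    unfolding w_def u_def by (rule hankel_log_coordinates(1)[OF f q])
  define k where "k = hconv K w"
  have k: "k \<in> L2 lborel" "integrable lborel k" unfolding k_def by (intro hconv_K_L2 hconv_integrable K_integrable w)+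
  define g where "g y = k (ln y) / complex_of_real (exp (ln y / 2))" for y
  have gU: "(g, k) \<in> U_op" unfolding U_op_eq g_def[abs_def] by (rule Uw.W_preimage[OF k(1)])
  have gH: "(f, g) \<in> hankel_on_D0 p0 q1"
  proof -
    have "f \<in> L2 lborel_plus" "g \<in> L2 lborel_plus" using u(1) gU unfolding U_op_eq Uw.W_iff by auto
    moreover have "AE t in lborel_plus. g t = (\<integral>s. of_real ((p0 + q1 * ln (t + s)) * inverse (t + s)) * f s \<partial>lborel_plus)"
    proof (rule AE_I2)
      fix t assume "t \<in> space lborel_plus"
      then have e: "exp (ln t) = t" by simp
      show "g t = (\<integral>s. of_real ((p0 + q1 * ln (t + s)) * inverse (t + s)) * f s \<partial>lborel_plus)"
        unfolding g_def k_def hank[symmetric] e by simp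
    qed
    ultimately show ?thesis using f by (simp add: hankel_on_D0_def op_restrict_def op_of_def)
  qed
  define m where "m \<xi> = Gh \<xi> * ft u \<xi>" for \<xi>
  \<comment> \<open>The reflection cancels the one in the transform of \<open>K u\<close>, so that \<open>m\<close> is itself a Fourier transform, and
    $xr(x)$ is integrable; hence \<open>m\<close> is absolutely continuous.\<close>
  define r where "r x = hconv K u (- x)" for x
  have hu: "integrable lborel (hconv K u)" by (intro hconv_integrable K_integrable u)
  have r: "integrable lborel r" unfolding r_def by (rule integrable_reflect[OF hu])
  have xr: "integrable lborel (\<lambda>x. of_real x * r x)"
    using integrable_mult_right[OF integrable_reflect[OF x_hconv_K_integrable[OF u(3,4)]], of "-1"] by (simp add: r_def)
  have ftr: "ft r = m" unfolding r_def[abs_def] m_def[abs_def] by (intro ext) (simp add: ft_reflect ft_hconv_K[OF u(3)])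
  define m' where "m' = ft (\<lambda>x. - \<i> * (of_real x * r x))"
  have Pm: "primitive m m'" unfolding m'_def ftr[symmetric] by (rule ft_primitive[OF r xr])
  have ftw: "of_real q0 * m \<xi> + of_real q1 * (\<i> * m' \<xi>) = ft w (- \<xi>)" for \<xi>
  proof -
    have "ft w (- \<xi>) = ft (\<lambda>x. w (- x)) \<xi>" by (simp add: ft_reflect)
    also have "(\<lambda>x. w (- x)) = (\<lambda>x. (of_real q0 * r x) + (of_real q1 * \<i>) * (- \<i> * (of_real x * r x)))"
    proof (intro ext)
      fix x
      have "(of_real q1 * \<i>) * (- \<i> * (of_real x * r x)) = of_real q1 * (of_real x * r x)"
        by (metis (no_types, lifting) mult.assoc mult_minus_right complex_i_mult_minus minus_mult_minus mult_minus_left)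
      then show "w (- x) = (of_real q0 * r x) + (of_real q1 * \<i>) * (- \<i> * (of_real x * r x))"
        by (simp add: w_def r_def algebra_simps)
    qed
    also have "ft \<dots> \<xi> = ft (\<lambda>x. of_real q0 * r x) \<xi> + (of_real q1 * \<i>) * m' \<xi>"
      unfolding m'_def by (rule ft_linear[OF integrable_mult_right[OF r] integrable_mult_right[OF xr]])
    also have "ft (\<lambda>x. of_real q0 * r x) \<xi> = of_real q0 * m \<xi>"
      using ft_linear[of "\<lambda>x. 0" r "of_real q0" \<xi>] r by (simp add: ftr) (simp add: ft_def)
    finally show ?thesis by (simp add: mult.assoc)
  qed
  have ft_k: "ft k \<xi> = Gh (- \<xi>) * (of_real q0 * m \<xi> + of_real q1 * (\<i> * m' \<xi>))" for \<xi>
    unfolding k_def ftw by (rule ft_hconv_K[OF w])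
  let ?w1 = "\<lambda>\<xi>. phase \<xi> * ft u \<xi>" and ?w3 = "\<lambda>\<xi>. phase \<xi> * ft k \<xi>"
  have F_u: "(f, ?w1) \<in> F_op" and F_k: "(g, ?w3) \<in> F_op"
  proof -
    note ftL = Plancherel(1)[OF u(3,2)] Plancherel(1)[OF k(2,1)]
    have "(ft u, ?w1) \<in> gamma_phase_op" "(ft k, ?w3) \<in> gamma_phase_op"
      unfolding gamma_phase_op_eq Pw.W_iff using ftL Pw.W_in_L2[OF ftL(1)] Pw.W_in_L2[OF ftL(2)] by auto
    then show "(f, ?w1) \<in> F_op" "(g, ?w3) \<in> F_op"
      unfolding F_op_def using u(1) gU fourier_op_L1_L2[OF u(2,3)] fourier_op_L1_L2[OF k] by blast+
  qed
  let ?w2 = "\<lambda>\<xi>. inverse (of_real q1) * ?w3 \<xi>"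
  have vnz: "complex_of_real (v_fun \<xi>) \<noteq> 0" for \<xi> using v_pos[of \<xi>] by simp
  have w1: "?w1 = (\<lambda>\<xi>. inverse (of_real (v_fun \<xi>)) * m \<xi>)"
    by (simp add: phase_def m_def divide_inverse[of "Gh _"] mult_ac)
  have w2: "?w2 = (\<lambda>\<xi>. of_real (v_fun \<xi>) * (of_real (q0 / q1) * m \<xi> + \<i> * m' \<xi>))"
  proof (intro ext)
    fix \<xi>
    have "?w3 \<xi> = (Gh \<xi> * Gh (- \<xi>)) / of_real (v_fun \<xi>) * (of_real q0 * m \<xi> + of_real q1 * (\<i> * m' \<xi>))"
      by (simp add: phase_def ft_k)
    also have "\<dots> = of_real (v_fun \<xi>) * (of_real q0 * m \<xi> + of_real q1 * (\<i> * m' \<xi>))"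
      unfolding Gh_reflection using vnz[of \<xi>] by (simp add: power2_eq_square)
    finally show "?w2 \<xi> = of_real (v_fun \<xi>) * (of_real (q0 / q1) * m \<xi> + \<i> * m' \<xi>)"
      using q1 by (simp add: field_simps)
  qed
  obtain a b where Ta: "(a, ?w1) \<in> T_op q0 q1" and Tb: "(b, ?w2) \<in> T_op q0 q1" and D: "(a, b) \<in> D_op"
    using T_intertwines[OF Pm F.in_L2(2)[OF F_u, unfolded w1] L2_scale[OF F.in_L2(2)[OF F_k], of "inverse (of_real q1)", unfolded w2]]
    unfolding w1 w2 by blast
  have "(\<lambda>x. of_real q1 * ?w2 x) = ?w3" using q1 by (auto simp flip: mult.assoc)
  then have "((\<lambda>x. of_real q1 * b x), ?w3) \<in> T_op q0 q1" using Tu.scale[OF Tb, of "of_real q1"] by simp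
  then have "(g, \<lambda>x. of_real q1 * b x) \<in> S_op q0 q1" unfolding S_op_def using F_k by blast
  moreover have "(f, a) \<in> S_op q0 q1" unfolding S_op_def using F_u Ta by blast
  ultimately show ?thesis using that gH D by blast
qed

subsection \<open>The domain\<close>

lemma L2_loc_measurable: "f \<in> L2_loc \<Longrightarrow> f \<in> borel_measurable borel"
  by (simp add: L2_loc_def)

lemma L2_loc_mult_continuous:
  assumes f: "f \<in> L2_loc" and m: "continuous_on UNIV m" shows "(\<lambda>x. m x * f x) \<in> L2_loc"
  unfolding L2_loc_def set_integrable_def
proof (intro CollectI conjI allI)
  note [measurable] = L2_loc_measurable[OF f] borel_measurable_continuous_onI[OF m]
  show "(\<lambda>x. m x * f x) \<in> borel_measurable lborel" by measurable
  fix a b :: real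
  have "compact (m ` {a..b})" by (intro compact_continuous_image continuous_on_subset[OF m]) auto
  from compact_imp_bounded[OF this] obtain C where C: "\<And>x. x \<in> {a..b} \<Longrightarrow> cmod (m x) \<le> C"
    by (force simp: bounded_iff)
  have "integrable lborel (\<lambda>x. C\<^sup>2 * (indicator {a..b} x *\<^sub>R (cmod (f x))\<^sup>2))"
    using f unfolding L2_loc_def set_integrable_def by (intro integrable_mult_right) blast
  then show "integrable lborel (\<lambda>x. indicator {a..b} x *\<^sub>R (cmod (m x * f x))\<^sup>2)"
  proof (rule Bochner_Integration.integrable_bound)
    have "norm (indicator {a..b} x *\<^sub>R (cmod (m x * f x))\<^sup>2) \<le> norm (C\<^sup>2 * (indicator {a..b} x *\<^sub>R (cmod (f x))\<^sup>2))" for x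
    proof (cases "x \<in> {a..b}")
      case True
      have "(cmod (m x))\<^sup>2 \<le> C\<^sup>2" using C[OF True] by (intro power_mono) auto
      then show ?thesis using True by (simp add: norm_mult power_mult_distrib mult_right_mono)
    qed simp
    then show "AE x in lborel. norm (indicator {a..b} x *\<^sub>R (cmod (m x * f x))\<^sup>2) \<le> norm (C\<^sup>2 * (indicator {a..b} x *\<^sub>R (cmod (f x))\<^sup>2))" by simp
  qed measurable
qed

lemma L2_loc_continuous:
  assumes f: "continuous_on UNIV f" shows "f \<in> L2_loc"
  unfolding L2_loc_def set_integrable_def
proof (intro CollectI conjI allI)
  show "f \<in> borel_measurable lborel" using borel_measurable_continuous_onI[OF f] by simp
  fix a b :: real
  show "integrable lborel (\<lambda>x. indicator {a..b} x *\<^sub>R (cmod (f x))\<^sup>2)"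
    unfolding set_integrable_def[symmetric]
    by (intro borel_integrable_atLeastAtMost' continuous_intros continuous_on_subset[OF f]) auto
qed

lemma L2_loc_add:
  assumes f: "f \<in> L2_loc" and g: "g \<in> L2_loc" shows "(\<lambda>x. f x + g x) \<in> L2_loc"
  unfolding L2_loc_def set_integrable_def
proof (intro CollectI conjI allI)
  note [measurable] = L2_loc_measurable[OF f] L2_loc_measurable[OF g]
  show "(\<lambda>x. f x + g x) \<in> borel_measurable lborel" by measurable
  fix a b :: real
  have "integrable lborel (\<lambda>x. indicator {a..b} x *\<^sub>R (cmod (h x))\<^sup>2)" if "h \<in> L2_loc" for h
    using that by (simp add: L2_loc_def set_integrable_def)
  then have "integrable lborel (\<lambda>x. 2 * (indicator {a..b} x *\<^sub>R (cmod (f x))\<^sup>2) + 2 * (indicator {a..b} x *\<^sub>R (cmod (g x))\<^sup>2))"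
    using f g by (intro Bochner_Integration.integrable_add integrable_mult_right)
  then show "integrable lborel (\<lambda>x. indicator {a..b} x *\<^sub>R (cmod (f x + g x))\<^sup>2)"
    by (rule Bochner_Integration.integrable_bound) (use norm_add_sq_le in \<open>auto simp: indicator_def\<close>)
qed

text \<open>
  Let $w = Ta$.  If \<open>a\<close> has an absolutely continuous representative, then so do $vw$ and \<open>w\<close>, by the product and chain
  rules.  Conversely, the weak derivative of $vw$ provides an absolutely continuous representative \<open>P\<close> of $vw$,
  and \<open>T_intertwines\<close> applies to it.
\<close>

lemma T_D_domain:
  assumes q1: "q1 \<noteq> 0" and Ta: "(a, w) \<in> T_op q0 q1"
  shows "a \<in> Domain D_op \<longleftrightarrow> w \<in> Dstar_set q0 q1"
proof -
  define c where "c = q0 / q1"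
  interpret T: weighted_composition lborel lborel Xf Yf "T_weight c" by (rule T_weighted_composition)
  interpret Tu: l2_unitary lborel lborel "T_op q0 q1" by (rule l2_unitary_T)
  have T_iff: "(f, k) \<in> T_op q0 q1 \<longleftrightarrow> f \<in> L2 lborel \<and> k \<in> L2 lborel \<and> (AE x in lborel. k x = T_weight c x * f (Xf x))" for f k
    unfolding T_op_eq c_def[symmetric] by (rule T.W_iff)
  note aL = Tu.in_L2(1)[OF Ta] and wL = Tu.in_L2(2)[OF Ta]
  note [measurable] = aL[THEN L2_lborel_measurable] wL[THEN L2_lborel_measurable]
  have wT: "AE x in lborel. w x = T_weight c x * a (Xf x)" using Ta T_iff by blast
  have vnz: "complex_of_real (v_fun \<xi>) \<noteq> 0" for \<xi> using v_pos[of \<xi>] by simp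
  have q0c: "of_real q0 = of_real q1 * complex_of_real c" using q1 by (simp add: c_def)
  have Twe: "T_weight c \<xi> = inverse (of_real (v_fun \<xi>)) * ek (- c * \<xi>)" for \<xi> by (simp add: T_weight_def ek_def)
  have Xc: "continuous_on UNIV (\<lambda>\<xi>. complex_of_real (inverse ((v_fun \<xi>)\<^sup>2)))" by (intro continuous_intros inverse_v_sq_continuous)
  show ?thesis
  proof
    assume "a \<in> Domain D_op"
    then obtain b where ab: "(a, b) \<in> D_op" by blast
    then obtain A where A: "primitive A (\<lambda>x. - \<i> * b x)" "AE x in lborel. a x = A x" and bL: "b \<in> L2 lborel"
      by (auto simp: D_op_iff)
    note [measurable] = bL[THEN L2_lborel_measurable]
    have A2: "AE x in lborel. a (Xf x) = A (Xf x)" by (rule T.AE_compose[OF A(2)])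
    define P where "P \<xi> = A (Xf \<xi>) * ek (- c * \<xi>)" for \<xi>
    define p where "p \<xi> = A (Xf \<xi>) * (- \<i> * of_real (- c) * ek (- c * \<xi>)) + of_real (inverse ((v_fun \<xi>)\<^sup>2)) * (- \<i> * b (Xf \<xi>)) * ek (- c * \<xi>)" for \<xi>
    have Pp: "primitive P p" unfolding P_def[abs_def] p_def[abs_def]
      by (rule primitive_mult[OF primitive_compose[OF A(1) Xf_has_derivative inverse_v_sq_continuous] ek_primitive]) simp
    have Ac: "continuous_on UNIV (\<lambda>\<xi>. A (Xf \<xi>))"
      by (rule continuous_on_compose2[OF primitive_continuous[OF A(1)] Xf_continuous]) auto
    have Pc: "continuous_on UNIV P" by (rule primitive_continuous[OF Pp])
    have vw: "AE x in lborel. of_real (v_fun x) * w x = P x"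
      using wT A2 by eventually_elim (use vnz in \<open>simp add: Twe P_def right_inverse\<close>)
    have wd: "weak_deriv (\<lambda>\<xi>. of_real (v_fun \<xi>) * w \<xi>) p"
      by (rule weak_deriv_AE_cong[OF primitive_imp_weak_deriv[OF Pp] vw]) measurable
    have TbL: "(\<lambda>\<xi>. T_weight c \<xi> * b (Xf \<xi>)) \<in> L2 lborel" by (rule T.W_in_L2[OF bL])
    have "(\<lambda>\<xi>. of_real (v_fun \<xi>) * (of_real q0 * (of_real (v_fun \<xi>) * w \<xi>) + of_real q1 * (\<i> * p \<xi>))) \<in> L2 lborel"
    proof (rule L2_AE_cong[OF L2_scale[OF TbL, of "of_real q1"]])
      note [measurable] = loc_integrable_measurable[OF primitive_loc_integrable[OF Pp]]
      show "(\<lambda>\<xi>. of_real (v_fun \<xi>) * (of_real q0 * (of_real (v_fun \<xi>) * w \<xi>) + of_real q1 * (\<i> * p \<xi>))) \<in> borel_measurable lborel" by measurable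
      show "AE \<xi> in lborel. of_real (v_fun \<xi>) * (of_real q0 * (of_real (v_fun \<xi>) * w \<xi>) + of_real q1 * (\<i> * p \<xi>)) = of_real q1 * (T_weight c \<xi> * b (Xf \<xi>))"
        using vw
      proof eventually_elim
        case (elim \<xi>)
        have alg: "q * C * (A * e) + q * (\<i> * (A * (- \<i> * (- C) * e) + X * (- \<i> * B) * e)) = q * (X * B * e)" for q C A e X B :: complex
          by (simp add: algebra_simps)
        have "of_real q0 * (of_real (v_fun \<xi>) * w \<xi>) + of_real q1 * (\<i> * p \<xi>) = of_real q1 * (of_real (inverse ((v_fun \<xi>)\<^sup>2)) * b (Xf \<xi>) * ek (- c * \<xi>))"
          unfolding elim q0c P_def p_def of_real_minus by (rule alg)
        then show ?case using vnz[of \<xi>] by (simp add: Twe power2_eq_square field_simps)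
      qed
    qed
    moreover have "w \<in> H1_loc"
    proof -
      let ?iv = "\<lambda>\<xi>. complex_of_real (inverse (v_fun \<xi>))" and ?iv' = "\<lambda>\<xi>. complex_of_real (sinh (pi * \<xi>) * v_fun \<xi> / 2)"
      have ivc: "continuous_on UNIV ?iv'" by (intro continuous_intros v_continuous) auto
      have ivP: "primitive ?iv ?iv'"
        by (rule primitive_of_C1[OF has_vector_derivative_of_real[OF inverse_v_has_derivative] ivc])
      have wP: "AE x in lborel. w x = ?iv x * P x" using vw by eventually_elim (use vnz in \<open>simp add: field_simps\<close>)
      have wd2: "weak_deriv w (\<lambda>x. ?iv x * p x + ?iv' x * P x)"
        by (rule weak_deriv_AE_cong[OF primitive_imp_weak_deriv[OF primitive_mult[OF ivP Pp]] wP]) measurable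
      have "(\<lambda>x. ?iv x * p x + ?iv' x * P x) = (\<lambda>x. (- \<i> * of_real (inverse ((v_fun x)\<^sup>2))) * (T_weight c x * b (Xf x))
          + (?iv x * (A (Xf x) * (- \<i> * of_real (- c) * ek (- c * x))) + ?iv' x * P x))"
        by (intro ext) (simp add: p_def Twe algebra_simps)
      moreover have "(\<lambda>x. (- \<i> * of_real (inverse ((v_fun x)\<^sup>2))) * (T_weight c x * b (Xf x))
          + (?iv x * (A (Xf x) * (- \<i> * of_real (- c) * ek (- c * x))) + ?iv' x * P x)) \<in> L2_loc"
      proof (rule L2_loc_add[OF L2_loc_mult_continuous[OF L2_imp_L2_loc[OF TbL]] L2_loc_continuous])
        show "continuous_on UNIV (\<lambda>x. - \<i> * complex_of_real (inverse ((v_fun x)\<^sup>2)))" by (rule continuous_on_mult[OF continuous_on_const Xc])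
        show "continuous_on UNIV (\<lambda>x. ?iv x * (A (Xf x) * (- \<i> * of_real (- c) * ek (- c * x))) + ?iv' x * P x)"
          by (intro continuous_on_add continuous_on_mult continuous_on_const Ac Pc ivc primitive_continuous[OF ivP] primitive_continuous[OF ek_primitive])
      qed
      ultimately have "(\<lambda>x. ?iv x * p x + ?iv' x * P x) \<in> L2_loc" by simp
      then show ?thesis unfolding H1_loc_def using wd2 L2_imp_L2_loc[OF wL] by blast
    qed
    ultimately show "w \<in> Dstar_set q0 q1" unfolding Dstar_set_def using wL wd by blast
  next
    assume "w \<in> Dstar_set q0 q1"
    then obtain p where wd: "weak_deriv (\<lambda>\<xi>. of_real (v_fun \<xi>) * w \<xi>) p"
      and zL: "(\<lambda>\<xi>. of_real (v_fun \<xi>) * (of_real q0 * (of_real (v_fun \<xi>) * w \<xi>) + of_real q1 * (\<i> * p \<xi>))) \<in> L2 lborel"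
      unfolding Dstar_set_def by blast
    obtain P where P: "primitive P p" "AE x in lborel. of_real (v_fun x) * w x = P x" using weak_deriv_primitive[OF wd] .
    note [measurable] = primitive_measurable[OF P(1)] loc_integrable_measurable[OF primitive_loc_integrable[OF P(1)]]
    let ?w = "\<lambda>\<xi>. inverse (of_real (v_fun \<xi>)) * P \<xi>"
    let ?z = "\<lambda>\<xi>. of_real (v_fun \<xi>) * (of_real c * P \<xi> + \<i> * p \<xi>)"
    have w_ae: "AE x in lborel. ?w x = w x" using P(2) by eventually_elim (use vnz in \<open>simp add: field_simps\<close>)
    have w'L: "?w \<in> L2 lborel" by (rule L2_AE_cong[OF wL _ w_ae]) measurable
    have z'L: "?z \<in> L2 lborel"
    proof (rule L2_AE_cong[OF L2_scale[OF zL, of "inverse (of_real q1)"]])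
      show "AE \<xi> in lborel. ?z \<xi> = inverse (of_real q1) * (of_real (v_fun \<xi>) * (of_real q0 * (of_real (v_fun \<xi>) * w \<xi>) + of_real q1 * (\<i> * p \<xi>)))"
        using P(2) by eventually_elim (use q1 in \<open>simp add: q0c field_simps\<close>)
    qed measurable
    obtain a' b where Ta': "(a', ?w) \<in> T_op q0 q1" and D: "(a', b) \<in> D_op"
      using T_intertwines[OF P(1) w'L z'L[unfolded c_def]] by blast
    have "AE x in lborel. a x = a' x"
      by (rule Tu.preimage_unique[OF Ta Ta']) (use w_ae in \<open>auto elim: eventually_mono\<close>)
    then have "(a, b) \<in> D_op" using D_op_AE_cong[OF D _ _ aL D_op_L2(2)[OF D]] by simp
    then show "a \<in> Domain D_op" by blast
  qed
qed

subsection \<open>The closure\<close>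

text \<open>A selfadjoint operator is closed, being an adjoint.\<close>

lemma closure_subset_selfadjoint:
  assumes sa: "selfadjoint M A" and sub: "A0 \<subseteq> A" and L: "A \<subseteq> L2 M \<times> L2 M"
  shows "op_closure M M A0 \<subseteq> A"
proof clarify
  fix f g assume "(f, g) \<in> op_closure M M A0"
  then have fg: "f \<in> L2 M" "g \<in> L2 M"
    and ap: "\<And>\<epsilon>. \<epsilon> > 0 \<Longrightarrow> \<exists>(f', g') \<in> A0. L2_norm M (\<lambda>x. f x - f' x) < \<epsilon> \<and> L2_norm M (\<lambda>x. g x - g' x) < \<epsilon>"
    by (auto simp: op_closure_def)
  have "\<exists>f' g'. (f', g') \<in> A0 \<and> L2_norm M (\<lambda>x. f' x - f x) < inverse (real (Suc n)) \<and> L2_norm M (\<lambda>x. g' x - g x) < inverse (real (Suc n))" for n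
    using ap[of "inverse (real (Suc n))"] L2_norm_minus_commute[of M f] L2_norm_minus_commute[of M g] by fastforce
  then obtain F G where FG: "\<And>n. (F n, G n) \<in> A0" "\<And>n. L2_norm M (\<lambda>x. F n x - f x) < inverse (real (Suc n))"
    "\<And>n. L2_norm M (\<lambda>x. G n x - g x) < inverse (real (Suc n))" by metis
  have lim: "(\<lambda>n. L2_norm M (\<lambda>x. F n x - f x)) \<longlonglongrightarrow> 0" "(\<lambda>n. L2_norm M (\<lambda>x. G n x - g x)) \<longlonglongrightarrow> 0"
    using less_imp_le[OF FG(2)] less_imp_le[OF FG(3)]
    by (auto intro!: Lim_null_comparison[OF _ LIMSEQ_inverse_real_of_nat] always_eventually simp del: of_nat_Suc)
  have FA: "(F n, G n) \<in> A" for n using FG(1) sub by blast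
  have FGL: "F n \<in> L2 M" "G n \<in> L2 M" for n using FA L by blast+
  have "L2_inner M b f = L2_inner M a g" if ab: "(a, b) \<in> A" for a b
  proof -
    have abL: "a \<in> L2 M" "b \<in> L2 M" using ab L by auto
    have "(F n, G n) \<in> op_adj M M A" for n using FA sa by (simp add: selfadjoint_def)
    then have "L2_inner M b (F n) = L2_inner M a (G n)" for n using ab by (auto simp: op_adj_def)
    then have eq: "L2_inner M (F n) b = L2_inner M (G n) a" for n
      unfolding L2_inner_commute[where f = b] L2_inner_commute[where f = a] by simp
    have "(\<lambda>n. L2_inner M (F n) b) \<longlonglongrightarrow> L2_inner M f b" by (rule L2_inner_tendsto[OF FGL(1) fg(1) abL(2) lim(1)])
    moreover have "(\<lambda>n. L2_inner M (F n) b) \<longlonglongrightarrow> L2_inner M g a"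
      unfolding eq by (rule L2_inner_tendsto[OF FGL(2) fg(2) abL(1) lim(2)])
    ultimately have "L2_inner M f b = L2_inner M g a" by (rule LIMSEQ_unique)
    then show ?thesis unfolding L2_inner_commute[where g = b] L2_inner_commute[where g = a] by simp
  qed
  then have "(f, g) \<in> op_adj M M A" using fg by (auto simp: op_adj_def)
  then show "(f, g) \<in> A" using sa by (simp add: selfadjoint_def)
qed

lemma op_closure_mono: "A \<subseteq> B \<Longrightarrow> op_closure M N A \<subseteq> op_closure M N B"
  unfolding op_closure_def by blast

text \<open>
  A symmetric operator with dense domain is single-valued up to null sets.
\<close>

lemma D_op_functional:
  assumes "(f, g) \<in> D_op" "(f, h) \<in> D_op" shows "AE x in lborel. g x = h x"
proof -
  have L: "g \<in> L2 lborel" "h \<in> L2 lborel" using D_op_L2 assms by auto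
  have d: "(\<lambda>x. g x - h x) \<in> L2 lborel" by (rule L2_diff[OF L])
  have "AE x in lborel. g x - h x = 0"
  proof (rule L2_orthogonal_dense_zero[OF _ _ d])
    show "L2_dense lborel (Domain D_op)" using selfadjoint_D by (simp add: selfadjoint_def)
    show "Domain D_op \<subseteq> L2 lborel" using D_op_L2 by auto
    fix s assume "s \<in> Domain D_op"
    then obtain t where t: "(s, t) \<in> D_op" by blast
    show "L2_inner lborel s (\<lambda>x. g x - h x) = 0"
      using D_op_symmetric[OF t assms(1)] D_op_symmetric[OF t assms(2)] L2_inner_diff_right[OF L D_op_L2(1)[OF t]] by simp
  qed
  then show ?thesis by simp
qed

text \<open>
  The right-hand side of the formula for \<open>H\<close>.
\<close>

definition H_model :: "real \<Rightarrow> real \<Rightarrow> (real, real) l2op" where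
  "H_model q0 q1 = op_scale lborel_plus (of_real q1) (S_op q0 q1 O D_op O (S_op q0 q1)\<inverse>)"

lemma H_model_iff:
  assumes q1: "q1 \<noteq> 0" and S: "(f, a) \<in> S_op q0 q1" "(k, b) \<in> S_op q0 q1"
  shows "(f, k) \<in> H_model q0 q1 \<longleftrightarrow> (a, \<lambda>x. inverse (of_real q1) * b x) \<in> D_op"
proof -
  interpret S: l2_unitary lborel_plus lborel "S_op q0 q1" by (rule l2_unitary_S)
  have nz: "complex_of_real q1 \<noteq> 0" using q1 by simp
  show ?thesis
  proof
    assume "(f, k) \<in> H_model q0 q1"
    then obtain g a' b' where g: "AE x in lborel_plus. k x = of_real q1 * g x" "(f, a') \<in> S_op q0 q1" "(a', b') \<in> D_op" "(g, b') \<in> S_op q0 q1"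
      unfolding H_model_def op_scale_def by blast
    have "AE x in lborel. b x = of_real q1 * b' x" using S.image_unique[OF S(2) S.scale[OF g(4)]] g(1) by blast
    then have 1: "AE x in lborel. inverse (of_real q1) * b x = b' x" by eventually_elim (use nz in simp)
    have 2: "AE x in lborel. a x = a' x" by (rule S.image_unique[OF S(1) g(2)]) simp
    show "(a, \<lambda>x. inverse (of_real q1) * b x) \<in> D_op"
      by (rule D_op_AE_cong[OF g(3) 2 1 S.in_L2(2)[OF S(1)] L2_scale[OF S.in_L2(2)[OF S(2)]]])
  next
    assume D: "(a, \<lambda>x. inverse (of_real q1) * b x) \<in> D_op"
    have "((\<lambda>x. inverse (of_real q1) * k x), (\<lambda>x. inverse (of_real q1) * b x)) \<in> S_op q0 q1" by (rule S.scale[OF S(2)])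
    then have "(f, \<lambda>x. inverse (of_real q1) * k x) \<in> S_op q0 q1 O D_op O (S_op q0 q1)\<inverse>" using S(1) D by blast
    moreover have "AE x in lborel_plus. k x = of_real q1 * (inverse (of_real q1) * k x)" using nz by (simp flip: mult.assoc)
    ultimately show "(f, k) \<in> H_model q0 q1" unfolding H_model_def op_scale_def using S.in_L2(1)[OF S(2)] by blast
  qed
qed

lemma H_model_L2: "H_model q0 q1 \<subseteq> L2 lborel_plus \<times> L2 lborel_plus"
  using l2_unitary.in_L2(1)[OF l2_unitary_S] unfolding H_model_def op_scale_def by blast

text \<open>
  After \<open>T\<^sup>*F\<close>, the inverse Fourier transform carries \<open>D\<close> to the multiplication by the independent variable; the scalar
  \<open>q\<^sub>1\<close> is then absorbed in the multiplier.
\<close>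

lemma spectral_representation:
  fixes q0 q1 :: real
  assumes q1: "q1 \<noteq> 0"
  defines "V \<equiv> S_op q0 q1 O fourier_op\<inverse>"
  shows "l2_scaling lborel_plus V q1" "H_model q0 q1 = l2_multiplier.A lborel V (\<lambda>x. q1 * x)"
proof -
  have V: "l2_unitary lborel_plus lborel V" unfolding V_def
    by (rule l2_unitary_comp[OF l2_unitary_S l2_unitary.converse[OF l2_unitary_fourier]])
  interpret V: l2_unitary lborel_plus lborel V by (rule V)
  show sc: "l2_scaling lborel_plus V q1"
    by (intro l2_scaling.intro l2_multiplier.intro V l2_multiplier_axioms.intro l2_scaling_axioms.intro q1) simp
  interpret sc: l2_scaling lborel_plus V q1 by (rule sc)
  have nz: "complex_of_real q1 \<noteq> 0" using q1 by simp
  have DV: "S_op q0 q1 O D_op O (S_op q0 q1)\<inverse> = V O mult_op lborel (\<lambda>x. x) O V\<inverse>"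
    unfolding V_def D_op_eq_fourier by (simp add: O_assoc converse_relcomp)
  show "H_model q0 q1 = sc.A"
  proof (intro set_eqI iffI; clarify)
    fix f k assume "(f, k) \<in> H_model q0 q1"
    then obtain g where g: "k \<in> L2 lborel_plus" "AE x in lborel_plus. k x = of_real q1 * g x" "(f, g) \<in> V O mult_op lborel (\<lambda>x. x) O V\<inverse>"
      unfolding H_model_def op_scale_def DV by blast
    obtain a b h where W: "(f, a) \<in> V" "(k, b) \<in> V" "(g, h) \<in> V"
      using g V.image_ex sc.conj_mult_in_L2[OF g(3)] by meson
    have "AE x in lborel. h x = of_real x * a x" using sc.conj_mult_iff[OF W(1,3), THEN iffD1, OF g(3)] .
    moreover have "AE x in lborel. b x = of_real q1 * h x" using V.image_unique[OF W(2) V.scale[OF W(3)]] g(2) by blast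
    ultimately have "AE x in lborel. b x = of_real (q1 * x) * a x" by eventually_elim simp
    then show "(f, k) \<in> sc.A" unfolding sc.A_def by (rule sc.conj_mult_iff[OF W(1,2), THEN iffD2])
  next
    fix f k assume fk: "(f, k) \<in> sc.A"
    then have L: "f \<in> L2 lborel_plus" "k \<in> L2 lborel_plus" unfolding sc.A_def using sc.conj_mult_in_L2 by blast+
    obtain a b where W: "(f, a) \<in> V" "(k, b) \<in> V" using L V.image_ex by meson
    have "AE x in lborel. b x = of_real (q1 * x) * a x" using sc.conj_mult_iff[OF W, THEN iffD1, OF fk[unfolded sc.A_def]] .
    then have "AE x in lborel. inverse (of_real q1) * b x = of_real x * a x" by eventually_elim (use nz in simp)
    then have "(f, \<lambda>x. inverse (of_real q1) * k x) \<in> V O mult_op lborel (\<lambda>x. x) O V\<inverse>"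
      by (rule sc.conj_mult_iff[OF W(1) V.scale[OF W(2)], THEN iffD2])
    moreover have "AE x in lborel_plus. k x = of_real q1 * (inverse (of_real q1) * k x)" using nz by (simp flip: mult.assoc)
    ultimately show "(f, k) \<in> H_model q0 q1" unfolding H_model_def op_scale_def DV using L(2) by blast
  qed
qed

lemma selfadjoint_H_model: "q1 \<noteq> 0 \<Longrightarrow> selfadjoint lborel_plus (H_model q0 q1)"
  unfolding spectral_representation(2)
  by (intro l2_multiplier.selfadjoint_A l2_scaling.axioms(1) spectral_representation(1))

lemma hankel_on_D0_subset:
  assumes q: "q0 = p0 - euler_mascheroni * q1" and q1: "q1 \<noteq> 0"
  shows "hankel_on_D0 p0 q1 \<subseteq> H_model q0 q1" "f \<in> D0_set 1 \<Longrightarrow> \<exists>g. (f, g) \<in> hankel_on_D0 p0 q1"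
proof -
  interpret S: l2_unitary lborel_plus lborel "S_op q0 q1" by (rule l2_unitary_S)
  have ex: "\<exists>g. (f, g) \<in> hankel_on_D0 p0 q1 \<and> (f, g) \<in> H_model q0 q1" if f: "f \<in> D0_set 1" for f
  proof -
    obtain g a b where g: "(f, g) \<in> hankel_on_D0 p0 q1" "(f, a) \<in> S_op q0 q1" "(g, \<lambda>x. of_real q1 * b x) \<in> S_op q0 q1" "(a, b) \<in> D_op"
      using hankel_on_D0_maps_to_D[OF f q q1] .
    have "(\<lambda>x. inverse (of_real q1) * (of_real q1 * b x)) = b" using q1 by (auto simp flip: mult.assoc)
    then have "(f, g) \<in> H_model q0 q1" using H_model_iff[OF q1 g(2,3)] g(4) by simp
    then show ?thesis using g(1) by blast
  qed
  then show "f \<in> D0_set 1 \<Longrightarrow> \<exists>g. (f, g) \<in> hankel_on_D0 p0 q1" by blast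
  show "hankel_on_D0 p0 q1 \<subseteq> H_model q0 q1"
  proof clarify
    fix f k assume fk: "(f, k) \<in> hankel_on_D0 p0 q1"
    then have "f \<in> D0_set 1" by (simp add: hankel_on_D0_def op_restrict_def)
    then obtain g where g: "(f, g) \<in> hankel_on_D0 p0 q1" "(f, g) \<in> H_model q0 q1" using ex by blast
    have kL: "k \<in> L2 lborel_plus" using fk by (simp add: hankel_on_D0_def op_restrict_def op_of_def)
    have "AE x in lborel_plus. k x = g x"
      using fk g(1) unfolding hankel_on_D0_def op_restrict_def op_of_def by (auto elim: eventually_elim2)
    moreover obtain g' where g': "(f, g') \<in> S_op q0 q1 O D_op O (S_op q0 q1)\<inverse>" "AE x in lborel_plus. g x = of_real q1 * g' x"
      using g(2) unfolding H_model_def op_scale_def by blast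
    ultimately have "AE x in lborel_plus. k x = of_real q1 * g' x" by (auto elim: eventually_elim2)
    then show "(f, k) \<in> H_model q0 q1" using g'(1) kL unfolding H_model_def op_scale_def by blast
  qed
qed

text \<open>
  The closure of the Hankel operator on $\mathcal{D}_0$ is the model operator, since $\mathcal{D}_0$ contains
  the preimages of the test functions, which form a core of \<open>D\<close>.
\<close>

theorem hankel_closure:
  assumes q: "q0 = p0 - euler_mascheroni * q1" and q1: "q1 \<noteq> 0"
  shows "op_closure lborel_plus lborel_plus (hankel_on_D0 p0 q1) = H_model q0 q1"
proof
  show "op_closure lborel_plus lborel_plus (hankel_on_D0 p0 q1) \<subseteq> H_model q0 q1"
    by (rule closure_subset_selfadjoint[OF selfadjoint_H_model[OF q1] hankel_on_D0_subset(1)[OF q q1] H_model_L2])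
  interpret S: l2_unitary lborel_plus lborel "S_op q0 q1" by (rule l2_unitary_S)
  have nz: "complex_of_real q1 \<noteq> 0" using q1 by simp
  show "H_model q0 q1 \<subseteq> op_closure lborel_plus lborel_plus (hankel_on_D0 p0 q1)"
  proof clarify
    fix f k assume fk: "(f, k) \<in> H_model q0 q1"
    then have L: "f \<in> L2 lborel_plus" "k \<in> L2 lborel_plus" using H_model_L2 by blast+
    obtain a b where S: "(f, a) \<in> S_op q0 q1" "(k, b) \<in> S_op q0 q1" using L S.image_ex by meson
    have D: "(a, \<lambda>x. inverse (of_real q1) * b x) \<in> D_op" using fk H_model_iff[OF q1 S] by blast
    have "\<exists>(f', k') \<in> hankel_on_D0 p0 q1. L2_norm lborel_plus (\<lambda>x. f x - f' x) < \<epsilon> \<and> L2_norm lborel_plus (\<lambda>x. k x - k' x) < \<epsilon>"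
      if e: "\<epsilon> > 0" for \<epsilon>
    proof -
      define e' where "e' = \<epsilon> / (1 + \<bar>q1\<bar>)"
      have e': "e' > 0" "e' \<le> \<epsilon>" "\<bar>q1\<bar> * e' < \<epsilon>" using e by (auto simp: e'_def field_simps)
      obtain \<tau> \<tau>' where t: "complex_test \<tau> \<tau>'" "L2_norm lborel (\<lambda>x. a x - \<tau> x) < e'"
        "L2_norm lborel (\<lambda>x. inverse (of_real q1) * b x - \<i> * \<tau>' x) < e'"
        using test_functions_core[OF D e'(1)] .
      note tD = complex_test_D[OF t(1)]
      obtain f' where f': "f' \<in> D0_set 1" "(f', \<lambda>\<xi>. T_weight (q0 / q1) \<xi> * \<tau> (Xf \<xi>)) \<in> F_op"
        using test_function_in_D0_image[OF t(1)] by blast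
      have "(\<tau>, \<lambda>\<xi>. T_weight (q0 / q1) \<xi> * \<tau> (Xf \<xi>)) \<in> T_op q0 q1"
        unfolding T_op_eq weighted_composition.W_iff[OF T_weighted_composition]
        using D_op_L2(1)[OF tD] weighted_composition.W_in_L2[OF T_weighted_composition] by auto
      then have S': "(f', \<tau>) \<in> S_op q0 q1" unfolding S_op_def using f'(2) by blast
      obtain k' where k': "(f', k') \<in> hankel_on_D0 p0 q1" using hankel_on_D0_subset(2)[OF q q1 f'(1)] by blast
      then have fk': "(f', k') \<in> H_model q0 q1" using hankel_on_D0_subset(1)[OF q q1] by blast
      then obtain b' where Sk: "(k', b') \<in> S_op q0 q1" using H_model_L2 S.image_ex by blast
      have ae: "AE x in lborel. inverse (of_real q1) * b' x = \<i> * \<tau>' x"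
        using D_op_functional[OF _ tD] fk' H_model_iff[OF q1 S' Sk] by blast
      have "L2_norm lborel_plus (\<lambda>x. k x - k' x) = L2_norm lborel (\<lambda>x. b x - b' x)" by (rule S.dist_eq[OF S(2) Sk, symmetric])
      also have "\<dots> = L2_norm lborel (\<lambda>x. of_real q1 * (inverse (of_real q1) * b x - \<i> * \<tau>' x))"
      proof (rule L2_norm_AE_cong)
        show "AE x in lborel. b x - b' x = of_real q1 * (inverse (of_real q1) * b x - \<i> * \<tau>' x)"
          using ae
          proof eventually_elim
            case (elim x)
            have "of_real q1 * (inverse (of_real q1) * b x - inverse (of_real q1) * b' x) = b x - b' x"
              using nz by (simp add: right_diff_distrib flip: mult.assoc)
            then show ?case unfolding elim by simp
          qed
        note m = S.in_L2(2)[OF S(2)] S.in_L2(2)[OF Sk] D_op_L2(2)[OF tD]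
        show "(\<lambda>x. b x - b' x) \<in> borel_measurable lborel" by (rule L2_measurable[OF L2_diff[OF m(1,2)]])
        show "(\<lambda>x. of_real q1 * (inverse (of_real q1) * b x - \<i> * \<tau>' x)) \<in> borel_measurable lborel"
          by (rule L2_measurable[OF L2_scale[OF L2_diff[OF L2_scale[OF m(1)] m(3)]]])
      qed
      also have "\<dots> = \<bar>q1\<bar> * L2_norm lborel (\<lambda>x. inverse (of_real q1) * b x - \<i> * \<tau>' x)" unfolding L2_norm_scale by simp
      also have "\<dots> \<le> \<bar>q1\<bar> * e'" using t(3) by (intro mult_left_mono) auto
      finally have "L2_norm lborel_plus (\<lambda>x. k x - k' x) < \<epsilon>" using e'(3) by simp
      moreover have "L2_norm lborel_plus (\<lambda>x. f x - f' x) < \<epsilon>" using S.dist_eq[OF S(1) S'] t(2) e'(2) by simp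
      ultimately show ?thesis using k' by blast
    qed
    then show "(f, k) \<in> op_closure lborel_plus lborel_plus (hankel_on_D0 p0 q1)" using L by (simp add: op_closure_def)
  qed
qed

lemma H_model_domain:
  assumes q1: "q1 \<noteq> 0"
  shows "Domain (H_model q0 q1) = op_adj lborel_plus lborel F_op `` Dstar_set q0 q1"
proof (intro set_eqI iffI)
  interpret F: l2_unitary lborel_plus lborel F_op by (rule l2_unitary_F)
  interpret S: l2_unitary lborel_plus lborel "S_op q0 q1" by (rule l2_unitary_S)
  interpret T: l2_unitary lborel lborel "T_op q0 q1" by (rule l2_unitary_T)
  fix f
  {
    assume "f \<in> Domain (H_model q0 q1)"
    then obtain a w where "(f, w) \<in> F_op" "(a, w) \<in> T_op q0 q1" "a \<in> Domain D_op"
      unfolding H_model_def op_scale_def S_op_def by blast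
    then show "f \<in> op_adj lborel_plus lborel F_op `` Dstar_set q0 q1"
      using T_D_domain[OF q1] unfolding F.adj_eq_converse by blast
  next
    assume "f \<in> op_adj lborel_plus lborel F_op `` Dstar_set q0 q1"
    then obtain w where w: "w \<in> Dstar_set q0 q1" "(f, w) \<in> F_op" unfolding F.adj_eq_converse by blast
    obtain a where a: "(a, w) \<in> T_op q0 q1" using T.preimage_ex[OF F.in_L2(2)[OF w(2)]] by blast
    obtain b where b: "(a, b) \<in> D_op" using T_D_domain[OF q1 a] w(1) by blast
    have fa: "(f, a) \<in> S_op q0 q1" unfolding S_op_def using w(2) a by blast
    obtain k where k: "(k, \<lambda>x. of_real q1 * b x) \<in> S_op q0 q1"
      using S.preimage_ex[OF L2_scale[OF D_op_L2(2)[OF b]]] by blast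
    have "(\<lambda>x. inverse (of_real q1) * (of_real q1 * b x)) = b" using q1 by (auto simp flip: mult.assoc)
    then have "(f, k) \<in> H_model q0 q1" using H_model_iff[OF q1 fa k] b by simp
    then show "f \<in> Domain (H_model q0 q1)" by blast
  }
qed

theorem theorem3p6:
  fixes p0 p1 q0 q1 :: real
    and H T :: "(real, real) l2op"
  assumes "p1 \<noteq> 0"
    and "H = hankel_op 1 (\<lambda>t. (p0 + p1 * ln t) * inverse t)"
    and "q0 = p0 - euler_mascheroni * p1"
    and "q1 = p1"
    and "T = T_op q0 q1"
  shows "unitary_op lborel_plus lborel F_op
    \<and> unitary_op lborel lborel T
    \<and> H = op_scale lborel_plus (of_real q1)
            (op_adj lborel_plus lborel F_op \<circ>\<^sub>L T \<circ>\<^sub>L D_op \<circ>\<^sub>L op_adj lborel lborel T \<circ>\<^sub>L F_op)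
    \<and> ess_selfadjoint_on lborel_plus H (D0_set 1)
    \<and> selfadjoint_on lborel_plus H (op_adj lborel_plus lborel F_op `` Dstar_set q0 q1)
    \<and> simple_spectrum lborel_plus H
    \<and> ac_spectrum lborel_plus H
    \<and> op_spectrum lborel_plus H = \<real>"
proof -
  have q1: "q1 \<noteq> 0" and q: "q0 = p0 - euler_mascheroni * q1" using assms by auto
  interpret F: l2_unitary lborel_plus lborel F_op by (rule l2_unitary_F)
  interpret T: l2_unitary lborel lborel T unfolding assms(5) by (rule l2_unitary_T)
  have Hc: "H = op_closure lborel_plus lborel_plus (hankel_on_D0 p0 q1)"
    unfolding assms(2,4) by (rule hankel_op_closure)
  have H: "H = H_model q0 q1" unfolding Hc by (rule hankel_closure[OF q q1])
  have sa: "selfadjoint lborel_plus H" unfolding H by (rule selfadjoint_H_model[OF q1])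
  define V where "V = S_op q0 q1 O fourier_op\<inverse>"
  interpret V: l2_scaling lborel_plus V q1 unfolding V_def by (rule spectral_representation(1)[OF q1])
  have HV: "H = V.A" unfolding H V_def by (rule spectral_representation(2)[OF q1])
  have "H = op_scale lborel_plus (of_real q1)
      (op_adj lborel_plus lborel F_op \<circ>\<^sub>L T \<circ>\<^sub>L D_op \<circ>\<^sub>L op_adj lborel lborel T \<circ>\<^sub>L F_op)"
    unfolding H H_model_def S_op_def F.adj_eq_converse T.adj_eq_converse assms(5)[symmetric]
    by (simp add: O_assoc converse_relcomp)
  moreover have "ess_selfadjoint_on lborel_plus H (D0_set 1)"
    unfolding ess_selfadjoint_on_def
  proof
    have sub: "hankel_on_D0 p0 q1 \<subseteq> H" unfolding H by (rule hankel_on_D0_subset(1)[OF q q1])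
    then show "D0_set 1 \<subseteq> Domain H" using hankel_on_D0_subset(2)[OF q q1] by blast
    \<comment> \<open>The restriction of \<open>H\<close> to $\mathcal{D}_0$ lies between the operator whose closure is \<open>H\<close>, and \<open>H\<close> itself.\<close>
    have "hankel_on_D0 p0 q1 \<subseteq> op_restrict H (D0_set 1)" using sub by (auto simp: hankel_on_D0_def op_restrict_def)
    then have "H \<subseteq> op_closure lborel_plus lborel_plus (op_restrict H (D0_set 1))"
      unfolding Hc by (rule op_closure_mono)
    moreover have "op_closure lborel_plus lborel_plus (op_restrict H (D0_set 1)) \<subseteq> H"
      by (rule closure_subset_selfadjoint[OF sa]) (use H_model_L2 in \<open>auto simp: op_restrict_def H\<close>)
    ultimately have "op_closure lborel_plus lborel_plus (op_restrict H (D0_set 1)) = H" by simp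
    then show "selfadjoint lborel_plus (op_closure lborel_plus lborel_plus (op_restrict H (D0_set 1)))"
      using sa by simp
  qed
  moreover have "selfadjoint_on lborel_plus H (op_adj lborel_plus lborel F_op `` Dstar_set q0 q1)"
    unfolding selfadjoint_on_def using sa H_model_domain[OF q1] H by simp
  moreover have "simple_spectrum lborel_plus H" "ac_spectrum lborel_plus H" "op_spectrum lborel_plus H = \<real>"
    unfolding HV by (rule V.simple_spectrum_A V.ac_spectrum_A V.op_spectrum_A)+
  ultimately show ?thesis using F.unitary T.unitary by blast
qed

end
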